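(* Let $G$ be a discrete group, let $\Gamma\le G$ be a subgroup with property (T), and suppose $t\in G$ is such that $t\Gamma t^{-1}$ is a proper subgroup of $\Gamma$. Let $A=\bigoplus_{G/\Gamma}\mathbb{Z}/2\mathbb{Z}$, let $G$ act on $A$ by permuting coordinates via left translation on $G/\Gamma$, and set $W=A\rtimes G$. Then the reduced group C*-algebra $C^*_r(W)$ is stably finite but is not an MF C*-algebra. The same holds for any discrete group containing $W$ as a subgroup: its reduced group C*-algebra is stably finite but not an MF C*-algebra.
   Context: A C*-algebra is called MF if it embeds (via an injective $*$-homomorphism) into $\prod_{n=1}^\infty M_{d_n}\big/\bigoplus_{n=1}^\infty M_{d_n}$ for some sequence $(d_n)$ of positive integers, where $M_k$ is the C*-algebra of $k\times k$ complex matrices, $\prod$ denotes norm-bounded sequences, and $\bigoplus$ denotes sequences whose operator norms tend to $0$. A unital C*-algebra $B$ is finite if $x^*x=1$ implies $xx^*=1$ for all $x\in B$; it is stably finite if $M_k(B)$ is finite for every $k\ge1$. *)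

theory Defs
  imports
    "HOL-Analysis.Infinite_Sum"
    "HOL-Algebra.Left_Coset"
    "HOL-Algebra.QuotRing"
    "HOL-Algebra.Elementary_Groups"
    "HOL-Algebra.Product_Groups"
    "Jordan_Normal_Form.Schur_Decomposition"
begin

section \<open>Hilbert spaces and bounded operators\<close>

text \<open>The ring fields \<open>mult\<close> and \<open>one\<close> of the module record are never used for Hilbert spaces.\<close>

record 'v inner_module = "(complex, 'v) module" +
  cinner :: "'v \<Rightarrow> 'v \<Rightarrow> complex"

definition hnorm :: "('v, 'm) inner_module_scheme \<Rightarrow> 'v \<Rightarrow> real"
  where "hnorm H x = sqrt (Re (cinner H x x))"

locale hilbert_space = module "class_ring :: complex ring" H
  for H :: "('v, 'm) inner_module_scheme" (structure) +
  assumes cinner_add_left: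
      "\<lbrakk>x \<in> carrier H; y \<in> carrier H; z \<in> carrier H\<rbrakk>
        \<Longrightarrow> cinner H (x \<oplus>\<^bsub>H\<^esub> y) z = cinner H x z + cinner H y z"
    and cinner_smult_left:
      "\<lbrakk>x \<in> carrier H; y \<in> carrier H\<rbrakk> \<Longrightarrow> cinner H (c \<odot>\<^bsub>H\<^esub> x) y = c * cinner H x y"
    and cinner_commute:
      "\<lbrakk>x \<in> carrier H; y \<in> carrier H\<rbrakk> \<Longrightarrow> cinner H x y = cnj (cinner H y x)"
    and cinner_nonneg: "x \<in> carrier H \<Longrightarrow> 0 \<le> Re (cinner H x x)"
    and cinner_definite: "\<lbrakk>x \<in> carrier H; cinner H x x = 0\<rbrakk> \<Longrightarrow> x = \<zero>\<^bsub>H\<^esub>"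
    and complete:
      "\<lbrakk>\<And>n. s n \<in> carrier H;
        \<And>e. e > 0 \<Longrightarrow> \<exists>N. \<forall>m\<ge>N. \<forall>n\<ge>N. hnorm H (s m \<ominus>\<^bsub>H\<^esub> s n) < e\<rbrakk>
        \<Longrightarrow> \<exists>x\<in>carrier H. (\<lambda>n. hnorm H (s n \<ominus>\<^bsub>H\<^esub> x)) \<longlonglongrightarrow> 0"

definition linear_op :: "('v, 'm) inner_module_scheme \<Rightarrow> ('v \<Rightarrow> 'v) \<Rightarrow> bool"
  where "linear_op H T \<longleftrightarrow> T \<in> carrier H \<rightarrow> carrier H \<and>
    (\<forall>x\<in>carrier H. \<forall>y\<in>carrier H. T (x \<oplus>\<^bsub>H\<^esub> y) = T x \<oplus>\<^bsub>H\<^esub> T y) \<and>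
    (\<forall>c. \<forall>x\<in>carrier H. T (c \<odot>\<^bsub>H\<^esub> x) = c \<odot>\<^bsub>H\<^esub> T x)"

text \<open>Operators are extensional, so that they are determined by their values on the space.\<close>

definition bounded_ops :: "('v, 'm) inner_module_scheme \<Rightarrow> ('v \<Rightarrow> 'v) set"
  where "bounded_ops H = {T \<in> extensional (carrier H). linear_op H T \<and>
    (\<exists>C. \<forall>x\<in>carrier H. hnorm H (T x) \<le> C * hnorm H x)}"

definition op_norm :: "('v, 'm) inner_module_scheme \<Rightarrow> ('v \<Rightarrow> 'v) \<Rightarrow> real"
  where "op_norm H T = (SUP x\<in>{x \<in> carrier H. hnorm H x \<le> 1}. hnorm H (T x))"

definition adjoint_op :: "('v, 'm) inner_module_scheme \<Rightarrow> ('v \<Rightarrow> 'v) \<Rightarrow> 'v \<Rightarrow> 'v"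
  where "adjoint_op H T = (THE S. S \<in> bounded_ops H \<and>
    (\<forall>x\<in>carrier H. \<forall>y\<in>carrier H. cinner H (S x) y = cinner H x (T y)))"

section \<open>Complex *-algebras\<close>

text \<open>The C*-norm is determined by the *-algebra structure, so the record does not carry it.\<close>

record 'b star_algebra = "(complex, 'b) module" +
  star :: "'b \<Rightarrow> 'b"

definition bounded_operators :: "('v, 'm) inner_module_scheme \<Rightarrow> ('v \<Rightarrow> 'v) star_algebra"
  where "bounded_operators H =
    \<lparr>carrier = bounded_ops H,
     mult = compose (carrier H),
     one = (\<lambda>x\<in>carrier H. x),
     zero = (\<lambda>x\<in>carrier H. \<zero>\<^bsub>H\<^esub>),
     add = (\<lambda>S T. \<lambda>x\<in>carrier H. S x \<oplus>\<^bsub>H\<^esub> T x),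
     module.smult = (\<lambda>c T. \<lambda>x\<in>carrier H. c \<odot>\<^bsub>H\<^esub> T x),
     star = adjoint_op H\<rparr>"

text \<open>Not required to preserve the unit.\<close>

definition star_hom :: "('a, 'm) star_algebra_scheme \<Rightarrow> ('b, 'n) star_algebra_scheme
    \<Rightarrow> ('a \<Rightarrow> 'b) \<Rightarrow> bool"
  where "star_hom A B f \<longleftrightarrow> f \<in> carrier A \<rightarrow> carrier B \<and>
    (\<forall>x\<in>carrier A. \<forall>y\<in>carrier A. f (x \<oplus>\<^bsub>A\<^esub> y) = f x \<oplus>\<^bsub>B\<^esub> f y \<and>
                                   f (x \<otimes>\<^bsub>A\<^esub> y) = f x \<otimes>\<^bsub>B\<^esub> f y) \<and>
    (\<forall>x\<in>carrier A. (\<forall>c. f (c \<odot>\<^bsub>A\<^esub> x) = c \<odot>\<^bsub>B\<^esub> f x) \<and> f (star A x) = star B (f x))"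

definition star_quotient :: "('b, 'm) star_algebra_scheme \<Rightarrow> 'b set \<Rightarrow> 'b set star_algebra"
  where "star_quotient B I =
    \<lparr>carrier = carrier (B Quot I),
     mult = mult (B Quot I),
     one = one (B Quot I),
     zero = zero (B Quot I),
     add = add (B Quot I),
     module.smult = (\<lambda>c X. \<Union>x\<in>X. I +>\<^bsub>B\<^esub> (c \<odot>\<^bsub>B\<^esub> x)),
     star = (\<lambda>X. \<Union>x\<in>X. I +>\<^bsub>B\<^esub> star B x)\<rparr>"

subsection \<open>Finiteness\<close>

definition matrix_algebra :: "nat \<Rightarrow> ('b, 'm) star_algebra_scheme \<Rightarrow> 'b mat star_algebra"
  where "matrix_algebra k B =
    \<lparr>carrier = {X \<in> carrier_mat k k. \<forall>i<k. \<forall>j<k. X $$ (i, j) \<in> carrier B},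
     mult = (\<lambda>X Y. mat k k (\<lambda>(i, j). \<Oplus>\<^bsub>B\<^esub>l\<in>{..<k}. X $$ (i, l) \<otimes>\<^bsub>B\<^esub> Y $$ (l, j))),
     one = mat k k (\<lambda>(i, j). if i = j then \<one>\<^bsub>B\<^esub> else \<zero>\<^bsub>B\<^esub>),
     zero = mat k k (\<lambda>(i, j). \<zero>\<^bsub>B\<^esub>),
     add = (\<lambda>X Y. mat k k (\<lambda>(i, j). X $$ (i, j) \<oplus>\<^bsub>B\<^esub> Y $$ (i, j))),
     module.smult = (\<lambda>c X. mat k k (\<lambda>(i, j). c \<odot>\<^bsub>B\<^esub> X $$ (i, j))),
     star = (\<lambda>X. mat k k (\<lambda>(i, j). star B (X $$ (j, i))))\<rparr>"

definition finite_algebra :: "('b, 'm) star_algebra_scheme \<Rightarrow> bool"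
  where "finite_algebra B \<longleftrightarrow>
    (\<forall>x\<in>carrier B. star B x \<otimes>\<^bsub>B\<^esub> x = \<one>\<^bsub>B\<^esub> \<longrightarrow> x \<otimes>\<^bsub>B\<^esub> star B x = \<one>\<^bsub>B\<^esub>)"

definition stably_finite :: "('b, 'm) star_algebra_scheme \<Rightarrow> bool"
  where "stably_finite B \<longleftrightarrow> (\<forall>k\<ge>1. finite_algebra (matrix_algebra k B))"

subsection \<open>MF algebras\<close>

definition vec_norm2 :: "complex vec \<Rightarrow> real"
  where "vec_norm2 v = sqrt (\<Sum>i<dim_vec v. (cmod (v $ i))\<^sup>2)"

definition mat_op_norm :: "complex mat \<Rightarrow> real"
  where "mat_op_norm A =
    (SUP v\<in>{v \<in> carrier_vec (dim_col A). vec_norm2 v \<le> 1}. vec_norm2 (A *\<^sub>v v))"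

definition matrix_product :: "(nat \<Rightarrow> nat) \<Rightarrow> (nat \<Rightarrow> complex mat) star_algebra"
  where "matrix_product d =
    \<lparr>carrier = {X. (\<forall>n. X n \<in> carrier_mat (d n) (d n)) \<and> (\<exists>C. \<forall>n. mat_op_norm (X n) \<le> C)},
     mult = (\<lambda>X Y n. X n * Y n),
     one = (\<lambda>n. 1\<^sub>m (d n)),
     zero = (\<lambda>n. 0\<^sub>m (d n) (d n)),
     add = (\<lambda>X Y n. X n + Y n),
     module.smult = (\<lambda>c X n. c \<cdot>\<^sub>m X n),
     star = (\<lambda>X n. mat_adjoint (X n))\<rparr>"

definition matrix_sum :: "(nat \<Rightarrow> nat) \<Rightarrow> (nat \<Rightarrow> complex mat) set"
  where "matrix_sum d =
    {X. (\<forall>n. X n \<in> carrier_mat (d n) (d n)) \<and> (\<lambda>n. mat_op_norm (X n)) \<longlonglongrightarrow> 0}"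

definition MF_algebra :: "('b, 'm) star_algebra_scheme \<Rightarrow> bool"
  where "MF_algebra B \<longleftrightarrow> (\<exists>d f. (\<forall>n. d n > 0) \<and>
    star_hom B (star_quotient (matrix_product d) (matrix_sum d)) f \<and> inj_on f (carrier B))"

section \<open>The reduced group C*-algebra\<close>

text \<open>Square-summable functions on \<open>X\<close>, extended by zero to the ambient type.\<close>

definition ell2 :: "'x set \<Rightarrow> ('x \<Rightarrow> complex) inner_module"
  where "ell2 X =
    \<lparr>carrier = {f. (\<forall>x. x \<notin> X \<longrightarrow> f x = 0) \<and> (\<lambda>x. (cmod (f x))\<^sup>2) summable_on X},
     mult = undefined,
     one = undefined,
     zero = (\<lambda>_. 0),
     add = (\<lambda>f g x. f x + g x),
     module.smult = (\<lambda>c f x. c * f x),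
     cinner = (\<lambda>f g. \<Sum>\<^sub>\<infinity>x\<in>X. f x * cnj (g x))\<rparr>"

definition left_regular :: "('g, 'm) monoid_scheme \<Rightarrow> 'g \<Rightarrow> ('g \<Rightarrow> complex) \<Rightarrow> 'g \<Rightarrow> complex"
  where "left_regular G g = (\<lambda>f\<in>carrier (ell2 (carrier G)).
    \<lambda>x. if x \<in> carrier G then f (inv\<^bsub>G\<^esub> g \<otimes>\<^bsub>G\<^esub> x) else 0)"

text \<open>The operator-norm closure of the linear span of the left translations, i.e.\ of the image of
  the group ring.\<close>

definition reduced_group_algebra ::
    "('g, 'm) monoid_scheme \<Rightarrow> (('g \<Rightarrow> complex) \<Rightarrow> ('g \<Rightarrow> complex)) star_algebra"
  where "reduced_group_algebra G = (let H = ell2 (carrier G); B = bounded_operators H in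
    B\<lparr>carrier := {T \<in> carrier B. \<forall>e>0. \<exists>F c. finite F \<and> F \<subseteq> carrier G \<and>
        op_norm H (T \<ominus>\<^bsub>B\<^esub> (\<Oplus>\<^bsub>B\<^esub>g\<in>F. c g \<odot>\<^bsub>B\<^esub> left_regular G g)) < e}\<rparr>)"

section \<open>Property (T)\<close>

definition unitary_op :: "('v, 'm) inner_module_scheme \<Rightarrow> ('v \<Rightarrow> 'v) \<Rightarrow> bool"
  where "unitary_op H U \<longleftrightarrow> linear_op H U \<and> U ` carrier H = carrier H \<and>
    (\<forall>x\<in>carrier H. \<forall>y\<in>carrier H. cinner H (U x) (U y) = cinner H x y)"

definition unitary_rep ::
    "('g, 'm) monoid_scheme \<Rightarrow> ('v, 'n) inner_module_scheme \<Rightarrow> ('g \<Rightarrow> 'v \<Rightarrow> 'v) \<Rightarrow> bool"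
  where "unitary_rep G H \<pi> \<longleftrightarrow> (\<forall>g\<in>carrier G. unitary_op H (\<pi> g)) \<and>
    (\<forall>g\<in>carrier G. \<forall>h\<in>carrier G. \<forall>x\<in>carrier H. \<pi> (g \<otimes>\<^bsub>G\<^esub> h) x = \<pi> g (\<pi> h x))"

text \<open>\<open>(K, \<epsilon>)\<close> is a Kazhdan pair for all unitary representations on Hilbert spaces whose
  elements are taken from the type \<open>'v\<close>.\<close>

definition kazhdan_pair ::
    "'v itself \<Rightarrow> ('g, 'm) monoid_scheme \<Rightarrow> 'g set \<Rightarrow> real \<Rightarrow> bool"
  where "kazhdan_pair _ G K \<epsilon> \<longleftrightarrow>
    (\<forall>(H :: 'v inner_module) \<pi> \<xi>. hilbert_space H \<longrightarrow> unitary_rep G H \<pi> \<longrightarrow>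
      \<xi> \<in> carrier H \<longrightarrow> \<xi> \<noteq> \<zero>\<^bsub>H\<^esub> \<longrightarrow>
      (\<forall>g\<in>K. hnorm H (\<pi> g \<xi> \<ominus>\<^bsub>H\<^esub> \<xi>) < \<epsilon> * hnorm H \<xi>) \<longrightarrow>
      (\<exists>\<eta>\<in>carrier H. \<eta> \<noteq> \<zero>\<^bsub>H\<^esub> \<and> (\<forall>g\<in>carrier G. \<pi> g \<eta> = \<eta>)))"

text \<open>A definition cannot quantify over all types of Hilbert spaces. The type
  \<open>'g \<Rightarrow> complex\<close> is large enough: by \<open>kazhdan_pair_any_type\<close> below, a Kazhdan pair for it is a
  Kazhdan pair for every type.\<close>

definition property_T :: "('g, 'm) monoid_scheme \<Rightarrow> bool"
  where "property_T (G :: ('g, 'm) monoid_scheme) \<longleftrightarrow>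
    (\<exists>K \<epsilon>. finite K \<and> K \<subseteq> carrier G \<and> \<epsilon> > 0 \<and> kazhdan_pair TYPE('g \<Rightarrow> complex) G K \<epsilon>)"

context hilbert_space
begin

lemma smult_minus_one: "x \<in> carrier H \<Longrightarrow> \<ominus>\<^bsub>H\<^esub> x = (-1) \<odot>\<^bsub>H\<^esub> x"
  using smult_l_distr[of "-1" 1 x] smult_one[of x] smult_l_null[of x] by (intro M.minus_equality) simp_all

lemma cinner_minus_left:
  "\<lbrakk>x \<in> carrier H; y \<in> carrier H; z \<in> carrier H\<rbrakk>
    \<Longrightarrow> cinner H (x \<ominus>\<^bsub>H\<^esub> y) z = cinner H x z - cinner H y z"
  by (simp add: a_minus_def smult_minus_one cinner_add_left cinner_smult_left)

lemma cinner_zero_left: "x \<in> carrier H \<Longrightarrow> cinner H \<zero>\<^bsub>H\<^esub> x = 0"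
  using cinner_smult_left[of "\<zero>\<^bsub>H\<^esub>" x 0] by simp

lemma cinner_add_right:
  "\<lbrakk>x \<in> carrier H; y \<in> carrier H; z \<in> carrier H\<rbrakk>
    \<Longrightarrow> cinner H x (y \<oplus>\<^bsub>H\<^esub> z) = cinner H x y + cinner H x z"
  by (metis M.add.m_closed cinner_add_left cinner_commute complex_cnj_add)

lemma cinner_smult_right:
  "\<lbrakk>x \<in> carrier H; y \<in> carrier H\<rbrakk> \<Longrightarrow> cinner H x (c \<odot>\<^bsub>H\<^esub> y) = cnj c * cinner H x y"
  using cinner_commute[of x "c \<odot>\<^bsub>H\<^esub> y"] cinner_commute[of x y] by (simp add: cinner_smult_left)

lemma cinner_self: "x \<in> carrier H \<Longrightarrow> cinner H x x = complex_of_real ((hnorm H x)\<^sup>2)"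
  using cinner_commute[of x x] cinner_nonneg[of x]
  by (simp add: hnorm_def complex_eq_iff)

lemma hnorm_nonneg: "x \<in> carrier H \<Longrightarrow> hnorm H x \<ge> 0"
  by (simp add: hnorm_def cinner_nonneg)

lemma cinner_bound:
  assumes x: "x \<in> carrier H" and y: "y \<in> carrier H"
  shows "cmod (cinner H x y) \<le> hnorm H x * hnorm H y"
proof (cases "hnorm H y = 0")
  case True
  hence "cinner H y y = 0" using cinner_self[OF y] by simp
  hence "y = \<zero>\<^bsub>H\<^esub>" using cinner_definite y by blast
  thus ?thesis using cinner_commute[OF x y] cinner_zero_left[OF x] True by simp
next
  case False
  let ?b = "cinner H x y" and ?n = "complex_of_real ((hnorm H y)\<^sup>2)"
  define z where "z = (?n \<odot>\<^bsub>H\<^esub> x) \<oplus>\<^bsub>H\<^esub> ((- ?b) \<odot>\<^bsub>H\<^esub> y)"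
  have z: "z \<in> carrier H" unfolding z_def using x y by simp
  have yx: "cinner H y x = cnj ?b" using cinner_commute[OF y x] .
  have "cinner H z z = ?n * (?n * of_real ((hnorm H x)\<^sup>2) - ?b * cnj ?b)"
    unfolding z_def using x y
    by (simp add: cinner_add_left cinner_add_right cinner_smult_left cinner_smult_right
        cinner_self[OF x] cinner_self[OF y] yx algebra_simps)
  also have "\<dots> = of_real ((hnorm H y)\<^sup>2 * ((hnorm H y)\<^sup>2 * (hnorm H x)\<^sup>2 - (cmod ?b)\<^sup>2))"
    by (simp add: complex_norm_square[symmetric] del: of_real_power)
  finally have "Re (cinner H z z)
      = (hnorm H y)\<^sup>2 * ((hnorm H y)\<^sup>2 * (hnorm H x)\<^sup>2 - (cmod ?b)\<^sup>2)" by simp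
  with cinner_nonneg[OF z] have "(hnorm H y)\<^sup>2 * (hnorm H x)\<^sup>2 - (cmod ?b)\<^sup>2 \<ge> 0"
    using False by (simp add: zero_le_mult_iff)
  hence "(cmod ?b)\<^sup>2 \<le> (hnorm H x * hnorm H y)\<^sup>2" by (simp add: power_mult_distrib mult.commute)
  thus ?thesis by (rule power2_le_imp_le) (intro mult_nonneg_nonneg hnorm_nonneg x y)
qed

end

text \<open>Restrict to the closed subspace generated by the orbit of \<open>\<xi>\<close> (below, the vectors orthogonal
  to everything orthogonal to the orbit); there, a vector \<open>v\<close> is determined by its coefficients
  \<open>\<langle>v, \<pi>(g) \<xi>\<rangle>\<close>, i.e. by a complex function on the group.\<close>

lemma kazhdan_pair_any_type:
  fixes G :: "('g, 'm) monoid_scheme"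
  assumes "group G" and K: "K \<subseteq> carrier G"
    and kp: "kazhdan_pair TYPE('g \<Rightarrow> complex) G K \<epsilon>"
  shows "kazhdan_pair TYPE('v) G K \<epsilon>"
  unfolding kazhdan_pair_def
proof (intro allI impI)
  fix H :: "'v inner_module" and \<pi> :: "'g \<Rightarrow> 'v \<Rightarrow> 'v" and \<xi>
  assume H: "hilbert_space H" and rep: "unitary_rep G H \<pi>"
    and \<xi>: "\<xi> \<in> carrier H" and \<xi>0: "\<xi> \<noteq> \<zero>\<^bsub>H\<^esub>"
    and near: "\<forall>g\<in>K. hnorm H (\<pi> g \<xi> \<ominus>\<^bsub>H\<^esub> \<xi>) < \<epsilon> * hnorm H \<xi>"
  interpret G: group G by fact
  interpret hilbert_space H by fact
  have \<pi>c: "\<pi> g x \<in> carrier H" if "g \<in> carrier G" "x \<in> carrier H" for g x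
    using rep that unfolding unitary_rep_def unitary_op_def linear_op_def by blast
  have \<pi>a: "\<pi> g (x \<oplus>\<^bsub>H\<^esub> y) = \<pi> g x \<oplus>\<^bsub>H\<^esub> \<pi> g y"
    if "g \<in> carrier G" "x \<in> carrier H" "y \<in> carrier H" for g x y
    using rep that unfolding unitary_rep_def unitary_op_def linear_op_def by blast
  have \<pi>s: "\<pi> g (c \<odot>\<^bsub>H\<^esub> x) = c \<odot>\<^bsub>H\<^esub> \<pi> g x" if "g \<in> carrier G" "x \<in> carrier H" for g c x
    using rep that unfolding unitary_rep_def unitary_op_def linear_op_def by blast
  have \<pi>i: "cinner H (\<pi> g x) (\<pi> g y) = cinner H x y"
    if "g \<in> carrier G" "x \<in> carrier H" "y \<in> carrier H" for g x y
    using rep that unfolding unitary_rep_def unitary_op_def by blast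
  have \<pi>m: "\<pi> (g \<otimes>\<^bsub>G\<^esub> h) x = \<pi> g (\<pi> h x)"
    if "g \<in> carrier G" "h \<in> carrier G" "x \<in> carrier H" for g h x
    using rep that unfolding unitary_rep_def by blast
  have \<pi>1: "\<pi> \<one>\<^bsub>G\<^esub> x = x" if x: "x \<in> carrier H" for x
  proof -
    have "\<pi> \<one>\<^bsub>G\<^esub> ` carrier H = carrier H"
      using rep unfolding unitary_rep_def unitary_op_def by simp
    then obtain y where y: "y \<in> carrier H" "x = \<pi> \<one>\<^bsub>G\<^esub> y" using x by (metis imageE)
    thus ?thesis using \<pi>m[of "\<one>\<^bsub>G\<^esub>" "\<one>\<^bsub>G\<^esub>" y] by simp
  qed
  have \<pi>inv: "\<pi> g (\<pi> (inv\<^bsub>G\<^esub> g) x) = x" if "g \<in> carrier G" "x \<in> carrier H" for g x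
    using that \<pi>m[of g "inv\<^bsub>G\<^esub> g" x] \<pi>1 by simp
  have \<pi>adj: "cinner H (\<pi> g x) y = cinner H x (\<pi> (inv\<^bsub>G\<^esub> g) y)"
    if "g \<in> carrier G" "x \<in> carrier H" "y \<in> carrier H" for g x y
    using \<pi>i[of g x "\<pi> (inv\<^bsub>G\<^esub> g) y"] \<pi>inv[of g y] \<pi>c[of "inv\<^bsub>G\<^esub> g" y] that by simp

  define M where "M = {w \<in> carrier H. \<forall>g\<in>carrier G. cinner H w (\<pi> g \<xi>) = 0}"
  define C where "C = {v \<in> carrier H. \<forall>w\<in>M. cinner H v w = 0}"
  have MH: "w \<in> carrier H" if "w \<in> M" for w using that by (simp add: M_def)
  have CH: "v \<in> carrier H" if "v \<in> C" for v using that by (simp add: C_def)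
  have M\<pi>: "\<pi> g w \<in> M" if g: "g \<in> carrier G" and w: "w \<in> M" for g w
    using w unfolding M_def
    by (auto simp: \<pi>c g \<pi>adj \<xi> \<pi>m[symmetric])
  have C\<pi>: "\<pi> g v \<in> C" if g: "g \<in> carrier G" and v: "v \<in> C" for g v
    using M\<pi>[of "inv\<^bsub>G\<^esub> g"] v g MH by (auto simp: C_def \<pi>c \<pi>adj)
  have C\<xi>: "\<xi> \<in> C"
    unfolding C_def
  proof (intro CollectI conjI ballI \<xi>)
    fix w assume w: "w \<in> M"
    hence "cinner H w \<xi> = 0" unfolding M_def using \<pi>1[OF \<xi>] by force
    thus "cinner H \<xi> w = 0" using cinner_commute[OF \<xi> MH[OF w]] by simp
  qed
  have Ca: "v \<oplus>\<^bsub>H\<^esub> w \<in> C" if "v \<in> C" "w \<in> C" for v w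
    using that MH by (auto simp: C_def cinner_add_left)
  have Cs: "c \<odot>\<^bsub>H\<^esub> v \<in> C" if "v \<in> C" for c v
    using that MH by (auto simp: C_def cinner_smult_left)
  have C0: "\<zero>\<^bsub>H\<^esub> \<in> C" using MH by (auto simp: C_def cinner_zero_left)
  have Cn: "\<ominus>\<^bsub>H\<^esub> v \<in> C" if "v \<in> C" for v using that by (simp add: smult_minus_one CH Cs)
  have Cm: "v \<ominus>\<^bsub>H\<^esub> w \<in> C" if "v \<in> C" "w \<in> C" for v w using that by (simp add: a_minus_def Ca Cn)

  define \<Phi> :: "'v \<Rightarrow> 'g \<Rightarrow> complex" where "\<Phi> v = (\<lambda>g. cinner H v (\<pi> g \<xi>))" for v
  have inj: "inj_on \<Phi> C"
  proof (rule inj_onI)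
    fix v w assume v: "v \<in> C" and w: "w \<in> C" and eq: "\<Phi> v = \<Phi> w"
    have "cinner H (v \<ominus>\<^bsub>H\<^esub> w) (\<pi> g \<xi>) = 0" if "g \<in> carrier G" for g
      using fun_cong[OF eq, of g] v w \<xi> that by (simp add: \<Phi>_def cinner_minus_left CH \<pi>c)
    hence "v \<ominus>\<^bsub>H\<^esub> w \<in> M" using Cm[OF v w] by (simp add: M_def CH)
    hence "cinner H (v \<ominus>\<^bsub>H\<^esub> w) (v \<ominus>\<^bsub>H\<^esub> w) = 0" using Cm[OF v w] by (simp add: C_def)
    hence "v \<ominus>\<^bsub>H\<^esub> w = \<zero>\<^bsub>H\<^esub>" using cinner_definite CH Cm v w by blast
    thus "v = w" using v w CH by simp
  qed
  define \<Psi> where "\<Psi> = inv_into C \<Phi>"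
  have \<Psi>\<Phi> [simp]: "\<Psi> (\<Phi> v) = v" if "v \<in> C" for v using that inj by (simp add: \<Psi>_def)

  define H' :: "('g \<Rightarrow> complex) inner_module" where
    "H' = \<lparr>carrier = \<Phi> ` C, mult = undefined, one = undefined, zero = \<Phi> \<zero>\<^bsub>H\<^esub>,
      add = (\<lambda>f g. \<Phi> (\<Psi> f \<oplus>\<^bsub>H\<^esub> \<Psi> g)), module.smult = (\<lambda>c f. \<Phi> (c \<odot>\<^bsub>H\<^esub> \<Psi> f)),
      cinner = (\<lambda>f g. cinner H (\<Psi> f) (\<Psi> g))\<rparr>"
  have c': "carrier H' = \<Phi> ` C" and z': "\<zero>\<^bsub>H'\<^esub> = \<Phi> \<zero>\<^bsub>H\<^esub>"
    and a': "\<And>v w. v \<in> C \<Longrightarrow> w \<in> C \<Longrightarrow> \<Phi> v \<oplus>\<^bsub>H'\<^esub> \<Phi> w = \<Phi> (v \<oplus>\<^bsub>H\<^esub> w)"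
    and s': "\<And>c v. v \<in> C \<Longrightarrow> c \<odot>\<^bsub>H'\<^esub> \<Phi> v = \<Phi> (c \<odot>\<^bsub>H\<^esub> v)"
    and i': "\<And>v w. v \<in> C \<Longrightarrow> w \<in> C \<Longrightarrow> cinner H' (\<Phi> v) (\<Phi> w) = cinner H v w"
    by (simp_all add: H'_def)
  have n': "hnorm H' (\<Phi> v) = hnorm H v" if "v \<in> C" for v
    using that by (simp add: hnorm_def i')
  have ag: "abelian_group H'"
  proof (rule abelian_groupI)
    fix x assume "x \<in> carrier H'"
    then obtain v where v: "v \<in> C" "x = \<Phi> v" by (auto simp: c')
    have "\<Phi> (\<ominus>\<^bsub>H\<^esub> v) \<oplus>\<^bsub>H'\<^esub> x = \<zero>\<^bsub>H'\<^esub>" using v by (simp add: a' Cn z' CH M.l_neg)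
    moreover have "\<Phi> (\<ominus>\<^bsub>H\<^esub> v) \<in> carrier H'" using Cn[OF v(1)] by (simp add: c')
    ultimately show "\<exists>y\<in>carrier H'. y \<oplus>\<^bsub>H'\<^esub> x = \<zero>\<^bsub>H'\<^esub>" by blast
    show "\<zero>\<^bsub>H'\<^esub> \<oplus>\<^bsub>H'\<^esub> x = x" using v by (simp add: z' a' C0 CH)
    fix y assume "y \<in> carrier H'"
    then obtain w where w: "w \<in> C" "y = \<Phi> w" by (auto simp: c')
    show "x \<oplus>\<^bsub>H'\<^esub> y \<in> carrier H'" using v w by (simp add: c' a' Ca)
    show "x \<oplus>\<^bsub>H'\<^esub> y = y \<oplus>\<^bsub>H'\<^esub> x" using v w M.a_comm[of v w] by (simp add: a' CH)
    fix z assume "z \<in> carrier H'"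
    then obtain u where u: "u \<in> C" "z = \<Phi> u" by (auto simp: c')
    show "x \<oplus>\<^bsub>H'\<^esub> y \<oplus>\<^bsub>H'\<^esub> z = x \<oplus>\<^bsub>H'\<^esub> (y \<oplus>\<^bsub>H'\<^esub> z)"
      using v w u M.a_assoc[of v w u] by (simp add: a' CH Ca)
  qed (simp add: z' c' C0)
  interpret H': abelian_group H' by (rule ag)
  have m': "\<Phi> v \<ominus>\<^bsub>H'\<^esub> \<Phi> w = \<Phi> (v \<ominus>\<^bsub>H\<^esub> w)" if v: "v \<in> C" and w: "w \<in> C" for v w
  proof -
    have "\<ominus>\<^bsub>H'\<^esub> \<Phi> w = \<Phi> (\<ominus>\<^bsub>H\<^esub> w)"
      by (rule H'.minus_equality) (use w in \<open>simp_all add: a' Cn z' c' CH M.l_neg\<close>)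
    thus ?thesis using v w by (simp add: a_minus_def a' Cn)
  qed
  have mod': "module (class_ring :: complex ring) H'"
    by (rule moduleI)
      (auto simp: c' s' a' Cs Ca ag CH smult_r_distr
          smult_l_distr[simplified] smult_assoc1[simplified] smult_one[simplified]
        intro: module.axioms(1)[OF module_axioms])
  have df: "\<Phi> v = \<Phi> \<zero>\<^bsub>H\<^esub>" if "cinner H v v = 0" "v \<in> C" for v
    using cinner_definite[OF CH] that by simp
  have hil: "hilbert_space H'"
  proof (intro hilbert_space.intro mod' hilbert_space_axioms.intro)
    fix s assume s: "\<And>n::nat. s n \<in> carrier H'"
      and cau: "\<And>e::real. e > 0 \<Longrightarrow> \<exists>N. \<forall>m\<ge>N. \<forall>n\<ge>N. hnorm H' (s m \<ominus>\<^bsub>H'\<^esub> s n) < e"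
    have "\<forall>n. \<exists>v. v \<in> C \<and> s n = \<Phi> v" using s c' by blast
    then obtain v where v: "\<And>n. v n \<in> C" and sv: "\<And>n. s n = \<Phi> (v n)" by metis
    have "\<exists>x\<in>carrier H. (\<lambda>n. hnorm H (v n \<ominus>\<^bsub>H\<^esub> x)) \<longlonglongrightarrow> 0"
      by (rule complete) (use cau in \<open>auto simp: CH v sv m' n' Cm\<close>)
    then obtain x where x: "x \<in> carrier H" and lim: "(\<lambda>n. hnorm H (v n \<ominus>\<^bsub>H\<^esub> x)) \<longlonglongrightarrow> 0" by blast
    have "x \<in> C" unfolding C_def
    proof (intro CollectI conjI ballI x)
      fix w assume w: "w \<in> M"
      have "cmod (cinner H x w) \<le> hnorm H (v n \<ominus>\<^bsub>H\<^esub> x) * hnorm H w" for n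
        using cinner_bound[of "v n \<ominus>\<^bsub>H\<^esub> x" w] cinner_minus_left[of "v n" x w] v[of n] MH[OF w] x w
        by (simp add: C_def)
      moreover have "(\<lambda>n. hnorm H (v n \<ominus>\<^bsub>H\<^esub> x) * hnorm H w) \<longlonglongrightarrow> 0"
        using tendsto_mult_right[OF lim, of "hnorm H w"] by simp
      ultimately have "cmod (cinner H x w) \<le> 0" by (meson LIMSEQ_le_const)
      thus "cinner H x w = 0" by simp
    qed
    thus "\<exists>x\<in>carrier H'. (\<lambda>n. hnorm H' (s n \<ominus>\<^bsub>H'\<^esub> x)) \<longlonglongrightarrow> 0"
      using lim by (auto simp: c' sv m' n' v Cm intro!: bexI[of _ "\<Phi> x"])
  qed (auto simp: c' a' s' i' z' Ca Cs CH cinner_add_left cinner_smult_left cinner_nonneg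
        intro: cinner_commute[OF CH CH] df)
  define \<rho> where "\<rho> g f = \<Phi> (\<pi> g (\<Psi> f))" for g f
  have \<rho>: "\<rho> g (\<Phi> v) = \<Phi> (\<pi> g v)" if "v \<in> C" for g v using that by (simp add: \<rho>_def)
  have rep': "unitary_rep G H' \<rho>"
    unfolding unitary_rep_def
  proof (intro conjI ballI)
    fix g assume g: "g \<in> carrier G"
    have "\<rho> g ` carrier H' = carrier H'"
    proof (rule antisym)
      show "carrier H' \<subseteq> \<rho> g ` carrier H'"
      proof
        fix f assume "f \<in> carrier H'"
        then obtain v where v: "v \<in> C" "f = \<Phi> v" using c' by blast
        have u: "\<pi> (inv\<^bsub>G\<^esub> g) v \<in> C" using C\<pi> g v by simp
        have "f = \<rho> g (\<Phi> (\<pi> (inv\<^bsub>G\<^esub> g) v))" using u v g by (simp add: \<rho> \<pi>inv CH)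
        thus "f \<in> \<rho> g ` carrier H'" using u c' by blast
      qed
    qed (auto simp: c' \<rho> C\<pi> g)
    thus "unitary_op H' (\<rho> g)"
      unfolding unitary_op_def linear_op_def
      using g by (auto simp: c' \<rho> a' s' i' C\<pi> Ca Cs CH \<pi>a \<pi>s \<pi>i)
  next
    fix g h f assume "g \<in> carrier G" "h \<in> carrier G" "f \<in> carrier H'"
    thus "\<rho> (g \<otimes>\<^bsub>G\<^esub> h) f = \<rho> g (\<rho> h f)" by (auto simp: c' \<rho> C\<pi> CH \<pi>m)
  qed
  have "\<exists>\<eta>\<in>carrier H'. \<eta> \<noteq> \<zero>\<^bsub>H'\<^esub> \<and> (\<forall>g\<in>carrier G. \<rho> g \<eta> = \<eta>)"
  proof (rule kp[unfolded kazhdan_pair_def, rule_format, OF hil rep'])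
    show "\<Phi> \<xi> \<in> carrier H'" using C\<xi> c' by blast
    show "\<Phi> \<xi> \<noteq> \<zero>\<^bsub>H'\<^esub>" using \<xi>0 C\<xi> C0 inj by (simp add: z' inj_on_eq_iff)
    show "hnorm H' (\<rho> g (\<Phi> \<xi>) \<ominus>\<^bsub>H'\<^esub> \<Phi> \<xi>) < \<epsilon> * hnorm H' (\<Phi> \<xi>)" if "g \<in> K" for g
      using near that K C\<xi> by (auto simp: \<rho> m' n' C\<pi> Cm subsetD)
  qed
  then obtain v where v: "v \<in> C" "\<Phi> v \<noteq> \<Phi> \<zero>\<^bsub>H\<^esub>" and fx: "\<forall>g\<in>carrier G. \<rho> g (\<Phi> v) = \<Phi> v"
    by (auto simp: c' z')
  have "\<pi> g v = v" if "g \<in> carrier G" for g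
    using fx that v(1) C\<pi>[OF that v(1)] by (intro inj_onD[OF inj]) (simp_all add: \<rho>)
  thus "\<exists>\<eta>\<in>carrier H. \<eta> \<noteq> \<zero>\<^bsub>H\<^esub> \<and> (\<forall>g\<in>carrier G. \<pi> g \<eta> = \<eta>)"
    using v CH[OF v(1)] by (intro bexI[of _ v]) auto
qed

section \<open>The semidirect product\<close>

definition semidirect_product ::
    "('a, 'm) monoid_scheme \<Rightarrow> ('g, 'n) monoid_scheme \<Rightarrow> ('g \<Rightarrow> 'a \<Rightarrow> 'a) \<Rightarrow> ('a \<times> 'g) monoid"
  where "semidirect_product A G \<alpha> =
    \<lparr>carrier = carrier A \<times> carrier G,
     mult = (\<lambda>(a, g) (b, h). (a \<otimes>\<^bsub>A\<^esub> \<alpha> g b, g \<otimes>\<^bsub>G\<^esub> h)),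
     one = (\<one>\<^bsub>A\<^esub>, \<one>\<^bsub>G\<^esub>)\<rparr>"

definition coset_sum :: "('g, 'm) monoid_scheme \<Rightarrow> 'g set \<Rightarrow> ('g set \<Rightarrow> int) monoid"
  where "coset_sum G \<Gamma> = sum_group (lcosets\<^bsub>G\<^esub> \<Gamma>) (\<lambda>_. integer_mod_group 2)"

definition coset_action ::
    "('g, 'm) monoid_scheme \<Rightarrow> 'g set \<Rightarrow> 'g \<Rightarrow> ('g set \<Rightarrow> int) \<Rightarrow> 'g set \<Rightarrow> int"
  where "coset_action G \<Gamma> g a = (\<lambda>x\<in>lcosets\<^bsub>G\<^esub> \<Gamma>. a (inv\<^bsub>G\<^esub> g <#\<^bsub>G\<^esub> x))"

definition coset_wreath :: "('g, 'm) monoid_scheme \<Rightarrow> 'g set \<Rightarrow> (('g set \<Rightarrow> int) \<times> 'g) monoid"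
  where "coset_wreath G \<Gamma> = semidirect_product (coset_sum G \<Gamma>) G (coset_action G \<Gamma>)"

end

theory Submission
  imports
    Defs
    "HOL-Analysis.Inner_Product"
    "HOL-Analysis.Operator_Norm"
    "HOL-Analysis.Convex"
    "HOL-Analysis.Topology_Euclidean_Space"
    "HOL-Library.Function_Algebras"
    "HOL-Library.Poly_Mapping"
    "HOL-Algebra.Generated_Groups"
begin

text \<open>
  \<^bold>\<open>Stable finiteness\<close> holds for every group \<open>L\<close>. An operator \<open>T\<close> in the reduced algebra is a convolution:
  its matrix coefficients \<open>(T \<delta>\<^sub>x) y\<close> depend only on \<open>y x\<inverse>\<close>. Hence \<open>T\<close> and its adjoint have equal lengths on
  point masses (\<open>nrm_adjoint_\<delta>\<close>), and an isometric matrix over the algebra is unitary by comparing the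
  total length of its rows with that of its columns (\<open>isometry_unitary\<close>).

  \<^bold>\<open>Failure of MF.\<close> Suppose that the reduced algebra of a group containing the wreath product is MF.
  Lifting the left translations gives matrices \<open>u w\<close> that multiply like the group up to errors of
  vanishing operator norm, while different group elements stay apart in operator norm
  (\<open>MF_asymptotic_rep\<close>). Let \<open>a\<close> be the generator of the copy of \<open>\<int>/2\<close> at the coset \<open>t\<Gamma>\<close>. Its conjugates
  by \<open>\<Gamma>\<close> commute with each other, and \<open>a\<close> is fixed by \<open>t\<Gamma>t\<inverse>\<close> but moved by some \<open>g \<in> \<Gamma>\<close>. The contradiction is
  that \<open>u a\<close> and \<open>u (g a g\<inverse>)\<close> approach each other (\<open>asymptotic_commutation\<close>).

  For this, \<open>\<Gamma>\<close> acts by conjugation on an ultraproduct of the matrix spaces with Hilbert--Schmidt norms.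
  Two consequences of property (T) are used. First, \<open>t\<Gamma>t\<inverse>\<close>-invariant vectors are \<open>\<Gamma>\<close>-invariant: the spaces
  of almost invariant vectors of the two groups in each matrix space are conjugate by \<open>t\<close>, so they have
  the same finite dimension (\<open>conjugate_invariants\<close>). Second, a cocycle is almost a coboundary, with
  bounds that depend only on its size on the Kazhdan set (\<open>cocycle_averaging\<close>).

  The difference \<open>\<rho> g = u a - u (g a g\<inverse>)\<close> is a cocycle. It cannot be normalized by its operator norm,
  which the ultraproduct does not see. But \<open>a\<close> and \<open>g a g\<inverse>\<close> are commuting involutions, so \<open>\<rho> g\<close> lives on the
  projection \<open>e g\<close> to the eigenspaces where they differ, and the square of \<open>\<rho> g\<close> is 4 times this
  projection. The Hilbert--Schmidt norm of \<open>\<rho> g\<close> is thus governed by the rank of \<open>e g\<close>. After compression to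
  this projection and division by the square root of the total rank over the Kazhdan set, the
  operator-norm errors become negligible (\<open>ip_null\<close>), and the cocycle of vectors so obtained is not zero on
  the Kazhdan set unless \<open>\<rho>\<close> vanishes there (\<open>not_all_null\<close>). On the other hand it vanishes on \<open>t\<Gamma>t\<inverse>\<close>. So a
  vector almost trivializing it is almost \<open>t\<Gamma>t\<inverse>\<close>-invariant, hence almost \<open>\<Gamma>\<close>-invariant, and the cocycle is
  arbitrarily small on the Kazhdan set (\<open>norm_r_small\<close>).
\<close>


section \<open>Finite complex matrices of arbitrary size\<close>

text \<open>Matrices of all sizes live in one type, as infinite matrices supported in a finite corner.
  This is a ring without unit, normed by the Hilbert--Schmidt norm.\<close>

typedef fmat = "{f :: nat \<Rightarrow> nat \<Rightarrow> complex. \<exists>N. \<forall>i j. N \<le> i \<or> N \<le> j \<longrightarrow> f i j = 0}"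
  morphisms ent Fmat
  by (rule exI[of _ "\<lambda>_ _. 0"]) auto

setup_lifting type_definition_fmat

lemma fmat_eqI: "(\<And>i j. ent X i j = ent Y i j) \<Longrightarrow> X = Y"
  by (simp add: ent_inject[symmetric] fun_eq_iff)

definition supp_le :: "nat \<Rightarrow> fmat \<Rightarrow> bool"
  where "supp_le N X \<longleftrightarrow> (\<forall>i j. N \<le> i \<or> N \<le> j \<longrightarrow> ent X i j = 0)"

lemma supp_le_mono: "supp_le N X \<Longrightarrow> N \<le> N' \<Longrightarrow> supp_le N' X"
  by (auto simp: supp_le_def)

lemma ex_supp_le: "\<exists>N. supp_le N X"
  using ent[of X] by (auto simp: supp_le_def)

lemma ex_supp_le2: obtains N where "supp_le N X" "supp_le N Y"
  by (metis ex_supp_le supp_le_mono nat_le_linear)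

lemma ex_supp_le3: obtains N where "supp_le N X" "supp_le N Y" "supp_le N Z"
  by (metis ex_supp_le supp_le_mono nat_le_linear)

lemma supp_leD: "supp_le N X \<Longrightarrow> N \<le> i \<or> N \<le> j \<Longrightarrow> ent X i j = 0"
  by (auto simp: supp_le_def)

instantiation fmat :: ab_group_add
begin

lift_definition zero_fmat :: fmat is "\<lambda>_ _. 0" by auto
lift_definition uminus_fmat :: "fmat \<Rightarrow> fmat" is "\<lambda>f i j. - f i j" by auto
lift_definition plus_fmat :: "fmat \<Rightarrow> fmat \<Rightarrow> fmat" is "\<lambda>f g i j. f i j + g i j"
proof -
  fix f g :: "nat \<Rightarrow> nat \<Rightarrow> complex"
  assume "\<exists>N. \<forall>i j. N \<le> i \<or> N \<le> j \<longrightarrow> f i j = 0" "\<exists>N. \<forall>i j. N \<le> i \<or> N \<le> j \<longrightarrow> g i j = 0"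
  then obtain N M where "\<forall>i j. N \<le> i \<or> N \<le> j \<longrightarrow> f i j = 0" "\<forall>i j. M \<le> i \<or> M \<le> j \<longrightarrow> g i j = 0"
    by blast
  thus "\<exists>N. \<forall>i j. N \<le> i \<or> N \<le> j \<longrightarrow> f i j + g i j = 0"
    by (intro exI[of _ "max N M"]) auto
qed
definition minus_fmat :: "fmat \<Rightarrow> fmat \<Rightarrow> fmat" where "minus_fmat X Y = X + - Y"

instance
proof
  fix X Y Z :: fmat
  show "X + Y + Z = X + (Y + Z)" "X + Y = Y + X" "0 + X = X"
    by (rule fmat_eqI, simp add: zero_fmat.rep_eq plus_fmat.rep_eq)+
  show "- X + X = 0"
    by (rule fmat_eqI) (simp add: zero_fmat.rep_eq plus_fmat.rep_eq uminus_fmat.rep_eq)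
  show "X - Y = X + - Y" by (rule minus_fmat_def)
qed

end

lemma ent_simps [simp]:
  "ent 0 i j = 0" "ent (- X) i j = - ent X i j" "ent (X + Y) i j = ent X i j + ent Y i j"
  "ent (X - Y) i j = ent X i j - ent Y i j"
  by (simp_all only: zero_fmat.rep_eq uminus_fmat.rep_eq plus_fmat.rep_eq minus_fmat_def) simp

lift_definition scaleC :: "complex \<Rightarrow> fmat \<Rightarrow> fmat" is "\<lambda>c f i j. c * f i j" by fastforce

lift_definition adj :: "fmat \<Rightarrow> fmat" is "\<lambda>f i j. cnj (f j i)" by fastforce

lemma ent_scaleC [simp]: "ent (scaleC c X) i j = c * ent X i j"
  by (simp add: scaleC.rep_eq)

lemma ent_adj [simp]: "ent (adj X) i j = cnj (ent X j i)"
  by (simp add: adj.rep_eq)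

instantiation fmat :: ring
begin

lift_definition times_fmat :: "fmat \<Rightarrow> fmat \<Rightarrow> fmat"
  is "\<lambda>f g i j. \<Sum>k | f i k \<noteq> 0. f i k * g k j"
proof -
  fix f g :: "nat \<Rightarrow> nat \<Rightarrow> complex"
  assume "\<exists>N. \<forall>i j. N \<le> i \<or> N \<le> j \<longrightarrow> f i j = 0" "\<exists>N. \<forall>i j. N \<le> i \<or> N \<le> j \<longrightarrow> g i j = 0"
  then obtain N M where "\<forall>i j. N \<le> i \<or> N \<le> j \<longrightarrow> f i j = 0" "\<forall>i j. M \<le> i \<or> M \<le> j \<longrightarrow> g i j = 0"
    by blast
  thus "\<exists>N. \<forall>i j. N \<le> i \<or> N \<le> j \<longrightarrow> (\<Sum>k | f i k \<noteq> 0. f i k * g k j) = 0"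
    by (intro exI[of _ "max N M"]) (auto intro!: sum.neutral)
qed

lemma ent_times: "supp_le N X \<Longrightarrow> ent (X * Y) i j = (\<Sum>k<N. ent X i k * ent Y k j)"
  unfolding times_fmat.rep_eq
  by (rule sum.mono_neutral_left) (auto simp: supp_le_def intro: not_le_imp_less)

lemma ent_times': "supp_le N Y \<Longrightarrow> ent (X * Y) i j = (\<Sum>k<N. ent X i k * ent Y k j)"
proof -
  assume Y: "supp_le N Y"
  obtain M where M: "supp_le M X" using ex_supp_le by blast
  have "ent (X * Y) i j = (\<Sum>k<max N M. ent X i k * ent Y k j)"
    by (rule ent_times) (rule supp_le_mono[OF M], simp)
  also have "\<dots> = (\<Sum>k<N. ent X i k * ent Y k j)"
    by (rule sum.mono_neutral_right) (use Y in \<open>auto simp: supp_le_def\<close>)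
  finally show ?thesis .
qed

lemma supp_le_times: "supp_le N X \<Longrightarrow> supp_le N Y \<Longrightarrow> supp_le N (X * Y)"
  unfolding supp_le_def[of N "X * Y"] by (auto simp: ent_times supp_leD)

instance
proof
  fix X Y Z :: fmat
  obtain N where N: "supp_le N X" "supp_le N Y" "supp_le N Z" by (rule ex_supp_le3)
  show "X * Y * Z = X * (Y * Z)"
  proof (rule fmat_eqI)
    fix i j
    have "ent (X * Y * Z) i j = (\<Sum>k<N. (\<Sum>l<N. ent X i l * ent Y l k) * ent Z k j)"
      by (simp add: ent_times'[OF N(3)] ent_times[OF N(1)])
    also have "\<dots> = (\<Sum>l<N. ent X i l * (\<Sum>k<N. ent Y l k * ent Z k j))"
      unfolding sum_distrib_left sum_distrib_right
      by (subst sum.swap) (simp add: mult.assoc)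
    also have "\<dots> = ent (X * (Y * Z)) i j"
      by (simp add: ent_times[OF N(1)] ent_times'[OF N(3)])
    finally show "ent (X * Y * Z) i j = ent (X * (Y * Z)) i j" .
  qed
  show "(X + Y) * Z = X * Z + Y * Z"
    by (rule fmat_eqI) (simp add: ent_times'[OF N(3)] sum.distrib algebra_simps)
  show "X * (Y + Z) = X * Y + X * Z"
    by (rule fmat_eqI) (simp add: ent_times[OF N(1)] sum.distrib algebra_simps)
qed

end

lemma scaleC_simps:
  "scaleC c (X + Y) = scaleC c X + scaleC c Y" "scaleC (c + d) X = scaleC c X + scaleC d X"
  "scaleC c (scaleC d X) = scaleC (c * d) X" "scaleC 1 X = X" "scaleC 0 X = 0"
  "scaleC c (X - Y) = scaleC c X - scaleC c Y" "scaleC (-1) X = - X"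
  by (rule fmat_eqI, simp add: algebra_simps)+

lemma scaleC_mult_left: "scaleC c X * Y = scaleC c (X * Y)"
proof -
  obtain N where N: "supp_le N X" "supp_le N Y" by (rule ex_supp_le2)
  show ?thesis
    by (rule fmat_eqI) (simp add: ent_times'[OF N(2)] sum_distrib_left mult.assoc)
qed

lemma scaleC_mult_right: "X * scaleC c Y = scaleC c (X * Y)"
proof -
  obtain N where N: "supp_le N X" "supp_le N Y" by (rule ex_supp_le2)
  show ?thesis
    by (rule fmat_eqI) (simp add: ent_times[OF N(1)] sum_distrib_left mult_ac)
qed

lemma adj_simps [simp]:
  "adj (adj X) = X" "adj (X + Y) = adj X + adj Y" "adj (X - Y) = adj X - adj Y"
  "adj (scaleC c X) = scaleC (cnj c) (adj X)" "adj 0 = 0" "adj (- X) = - adj X"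
  by (rule fmat_eqI, simp)+

lemma supp_le_adj [simp]: "supp_le N (adj X) \<longleftrightarrow> supp_le N X"
  by (auto simp: supp_le_def)

lemma adj_mult [simp]: "adj (X * Y) = adj Y * adj X"
proof -
  obtain N where N: "supp_le N X" "supp_le N Y" by (rule ex_supp_le2)
  have N': "supp_le N (adj Y)" using N by simp
  show ?thesis
    by (rule fmat_eqI) (simp add: ent_times[OF N(1)] ent_times[OF N'] mult.commute)
qed

definition cin :: "fmat \<Rightarrow> fmat \<Rightarrow> complex"
  where "cin X Y = (\<Sum>(i, j) | ent X i j \<noteq> 0. ent X i j * cnj (ent Y i j))"

lemma cin_eq:
  assumes "supp_le N X"
  shows "cin X Y = (\<Sum>i<N. \<Sum>j<N. ent X i j * cnj (ent Y i j))"
proof -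
  have "cin X Y = (\<Sum>(i, j)\<in>{..<N} \<times> {..<N}. ent X i j * cnj (ent Y i j))"
    unfolding cin_def
    by (rule sum.mono_neutral_left) (use assms in \<open>auto simp: supp_le_def intro: not_le_imp_less\<close>)
  thus ?thesis by (simp add: sum.cartesian_product)
qed

lemma cin_add_left: "cin (X + Y) Z = cin X Z + cin Y Z"
proof -
  obtain N where N: "supp_le N X" "supp_le N Y" by (rule ex_supp_le2)
  hence "supp_le N (X + Y)" by (auto simp: supp_le_def)
  thus ?thesis using N by (simp add: cin_eq sum.distrib algebra_simps)
qed

lemma cin_scaleC_left: "cin (scaleC c X) Y = c * cin X Y"
proof -
  obtain N where N: "supp_le N X" using ex_supp_le by blast
  hence "supp_le N (scaleC c X)" by (auto simp: supp_le_def)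
  thus ?thesis using N by (simp add: cin_eq sum_distrib_left mult.assoc)
qed

lemma cin_commute: "cin X Y = cnj (cin Y X)"
proof -
  obtain N where N: "supp_le N X" "supp_le N Y" by (rule ex_supp_le2)
  thus ?thesis by (simp add: cin_eq mult.commute)
qed

lemma cin_add_right: "cin X (Y + Z) = cin X Y + cin X Z"
  by (metis cin_add_left cin_commute complex_cnj_add)

lemma cin_scaleC_right: "cin X (scaleC c Y) = cnj c * cin X Y"
  by (metis cin_scaleC_left cin_commute complex_cnj_mult)

lemma cin_self:
  assumes "supp_le N X"
  shows "cin X X = of_real (\<Sum>i<N. \<Sum>j<N. (cmod (ent X i j))\<^sup>2)"
  by (simp add: cin_eq[OF assms] complex_norm_square[symmetric] del: of_real_power)

lemma cin_self_Im [simp]: "Im (cin X X) = 0"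
  using ex_supp_le[of X] cin_self by force

lemma cin_zero [simp]: "cin 0 X = 0" "cin X 0 = 0"
  by (simp_all add: cin_def)

text \<open>The trace property in the form in which it is used.\<close>

lemma cin_mult_left: "cin (X * Y) Z = cin Y (adj X * Z)"
proof -
  obtain N where N: "supp_le N X" "supp_le N Y" "supp_le N Z" by (rule ex_supp_le3)
  have *: "supp_le N (adj X)" "supp_le N (X * Y)" using N by (simp_all add: supp_le_times)
  have "cin (X * Y) Z = (\<Sum>i<N. \<Sum>j<N. \<Sum>k<N. ent X i k * ent Y k j * cnj (ent Z i j))"
    by (simp add: cin_eq[OF *(2)] ent_times[OF N(1)] sum_distrib_right)
  also have "\<dots> = (\<Sum>i<N. \<Sum>k<N. \<Sum>j<N. ent X i k * ent Y k j * cnj (ent Z i j))"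
    by (rule sum.cong[OF refl], rule sum.swap)
  also have "\<dots> = (\<Sum>k<N. \<Sum>i<N. \<Sum>j<N. ent X i k * ent Y k j * cnj (ent Z i j))"
    by (rule sum.swap)
  also have "\<dots> = (\<Sum>k<N. \<Sum>j<N. \<Sum>i<N. ent X i k * ent Y k j * cnj (ent Z i j))"
    by (rule sum.cong[OF refl], rule sum.swap)
  also have "\<dots> = cin Y (adj X * Z)"
    by (simp add: cin_eq[OF N(2)] ent_times[OF *(1)] sum_distrib_left mult_ac)
  finally show ?thesis .
qed

lemma cin_adj: "cin (adj X) (adj Y) = cin Y X"
proof -
  obtain N where N: "supp_le N X" "supp_le N Y" by (rule ex_supp_le2)
  hence N': "supp_le N (adj X)" by simp
  show ?thesis by (simp add: cin_eq[OF N'] cin_eq[OF N(2)] mult.commute) (rule sum.swap)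
qed

lemma cin_mult_right: "cin (X * Y) Z = cin X (Z * adj Y)"
  by (metis adj_mult adj_simps(1) cin_adj cin_commute cin_mult_left)

instantiation fmat :: real_inner
begin

definition "scaleR r (X :: fmat) = scaleC (of_real r) X"
definition "inner (X :: fmat) Y = Re (cin X Y)"
definition "norm (X :: fmat) = sqrt (inner X X)"
definition "dist X Y = norm (X - Y :: fmat)"
definition "sgn X = inverse (norm X) *\<^sub>R (X :: fmat)"
definition [code del]: "(uniformity :: (fmat \<times> fmat) filter) = (INF e\<in>{0<..}. principal {(x, y). dist x y < e})"
definition [code del]: "open (U :: fmat set) \<longleftrightarrow> (\<forall>x\<in>U. \<forall>\<^sub>F (x', y) in uniformity. x' = x \<longrightarrow> y \<in> U)"

instance
proof
  fix X Y Z :: fmat and r s :: real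
  show "r *\<^sub>R (X + Y) = r *\<^sub>R X + r *\<^sub>R Y" "(r + s) *\<^sub>R X = r *\<^sub>R X + s *\<^sub>R X"
    "r *\<^sub>R s *\<^sub>R X = (r * s) *\<^sub>R X" "1 *\<^sub>R X = X"
    by (simp_all add: scaleR_fmat_def scaleC_simps)
  show "dist X Y = norm (X - Y)" "norm X = sqrt (inner X X)" "sgn X = inverse (norm X) *\<^sub>R X"
    by (rule dist_fmat_def norm_fmat_def sgn_fmat_def)+
  show "(uniformity :: (fmat \<times> fmat) filter) = (INF e\<in>{0<..}. principal {(x, y). dist x y < e})"
    by (rule uniformity_fmat_def)
  show "open U \<longleftrightarrow> (\<forall>x\<in>U. \<forall>\<^sub>F (x', y) in uniformity. x' = x \<longrightarrow> y \<in> U)" for U :: "fmat set"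
    by (rule open_fmat_def)
  show "inner X Y = inner Y X" by (simp add: inner_fmat_def cin_commute[of X Y])
  show "inner (X + Y) Z = inner X Z + inner Y Z" by (simp add: inner_fmat_def cin_add_left)
  show "inner (r *\<^sub>R X) Y = r * inner X Y"
    by (simp add: inner_fmat_def scaleR_fmat_def cin_scaleC_left)
  obtain N where N: "supp_le N X" using ex_supp_le by blast
  have e: "inner X X = (\<Sum>i<N. \<Sum>j<N. (cmod (ent X i j))\<^sup>2)"
    by (simp add: inner_fmat_def cin_self[OF N])
  show "0 \<le> inner X X" unfolding e by (intro sum_nonneg) auto
  show "inner X X = 0 \<longleftrightarrow> X = 0"
  proof
    assume "inner X X = 0"
    hence z: "\<forall>i<N. \<forall>j<N. ent X i j = 0" unfolding e
      by (subst (asm) sum_nonneg_eq_0_iff) (auto intro!: sum_nonneg simp: sum_nonneg_eq_0_iff)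
    have "ent X i j = 0" for i j
      using z N by (cases "i < N"; cases "j < N") (auto simp: supp_le_def)
    thus "X = 0" by (intro fmat_eqI) simp
  qed (simp add: inner_fmat_def)
qed

end

lemma cin_norm: "cin X X = of_real ((norm X)\<^sup>2)"
  by (simp add: complex_eq_iff power2_norm_eq_inner inner_fmat_def)

lemma norm_sq_entries: "supp_le N X \<Longrightarrow> (norm X)\<^sup>2 = (\<Sum>i<N. \<Sum>j<N. (cmod (ent X i j))\<^sup>2)"
  by (simp add: power2_norm_eq_inner inner_fmat_def cin_self)

lemma norm_scaleC [simp]: "norm (scaleC c X) = cmod c * norm X"
proof -
  have "(norm (scaleC c X))\<^sup>2 = (cmod c * norm X)\<^sup>2"
    using arg_cong[OF cin_norm[of "scaleC c X"], of Re] cin_norm[of X]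
    by (simp add: cin_scaleC_left cin_scaleC_right power_mult_distrib mult.assoc[symmetric]
        cmod_power2 power2_eq_square[of "Re c"] power2_eq_square[of "Im c"])
  thus ?thesis by (simp add: power2_eq_imp_eq)
qed

lemma norm_adj [simp]: "norm (adj X) = norm X"
  by (simp add: norm_fmat_def inner_fmat_def cin_adj)

text \<open>Turning \<open>Y\<close> by a phase reduces this to the real Cauchy--Schwarz inequality.\<close>

lemma cin_bound: "cmod (cin X Y) \<le> norm X * norm Y"
proof (cases "cin X Y = 0")
  case False
  define c where "c = cin X Y / of_real (cmod (cin X Y))"
  have c1: "cmod c = 1" using False by (simp add: c_def norm_divide)
  have cc: "cnj (cin X Y) * cin X Y = of_real ((cmod (cin X Y))\<^sup>2)"
    by (metis complex_norm_square mult.commute)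
  have "cin X (scaleC c Y) = of_real (cmod (cin X Y))"
    using False by (simp add: cin_scaleC_right c_def cc power2_eq_square)
  hence "cmod (cin X Y) = inner X (scaleC c Y)" by (simp add: inner_fmat_def)
  also have "\<dots> \<le> norm X * norm (scaleC c Y)" by (rule norm_cauchy_schwarz)
  finally show ?thesis by (simp add: c1)
qed simp

lemma norm_mult_fmat: "norm (X * Y) \<le> norm X * norm (Y :: fmat)"
proof -
  obtain N where N: "supp_le N X" "supp_le N Y" by (rule ex_supp_le2)
  have cs: "(cmod (\<Sum>k<N. ent X i k * ent Y k j))\<^sup>2
      \<le> (\<Sum>k<N. (cmod (ent X i k))\<^sup>2) * (\<Sum>k<N. (cmod (ent Y k j))\<^sup>2)" for i j
  proof -
    have "cmod (\<Sum>k<N. ent X i k * ent Y k j) \<le> (\<Sum>k<N. cmod (ent X i k) * cmod (ent Y k j))"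
      by (rule order_trans[OF norm_sum]) (simp add: norm_mult)
    hence "(cmod (\<Sum>k<N. ent X i k * ent Y k j))\<^sup>2 \<le> (\<Sum>k<N. cmod (ent X i k) * cmod (ent Y k j))\<^sup>2"
      by (rule power_mono) simp
    also have "\<dots> \<le> (\<Sum>k<N. (cmod (ent X i k))\<^sup>2) * (\<Sum>k<N. (cmod (ent Y k j))\<^sup>2)"
      by (rule Cauchy_Schwarz_ineq_sum)
    finally show ?thesis .
  qed
  have "(norm (X * Y))\<^sup>2 = (\<Sum>i<N. \<Sum>j<N. (cmod (\<Sum>k<N. ent X i k * ent Y k j))\<^sup>2)"
    by (simp add: norm_sq_entries[OF supp_le_times[OF N]] ent_times[OF N(1)])
  also have "\<dots> \<le> (\<Sum>i<N. \<Sum>j<N. (\<Sum>k<N. (cmod (ent X i k))\<^sup>2) * (\<Sum>k<N. (cmod (ent Y k j))\<^sup>2))"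
    by (intro sum_mono cs)
  also have "\<dots> = (\<Sum>i<N. \<Sum>k<N. (cmod (ent X i k))\<^sup>2) * (\<Sum>j<N. \<Sum>k<N. (cmod (ent Y k j))\<^sup>2)"
    by (simp add: sum_product)
  also have "(\<Sum>j<N. \<Sum>k<N. (cmod (ent Y k j))\<^sup>2) = (\<Sum>k<N. \<Sum>j<N. (cmod (ent Y k j))\<^sup>2)"
    by (rule sum.swap)
  also have "(\<Sum>i<N. \<Sum>k<N. (cmod (ent X i k))\<^sup>2) * \<dots> = (norm X * norm Y)\<^sup>2"
    by (simp add: norm_sq_entries[OF N(1)] norm_sq_entries[OF N(2)] power_mult_distrib)
  finally show ?thesis by (rule power2_le_imp_le) simp
qed

instance fmat :: real_normed_algebra
  by standard (simp_all add: norm_mult_fmat scaleR_fmat_def scaleC_mult_left scaleC_mult_right)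

subsection \<open>The operator norm\<close>

text \<open>The operator norm of a matrix is its norm as a left multiplication on Hilbert--Schmidt
  matrices, that is, on columns.\<close>

definition opn :: "fmat \<Rightarrow> real"
  where "opn A = onorm (\<lambda>X. A * X)"

lemma opn_mult_left: "norm (A * X) \<le> opn A * norm X"
  unfolding opn_def by (rule onorm) (rule bounded_linear_mult_right)

lemma opn_nonneg [simp]: "0 \<le> opn A"
  unfolding opn_def by (rule onorm_pos_le) (rule bounded_linear_mult_right)

lemma opn_le: "(\<And>X. norm (A * X) \<le> c * norm X) \<Longrightarrow> 0 \<le> c \<Longrightarrow> opn A \<le> c"
  unfolding opn_def by (rule onorm_bound)

lemma opn_le_norm: "opn A \<le> norm A"
  by (rule opn_le) (auto simp: norm_mult_fmat)

lemma opn_adj_le: "opn (adj A) \<le> opn A"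
proof (rule opn_le)
  fix X
  have "(norm (adj A * X))\<^sup>2 = Re (cin (adj A * X) (adj A * X))" by (simp add: cin_norm)
  also have "\<dots> = Re (cin X (A * (adj A * X)))" by (subst cin_mult_left) simp
  also have "\<dots> \<le> cmod (cin X (A * (adj A * X)))" by (rule complex_Re_le_cmod)
  also have "\<dots> \<le> norm X * norm (A * (adj A * X))" by (rule cin_bound)
  also have "\<dots> \<le> norm X * (opn A * norm (adj A * X))"
    by (intro mult_left_mono opn_mult_left) simp
  finally have "norm (adj A * X) * norm (adj A * X) \<le> (opn A * norm X) * norm (adj A * X)"
    by (simp add: power2_eq_square mult_ac)
  thus "norm (adj A * X) \<le> opn A * norm X"
    by (cases "norm (adj A * X) = 0") auto
qed simp

lemma opn_adj [simp]: "opn (adj A) = opn A"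
  using opn_adj_le[of A] opn_adj_le[of "adj A"] by simp

lemma opn_mult_right: "norm (X * A) \<le> opn A * norm X"
  using opn_mult_left[of "adj A" "adj X"] by (metis adj_mult norm_adj opn_adj)

lemma opn_add: "opn (A + B) \<le> opn A + opn B"
proof (rule opn_le)
  fix X
  have "norm ((A + B) * X) \<le> norm (A * X) + norm (B * X)"
    by (simp add: distrib_right norm_triangle_ineq)
  also have "\<dots> \<le> opn A * norm X + opn B * norm X" by (intro add_mono opn_mult_left)
  finally show "norm ((A + B) * X) \<le> (opn A + opn B) * norm X" by (simp add: distrib_right)
qed simp

lemma opn_mult: "opn (A * B) \<le> opn A * opn B"
proof (rule opn_le)
  fix X
  have "norm (A * B * X) \<le> opn A * norm (B * X)" by (simp add: mult.assoc opn_mult_left)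
  also have "\<dots> \<le> opn A * (opn B * norm X)" by (intro mult_left_mono opn_mult_left) simp
  finally show "norm (A * B * X) \<le> opn A * opn B * norm X" by simp
qed simp

lemma opn_scaleC_le: "opn (scaleC c A) \<le> cmod c * opn A"
  by (rule opn_le) (auto simp: scaleC_mult_left mult.assoc intro!: mult_left_mono opn_mult_left)

lemma opn_zero [simp]: "opn 0 = 0"
  using opn_le[of 0 0] opn_nonneg[of 0] by auto

lemma opn_uminus [simp]: "opn (- A) = opn A"
proof -
  have "opn (- A) \<le> opn A" for A using opn_scaleC_le[of "-1" A] by (simp add: scaleC_simps)
  from this[of A] this[of "- A"] show ?thesis by simp
qed

lemma opn_diff: "opn (A - B) \<le> opn A + opn B"
  using opn_add[of A "- B"] by simp

text \<open>The polynomial \<open>3x\<^sup>2 - 2x\<^sup>3\<close> has superattracting fixed points at 0 and 1, so iterating it turns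
  an approximate idempotent into one whose defect is as small as required.\<close>

lemma polish_idempotent:
  assumes d: "opn (x * x - x) \<le> 1/32" and x: "opn x \<le> 2" and \<eta>: "\<eta> > 0"
  shows "\<exists>y. norm (y * y - y) \<le> \<eta> \<and> opn (y - x) \<le> 10 * opn (x * x - x)
    \<and> (\<forall>p. p * x = x \<longrightarrow> p * y = y) \<and> (\<forall>p. x * p = x \<longrightarrow> y * p = y)"
proof -
  define D where "D = opn (x * x - x)"
  have D0: "0 \<le> D" "D \<le> 1/32" using d by (simp_all add: D_def)
  have it: "\<exists>y. opn (y * y - y) \<le> D * (1/4) ^ j \<and> norm (y * y - y) \<le> norm (x * x - x) * (1/4) ^ j
      \<and> opn (y - x) \<le> 10 * D * (1 - (1/4) ^ j)
      \<and> (\<forall>p. p * x = x \<longrightarrow> p * y = y) \<and> (\<forall>p. x * p = x \<longrightarrow> y * p = y)" for j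
  proof (induction j)
    case 0
    show ?case by (rule exI[of _ x]) (simp add: D_def)
  next
    case (Suc j)
    then obtain y where y: "opn (y * y - y) \<le> D * (1/4) ^ j"
      "norm (y * y - y) \<le> norm (x * x - x) * (1/4) ^ j" "opn (y - x) \<le> 10 * D * (1 - (1/4) ^ j)"
      and cor: "\<And>p. p * x = x \<Longrightarrow> p * y = y" "\<And>p. x * p = x \<Longrightarrow> y * p = y" by blast
    define z where "z = y * y - y"
    define y' where "y' = y * y + y * y + y * y - (y * y * y + y * y * y)"
    have p: "0 \<le> (1/4 :: real) ^ j" "(1/4 :: real) ^ j \<le> 1" by (simp_all add: power_le_one)
    have z: "opn z \<le> D * (1/4) ^ j" using y(1) by (simp add: z_def)
    have "D * (1/4) ^ j \<le> (1/32) * 1" using D0 p by (intro mult_mono) auto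
    hence z32: "opn z \<le> 1/32" using z by simp
    have "10 * D * (1 - (1/4) ^ j) \<le> 10 * (1/32) * 1" using D0 p by (intro mult_mono) auto
    hence "opn (y - x) \<le> 1" using y(3) by simp
    hence y3: "opn y \<le> 3" using opn_add[of "y - x" x] x by simp
    have e1: "y' - y = z - (y * z + y * z)" by (simp add: y'_def z_def algebra_simps)
    have e2: "y' * y' - y' = (z * z + z * z + (z * z + z * z) - (z + z + z)) * z"
      by (simp add: y'_def z_def algebra_simps)
    have zz: "opn (z * z) \<le> opn z / 32"
    proof -
      have "opn (z * z) \<le> opn z * opn z" by (rule opn_mult)
      also have "\<dots> \<le> opn z * (1/32)" using z32 by (intro mult_left_mono) auto
      finally show ?thesis by simp
    qed
    have c: "opn (z * z + z * z + (z * z + z * z) - (z + z + z)) \<le> 1/4"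
      using opn_diff[of "z * z + z * z + (z * z + z * z)" "z + z + z"] opn_add[of "z * z + z * z" "z * z + z * z"]
        opn_add[of "z * z" "z * z"] opn_add[of "z + z" z] opn_add[of z z] zz z32 by linarith
    have n1: "norm (y' * y' - y') \<le> norm z * (1/4)"
    proof -
      have "norm (y' * y' - y') \<le> opn (z * z + z * z + (z * z + z * z) - (z + z + z)) * norm z"
        unfolding e2 by (rule opn_mult_left)
      also have "\<dots> \<le> (1/4) * norm z" using c by (intro mult_right_mono) auto
      finally show ?thesis by simp
    qed
    have n2: "opn (y' * y' - y') \<le> opn z * (1/4)"
    proof -
      have "opn (y' * y' - y') \<le> opn (z * z + z * z + (z * z + z * z) - (z + z + z)) * opn z"
        unfolding e2 by (rule opn_mult)
      also have "\<dots> \<le> (1/4) * opn z" using c by (intro mult_right_mono) auto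
      finally show ?thesis by simp
    qed
    have yz: "opn (y * z) \<le> 3 * opn z"
      using opn_mult[of y z] mult_right_mono[OF y3, of "opn z"] by simp
    have n3: "opn (y' - y) \<le> 7 * opn z"
      unfolding e1 using opn_diff[of z "y * z + y * z"] opn_add[of "y * z" "y * z"] yz by linarith
    have "opn (y' - x) \<le> 7 * opn z + 10 * D * (1 - (1/4) ^ j)"
      using opn_add[of "y' - y" "y - x"] n3 y(3) by simp
    also have "\<dots> \<le> 10 * D * (1 - (1/4) ^ Suc j)"
      using z mult_nonneg_nonneg[OF D0(1) p(1)] by (simp add: right_diff_distrib)
    finally have "opn (y' - x) \<le> 10 * D * (1 - (1/4) ^ Suc j)" .
    moreover have "opn (y' * y' - y') \<le> D * (1/4) ^ Suc j" using n2 z by simp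
    moreover have "norm (y' * y' - y') \<le> norm (x * x - x) * (1/4) ^ Suc j"
      using n1 y(2) by (simp add: z_def)
    moreover have "p * y' = y'" if "p * x = x" for p
      unfolding y'_def using cor(1)[OF that] by (simp add: distrib_left right_diff_distrib mult.assoc[symmetric])
    moreover have "y' * p = y'" if "x * p = x" for p
      unfolding y'_def using cor(2)[OF that] by (simp add: distrib_right left_diff_distrib mult.assoc)
    ultimately show ?case by blast
  qed
  have "(\<lambda>j. norm (x * x - x) * (1/4) ^ j) \<longlonglongrightarrow> norm (x * x - x) * 0"
    by (intro tendsto_mult tendsto_const LIMSEQ_realpow_zero) auto
  hence "\<forall>\<^sub>F j in sequentially. norm (x * x - x) * (1/4) ^ j < \<eta>"
    using \<eta> by (intro order_tendstoD) auto
  then obtain j where j: "norm (x * x - x) * (1/4) ^ j < \<eta>"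
    by (auto simp: eventually_sequentially)
  obtain y where y: "norm (y * y - y) \<le> norm (x * x - x) * (1/4) ^ j"
    "opn (y - x) \<le> 10 * D * (1 - (1/4) ^ j)"
    "\<forall>p. p * x = x \<longrightarrow> p * y = y" "\<forall>p. x * p = x \<longrightarrow> y * p = y" using it by blast
  have "10 * D * (1 - (1/4) ^ j) \<le> 10 * D * 1"
    using D0 by (intro mult_left_mono) auto
  thus ?thesis using y j unfolding D_def by (intro exI[of _ y]) auto
qed

section \<open>Ultrafilters\<close>

definition ultrafilter :: "'i filter \<Rightarrow> bool"
  where "ultrafilter U \<longleftrightarrow> U \<noteq> bot \<and> (\<forall>P. eventually P U \<or> eventually (\<lambda>x. \<not> P x) U)"

lemma ultrafilter_exists:
  assumes F: "F \<noteq> bot"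
  shows "\<exists>U\<le>F. ultrafilter U"
proof -
  define A where "A = {G. G \<le> F \<and> G \<noteq> bot}"
  have "\<exists>m\<in>A. \<forall>a\<in>A. m \<ge> a \<longrightarrow> a = m"
  proof (rule predicate_Zorn)
    show "partial_order_on A (relation_of (\<ge>) A)"
      by (auto simp: partial_order_on_def preorder_on_def refl_on_def trans_def antisym_def relation_of_def)
    fix C assume C: "C \<in> Chains (relation_of (\<ge>) A)"
    have CA: "C \<subseteq> A" using C by (auto simp: Chains_def relation_of_def)
    show "\<exists>u\<in>A. \<forall>a\<in>C. a \<ge> u"
    proof (cases "C = {}")
      case True
      thus ?thesis using F by (auto simp: A_def)
    next
      case False
      have ch: "\<exists>x\<in>C. x \<le> inf G H" if "G \<in> C" "H \<in> C" for G H
        using C that by (auto simp: Chains_def relation_of_def)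
      have "Inf C \<noteq> bot"
      proof
        assume "Inf C = bot"
        hence "eventually (\<lambda>_. False) (Inf C)" by simp
        hence "\<exists>b\<in>C. eventually (\<lambda>_. False) b"
          by (subst (asm) eventually_Inf_base[OF False ch]) auto
        thus False using CA by (auto simp: A_def eventually_False)
      qed
      moreover have "Inf C \<le> F" using False CA by (auto simp: A_def intro: Inf_lower2)
      ultimately have "Inf C \<in> A" by (simp add: A_def)
      thus ?thesis by (auto intro: Inf_lower)
    qed
  qed
  then obtain m where m: "m \<le> F" "m \<noteq> bot" "\<And>a. a \<le> F \<Longrightarrow> a \<noteq> bot \<Longrightarrow> a \<le> m \<Longrightarrow> a = m"
    by (auto simp: A_def)
  have "eventually P m \<or> eventually (\<lambda>x. \<not> P x) m" for P
  proof (rule disjCI)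
    assume np: "\<not> eventually (\<lambda>x. \<not> P x) m"
    have "inf m (principal {x. P x}) \<noteq> bot"
    proof
      assume "inf m (principal {x. P x}) = bot"
      hence "eventually (\<lambda>_. False) (inf m (principal {x. P x}))" by simp
      thus False using np by (simp add: eventually_inf_principal)
    qed
    hence "inf m (principal {x. P x}) = m" using m by (simp add: le_infI1)
    hence "m \<le> principal {x. P x}" by (metis inf.cobounded2)
    thus "eventually P m" by (simp add: le_principal)
  qed
  thus ?thesis using m unfolding ultrafilter_def by blast
qed

lemma ultrafilter_not:
  assumes U: "ultrafilter U"
  shows "(\<not> eventually P U) \<longleftrightarrow> eventually (\<lambda>x. \<not> P x) U"
proof
  assume np: "eventually (\<lambda>x. \<not> P x) U"
  show "\<not> eventually P U"
  proof
    assume "eventually P U"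
    with np have "eventually (\<lambda>_. False) U" by eventually_elim blast
    thus False using U by (simp add: ultrafilter_def eventually_False)
  qed
qed (use U in \<open>auto simp: ultrafilter_def\<close>)

lemma ultrafilter_ex_finite:
  assumes U: "ultrafilter U" and fin: "finite K" and ev: "eventually (\<lambda>n. \<exists>k\<in>K. P k n) U"
  shows "\<exists>k\<in>K. eventually (P k) U"
proof (rule ccontr)
  assume "\<not> ?thesis"
  hence "\<forall>k\<in>K. eventually (\<lambda>n. \<not> P k n) U" using ultrafilter_not[OF U] by blast
  hence "eventually (\<lambda>n. \<forall>k\<in>K. \<not> P k n) U" using fin by (simp add: eventually_ball_finite)
  with ev have "eventually (\<lambda>_. False) U" by eventually_elim blast
  thus False using U by (simp add: ultrafilter_def eventually_False)
qed

lemma ultrafilter_tendsto: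
  fixes f :: "'i \<Rightarrow> 'a::topological_space"
  assumes U: "ultrafilter U" and C: "compact C" and ev: "eventually (\<lambda>n. f n \<in> C) U"
  shows "\<exists>l\<in>C. (f \<longlongrightarrow> l) U"
proof -
  have "filtermap f U \<noteq> bot" using U by (simp add: ultrafilter_def filtermap_bot_iff)
  moreover have "eventually (\<lambda>x. x \<in> C) (filtermap f U)" using ev by (simp add: eventually_filtermap)
  ultimately obtain l where l: "l \<in> C" "inf (nhds l) (filtermap f U) \<noteq> bot"
    using C by (auto simp: compact_filter)
  have "eventually (\<lambda>n. f n \<in> V) U" if V: "open V" "l \<in> V" for V
  proof (rule ccontr)
    assume "\<not> ?thesis"
    hence "eventually (\<lambda>x. x \<notin> V) (filtermap f U)"
      using ultrafilter_not[OF U] by (simp add: eventually_filtermap)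
    moreover have "eventually (\<lambda>x. x \<in> V) (nhds l)" using V by (simp add: eventually_nhds_in_open)
    ultimately have "eventually (\<lambda>_. False) (inf (nhds l) (filtermap f U))"
      unfolding eventually_inf by (intro exI conjI) auto
    thus False using l by (simp add: eventually_False)
  qed
  thus ?thesis using l(1) by (auto simp: tendsto_def)
qed

section \<open>Semi-inner products\<close>

text \<open>Vectors of norm zero are kept, and all statements about vectors are made up to norm zero. This makes it
  possible to take sequences of matrices themselves as the vectors of an ultraproduct.\<close>

locale semi_inner =
  fixes sc :: "complex \<Rightarrow> 'v::ab_group_add \<Rightarrow> 'v" and S :: "'v set" and b :: "'v \<Rightarrow> 'v \<Rightarrow> complex"
  assumes zero_in [simp]: "0 \<in> S"
    and add_in [simp]: "x \<in> S \<Longrightarrow> y \<in> S \<Longrightarrow> x + y \<in> S"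
    and sc_in [simp]: "x \<in> S \<Longrightarrow> sc c x \<in> S"
    and sc_add_right: "sc c (x + y) = sc c x + sc c y"
    and sc_add_left: "sc (c + d) x = sc c x + sc d x"
    and sc_sc: "sc c (sc d x) = sc (c * d) x"
    and sc_one [simp]: "sc 1 x = x"
    and b_add_left: "x \<in> S \<Longrightarrow> y \<in> S \<Longrightarrow> z \<in> S \<Longrightarrow> b (x + y) z = b x z + b y z"
    and b_sc_left: "x \<in> S \<Longrightarrow> y \<in> S \<Longrightarrow> b (sc c x) y = c * b x y"
    and b_commute: "x \<in> S \<Longrightarrow> y \<in> S \<Longrightarrow> b x y = cnj (b y x)"
    and b_nonneg: "x \<in> S \<Longrightarrow> 0 \<le> Re (b x x)"
begin

definition nrm :: "'v \<Rightarrow> real" where "nrm x = sqrt (Re (b x x))"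

lemma sc_zero [simp]: "sc 0 x = 0" "sc c 0 = 0"
  using sc_add_left[of 0 0 x] sc_add_right[of c 0 0] by simp_all

lemma sc_minus_one: "sc (-1) x = - x"
  using sc_add_left[of "-1" 1 x] by (simp add: eq_neg_iff_add_eq_0)

lemma sc_minus: "sc c (- x) = - sc c x"
  by (metis sc_minus_one sc_sc mult.commute)

lemma sc_diff: "sc c (x - y) = sc c x - sc c y"
  using sc_add_right[of c x "- y"] by (simp add: sc_minus)

lemma sc_sum: "sc c (sum f A) = (\<Sum>i\<in>A. sc c (f i))"
  by (induction A rule: infinite_finite_induct) (simp_all add: sc_add_right)

lemma uminus_in [simp]: "x \<in> S \<Longrightarrow> - x \<in> S"
  using sc_in[of x "-1"] by (simp add: sc_minus_one)

lemma diff_in [simp]: "x \<in> S \<Longrightarrow> y \<in> S \<Longrightarrow> x - y \<in> S"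
  using add_in[of x "- y"] by simp

lemma sum_in: "(\<And>i. i \<in> A \<Longrightarrow> f i \<in> S) \<Longrightarrow> sum f A \<in> S"
  by (induction A rule: infinite_finite_induct) auto

lemma b_minus_left: "x \<in> S \<Longrightarrow> y \<in> S \<Longrightarrow> b (- x) y = - b x y"
  using b_sc_left[of x y "-1"] by (simp add: sc_minus_one)

lemma b_diff_left: "x \<in> S \<Longrightarrow> y \<in> S \<Longrightarrow> z \<in> S \<Longrightarrow> b (x - y) z = b x z - b y z"
  using b_add_left[of x "- y" z] by (simp add: b_minus_left)

lemma b_zero_left [simp]: "x \<in> S \<Longrightarrow> b 0 x = 0"
  using b_sc_left[of 0 x 0] by simp

lemma b_zero_right [simp]: "x \<in> S \<Longrightarrow> b x 0 = 0"
  using b_commute[of x 0] by simp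

lemma b_add_right: "x \<in> S \<Longrightarrow> y \<in> S \<Longrightarrow> z \<in> S \<Longrightarrow> b x (y + z) = b x y + b x z"
  by (metis add_in b_add_left b_commute complex_cnj_add)

lemma b_diff_right: "x \<in> S \<Longrightarrow> y \<in> S \<Longrightarrow> z \<in> S \<Longrightarrow> b x (y - z) = b x y - b x z"
  by (metis diff_in b_diff_left b_commute complex_cnj_diff)

lemma b_sc_right: "x \<in> S \<Longrightarrow> y \<in> S \<Longrightarrow> b x (sc c y) = cnj c * b x y"
  by (metis sc_in b_sc_left b_commute complex_cnj_mult)

lemma b_sum_left: "(\<And>i. i \<in> A \<Longrightarrow> f i \<in> S) \<Longrightarrow> y \<in> S \<Longrightarrow> b (sum f A) y = (\<Sum>i\<in>A. b (f i) y)"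
  by (induction A rule: infinite_finite_induct) (simp_all add: b_add_left sum_in)

lemma nrm_nonneg [simp]: "x \<in> S \<Longrightarrow> 0 \<le> nrm x"
  by (simp add: nrm_def b_nonneg)

lemma b_self: "x \<in> S \<Longrightarrow> b x x = of_real ((nrm x)\<^sup>2)"
  using b_commute[of x x] b_nonneg[of x] by (simp add: nrm_def complex_eq_iff)

lemma nrm_zero [simp]: "nrm 0 = 0" by (simp add: nrm_def)

lemma nrm_sc [simp]:
  assumes x: "x \<in> S" shows "nrm (sc c x) = cmod c * nrm x"
proof -
  have "b (sc c x) (sc c x) = (c * cnj c) * b x x" using x by (simp add: b_sc_left b_sc_right)
  also have "\<dots> = of_real ((cmod c * nrm x)\<^sup>2)"
    by (simp add: b_self[OF x] complex_norm_square[symmetric] power_mult_distrib del: of_real_power flip: of_real_mult)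
  finally show ?thesis using x by (simp add: nrm_def real_sqrt_unique b_nonneg)
qed

lemma nrm_minus [simp]: "x \<in> S \<Longrightarrow> nrm (- x) = nrm x"
  using nrm_sc[of x "-1"] by (simp add: sc_minus_one)

lemma nrm_diff_commute: "x \<in> S \<Longrightarrow> y \<in> S \<Longrightarrow> nrm (x - y) = nrm (y - x)"
  using nrm_minus[of "x - y"] by simp

lemma nrm_add_sq: "x \<in> S \<Longrightarrow> y \<in> S \<Longrightarrow> (nrm (x + y))\<^sup>2 = (nrm x)\<^sup>2 + (nrm y)\<^sup>2 + 2 * Re (b x y)"
  using b_self[of "x + y"] b_self[of x] b_self[of y] b_commute[of y x]
  by (simp add: b_add_left b_add_right complex_eq_iff)

lemma nrm_diff_sq: "x \<in> S \<Longrightarrow> y \<in> S \<Longrightarrow> (nrm (x - y))\<^sup>2 = (nrm x)\<^sup>2 + (nrm y)\<^sup>2 - 2 * Re (b x y)"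
  using nrm_add_sq[of x "- y"] b_commute[of x "- y"] b_commute[of x y] by (simp add: b_minus_left)

lemma parallelogram:
  "x \<in> S \<Longrightarrow> y \<in> S \<Longrightarrow> (nrm (x + y))\<^sup>2 + (nrm (x - y))\<^sup>2 = 2 * (nrm x)\<^sup>2 + 2 * (nrm y)\<^sup>2"
  by (simp add: nrm_add_sq nrm_diff_sq)

lemma b_bound:
  assumes x: "x \<in> S" and y: "y \<in> S"
  shows "cmod (b x y) \<le> nrm x * nrm y"
proof (cases "b x y = 0")
  case False
  define B where "B = cmod (b x y)"
  define c where "c = b x y / of_real B"
  have B: "B > 0" using False by (simp add: B_def)
  have c1: "cmod c = 1" using B by (simp add: c_def norm_divide B_def)
  have cb: "cnj c * b x y = of_real B"
  proof -
    have "cnj (b x y) * b x y = of_real (B\<^sup>2)" by (metis complex_norm_square mult.commute B_def)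
    thus ?thesis using B by (simp add: c_def power2_eq_square)
  qed
  have q: "0 \<le> (nrm x)\<^sup>2 + r\<^sup>2 * (nrm y)\<^sup>2 - 2 * (r * B)" for r :: real
  proof -
    have "b x (sc (of_real r * c) y) = of_real (r * B)"
      using x y cb by (simp add: b_sc_right mult.assoc)
    hence "(nrm (x - sc (of_real r * c) y))\<^sup>2 = (nrm x)\<^sup>2 + r\<^sup>2 * (nrm y)\<^sup>2 - 2 * (r * B)"
      using x y by (simp add: nrm_diff_sq norm_mult c1 power_mult_distrib)
    thus ?thesis by (metis zero_le_power2)
  qed
  have "nrm y \<noteq> 0"
  proof
    assume "nrm y = 0"
    thus False using q[of "((nrm x)\<^sup>2 + 1) / (2 * B)"] B by simp
  qed
  hence "(B / (nrm y)\<^sup>2)\<^sup>2 * (nrm y)\<^sup>2 = (B / nrm y)\<^sup>2" "B / (nrm y)\<^sup>2 * B = (B / nrm y)\<^sup>2"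
    by (simp_all add: power2_eq_square)
  hence "0 \<le> (nrm x)\<^sup>2 - (B / nrm y)\<^sup>2"
    using q[of "B / (nrm y)\<^sup>2"] by simp
  hence "(B / nrm y)\<^sup>2 \<le> (nrm x)\<^sup>2" by simp
  hence "B / nrm y \<le> nrm x" by (rule power2_le_imp_le) (simp add: x)
  thus ?thesis using \<open>nrm y \<noteq> 0\<close> nrm_nonneg[OF y] by (simp add: B_def field_simps)
qed (simp add: x y)

lemma nrm_triangle:
  assumes "x \<in> S" "y \<in> S" shows "nrm (x + y) \<le> nrm x + nrm y"
proof -
  have "(nrm (x + y))\<^sup>2 \<le> (nrm x + nrm y)\<^sup>2"
    using nrm_add_sq[OF assms] b_bound[OF assms] complex_Re_le_cmod[of "b x y"]
    by (simp add: power2_sum)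
  thus ?thesis by (rule power2_le_imp_le) (use assms in simp)
qed

lemma nrm_triangle_diff: "x \<in> S \<Longrightarrow> y \<in> S \<Longrightarrow> nrm (x - y) \<le> nrm x + nrm y"
  using nrm_triangle[of x "- y"] by simp

lemma nrm_diff_triangle: "x \<in> S \<Longrightarrow> y \<in> S \<Longrightarrow> z \<in> S \<Longrightarrow> nrm (x - z) \<le> nrm (x - y) + nrm (y - z)"
  using nrm_triangle[of "x - y" "y - z"] by simp

lemma nrm_le_diff: "x \<in> S \<Longrightarrow> y \<in> S \<Longrightarrow> nrm x \<le> nrm (x - y) + nrm y"
  using nrm_triangle[of "x - y" y] by simp

lemma nrm_cong0: "x \<in> S \<Longrightarrow> y \<in> S \<Longrightarrow> nrm (x - y) = 0 \<Longrightarrow> nrm x = nrm y"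
  using nrm_le_diff[of x y] nrm_le_diff[of y x] nrm_diff_commute[of x y] by simp

lemma nrm_sum: "(\<And>i. i \<in> A \<Longrightarrow> f i \<in> S) \<Longrightarrow> nrm (sum f A) \<le> (\<Sum>i\<in>A. nrm (f i))"
proof (induction A rule: infinite_finite_induct)
  case (insert a A)
  hence "nrm (sum f (insert a A)) \<le> nrm (f a) + nrm (sum f A)"
    using nrm_triangle[of "f a" "sum f A"] by (simp add: sum_in)
  thus ?case using insert by simp
qed simp_all

lemma b_cong0:
  assumes "x \<in> S" "x' \<in> S" "y \<in> S" "nrm (x - x') = 0"
  shows "b x y = b x' y"
  using b_bound[of "x - x'" y] assms by (simp add: b_diff_left)

lemma b_cong0_right:
  assumes "x \<in> S" "y' \<in> S" "y \<in> S" "nrm (y - y') = 0"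
  shows "b x y = b x y'"
  using b_bound[of x "y - y'"] assms by (simp add: b_diff_right)

text \<open>The vector \<open>x\<close> modulo vectors of norm zero is represented by the functional of inner products
  with \<open>x\<close>, so that the quotient has pointwise operations.\<close>

definition emb :: "'v \<Rightarrow> 'v \<Rightarrow> complex" where "emb x = (\<lambda>y. if y \<in> S then b x y else 0)"

definition rep :: "('v \<Rightarrow> complex) \<Rightarrow> 'v" where "rep f = (SOME x. x \<in> S \<and> emb x = f)"

definition Hil :: "('v \<Rightarrow> complex) inner_module"
  where "Hil = \<lparr>carrier = emb ` S, mult = undefined, one = undefined, zero = (\<lambda>_. 0),
    add = (\<lambda>f g y. f y + g y), module.smult = (\<lambda>c f y. c * f y),
    cinner = (\<lambda>f g. b (rep f) (rep g))\<rparr>"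

lemma emb_eq_iff: "x \<in> S \<Longrightarrow> y \<in> S \<Longrightarrow> emb x = emb y \<longleftrightarrow> nrm (x - y) = 0"
proof
  assume S: "x \<in> S" "y \<in> S" and "emb x = emb y"
  hence "b x (x - y) = b y (x - y)" by (metis diff_in emb_def)
  hence "b (x - y) (x - y) = 0" using S by (simp add: b_diff_left)
  thus "nrm (x - y) = 0" by (simp add: nrm_def)
next
  assume S: "x \<in> S" "y \<in> S" and "nrm (x - y) = 0"
  hence "b x z = b y z" if "z \<in> S" for z using that b_cong0 by blast
  thus "emb x = emb y" by (auto simp: emb_def fun_eq_iff)
qed

lemma rep: "x \<in> S \<Longrightarrow> rep (emb x) \<in> S" "x \<in> S \<Longrightarrow> emb (rep (emb x)) = emb x"
proof -
  assume "x \<in> S"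
  hence "\<exists>z. z \<in> S \<and> emb z = emb x" by blast
  from someI_ex[OF this] show "rep (emb x) \<in> S" "emb (rep (emb x)) = emb x"
    unfolding rep_def by auto
qed

lemma nrm_rep: "x \<in> S \<Longrightarrow> nrm (rep (emb x) - x) = 0"
  using rep emb_eq_iff by blast

lemma Hil_simps:
  "carrier Hil = emb ` S" "\<zero>\<^bsub>Hil\<^esub> = (\<lambda>_. 0)" "f \<oplus>\<^bsub>Hil\<^esub> g = (\<lambda>y. f y + g y)"
  "c \<odot>\<^bsub>Hil\<^esub> f = (\<lambda>y. c * f y)"
  by (simp_all add: Hil_def)

lemma emb_add: "x \<in> S \<Longrightarrow> y \<in> S \<Longrightarrow> emb x \<oplus>\<^bsub>Hil\<^esub> emb y = emb (x + y)"
  and emb_sc: "x \<in> S \<Longrightarrow> c \<odot>\<^bsub>Hil\<^esub> emb x = emb (sc c x)"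
  and emb_zero: "\<zero>\<^bsub>Hil\<^esub> = emb 0"
  by (auto simp: Hil_simps emb_def b_add_left b_sc_left)

lemma cinner_emb: "x \<in> S \<Longrightarrow> y \<in> S \<Longrightarrow> cinner Hil (emb x) (emb y) = b x y"
  using b_cong0[of "rep (emb x)" x "rep (emb y)"] b_cong0_right[of x y "rep (emb y)"] nrm_rep rep(1)
  by (simp add: Hil_def)

lemma hnorm_emb: "x \<in> S \<Longrightarrow> hnorm Hil (emb x) = nrm x"
  by (simp add: hnorm_def cinner_emb nrm_def)

lemma abelian_group_Hil: "abelian_group Hil"
proof (rule abelian_groupI)
  fix f assume "f \<in> carrier Hil"
  then obtain x where x: "x \<in> S" "f = emb x" by (auto simp: Hil_simps)
  have "emb (- x) \<oplus>\<^bsub>Hil\<^esub> f = \<zero>\<^bsub>Hil\<^esub>" using x by (simp add: emb_add emb_zero)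
  thus "\<exists>g\<in>carrier Hil. g \<oplus>\<^bsub>Hil\<^esub> f = \<zero>\<^bsub>Hil\<^esub>" using x by (intro bexI[of _ "emb (- x)"]) (auto simp: Hil_simps)
  show "\<zero>\<^bsub>Hil\<^esub> \<oplus>\<^bsub>Hil\<^esub> f = f" by (simp add: Hil_simps)
  fix g assume "g \<in> carrier Hil"
  then obtain y where y: "y \<in> S" "g = emb y" by (auto simp: Hil_simps)
  show "f \<oplus>\<^bsub>Hil\<^esub> g \<in> carrier Hil" using x y by (simp add: emb_add) (simp add: Hil_simps)
qed (auto simp: Hil_simps add_ac intro!: image_eqI[of _ _ 0] simp: emb_def)

lemma emb_minus: "x \<in> S \<Longrightarrow> y \<in> S \<Longrightarrow> emb x \<ominus>\<^bsub>Hil\<^esub> emb y = emb (x - y)"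
proof -
  assume S: "x \<in> S" "y \<in> S"
  interpret H: abelian_group Hil by (rule abelian_group_Hil)
  have "\<ominus>\<^bsub>Hil\<^esub> emb y = emb (- y)"
    by (rule H.minus_equality) (use S in \<open>simp_all add: emb_add emb_zero\<close>, simp_all add: Hil_simps)
  thus ?thesis using S by (simp add: a_minus_def emb_add)
qed

lemma hilbert_space_Hil:
  assumes complete: "\<And>s. (\<And>n::nat. s n \<in> S)
      \<Longrightarrow> (\<And>e::real. e > 0 \<Longrightarrow> \<exists>N. \<forall>m\<ge>N. \<forall>n\<ge>N. nrm (s m - s n) < e)
      \<Longrightarrow> \<exists>x\<in>S. (\<lambda>n. nrm (s n - x)) \<longlonglongrightarrow> 0"
  shows "hilbert_space Hil"
proof (intro hilbert_space.intro hilbert_space_axioms.intro)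
  show "module (class_ring :: complex ring) Hil"
  proof (rule moduleI)
    show "cring (class_ring :: complex ring)" by (rule class_cring.cring_axioms)
    show "abelian_group Hil" by (rule abelian_group_Hil)
  next
    fix c d f assume "f \<in> carrier Hil"
    then obtain x where "x \<in> S" "f = emb x" by (auto simp: Hil_simps(1))
    thus "c \<odot>\<^bsub>Hil\<^esub> f \<in> carrier Hil" by (simp add: emb_sc Hil_simps(1))
  qed (auto simp: Hil_simps algebra_simps)
next
  fix s assume s: "\<And>n::nat. s n \<in> carrier Hil"
    and cau: "\<And>e::real. e > 0 \<Longrightarrow> \<exists>N. \<forall>m\<ge>N. \<forall>n\<ge>N. hnorm Hil (s m \<ominus>\<^bsub>Hil\<^esub> s n) < e"
  have "\<forall>n. \<exists>x. x \<in> S \<and> s n = emb x" using s by (auto simp: Hil_simps)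
  then obtain x where x: "\<And>n. x n \<in> S" and sx: "\<And>n. s n = emb (x n)" by metis
  have "\<exists>z\<in>S. (\<lambda>n. nrm (x n - z)) \<longlonglongrightarrow> 0"
    by (rule complete) (use cau in \<open>auto simp: x sx emb_minus hnorm_emb\<close>)
  then obtain z where "z \<in> S" "(\<lambda>n. nrm (x n - z)) \<longlonglongrightarrow> 0" by blast
  thus "\<exists>f\<in>carrier Hil. (\<lambda>n. hnorm Hil (s n \<ominus>\<^bsub>Hil\<^esub> f)) \<longlonglongrightarrow> 0"
    by (intro bexI[of _ "emb z"]) (auto simp: x sx emb_minus hnorm_emb Hil_simps)
next
  fix f assume "f \<in> carrier Hil" "cinner Hil f f = 0"
  then obtain x where x: "x \<in> S" "f = emb x" "b x x = 0" by (auto simp: Hil_simps(1) cinner_emb)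
  thus "f = \<zero>\<^bsub>Hil\<^esub>" by (simp add: emb_zero emb_eq_iff nrm_def)
next
  fix f g assume "f \<in> carrier Hil" "g \<in> carrier Hil"
  thus "cinner Hil f g = cnj (cinner Hil g f)" by (auto simp: Hil_simps(1) cinner_emb intro: b_commute)
next
  fix f assume "f \<in> carrier Hil"
  thus "0 \<le> Re (cinner Hil f f)" by (auto simp: Hil_simps(1) cinner_emb b_nonneg)
qed (auto simp: Hil_simps(1) emb_add emb_sc cinner_emb b_add_left b_sc_left)

end

section \<open>Property (T) as a quantitative averaging principle\<close>

context semi_inner
begin

definition converges :: bool
  where "converges \<longleftrightarrow> (\<forall>s. (\<forall>n::nat. s n \<in> S) \<longrightarrow>
    (\<forall>e>0::real. \<exists>N. \<forall>m\<ge>N. \<forall>n\<ge>N. nrm (s m - s n) < e) \<longrightarrow> (\<exists>x\<in>S. (\<lambda>n. nrm (s n - x)) \<longlonglongrightarrow> 0))"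

end

text \<open>The contraction factor on the orthogonal complement of the invariant vectors: one of the
  \<open>c\<close> generators moves a unit vector by \<open>\<epsilon>\<close> or more, so by the parallelogram law its average with the
  vector itself is shorter.\<close>

definition rate :: "nat \<Rightarrow> real \<Rightarrow> real"
  where "rate c \<epsilon> = (sqrt (4 - \<epsilon>\<^sup>2) + real c - 1) / (1 + real c)"

lemma rate_nonneg:
  assumes "0 < \<epsilon>" "\<epsilon> \<le> 1" shows "0 \<le> rate c \<epsilon>"
proof -
  have "\<epsilon>\<^sup>2 \<le> 1" using assms by (simp add: power_le_one)
  hence "1 \<le> sqrt (4 - \<epsilon>\<^sup>2)" by (intro real_le_rsqrt) simp
  thus ?thesis unfolding rate_def by (intro divide_nonneg_nonneg) linarith+
qed

lemma rate_less_1: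
  assumes "0 < \<epsilon>" "\<epsilon> \<le> 1" shows "rate c \<epsilon> < 1"
proof -
  have "4 - \<epsilon>\<^sup>2 < 2\<^sup>2" using assms by simp
  hence "sqrt (4 - \<epsilon>\<^sup>2) < 2" by (intro real_less_lsqrt) auto
  thus ?thesis by (simp add: rate_def)
qed

locale semi_rep = semi_inner sc S b + G: group G
  for sc :: "complex \<Rightarrow> 'v::ab_group_add \<Rightarrow> 'v" and S b and G :: "('g, 'm) monoid_scheme" +
  fixes act :: "'g \<Rightarrow> 'v \<Rightarrow> 'v"
  assumes act_in [simp]: "g \<in> carrier G \<Longrightarrow> x \<in> S \<Longrightarrow> act g x \<in> S"
    and act_add: "g \<in> carrier G \<Longrightarrow> act g (x + y) = act g x + act g y"
    and act_sc: "g \<in> carrier G \<Longrightarrow> act g (sc c x) = sc c (act g x)"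
    and act_b: "g \<in> carrier G \<Longrightarrow> x \<in> S \<Longrightarrow> y \<in> S \<Longrightarrow> b (act g x) (act g y) = b x y"
    and act_mult: "g \<in> carrier G \<Longrightarrow> h \<in> carrier G \<Longrightarrow> x \<in> S
      \<Longrightarrow> nrm (act (g \<otimes>\<^bsub>G\<^esub> h) x - act g (act h x)) = 0"
    and act_one: "x \<in> S \<Longrightarrow> nrm (act \<one>\<^bsub>G\<^esub> x - x) = 0"
begin

lemma nrm_pos: "x \<in> S \<Longrightarrow> nrm x \<noteq> 0 \<Longrightarrow> 0 < nrm x"
  using nrm_nonneg[of x] by linarith

lemma nrm_le_zeroD: "x \<in> S \<Longrightarrow> nrm x \<le> 0 \<Longrightarrow> nrm x = 0"
  using nrm_nonneg[of x] by linarith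

lemma act_zero [simp]: "g \<in> carrier G \<Longrightarrow> act g 0 = 0"
  using act_sc[of g 0 0] by simp

lemma act_minus: "g \<in> carrier G \<Longrightarrow> act g (- x) = - act g x"
  using act_sc[of g "-1" x] by (simp add: sc_minus_one)

lemma act_diff: "g \<in> carrier G \<Longrightarrow> act g (x - y) = act g x - act g y"
  using act_add[of g x "- y"] by (simp add: act_minus)

lemma act_sum: "g \<in> carrier G \<Longrightarrow> act g (sum f A) = (\<Sum>i\<in>A. act g (f i))"
  by (induction A rule: infinite_finite_induct) (simp_all add: act_add)

lemma act_nrm [simp]: "g \<in> carrier G \<Longrightarrow> x \<in> S \<Longrightarrow> nrm (act g x) = nrm x"
  by (simp add: nrm_def act_b)

definition Inv :: "'v set" where "Inv = {w \<in> S. \<forall>g\<in>carrier G. nrm (act g w - w) = 0}"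

definition Orth :: "'v set" where "Orth = {x \<in> S. \<forall>w\<in>Inv. b x w = 0}"

definition avg :: "'g set \<Rightarrow> 'v \<Rightarrow> 'v"
  where "avg K x = sc (of_real (1 / (1 + real (card K)))) (x + (\<Sum>k\<in>K. act k x))"

lemma InvD: "w \<in> Inv \<Longrightarrow> w \<in> S" "w \<in> Inv \<Longrightarrow> g \<in> carrier G \<Longrightarrow> nrm (act g w - w) = 0"
  by (auto simp: Inv_def)

lemma OrthD: "x \<in> Orth \<Longrightarrow> x \<in> S" "x \<in> Orth \<Longrightarrow> w \<in> Inv \<Longrightarrow> b x w = 0"
  by (auto simp: Orth_def)

lemma Orth_zero: "0 \<in> Orth" by (auto simp: Orth_def InvD)
lemma Orth_add: "x \<in> Orth \<Longrightarrow> y \<in> Orth \<Longrightarrow> x + y \<in> Orth"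
  by (auto simp: Orth_def b_add_left InvD)
lemma Orth_sc: "x \<in> Orth \<Longrightarrow> sc c x \<in> Orth"
  by (auto simp: Orth_def b_sc_left InvD)
lemma Orth_minus: "x \<in> Orth \<Longrightarrow> - x \<in> Orth"
  using Orth_sc[of x "-1"] by (simp add: sc_minus_one)
lemma Orth_diff: "x \<in> Orth \<Longrightarrow> y \<in> Orth \<Longrightarrow> x - y \<in> Orth"
  using Orth_add[of x "- y"] Orth_minus[of y] by simp
lemma Orth_sum: "(\<And>i. i \<in> A \<Longrightarrow> f i \<in> Orth) \<Longrightarrow> sum f A \<in> Orth"
  by (induction A rule: infinite_finite_induct) (auto simp: Orth_zero Orth_add)

lemma b_act_Inv: "g \<in> carrier G \<Longrightarrow> x \<in> S \<Longrightarrow> w \<in> Inv \<Longrightarrow> b (act g x) w = b x w"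
  using act_b[of g x w] b_cong0_right[of "act g x" w "act g w"] InvD[of w] by simp

lemma Orth_act: "g \<in> carrier G \<Longrightarrow> x \<in> Orth \<Longrightarrow> act g x \<in> Orth"
  by (auto simp: Orth_def b_act_Inv)

lemma Orth_coboundary: "g \<in> carrier G \<Longrightarrow> x \<in> S \<Longrightarrow> act g x - x \<in> Orth"
  by (auto simp: Orth_def b_act_Inv b_diff_left InvD)

lemma Orth_closed:
  assumes x: "x \<in> S" and s: "\<And>n. s n \<in> Orth" and lim: "(\<lambda>n. nrm (s n - x)) \<longlonglongrightarrow> 0"
  shows "x \<in> Orth"
  unfolding Orth_def
proof (intro CollectI conjI ballI x)
  fix w assume w: "w \<in> Inv"
  have "cmod (b x w) \<le> nrm (s n - x) * nrm w" for n
  proof -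
    have "b (s n - x) w = - b x w"
      using OrthD[OF s[of n]] w x InvD by (simp add: b_diff_left)
    thus ?thesis using b_bound[of "s n - x" w] OrthD(1)[OF s[of n]] InvD(1)[OF w] x
      by (metis diff_in norm_minus_cancel)
  qed
  moreover have "(\<lambda>n. nrm (s n - x) * nrm w) \<longlonglongrightarrow> 0"
    using tendsto_mult_right[OF lim, of "nrm w"] by simp
  ultimately have "cmod (b x w) \<le> 0" by (meson LIMSEQ_le_const)
  thus "b x w = 0" by simp
qed

lemma avg_in [simp]: "K \<subseteq> carrier G \<Longrightarrow> x \<in> S \<Longrightarrow> avg K x \<in> S"
  unfolding avg_def by (intro sc_in add_in sum_in act_in) auto

lemma avg_diff: "K \<subseteq> carrier G \<Longrightarrow> avg K (x - y) = avg K x - avg K y"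
proof -
  assume K: "K \<subseteq> carrier G"
  have "(\<Sum>k\<in>K. act k (x - y)) = (\<Sum>k\<in>K. act k x) - (\<Sum>k\<in>K. act k y)"
    using K by (subst sum_subtractf[symmetric]) (auto intro!: sum.cong act_diff)
  hence "x - y + (\<Sum>k\<in>K. act k (x - y)) = (x + (\<Sum>k\<in>K. act k x)) - (y + (\<Sum>k\<in>K. act k y))" by simp
  thus ?thesis unfolding avg_def by (simp only: sc_diff)
qed

lemma avg_Orth: "K \<subseteq> carrier G \<Longrightarrow> x \<in> Orth \<Longrightarrow> avg K x \<in> Orth"
  unfolding avg_def by (intro Orth_sc Orth_add Orth_sum Orth_act) auto

lemma avg_minus_eq:
  assumes K: "finite K" "K \<subseteq> carrier G" and x: "x \<in> S"
  shows "avg K x - x = sc (of_real (1 / (1 + real (card K)))) (\<Sum>k\<in>K. act k x - x)"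
proof -
  let ?c = "1 + real (card K)"
  have c: "complex_of_real (1 / ?c) * (1 + of_nat (card K)) = 1"
  proof -
    have "complex_of_real (1 / ?c) * of_real ?c = of_real (1 / ?c * ?c)" by (simp only: of_real_mult)
    also have "1 / ?c * ?c = 1" by simp
    finally show ?thesis by simp
  qed
  have nat: "(\<Sum>k\<in>K. x) = sc (of_nat (card K)) x"
    using K(1) by (induction K rule: finite_induct) (simp_all add: sc_add_left)
  have "x = sc (of_real (1 / ?c)) (sc (1 + of_nat (card K)) x)"
    by (simp only: sc_sc c sc_one)
  also have "sc (1 + of_nat (card K)) x = x + (\<Sum>k\<in>K. x)" by (simp add: nat sc_add_left)
  finally have "avg K x - x = sc (of_real (1 / ?c)) (x + (\<Sum>k\<in>K. act k x)) - sc (of_real (1 / ?c)) (x + (\<Sum>k\<in>K. x))"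
    by (simp add: avg_def)
  thus ?thesis by (simp add: sc_diff[symmetric] sum_subtractf)
qed

lemma avg_coboundary: "finite K \<Longrightarrow> K \<subseteq> carrier G \<Longrightarrow> x \<in> S \<Longrightarrow> avg K x - x \<in> Orth"
  by (subst avg_minus_eq) (auto intro!: Orth_sc Orth_sum Orth_coboundary)

lemma nrm_avg_minus_le:
  assumes K: "finite K" "K \<subseteq> carrier G" and x: "x \<in> S" and D: "\<And>k. k \<in> K \<Longrightarrow> nrm (act k x - x) \<le> D" "0 \<le> D"
  shows "nrm (avg K x - x) \<le> D"
proof -
  have "nrm (\<Sum>k\<in>K. act k x - x) \<le> (\<Sum>k\<in>K. nrm (act k x - x))"
    by (rule nrm_sum) (use K x in auto)
  also have "\<dots> \<le> real (card K) * D" using sum_bounded_above[of K "\<lambda>k. nrm (act k x - x)" D] D by simp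
  also have "\<dots> \<le> (1 + real (card K)) * D" using D by (simp add: distrib_right)
  finally have *: "nrm (\<Sum>k\<in>K. act k x - x) \<le> (1 + real (card K)) * D" .
  have S: "(\<Sum>k\<in>K. act k x - x) \<in> S" by (rule sum_in) (use K x in auto)
  have "nrm (avg K x - x) = 1 / (1 + real (card K)) * nrm (\<Sum>k\<in>K. act k x - x)"
    by (simp only: avg_minus_eq[OF K x] nrm_sc[OF S] norm_of_real) simp
  also have "\<dots> \<le> D" using * by (simp add: field_simps)
  finally show ?thesis .
qed

text \<open>Strict convexity: an average of unit vectors has length close to one only if they are close to
  each other.\<close>

lemma nrm_avg_le:
  assumes K: "finite K" "K \<subseteq> carrier G" and k: "k \<in> K" and x: "x \<in> S"
  shows "(1 + real (card K)) * nrm (avg K x) \<le> nrm (x + act k x) + (real (card K) - 1) * nrm x"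
proof -
  have sS: "(\<Sum>k\<in>J. act k x) \<in> S" if "J \<subseteq> K" for J
    by (rule sum_in) (use that K x in auto)
  have S: "(\<Sum>k\<in>K - {k}. act k x) \<in> S" "x + act k x \<in> S" "x + (\<Sum>k\<in>K. act k x) \<in> S"
    using K x k sS[of "K - {k}"] sS[of K] by auto
  have "(1 + real (card K)) * nrm (avg K x) = nrm (x + (\<Sum>k\<in>K. act k x))"
    by (simp only: avg_def nrm_sc[OF S(3)] norm_of_real) simp
  also have "x + (\<Sum>k\<in>K. act k x) = (x + act k x) + (\<Sum>k\<in>K - {k}. act k x)"
    using K k by (simp add: sum.remove add.assoc)
  also have "nrm \<dots> \<le> nrm (x + act k x) + nrm (\<Sum>k\<in>K - {k}. act k x)"
    by (rule nrm_triangle[OF S(2,1)])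
  also have "nrm (\<Sum>k\<in>K - {k}. act k x) \<le> (\<Sum>k\<in>K - {k}. nrm (act k x))"
    by (rule nrm_sum) (use K x in auto)
  also have "\<dots> = (\<Sum>k\<in>K - {k}. nrm x)" by (rule sum.cong) (use K x in auto)
  also have "\<dots> = (real (card K) - 1) * nrm x"
  proof -
    have "card K > 0" using K k by (auto simp: card_gt_0_iff)
    hence "real (card (K - {k})) = real (card K) - 1" using k by (simp add: card_Diff_singleton of_nat_diff)
    thus ?thesis by simp
  qed
  finally show ?thesis by simp
qed

text \<open>The Kazhdan condition, on the Hilbert space of vectors orthogonal to the invariant ones.\<close>

lemma Orth_moved:
  assumes conv: converges and K: "K \<subseteq> carrier G" and kp: "kazhdan_pair TYPE('v \<Rightarrow> complex) G K \<epsilon>"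
    and x: "x \<in> Orth" and x0: "nrm x > 0"
  shows "\<exists>k\<in>K. nrm (act k x - x) \<ge> \<epsilon> * nrm x"
proof (rule ccontr)
  assume "\<not> ?thesis"
  hence small: "\<And>k. k \<in> K \<Longrightarrow> nrm (act k x - x) < \<epsilon> * nrm x" by force
  interpret M: semi_inner sc Orth b
  proof
    show "b y z = cnj (b z y)" if "y \<in> Orth" "z \<in> Orth" for y z
      by (rule b_commute) (use that OrthD in auto)
  qed (simp_all add: Orth_zero Orth_add Orth_sc sc_add_right sc_add_left sc_sc
        b_add_left b_sc_left b_nonneg OrthD(1))
  have hil: "hilbert_space M.Hil"
  proof (rule M.hilbert_space_Hil)
    fix s assume s: "\<And>n::nat. s n \<in> Orth" and cau: "\<And>e::real. e > 0 \<Longrightarrow> \<exists>N. \<forall>m\<ge>N. \<forall>n\<ge>N. nrm (s m - s n) < e"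
    have "\<forall>n. s n \<in> S" using s OrthD(1) by blast
    moreover have "\<forall>e>0::real. \<exists>N. \<forall>m\<ge>N. \<forall>n\<ge>N. nrm (s m - s n) < e" using cau by blast
    ultimately obtain z where "z \<in> S" "(\<lambda>n. nrm (s n - z)) \<longlonglongrightarrow> 0"
      using conv unfolding converges_def by blast
    moreover from this have "z \<in> Orth" by (intro Orth_closed[of z s] s)
    ultimately show "\<exists>x\<in>Orth. (\<lambda>n. nrm (s n - x)) \<longlonglongrightarrow> 0" by (intro bexI[of _ z])
  qed
  define \<pi> where "\<pi> g f = M.emb (act g (M.rep f))" for g f
  have \<pi>: "\<pi> g (M.emb x) = M.emb (act g x)" if "g \<in> carrier G" "x \<in> Orth" for g x
  proof -
    have r: "M.rep (M.emb x) \<in> Orth" "nrm (M.rep (M.emb x) - x) = 0"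
      using M.rep(1)[OF that(2)] M.nrm_rep[OF that(2)] by auto
    hence "nrm (act g (M.rep (M.emb x)) - act g x) = 0"
      using that by (simp add: act_diff[symmetric] OrthD(1))
    thus ?thesis unfolding \<pi>_def
      by (subst M.emb_eq_iff) (use that r in \<open>auto simp: Orth_act\<close>)
  qed
  have rp: "unitary_rep G M.Hil \<pi>"
    unfolding unitary_rep_def unitary_op_def linear_op_def
  proof (intro conjI ballI allI)
    fix g assume g: "g \<in> carrier G"
    show "\<pi> g \<in> carrier M.Hil \<rightarrow> carrier M.Hil" by (auto simp: M.Hil_simps(1) \<pi> g Orth_act)
    have "M.emb x \<in> \<pi> g ` carrier M.Hil" if x: "x \<in> Orth" for x
    proof (rule image_eqI)
      show "M.emb (act (inv\<^bsub>G\<^esub> g) x) \<in> carrier M.Hil" by (simp add: M.Hil_simps(1) Orth_act g x)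
      have "nrm (x - act g (act (inv\<^bsub>G\<^esub> g) x)) = 0"
      proof -
        have xS: "x \<in> S" using x OrthD by blast
        have "nrm (act \<one>\<^bsub>G\<^esub> x - act g (act (inv\<^bsub>G\<^esub> g) x)) = 0"
          using act_mult[of g "inv\<^bsub>G\<^esub> g" x] g xS by simp
        thus ?thesis using act_one[OF xS] xS g nrm_diff_triangle[of x "act \<one>\<^bsub>G\<^esub> x" "act g (act (inv\<^bsub>G\<^esub> g) x)"]
            nrm_diff_commute[of x "act \<one>\<^bsub>G\<^esub> x"] by (intro nrm_le_zeroD) auto
      qed
      thus "M.emb x = \<pi> g (M.emb (act (inv\<^bsub>G\<^esub> g) x))"
        using x g by (simp add: \<pi> Orth_act M.emb_eq_iff)
    qed
    thus "\<pi> g ` carrier M.Hil = carrier M.Hil"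
      by (auto simp: M.Hil_simps(1) \<pi> g Orth_act)
  next
    fix g f f' assume "g \<in> carrier G" "f \<in> carrier M.Hil" "f' \<in> carrier M.Hil"
    thus "\<pi> g (f \<oplus>\<^bsub>M.Hil\<^esub> f') = \<pi> g f \<oplus>\<^bsub>M.Hil\<^esub> \<pi> g f'"
      by (auto simp: M.Hil_simps(1) M.emb_add \<pi> Orth_add Orth_act act_add)
  next
    fix g f f' assume "g \<in> carrier G" "f \<in> carrier M.Hil" "f' \<in> carrier M.Hil"
    thus "cinner M.Hil (\<pi> g f) (\<pi> g f') = cinner M.Hil f f'"
      by (auto simp: M.Hil_simps(1) M.cinner_emb \<pi> Orth_act act_b OrthD(1))
  next
    fix g c f assume "g \<in> carrier G" "f \<in> carrier M.Hil"
    thus "\<pi> g (c \<odot>\<^bsub>M.Hil\<^esub> f) = c \<odot>\<^bsub>M.Hil\<^esub> \<pi> g f"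
      by (auto simp: M.Hil_simps(1) M.emb_sc \<pi> Orth_sc Orth_act act_sc)
  next
    fix g h f assume gh: "g \<in> carrier G" "h \<in> carrier G" and "f \<in> carrier M.Hil"
    then obtain x where x: "x \<in> Orth" "f = M.emb x" by (auto simp: M.Hil_simps(1))
    show "\<pi> (g \<otimes>\<^bsub>G\<^esub> h) f = \<pi> g (\<pi> h f)"
      using x gh by (simp add: \<pi> Orth_act M.emb_eq_iff act_mult OrthD(1))
  qed
  have "\<exists>\<eta>\<in>carrier M.Hil. \<eta> \<noteq> \<zero>\<^bsub>M.Hil\<^esub> \<and> (\<forall>g\<in>carrier G. \<pi> g \<eta> = \<eta>)"
  proof (rule kp[unfolded kazhdan_pair_def, rule_format, OF hil rp])
    show "M.emb x \<in> carrier M.Hil" using x by (simp add: M.Hil_simps(1))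
    show "M.emb x \<noteq> \<zero>\<^bsub>M.Hil\<^esub>" using x x0 by (simp add: M.emb_zero M.emb_eq_iff)
    show "hnorm M.Hil (\<pi> g (M.emb x) \<ominus>\<^bsub>M.Hil\<^esub> M.emb x) < \<epsilon> * hnorm M.Hil (M.emb x)" if "g \<in> K" for g
    proof -
      have g: "g \<in> carrier G" using that K by blast
      show ?thesis using small[OF that] x g
        by (simp add: \<pi> M.emb_minus M.hnorm_emb Orth_act Orth_diff)
    qed
  qed
  then obtain y where y: "y \<in> Orth" "M.emb y \<noteq> M.emb 0" "\<And>g. g \<in> carrier G \<Longrightarrow> \<pi> g (M.emb y) = M.emb y"
    by (auto simp: M.Hil_simps(1) M.emb_zero)
  have "y \<in> Inv" unfolding Inv_def
    using y(1,3) by (auto simp: \<pi> M.emb_eq_iff Orth_act OrthD(1))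
  hence "b y y = 0" using y(1) OrthD(2) by blast
  thus False using y(1,2) by (simp add: M.emb_eq_iff nrm_def)
qed

lemma nrm_avg_le_self:
  assumes K: "finite K" "K \<subseteq> carrier G" and x: "x \<in> S"
  shows "nrm (avg K x) \<le> nrm x"
proof -
  have sS: "(\<Sum>k\<in>K. act k x) \<in> S" by (rule sum_in) (use K x in auto)
  have "nrm (\<Sum>k\<in>K. act k x) \<le> (\<Sum>k\<in>K. nrm (act k x))" by (rule nrm_sum) (use K x in auto)
  also have "\<dots> = (\<Sum>k\<in>K. nrm x)" by (rule sum.cong) (use K x in auto)
  finally have "nrm (x + (\<Sum>k\<in>K. act k x)) \<le> (1 + real (card K)) * nrm x"
    using nrm_triangle[OF x sS] by (simp add: distrib_right)
  moreover have "nrm (avg K x) = 1 / (1 + real (card K)) * nrm (x + (\<Sum>k\<in>K. act k x))"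
    by (simp only: avg_def nrm_sc[OF add_in[OF x sS]] norm_of_real) simp
  ultimately have "(1 + real (card K)) * nrm (avg K x) \<le> (1 + real (card K)) * nrm x" by simp
  thus ?thesis by (rule mult_left_le_imp_le) simp
qed

lemma avg_contracts:
  assumes conv: converges and K: "finite K" "K \<subseteq> carrier G" and kp: "kazhdan_pair TYPE('v \<Rightarrow> complex) G K \<epsilon>"
    and \<epsilon>: "0 < \<epsilon>" "\<epsilon> \<le> 1" and x: "x \<in> Orth"
  shows "nrm (avg K x) \<le> rate (card K) \<epsilon> * nrm x"
proof (cases "nrm x = 0")
  case True
  thus ?thesis using nrm_avg_le_self[OF K OrthD(1)[OF x]] by simp
next
  case False
  have xS: "x \<in> S" using x by (rule OrthD)
  hence n: "nrm x > 0" using False nrm_nonneg[of x] by linarith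
  obtain k where k: "k \<in> K" "nrm (act k x - x) \<ge> \<epsilon> * nrm x" using Orth_moved[OF conv K(2) kp x n] by blast
  have kS: "act k x \<in> S" using k K xS by auto
  have "(\<epsilon> * nrm x)\<^sup>2 \<le> (nrm (act k x - x))\<^sup>2" using k(2) \<epsilon> n by (intro power_mono) auto
  moreover have "(nrm (x + act k x))\<^sup>2 + (nrm (act k x - x))\<^sup>2 = 4 * (nrm x)\<^sup>2"
    using parallelogram[OF kS xS] k K xS by (simp add: subset_iff add.commute)
  ultimately have "(nrm (x + act k x))\<^sup>2 \<le> (4 - \<epsilon>\<^sup>2) * (nrm x)\<^sup>2" by (simp add: power_mult_distrib algebra_simps)
  hence "nrm (x + act k x) \<le> sqrt ((4 - \<epsilon>\<^sup>2) * (nrm x)\<^sup>2)" by (rule real_le_rsqrt)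
  also have "\<dots> = sqrt (4 - \<epsilon>\<^sup>2) * nrm x" using n by (simp add: real_sqrt_mult)
  finally have "(1 + real (card K)) * nrm (avg K x) \<le> (sqrt (4 - \<epsilon>\<^sup>2) + real (card K) - 1) * nrm x"
    using nrm_avg_le[OF K k(1) xS] by (simp add: algebra_simps)
  thus ?thesis by (simp add: rate_def field_simps)
qed

lemma avg_funpow_in: "K \<subseteq> carrier G \<Longrightarrow> x \<in> S \<Longrightarrow> (avg K ^^ m) x \<in> S"
  by (induction m) auto

lemma avg_funpow_diff: "K \<subseteq> carrier G \<Longrightarrow> (avg K ^^ m) (x - y) = (avg K ^^ m) x - (avg K ^^ m) y"
  by (induction m) (auto simp: avg_diff)

lemma avg_funpow_contracts:
  assumes conv: converges and K: "finite K" "K \<subseteq> carrier G" and kp: "kazhdan_pair TYPE('v \<Rightarrow> complex) G K \<epsilon>"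
    and \<epsilon>: "0 < \<epsilon>" "\<epsilon> \<le> 1" and x: "x \<in> Orth"
  shows "(avg K ^^ m) x \<in> Orth \<and> nrm ((avg K ^^ m) x) \<le> rate (card K) \<epsilon> ^ m * nrm x"
proof (induction m)
  case (Suc m)
  have "nrm ((avg K ^^ Suc m) x) \<le> rate (card K) \<epsilon> * nrm ((avg K ^^ m) x)"
    using avg_contracts[OF conv K kp \<epsilon>] Suc by simp
  also have "\<dots> \<le> rate (card K) \<epsilon> * (rate (card K) \<epsilon> ^ m * nrm x)"
    using Suc rate_nonneg[OF \<epsilon>] by (intro mult_left_mono) auto
  finally show ?case using Suc K by (simp add: avg_Orth mult.assoc)
qed (simp add: x)

lemma avg_fixed:
  assumes K: "finite K" "K \<subseteq> carrier G" and w: "w \<in> S" and fx: "nrm (avg K w - w) = 0" and k: "k \<in> K"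
  shows "nrm (act k w - w) = 0"
proof -
  have kS: "act k w \<in> S" using k K w by auto
  have "nrm (avg K w) = nrm w" by (rule nrm_cong0) (use K w fx in auto)
  hence "2 * nrm w \<le> nrm (w + act k w)" using nrm_avg_le[OF K k w] by (simp add: algebra_simps)
  hence "(2 * nrm w)\<^sup>2 \<le> (nrm (w + act k w))\<^sup>2" using w by (intro power_mono) auto
  hence "4 * (nrm w)\<^sup>2 \<le> (nrm (w + act k w))\<^sup>2" by (simp add: power_mult_distrib)
  moreover have "(nrm (w + act k w))\<^sup>2 + (nrm (act k w - w))\<^sup>2 = 4 * (nrm w)\<^sup>2"
    using parallelogram[OF kS w] k K w by (simp add: subset_iff add.commute)
  ultimately have "(nrm (act k w - w))\<^sup>2 \<le> 0" by linarith
  thus ?thesis by simp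
qed

lemma ex_K_fixed:
  assumes conv: converges and K: "finite K" "K \<subseteq> carrier G" and kp: "kazhdan_pair TYPE('v \<Rightarrow> complex) G K \<epsilon>"
    and \<epsilon>: "0 < \<epsilon>" "\<epsilon> \<le> 1" and x: "x \<in> S"
  shows "\<exists>w\<in>S. x - w \<in> Orth \<and> (\<forall>k\<in>K. nrm (act k w - w) = 0)"
proof -
  define q where "q = rate (card K) \<epsilon>"
  have q: "0 \<le> q" "q < 1" using rate_nonneg[OF \<epsilon>] rate_less_1[OF \<epsilon>] by (simp_all add: q_def)
  define s where "s m = (avg K ^^ m) x" for m
  define D where "D = nrm (avg K x - x)"
  have sS: "s m \<in> S" for m using avg_funpow_in[OF K(2) x] by (simp add: s_def)
  have D0: "0 \<le> D" using x K by (simp add: D_def)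
  have step: "s (Suc m) - s m \<in> Orth \<and> nrm (s (Suc m) - s m) \<le> q ^ m * D" for m
  proof -
    have "s (Suc m) - s m = (avg K ^^ m) (avg K x - x)"
      using K by (simp add: s_def avg_funpow_diff funpow_swap1)
    thus ?thesis using avg_funpow_contracts[OF conv K kp \<epsilon> avg_coboundary[OF K x], of m] by (simp add: q_def D_def)
  qed
  have so: "s m - x \<in> Orth" for m
  proof (induction m)
    case (Suc m)
    have "s (Suc m) - x = (s (Suc m) - s m) + (s m - x)" by simp
    thus ?case using Suc step Orth_add by metis
  qed (simp add: s_def Orth_zero)
  have tel: "nrm (s (m + p) - s m) \<le> D * q ^ m * (1 - q ^ p) / (1 - q)" for m p
  proof (induction p)
    case (Suc p)
    have "nrm (s (m + Suc p) - s m) \<le> nrm (s (Suc (m + p)) - s (m + p)) + nrm (s (m + p) - s m)"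
      using nrm_diff_triangle[OF sS sS sS] by simp
    also have "\<dots> \<le> q ^ (m + p) * D + D * q ^ m * (1 - q ^ p) / (1 - q)" using step Suc by (intro add_mono) auto
    also have "\<dots> = D * q ^ m * (1 - q ^ Suc p) / (1 - q)" using q by (simp add: field_simps power_add)
    finally show ?case .
  qed simp
  have tel': "nrm (s n - s m) \<le> D / (1 - q) * q ^ m" if "m \<le> n" for m n
  proof -
    have "1 - q ^ (n - m) \<le> 1" using q by simp
    hence "D * q ^ m * (1 - q ^ (n - m)) \<le> D * q ^ m * 1" using D0 q by (intro mult_left_mono) auto
    hence "D * q ^ m * (1 - q ^ (n - m)) / (1 - q) \<le> D * q ^ m / (1 - q)" using q by (intro divide_right_mono) auto
    thus ?thesis using tel[of m "n - m"] that by simp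
  qed
  have lim0: "(\<lambda>m. D / (1 - q) * q ^ m) \<longlonglongrightarrow> 0"
    using tendsto_mult_left[OF LIMSEQ_realpow_zero[OF q], of "D / (1 - q)"] by simp
  have "\<forall>e>0::real. \<exists>N. \<forall>m\<ge>N. \<forall>n\<ge>N. nrm (s m - s n) < e"
  proof (intro allI impI)
    fix e :: real assume "e > 0"
    hence "\<forall>\<^sub>F m in sequentially. D / (1 - q) * q ^ m < e / 2" using lim0 by (intro order_tendstoD) auto
    then obtain N where N: "D / (1 - q) * q ^ N < e / 2" by (auto simp: eventually_sequentially)
    have "nrm (s m - s n) < e" if "m \<ge> N" "n \<ge> N" for m n
      using tel'[OF that(1)] tel'[OF that(2)] nrm_diff_triangle[OF sS[of m] sS[of N] sS[of n]]
        nrm_diff_commute[OF sS[of N] sS[of n]] N by linarith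
    thus "\<exists>N. \<forall>m\<ge>N. \<forall>n\<ge>N. nrm (s m - s n) < e" by blast
  qed
  then obtain w where w: "w \<in> S" and lim: "(\<lambda>n. nrm (s n - w)) \<longlonglongrightarrow> 0"
    using conv sS unfolding converges_def by blast
  have "nrm (avg K w - w) \<le> nrm (s m - w) + D * q ^ m + nrm (s m - w)" for m
  proof -
    have "nrm (avg K w - s (Suc m)) \<le> nrm (w - s m)"
      using nrm_avg_le_self[OF K diff_in[OF w sS[of m]]] K by (simp add: avg_diff s_def)
    hence "nrm (avg K w - s (Suc m)) \<le> nrm (s m - w)" using nrm_diff_commute[OF w sS] by simp
    moreover have "nrm (avg K w - w) \<le> nrm (avg K w - s (Suc m)) + nrm (s (Suc m) - w)"
      by (rule nrm_diff_triangle) (use w sS K in auto)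
    moreover have "nrm (s (Suc m) - w) \<le> nrm (s (Suc m) - s m) + nrm (s m - w)"
      by (rule nrm_diff_triangle) (use w sS in auto)
    ultimately show ?thesis using step[of m] by (simp add: mult.commute)
  qed
  moreover have "(\<lambda>m. nrm (s m - w) + D * q ^ m + nrm (s m - w)) \<longlonglongrightarrow> 0 + D * 0 + 0"
    by (intro tendsto_intros lim LIMSEQ_realpow_zero q)
  ultimately have "nrm (avg K w - w) \<le> 0" by (simp add: LIMSEQ_le_const)
  hence fx: "nrm (avg K w - w) = 0" using w K by (simp add: antisym)
  have "x - w \<in> Orth"
  proof (rule Orth_closed)
    show "x - w \<in> S" using x w by simp
    show "x - s n \<in> Orth" for n using Orth_minus[OF so[of n]] by simp
    have "nrm (x - s n - (x - w)) = nrm (s n - w)" for n using nrm_diff_commute[OF w sS] by simp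
    thus "(\<lambda>n. nrm (x - s n - (x - w))) \<longlonglongrightarrow> 0" using lim by simp
  qed
  thus ?thesis using w avg_fixed[OF K w fx] by blast
qed

text \<open>Kazhdan pairs may be enlarged; comparing the limits for \<open>K\<close> and \<open>insert g K\<close> shows that a vector
  fixed by \<open>K\<close> is fixed by \<open>g\<close>.\<close>

lemma ex_projection:
  assumes conv: converges and K: "finite K" "K \<subseteq> carrier G" and kp: "kazhdan_pair TYPE('v \<Rightarrow> complex) G K \<epsilon>"
    and \<epsilon>: "0 < \<epsilon>" "\<epsilon> \<le> 1" and x: "x \<in> S"
  shows "\<exists>w\<in>Inv. x - w \<in> Orth"
proof -
  obtain w where w: "w \<in> S" "x - w \<in> Orth" "\<forall>k\<in>K. nrm (act k w - w) = 0"
    using ex_K_fixed[OF conv K kp \<epsilon> x] by blast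
  have "nrm (act g w - w) = 0" if g: "g \<in> carrier G" for g
  proof -
    have "kazhdan_pair TYPE('v \<Rightarrow> complex) G (insert g K) \<epsilon>"
      using kp unfolding kazhdan_pair_def by blast
    then obtain v where v: "v \<in> S" "x - v \<in> Orth" "\<forall>k\<in>insert g K. nrm (act k v - v) = 0"
      using ex_K_fixed[OF conv _ _ _ \<epsilon> x, of "insert g K"] K g by blast
    have o: "w - v \<in> Orth" using Orth_diff[OF v(2) w(2)] by simp
    have "nrm (w - v) = 0"
    proof (rule ccontr)
      assume "nrm (w - v) \<noteq> 0"
      hence n: "nrm (w - v) > 0" using w v by (intro nrm_pos) auto
      then obtain k where k: "k \<in> K" "nrm (act k (w - v) - (w - v)) \<ge> \<epsilon> * nrm (w - v)"
        using Orth_moved[OF conv K(2) kp o] by blast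
      have kG: "k \<in> carrier G" using k K by blast
      have "act k (w - v) - (w - v) = (act k w - w) - (act k v - v)"
        using kG by (simp add: act_diff algebra_simps)
      hence "nrm (act k (w - v) - (w - v)) \<le> nrm (act k w - w) + nrm (act k v - v)"
        using nrm_triangle_diff[of "act k w - w" "act k v - v"] kG w v by (simp only: act_in diff_in)
      hence "nrm (act k (w - v) - (w - v)) \<le> 0" using w v k by simp
      thus False using k(2) n \<epsilon> mult_pos_pos[of \<epsilon> "nrm (w - v)"] by linarith
    qed
    moreover have "nrm (act g w - w) \<le> nrm (act g w - act g v) + nrm (act g v - v) + nrm (v - w)"
      using nrm_diff_triangle[of "act g w" "act g v" w] nrm_diff_triangle[of "act g v" v w] g w v by simp
    moreover have "nrm (act g w - act g v) = nrm (w - v)" using g w v by (simp add: act_diff[symmetric])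
    ultimately have "nrm (act g w - w) \<le> 0" using v nrm_diff_commute[of v w] w by simp
    thus ?thesis using g w by (simp add: antisym)
  qed
  thus ?thesis using w by (auto simp: Inv_def)
qed

text \<open>The invariant vector is the projection of \<open>x\<close>, which averaging fixes, while the orthogonal part is contracted.
  This part is also short if the generators move \<open>x\<close> little, since they move it as much as \<open>x\<close>.\<close>

lemma kazhdan_averaging:
  assumes conv: converges and K: "finite K" "K \<subseteq> carrier G" and kp: "kazhdan_pair TYPE('v \<Rightarrow> complex) G K \<epsilon>"
    and \<epsilon>: "0 < \<epsilon>" "\<epsilon> \<le> 1" and x: "x \<in> S"
  obtains w where "w \<in> Inv" "x - w \<in> Orth"
    "\<And>m. nrm ((avg K ^^ m) x - w) \<le> rate (card K) \<epsilon> ^ m * nrm (x - w)"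
    "\<And>D. 0 \<le> D \<Longrightarrow> (\<And>k. k \<in> K \<Longrightarrow> nrm (act k x - x) \<le> D) \<Longrightarrow> \<epsilon> * nrm (x - w) \<le> D"
proof -
  obtain w where w: "w \<in> Inv" "x - w \<in> Orth" using ex_projection[OF conv K kp \<epsilon> x] by blast
  have wS: "w \<in> S" using w(1) by (rule InvD)
  have fw: "nrm ((avg K ^^ m) w - w) = 0" for m
  proof (induction m)
    case (Suc m)
    let ?y = "(avg K ^^ m) w"
    have yS: "?y \<in> S" using avg_funpow_in K wS by blast
    have "nrm (avg K w - w) \<le> 0"
      by (rule nrm_avg_minus_le[OF K wS]) (use InvD(2)[OF w(1)] K in auto)
    moreover have "nrm (avg K ?y - avg K w) \<le> nrm (?y - w)"
      using nrm_avg_le_self[OF K diff_in[OF yS wS]] K by (simp add: avg_diff)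
    moreover have "nrm (avg K ?y - w) \<le> nrm (avg K ?y - avg K w) + nrm (avg K w - w)"
      by (rule nrm_diff_triangle) (use K yS wS in auto)
    ultimately have "nrm (avg K ?y - w) \<le> 0" using Suc by linarith
    thus ?case using K yS wS by (simp add: antisym)
  qed simp
  show thesis
  proof (rule that[OF w])
    fix m
    have "nrm ((avg K ^^ m) x - w) \<le> nrm ((avg K ^^ m) x - (avg K ^^ m) w) + nrm ((avg K ^^ m) w - w)"
      by (rule nrm_diff_triangle) (use avg_funpow_in K x wS in auto)
    also have "\<dots> = nrm ((avg K ^^ m) (x - w))" using fw K by (simp add: avg_funpow_diff)
    also have "\<dots> \<le> rate (card K) \<epsilon> ^ m * nrm (x - w)" using avg_funpow_contracts[OF conv K kp \<epsilon> w(2)] by blast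
    finally show "nrm ((avg K ^^ m) x - w) \<le> rate (card K) \<epsilon> ^ m * nrm (x - w)" .
  next
    fix D assume D: "0 \<le> D" "\<And>k. k \<in> K \<Longrightarrow> nrm (act k x - x) \<le> D"
    show "\<epsilon> * nrm (x - w) \<le> D"
    proof (cases "nrm (x - w) = 0")
      case False
      hence "nrm (x - w) > 0" using x wS by (intro nrm_pos) auto
      then obtain k where k: "k \<in> K" "\<epsilon> * nrm (x - w) \<le> nrm (act k (x - w) - (x - w))"
        using Orth_moved[OF conv K(2) kp w(2)] by blast
      have kG: "k \<in> carrier G" using k K by blast
      have "act k (x - w) - (x - w) = (act k x - x) - (act k w - w)" using kG by (simp add: act_diff algebra_simps)
      hence "nrm (act k (x - w) - (x - w)) \<le> nrm (act k x - x) + nrm (act k w - w)"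
        using nrm_triangle_diff[of "act k x - x" "act k w - w"] kG x wS by (simp only: act_in diff_in)
      thus ?thesis using k D(2)[OF k(1)] InvD(2)[OF w(1) kG] by linarith
    qed (simp add: D)
  qed
qed

lemma act_near_Inv:
  assumes g: "g \<in> carrier G" and x: "x \<in> S" and w: "w \<in> Inv"
  shows "nrm (act g x - x) \<le> 2 * nrm (x - w)"
proof -
  have wS: "w \<in> S" using w by (rule InvD)
  have "act g x - x = (act g (x - w) - (x - w)) + (act g w - w)" using g by (simp add: act_diff)
  hence "nrm (act g x - x) \<le> nrm (act g (x - w) - (x - w)) + nrm (act g w - w)"
    using nrm_triangle[of "act g (x - w) - (x - w)" "act g w - w"] g x wS by (simp only: act_in diff_in)
  also have "nrm (act g (x - w) - (x - w)) \<le> nrm (act g (x - w)) + nrm (x - w)"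
    by (rule nrm_triangle_diff) (use g x wS in auto)
  finally show ?thesis using InvD(2)[OF w g] g x wS by simp
qed

lemma kazhdan_averaging_orbit:
  assumes conv: converges and K: "finite K" "K \<subseteq> carrier G" and kp: "kazhdan_pair TYPE('v \<Rightarrow> complex) G K \<epsilon>"
    and \<epsilon>: "0 < \<epsilon>" "\<epsilon> \<le> 1" and x: "x \<in> S"
    and D: "0 \<le> D" "\<And>k. k \<in> K \<Longrightarrow> nrm (act k x - x) \<le> D" and g: "g \<in> carrier G"
  shows "nrm (act g ((avg K ^^ m) x) - (avg K ^^ m) x) \<le> 2 * rate (card K) \<epsilon> ^ m * D / \<epsilon>"
proof -
  obtain w where w: "w \<in> Inv" "nrm ((avg K ^^ m) x - w) \<le> rate (card K) \<epsilon> ^ m * nrm (x - w)"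
    "\<epsilon> * nrm (x - w) \<le> D"
    using kazhdan_averaging[OF conv K kp \<epsilon> x] D by metis
  have "nrm (x - w) \<le> D / \<epsilon>" using w(3) \<epsilon> by (simp add: field_simps)
  hence "rate (card K) \<epsilon> ^ m * nrm (x - w) \<le> rate (card K) \<epsilon> ^ m * (D / \<epsilon>)"
    using rate_nonneg[OF \<epsilon>] by (intro mult_left_mono) auto
  thus ?thesis
    using act_near_Inv[OF g avg_funpow_in[OF K(2) x, of m] w(1)] w(2) by simp
qed

end

section \<open>Ultraproducts\<close>

lemma sum_fun_apply: "(\<Sum>i\<in>A. f i) n = (\<Sum>i\<in>A. f i n)" for f :: "'i \<Rightarrow> 'j \<Rightarrow> 'v::ab_group_add"
  by (induction A rule: infinite_finite_induct) (simp_all add: zero_fun_def)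

text \<open>The ultraproduct of semi-inner product spaces along a free ultrafilter, as a space of sequences.\<close>

locale ultraproduct =
  fixes sc :: "complex \<Rightarrow> 'v::ab_group_add \<Rightarrow> 'v" and B :: "nat \<Rightarrow> 'v \<Rightarrow> 'v \<Rightarrow> complex"
    and U :: "nat filter"
  assumes semi: "semi_inner sc UNIV (B n)"
    and ultra: "ultrafilter U" and free: "U \<le> sequentially"
begin

abbreviation nr :: "nat \<Rightarrow> 'v \<Rightarrow> real" where "nr n \<equiv> semi_inner.nrm (B n)"

definition bdd :: "(nat \<Rightarrow> 'v) set" where "bdd = {X. \<exists>C. eventually (\<lambda>n. nr n (X n) \<le> C) U}"

definition ip :: "(nat \<Rightarrow> 'v) \<Rightarrow> (nat \<Rightarrow> 'v) \<Rightarrow> complex" where "ip X Y = Lim U (\<lambda>n. B n (X n) (Y n))"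

definition scs :: "complex \<Rightarrow> (nat \<Rightarrow> 'v) \<Rightarrow> nat \<Rightarrow> 'v" where "scs c X = (\<lambda>n. sc c (X n))"

lemma U_nonbot: "U \<noteq> bot" using ultra by (simp add: ultrafilter_def)

lemma ip_eqI: "((\<lambda>n. B n (X n) (Y n)) \<longlongrightarrow> l) U \<Longrightarrow> ip X Y = l"
  unfolding ip_def using U_nonbot by (intro tendsto_Lim)

lemma tendsto_ip:
  assumes "X \<in> bdd" "Y \<in> bdd"
  shows "((\<lambda>n. B n (X n) (Y n)) \<longlongrightarrow> ip X Y) U"
proof -
  obtain C D where C: "eventually (\<lambda>n. nr n (X n) \<le> C) U" and D: "eventually (\<lambda>n. nr n (Y n) \<le> D) U"
    using assms by (auto simp: bdd_def)
  from C D have "eventually (\<lambda>n. B n (X n) (Y n) \<in> cball 0 (C * D)) U"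
  proof eventually_elim
    case (elim n)
    interpret semi_inner sc UNIV "B n" by (rule semi)
    have "cmod (B n (X n) (Y n)) \<le> nrm (X n) * nrm (Y n)" by (rule b_bound) auto
    also have "\<dots> \<le> C * D"
      using elim order_trans[OF nrm_nonneg[OF UNIV_I] elim(1)] by (intro mult_mono) auto
    finally show ?case by simp
  qed
  from ultrafilter_tendsto[OF ultra compact_cball this]
  obtain l where "((\<lambda>n. B n (X n) (Y n)) \<longlongrightarrow> l) U" by blast
  thus ?thesis using ip_eqI by simp
qed

lemma bdd_zero: "0 \<in> bdd"
proof -
  have "nr n 0 = 0" for n
  proof -
    interpret semi_inner sc UNIV "B n" by (rule semi)
    show ?thesis by simp
  qed
  thus ?thesis by (auto simp: bdd_def intro!: exI[of _ 0])
qed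

lemma bdd_add:
  assumes "X \<in> bdd" "Y \<in> bdd" shows "X + Y \<in> bdd"
proof -
  obtain C D where C: "eventually (\<lambda>n. nr n (X n) \<le> C) U" and D: "eventually (\<lambda>n. nr n (Y n) \<le> D) U"
    using assms by (auto simp: bdd_def)
  from C D have "eventually (\<lambda>n. nr n ((X + Y) n) \<le> C + D) U"
  proof eventually_elim
    case (elim n)
    interpret semi_inner sc UNIV "B n" by (rule semi)
    show ?case using nrm_triangle[of "X n" "Y n"] elim by simp
  qed
  thus ?thesis by (auto simp: bdd_def)
qed

lemma bdd_scs:
  assumes "X \<in> bdd" shows "scs c X \<in> bdd"
proof -
  obtain C where C: "eventually (\<lambda>n. nr n (X n) \<le> C) U" using assms by (auto simp: bdd_def)
  hence "eventually (\<lambda>n. nr n (scs c X n) \<le> cmod c * C) U"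
  proof eventually_elim
    case (elim n)
    interpret semi_inner sc UNIV "B n" by (rule semi)
    show ?case using elim by (simp add: scs_def mult_left_mono)
  qed
  thus ?thesis by (auto simp: bdd_def)
qed

sublocale UP: semi_inner scs bdd ip
proof
  fix X Y Z :: "nat \<Rightarrow> 'v" and c d :: complex
  show "0 \<in> bdd" by (rule bdd_zero)
  show "X \<in> bdd \<Longrightarrow> Y \<in> bdd \<Longrightarrow> X + Y \<in> bdd" by (rule bdd_add)
  show "X \<in> bdd \<Longrightarrow> scs c X \<in> bdd" by (rule bdd_scs)
  interpret S: semi_inner sc UNIV "B 0" by (rule semi)
  show "scs c (X + Y) = scs c X + scs c Y" "scs (c + d) X = scs c X + scs d X"
    "scs c (scs d X) = scs (c * d) X" "scs 1 X = X"
    by (simp_all add: scs_def fun_eq_iff S.sc_add_right S.sc_add_left S.sc_sc)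
next
  fix X Y Z assume b: "X \<in> bdd" "Y \<in> bdd" "Z \<in> bdd"
  show "ip (X + Y) Z = ip X Z + ip Y Z"
  proof (rule ip_eqI)
    have "B n ((X + Y) n) (Z n) = B n (X n) (Z n) + B n (Y n) (Z n)" for n
    proof -
      interpret S: semi_inner sc UNIV "B n" by (rule semi)
      show ?thesis by (simp add: S.b_add_left)
    qed
    thus "((\<lambda>n. B n ((X + Y) n) (Z n)) \<longlongrightarrow> ip X Z + ip Y Z) U"
      using tendsto_add[OF tendsto_ip tendsto_ip] b by simp
  qed
next
  fix X Y c assume b: "X \<in> bdd" "Y \<in> bdd"
  show "ip (scs c X) Y = c * ip X Y"
  proof (rule ip_eqI)
    have "B n (scs c X n) (Y n) = c * B n (X n) (Y n)" for n
    proof -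
      interpret S: semi_inner sc UNIV "B n" by (rule semi)
      show ?thesis by (simp add: S.b_sc_left scs_def)
    qed
    thus "((\<lambda>n. B n (scs c X n) (Y n)) \<longlongrightarrow> c * ip X Y) U"
      using tendsto_mult_left[OF tendsto_ip] b by simp
  qed
  show "ip X Y = cnj (ip Y X)"
  proof (rule ip_eqI)
    have "B n (X n) (Y n) = cnj (B n (Y n) (X n))" for n
    proof -
      interpret S: semi_inner sc UNIV "B n" by (rule semi)
      show ?thesis by (rule S.b_commute) auto
    qed
    thus "((\<lambda>n. B n (X n) (Y n)) \<longlongrightarrow> cnj (ip Y X)) U"
      using tendsto_cnj[OF tendsto_ip] b by simp
  qed
next
  fix X assume b: "X \<in> bdd"
  have "0 \<le> Re (B n (X n) (X n))" for n
  proof -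
    interpret S: semi_inner sc UNIV "B n" by (rule semi)
    show ?thesis by (rule S.b_nonneg) simp
  qed
  thus "0 \<le> Re (ip X X)"
    using tendsto_Re[OF tendsto_ip[OF b b]] U_nonbot by (intro tendsto_lowerbound) auto
qed

lemma tendsto_nrm: "X \<in> bdd \<Longrightarrow> ((\<lambda>n. nr n (X n)) \<longlongrightarrow> UP.nrm X) U"
  unfolding UP.nrm_def semi_inner.nrm_def[OF semi]
  by (intro tendsto_real_sqrt tendsto_Re tendsto_ip)

lemma nrm_eqI: "X \<in> bdd \<Longrightarrow> ((\<lambda>n. nr n (X n)) \<longlongrightarrow> l) U \<Longrightarrow> UP.nrm X = l"
  using tendsto_nrm tendsto_unique U_nonbot by blast

lemma nrm_leI: "X \<in> bdd \<Longrightarrow> eventually (\<lambda>n. nr n (X n) \<le> c) U \<Longrightarrow> UP.nrm X \<le> c"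
  using tendsto_nrm U_nonbot by (intro tendsto_upperbound) auto

lemma null_bdd: "((\<lambda>n. nr n (X n)) \<longlongrightarrow> 0) U \<Longrightarrow> X \<in> bdd \<and> UP.nrm X = 0"
proof -
  assume l: "((\<lambda>n. nr n (X n)) \<longlongrightarrow> 0) U"
  hence "eventually (\<lambda>n. nr n (X n) < 1) U" by (intro order_tendstoD) auto
  hence "X \<in> bdd" unfolding bdd_def by (auto elim!: eventually_mono intro!: exI[of _ 1])
  thus ?thesis using l nrm_eqI by blast
qed

lemma nr_nonneg [simp]: "0 \<le> nr n x"
proof -
  interpret S: semi_inner sc UNIV "B n" by (rule semi)
  show ?thesis by simp
qed

text \<open>Countable saturation, in the form of completeness: a fast Cauchy sequence is followed, at the
  index \<open>n\<close>, up to the last position where it is still fast at that index.\<close>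

lemma UP_converges: UP.converges
  unfolding UP.converges_def
proof (intro allI impI)
  fix s :: "nat \<Rightarrow> nat \<Rightarrow> 'v"
  assume s: "\<forall>n. s n \<in> bdd" and cau: "\<forall>e>0. \<exists>N. \<forall>m\<ge>N. \<forall>n\<ge>N. UP.nrm (s m - s n) < e"
  have "\<forall>i. \<exists>N. \<forall>m\<ge>N. \<forall>n\<ge>N. UP.nrm (s m - s n) < (1/2) ^ i" using cau by simp
  then obtain N where N: "\<And>i m n. m \<ge> N i \<Longrightarrow> n \<ge> N i \<Longrightarrow> UP.nrm (s m - s n) < (1/2) ^ i" by metis
  define M where "M i = (\<Sum>j\<le>i. N j)" for i
  have MN: "N i \<le> M j" if "i \<le> j" for i j
    unfolding M_def by (rule member_le_sum) (use that in auto)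
  define t where "t i = s (M i)" for i
  have tb: "t i \<in> bdd" for i using s by (simp add: t_def)
  have ti: "UP.nrm (t j - t i) < (1/2) ^ i" if "i \<le> j" for i j
    unfolding t_def by (rule N) (use MN that in auto)
  define P where "P n j \<longleftrightarrow> (\<forall>i\<le>j. nr n (t j n - t i n) \<le> (1/2) ^ i)" for n j
  define J where "J n = Max {j. j \<le> n \<and> P n j}" for n
  have P0: "P n 0" for n
  proof -
    interpret S: semi_inner sc UNIV "B n" by (rule semi)
    show ?thesis by (simp add: P_def)
  qed
  have JP: "P n (J n)" for n
    using Max_in[of "{j. j \<le> n \<and> P n j}"] P0[of n] by (auto simp: J_def)
  define z where "z n = t (J n) n" for n
  have ev: "eventually (\<lambda>n. nr n (z n - t i n) \<le> (1/2) ^ i) U" for i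
  proof -
    have "eventually (\<lambda>n. nr n (t i n - t k n) < (1/2) ^ k) U" if "k \<le> i" for k
      using order_tendstoD(2)[OF tendsto_nrm ti[OF that]] tb by simp
    hence "eventually (\<lambda>n. \<forall>k\<in>{..i}. nr n (t i n - t k n) < (1/2) ^ k) U"
      by (simp add: eventually_ball_finite)
    moreover have "eventually (\<lambda>n. i \<le> n) U"
      using free eventually_ge_at_top by (rule filter_leD)
    ultimately show ?thesis
    proof eventually_elim
      case (elim n)
      hence "P n i" by (auto simp: P_def less_imp_le)
      hence "i \<le> J n" unfolding J_def using elim by (intro Max_ge) auto
      thus ?case using JP[of n] by (simp add: P_def z_def)
    qed
  qed
  have zb: "z \<in> bdd"
  proof -
    have "z - t 0 \<in> bdd" using ev[of 0] by (auto simp: bdd_def)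
    hence "z - t 0 + t 0 \<in> bdd" using tb by (rule bdd_add)
    thus ?thesis by simp
  qed
  have zt: "UP.nrm (z - t i) \<le> (1/2) ^ i" for i
    by (rule nrm_leI) (use ev[of i] zb tb in auto)
  have "(\<lambda>n. UP.nrm (s n - z)) \<longlonglongrightarrow> 0"
  proof (rule LIMSEQ_I)
    fix e :: real assume e: "e > 0"
    have "(\<lambda>i. (1/2 :: real) ^ i) \<longlonglongrightarrow> 0" by (rule LIMSEQ_realpow_zero) auto
    hence "\<forall>\<^sub>F i in sequentially. (1/2 :: real) ^ i < e / 2" using e by (intro order_tendstoD) auto
    then obtain i where i: "(1/2 :: real) ^ i < e / 2" by (auto simp: eventually_sequentially)
    have "norm (UP.nrm (s n - z) - 0) < e" if n: "n \<ge> M i" for n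
    proof -
      have "UP.nrm (s n - t i) < (1/2) ^ i" unfolding t_def by (rule N) (use n MN[of i i] in auto)
      moreover have "UP.nrm (s n - z) \<le> UP.nrm (s n - t i) + UP.nrm (t i - z)"
        by (rule UP.nrm_diff_triangle) (use s tb zb in auto)
      moreover have "UP.nrm (t i - z) = UP.nrm (z - t i)"
        by (rule UP.nrm_diff_commute) (use tb zb in auto)
      moreover have "0 \<le> UP.nrm (s n - z)" by (rule UP.nrm_nonneg) (use s zb in auto)
      ultimately show ?thesis using zt[of i] i by simp
    qed
    thus "\<exists>n0. \<forall>n\<ge>n0. norm (UP.nrm (s n - z) - 0) < e" by blast
  qed
  thus "\<exists>x\<in>bdd. (\<lambda>n. UP.nrm (s n - x)) \<longlonglongrightarrow> 0" using zb by blast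
qed

end

locale ultra_rep = ultraproduct sc B U + G: group G
  for sc :: "complex \<Rightarrow> 'v::ab_group_add \<Rightarrow> 'v" and B U and G :: "('g, 'm) monoid_scheme" +
  fixes \<pi> :: "'g \<Rightarrow> nat \<Rightarrow> 'v \<Rightarrow> 'v"
  assumes \<pi>_add: "g \<in> carrier G \<Longrightarrow> \<pi> g n (x + y) = \<pi> g n x + \<pi> g n y"
    and \<pi>_sc: "g \<in> carrier G \<Longrightarrow> \<pi> g n (sc c x) = sc c (\<pi> g n x)"
    and \<pi>_bdd: "g \<in> carrier G \<Longrightarrow> X \<in> bdd \<Longrightarrow> (\<lambda>n. \<pi> g n (X n)) \<in> bdd"
    and \<pi>_ip: "g \<in> carrier G \<Longrightarrow> X \<in> bdd \<Longrightarrow> Y \<in> bdd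
      \<Longrightarrow> ip (\<lambda>n. \<pi> g n (X n)) (\<lambda>n. \<pi> g n (Y n)) = ip X Y"
    and \<pi>_mult: "g \<in> carrier G \<Longrightarrow> h \<in> carrier G \<Longrightarrow> X \<in> bdd
      \<Longrightarrow> UP.nrm ((\<lambda>n. \<pi> (g \<otimes>\<^bsub>G\<^esub> h) n (X n)) - (\<lambda>n. \<pi> g n (\<pi> h n (X n)))) = 0"
    and \<pi>_one: "X \<in> bdd \<Longrightarrow> UP.nrm ((\<lambda>n. \<pi> \<one>\<^bsub>G\<^esub> n (X n)) - X) = 0"
begin

definition act :: "'g \<Rightarrow> (nat \<Rightarrow> 'v) \<Rightarrow> nat \<Rightarrow> 'v" where "act g X = (\<lambda>n. \<pi> g n (X n))"

sublocale R: semi_rep scs bdd ip G act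
  by unfold_locales
    (simp_all add: act_def \<pi>_bdd \<pi>_add \<pi>_sc \<pi>_ip \<pi>_mult \<pi>_one scs_def fun_eq_iff)

definition avgn :: "'g set \<Rightarrow> nat \<Rightarrow> 'v \<Rightarrow> 'v"
  where "avgn K n x = sc (of_real (1 / (1 + real (card K)))) (x + (\<Sum>k\<in>K. \<pi> k n x))"

lemma avg_eq_avgn: "R.avg K X = (\<lambda>n. avgn K n (X n))"
  by (rule ext) (simp add: R.avg_def avgn_def scs_def act_def sum_fun_apply)

lemma avg_funpow_eq_avgn: "(R.avg K ^^ m) X = (\<lambda>n. (avgn K n ^^ m) (X n))"
  by (induction m) (simp_all add: avg_eq_avgn)

lemma avgn_add:
  assumes "K \<subseteq> carrier G" shows "avgn K n (x + y) = avgn K n x + avgn K n y"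
proof -
  interpret S: semi_inner sc UNIV "B n" by (rule semi)
  have "(\<Sum>k\<in>K. \<pi> k n (x + y)) = (\<Sum>k\<in>K. \<pi> k n x) + (\<Sum>k\<in>K. \<pi> k n y)"
    using assms by (subst sum.distrib[symmetric]) (auto intro!: sum.cong \<pi>_add)
  hence "x + y + (\<Sum>k\<in>K. \<pi> k n (x + y)) = (x + (\<Sum>k\<in>K. \<pi> k n x)) + (y + (\<Sum>k\<in>K. \<pi> k n y))"
    by (simp add: add_ac)
  thus ?thesis unfolding avgn_def by (simp only: S.sc_add_right)
qed

lemma avgn_sc:
  assumes "K \<subseteq> carrier G" shows "avgn K n (sc c x) = sc c (avgn K n x)"
proof -
  interpret S: semi_inner sc UNIV "B n" by (rule semi)
  have "(\<Sum>k\<in>K. \<pi> k n (sc c x)) = sc c (\<Sum>k\<in>K. \<pi> k n x)"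
    unfolding S.sc_sum using assms by (auto intro!: sum.cong \<pi>_sc)
  thus ?thesis unfolding avgn_def by (simp add: S.sc_add_right[symmetric] S.sc_sc mult.commute)
qed

lemma scalar_limit:
  assumes X: "X \<in> bdd" and a: "(a \<longlongrightarrow> l) U"
  shows "(\<lambda>n. sc (a n) (X n)) \<in> bdd" "UP.nrm ((\<lambda>n. sc (a n) (X n)) - scs l X) = 0"
proof -
  define Z where "Z = (\<lambda>n. sc (a n) (X n)) - scs l X"
  have "nr n (sc (a n) (X n) - scs l X n) = cmod (a n - l) * nr n (X n)" for n
  proof -
    interpret S: semi_inner sc UNIV "B n" by (rule semi)
    have "sc (a n) (X n) - sc l (X n) = sc (a n - l) (X n)"
      by (metis S.sc_add_left add_diff_cancel diff_add_cancel)
    thus ?thesis by (simp add: scs_def)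
  qed
  moreover have "((\<lambda>n. cmod (a n - l) * nr n (X n)) \<longlongrightarrow> cmod (l - l) * UP.nrm X) U"
    by (intro tendsto_intros a tendsto_nrm X)
  ultimately have l: "((\<lambda>n. nr n (Z n)) \<longlongrightarrow> 0) U" by (simp add: Z_def)
  from null_bdd[OF l] show "UP.nrm ((\<lambda>n. sc (a n) (X n)) - scs l X) = 0" unfolding Z_def by blast
  from null_bdd[OF l] have "Z + scs l X \<in> bdd" using X bdd_add bdd_scs by blast
  thus "(\<lambda>n. sc (a n) (X n)) \<in> bdd" by (simp add: Z_def)
qed

text \<open>The vectors invariant under a subgroup \<open>\<theta>(G)\<close> conjugate to \<open>G\<close> are invariant under \<open>G\<close>, because
  the spaces in the ultraproduct have finite dimension. Consider in the \<open>n\<close>-th space a subspace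
  of maximal dimension consisting of \<open>\<epsilon>/2\<close>-invariant vectors. Averaging makes these vectors nearly
  \<open>G\<close>-invariant without lowering the dimension. If some \<open>\<theta>(G)\<close>-invariant vector were orthogonal to the
  \<open>G\<close>-invariant ones, adding it and transporting by the conjugation \<open>\<tau>\<close> would give an
  \<open>\<epsilon>/2\<close>-invariant subspace of larger dimension.\<close>

lemma conjugate_invariants:
  fixes \<theta> :: "'g \<Rightarrow> 'g" and \<tau> :: "nat \<Rightarrow> 'v \<Rightarrow> 'v"
  assumes K: "finite K" "K \<subseteq> carrier G" and kp: "kazhdan_pair TYPE((nat \<Rightarrow> 'v) \<Rightarrow> complex) G K \<epsilon>"
    and \<epsilon>: "0 < \<epsilon>" "\<epsilon> \<le> 1"
    and \<theta>: "\<And>g. g \<in> carrier G \<Longrightarrow> \<theta> g \<in> carrier G"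
    and \<tau>_add: "\<And>n x y. \<tau> n (x + y) = \<tau> n x + \<tau> n y" and \<tau>_sc: "\<And>n c x. \<tau> n (sc c x) = sc c (\<tau> n x)"
    and \<tau>_bdd: "\<And>X. X \<in> bdd \<Longrightarrow> (\<lambda>n. \<tau> n (X n)) \<in> bdd"
    and \<tau>_nrm: "\<And>X. X \<in> bdd \<Longrightarrow> UP.nrm (\<lambda>n. \<tau> n (X n)) = UP.nrm X"
    and \<tau>_\<theta>: "\<And>k X. k \<in> K \<Longrightarrow> X \<in> bdd
      \<Longrightarrow> UP.nrm ((\<lambda>n. \<pi> k n (\<tau> n (X n))) - (\<lambda>n. \<tau> n (\<pi> (\<theta> k) n (X n)))) = 0"
    and fin: "\<And>n. \<exists>D. \<forall>r>D. \<forall>x. \<exists>c. (\<exists>i<r. c i \<noteq> (0::complex)) \<and> nr n (\<Sum>i<(r::nat). sc (c i) (x i)) = 0"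
    and Y0: "Y0 \<in> bdd" "\<And>g. g \<in> carrier G \<Longrightarrow> UP.nrm (act (\<theta> g) Y0 - Y0) = 0"
  shows "Y0 \<in> R.Inv"
proof -
  note conv = UP_converges
  obtain w0 where w0: "w0 \<in> R.Inv" "Y0 - w0 \<in> R.Orth" using R.ex_projection[OF conv K kp \<epsilon> Y0(1)] by blast
  have w0b: "w0 \<in> bdd" using w0(1) by (rule R.InvD)
  show ?thesis
  proof (cases "UP.nrm (Y0 - w0) = 0")
    case True
    have "UP.nrm (act g Y0 - Y0) = 0" if "g \<in> carrier G" for g
      using R.act_near_Inv[OF that Y0(1) w0(1)] True that Y0 by (intro R.nrm_le_zeroD) auto
    thus ?thesis using Y0 by (simp add: R.Inv_def)
  next
    case False
    hence pos: "UP.nrm (Y0 - w0) > 0" using Y0 w0b by (intro R.nrm_pos) auto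
    define Y where "Y = scs (of_real (1 / UP.nrm (Y0 - w0))) (Y0 - w0)"
    have Yb: "Y \<in> bdd" using Y0 w0b by (simp add: Y_def bdd_scs)
    have YO: "Y \<in> R.Orth" unfolding Y_def by (rule R.Orth_sc[OF w0(2)])
    have Y1: "UP.nrm Y = 1"
      using Y0 w0b pos by (simp only: Y_def UP.nrm_sc UP.diff_in norm_of_real) simp
    have Y\<theta>: "UP.nrm (act (\<theta> g) Y - Y) = 0" if g: "g \<in> carrier G" for g
    proof -
      have eq: "act (\<theta> g) (Y0 - w0) - (Y0 - w0) = (act (\<theta> g) Y0 - Y0) - (act (\<theta> g) w0 - w0)"
        using \<theta>[OF g] by (simp add: R.act_diff)
      have "UP.nrm ((act (\<theta> g) Y0 - Y0) - (act (\<theta> g) w0 - w0)) \<le> UP.nrm (act (\<theta> g) Y0 - Y0) + UP.nrm (act (\<theta> g) w0 - w0)"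
        by (rule UP.nrm_triangle_diff) (use \<theta>[OF g] Y0 w0b in auto)
      hence "UP.nrm (act (\<theta> g) (Y0 - w0) - (Y0 - w0)) \<le> 0"
        unfolding eq using Y0(2)[OF g] R.InvD(2)[OF w0(1) \<theta>[OF g]] by simp
      hence *: "UP.nrm (act (\<theta> g) (Y0 - w0) - (Y0 - w0)) = 0"
        by (intro R.nrm_le_zeroD) (use \<theta>[OF g] Y0 w0b in auto)
      have "act (\<theta> g) Y - Y = scs (of_real (1 / UP.nrm (Y0 - w0))) (act (\<theta> g) (Y0 - w0) - (Y0 - w0))"
        unfolding Y_def R.act_sc[OF \<theta>[OF g]] by (rule UP.sc_diff[symmetric])
      thus ?thesis using * \<theta>[OF g] Y0 w0b by (simp only: UP.nrm_sc UP.diff_in R.act_in mult_zero_right)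
    qed
    define q where "q = rate (card K) \<epsilon>"
    have q: "0 \<le> q" "q < 1" using rate_nonneg[OF \<epsilon>] rate_less_1[OF \<epsilon>] by (simp_all add: q_def)
    have "(\<lambda>m. q ^ m) \<longlonglongrightarrow> 0" by (rule LIMSEQ_realpow_zero[OF q])
    hence "\<forall>\<^sub>F m in sequentially. q ^ m < \<epsilon> / 16" using \<epsilon> by (intro order_tendstoD) auto
    then obtain m where m: "q ^ m < \<epsilon> / 16" by (auto simp: eventually_sequentially)
    define h where "h n x = (avgn K n ^^ m) x" for n x
    have h_add: "h n (x + y) = h n x + h n y" for n x y
      unfolding h_def by (induction m) (simp_all add: avgn_add[OF K(2)])
    have h_sc: "h n (sc c x) = sc c (h n x)" for n c x
      unfolding h_def by (induction m) (simp_all add: avgn_sc[OF K(2)])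

    have ex: "\<exists>S a. (nr n S)\<^sup>2 + (cmod a)\<^sup>2 = 1 \<and> (\<forall>k\<in>K. nr n (\<pi> k n S - S) \<le> \<epsilon> / 2 * nr n S) \<and>
        (let V = \<tau> n (h n S + sc a (Y n)) in nr n V = 0 \<or> (\<exists>k\<in>K. nr n (\<pi> k n V - V) > \<epsilon> / 2 * nr n V))" for n
    proof -
      interpret S: semi_inner sc UNIV "B n" by (rule semi)
      define good where "good r x \<longleftrightarrow> (\<forall>c. (\<exists>i<r. c i \<noteq> (0::complex)) \<longrightarrow>
          (0 < nr n (\<Sum>i<r. sc (c i) (x i)) \<and> (\<forall>k\<in>K. nr n (\<pi> k n (\<Sum>i<r. sc (c i) (x i)) - (\<Sum>i<r. sc (c i) (x i)))
            \<le> \<epsilon> / 2 * nr n (\<Sum>i<r. sc (c i) (x i)))))" for r :: nat and x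
      obtain D where D: "\<forall>r>D. \<forall>x. \<exists>c. (\<exists>i<r. c i \<noteq> (0::complex)) \<and> nr n (\<Sum>i<(r::nat). sc (c i) (x i)) = 0"
        using fin[of n] by blast
      have g0: "good 0 (\<lambda>_. 0)" by (simp add: good_def)
      have gD: "r \<le> D" if ex: "\<exists>x. good r x" for r
      proof (rule ccontr)
        assume "\<not> r \<le> D"
        obtain x where x: "good r x" using ex by blast
        obtain c where "\<exists>i<r. c i \<noteq> (0::complex)" "nr n (\<Sum>i<r. sc (c i) (x i)) = 0"
          using D \<open>\<not> r \<le> D\<close> by (metis not_le)
        thus False using x unfolding good_def by force
      qed
      define r where "r = (GREATEST r. \<exists>x. good r x)"
      have "\<exists>x. good r x" unfolding r_def
        by (rule GreatestI_nat[where k = 0 and b = D]) (use g0 gD in auto)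
      then obtain x where x: "good r x" by blast
      have max: "\<not> good (Suc r) y" for y
      proof
        assume "good (Suc r) y"
        hence "Suc r \<le> r" unfolding r_def by (intro Greatest_le_nat[where b = D]) (use gD in auto)
        thus False by simp
      qed
      define y where "y i = \<tau> n (if i < r then h n (x i) else Y n)" for i
      obtain c where c: "\<exists>i<Suc r. c i \<noteq> (0::complex)" and
        cV: "\<not> (0 < nr n (\<Sum>i<Suc r. sc (c i) (y i)) \<and> (\<forall>k\<in>K. nr n (\<pi> k n (\<Sum>i<Suc r. sc (c i) (y i)) - (\<Sum>i<Suc r. sc (c i) (y i)))
            \<le> \<epsilon> / 2 * nr n (\<Sum>i<Suc r. sc (c i) (y i))))"
        using max[of y] unfolding good_def by blast
      define S0 where "S0 = (\<Sum>i<r. sc (c i) (x i))"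
      define V0 where "V0 = \<tau> n (h n S0 + sc (c r) (Y n))"
      have \<tau>0: "\<tau> n 0 = 0" using \<tau>_sc[of n 0 0] by simp
      have h0: "h n 0 = 0" using h_sc[of n 0 0] by simp
      have \<tau>_sum: "\<tau> n (sum f A) = (\<Sum>i\<in>A. \<tau> n (f i))" for f :: "nat \<Rightarrow> 'v" and A
        by (induction A rule: infinite_finite_induct) (simp_all add: \<tau>0 \<tau>_add)
      have h_sum: "h n (sum f A) = (\<Sum>i\<in>A. h n (f i))" for f :: "nat \<Rightarrow> 'v" and A
        by (induction A rule: infinite_finite_induct) (simp_all add: h0 h_add)
      have V0: "(\<Sum>i<Suc r. sc (c i) (y i)) = V0"
        by (simp add: V0_def S0_def y_def \<tau>_add \<tau>_sum h_sum \<tau>_sc h_sc)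
      have S0: "nr n (\<pi> k n S0 - S0) \<le> \<epsilon> / 2 * nr n S0" if k: "k \<in> K" for k
      proof (cases "\<exists>i<r. c i \<noteq> 0")
        case True
        thus ?thesis using x k unfolding good_def S0_def by blast
      next
        case False
        hence "S0 = 0" by (simp add: S0_def)
        moreover have "\<pi> k n 0 = 0" using \<pi>_sc[of k n 0 0] k K by auto
        ultimately show ?thesis by simp
      qed
      define \<rho> where "\<rho> = sqrt ((nr n S0)\<^sup>2 + (cmod (c r))\<^sup>2)"
      have "0 < (nr n S0)\<^sup>2 + (cmod (c r))\<^sup>2"
      proof (cases "c r = 0")
        case True
        hence "\<exists>i<r. c i \<noteq> 0" using c less_antisym by blast
        hence "0 < nr n S0" using x unfolding good_def S0_def by blast
        thus ?thesis by (simp add: add_pos_nonneg)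
      qed (simp add: add_nonneg_pos)
      hence \<rho>: "\<rho> > 0" "\<rho>\<^sup>2 = (nr n S0)\<^sup>2 + (cmod (c r))\<^sup>2" by (simp_all add: \<rho>_def)
      define s where "s = complex_of_real (1 / \<rho>)"
      have s: "cmod s = 1 / \<rho>" using \<rho> by (simp add: s_def norm_divide)
      have V: "\<tau> n (h n (sc s S0) + sc (s * c r) (Y n)) = sc s V0"
        by (simp add: V0_def h_sc \<tau>_add \<tau>_sc S.sc_add_right S.sc_sc)
      show ?thesis
      proof (rule exI[of _ "sc s S0"], rule exI[of _ "s * c r"], intro conjI ballI)
        have "(nr n (sc s S0))\<^sup>2 + (cmod (s * c r))\<^sup>2 = (1 / \<rho>)\<^sup>2 * \<rho>\<^sup>2"
          unfolding \<rho>(2) by (simp add: norm_mult s power_mult_distrib power_divide add_divide_distrib)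
        also have "\<dots> = 1" using \<rho>(1) by (simp add: power_divide)
        finally show "(nr n (sc s S0))\<^sup>2 + (cmod (s * c r))\<^sup>2 = 1" .
        fix k assume k: "k \<in> K"
        have "\<pi> k n (sc s S0) - sc s S0 = sc s (\<pi> k n S0 - S0)" using k K by (auto simp: \<pi>_sc S.sc_diff)
        thus "nr n (\<pi> k n (sc s S0) - sc s S0) \<le> \<epsilon> / 2 * nr n (sc s S0)"
          using mult_left_mono[OF S0[OF k], of "cmod s"] by (simp add: mult_ac)
      next
        have kk: "\<pi> k n (sc s V0) - sc s V0 = sc s (\<pi> k n V0 - V0)" if "k \<in> K" for k
          using that K by (auto simp: \<pi>_sc S.sc_diff)
        have s0: "cmod s > 0" using s \<rho> by simp
        have "nr n V0 = 0 \<or> (\<exists>k\<in>K. nr n (\<pi> k n V0 - V0) > \<epsilon> / 2 * nr n V0)"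
          using cV nr_nonneg[of n V0] unfolding V0 by force
        hence "nr n (sc s V0) = 0 \<or> (\<exists>k\<in>K. nr n (\<pi> k n (sc s V0) - sc s V0) > \<epsilon> / 2 * nr n (sc s V0))"
          using s0 by (auto simp: kk mult.left_commute)
        thus "let V = \<tau> n (h n (sc s S0) + sc (s * c r) (Y n)) in nr n V = 0 \<or> (\<exists>k\<in>K. nr n (\<pi> k n V - V) > \<epsilon> / 2 * nr n V)"
          unfolding V Let_def .
      qed
    qed
    then obtain S a where Sa: "\<And>n. (nr n (S n))\<^sup>2 + (cmod (a n))\<^sup>2 = 1"
      and SK: "\<And>n k. k \<in> K \<Longrightarrow> nr n (\<pi> k n (S n) - S n) \<le> \<epsilon> / 2 * nr n (S n)"
      and SV: "\<And>n. (let V = \<tau> n (h n (S n) + sc (a n) (Y n)) in nr n V = 0 \<or> (\<exists>k\<in>K. nr n (\<pi> k n V - V) > \<epsilon> / 2 * nr n V))"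
      by metis
    have S1: "nr n (S n) \<le> 1" and a1: "cmod (a n) \<le> 1" for n
    proof -
      have "(nr n (S n))\<^sup>2 \<le> 1\<^sup>2" "(cmod (a n))\<^sup>2 \<le> 1\<^sup>2"
        unfolding power_one using Sa[of n] zero_le_power2[of "nr n (S n)"] zero_le_power2[of "cmod (a n)"] by linarith+
      thus "nr n (S n) \<le> 1" "cmod (a n) \<le> 1" by (auto intro: power2_le_imp_le)
    qed
    have Sb: "S \<in> bdd" using S1 by (auto simp: bdd_def intro!: exI[of _ 1])
    have "eventually (\<lambda>n. a n \<in> cball 0 1) U" using a1 by simp
    from ultrafilter_tendsto[OF ultra compact_cball this] obtain l where l: "(a \<longlongrightarrow> l) U" by blast
    define A where "A = (\<lambda>n. sc (a n) (Y n))"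
    have Ab: "A \<in> bdd" "UP.nrm (A - scs l Y) = 0" unfolding A_def by (rule scalar_limit[OF Yb l])+
    have lY: "scs l Y \<in> bdd" using Yb by (rule bdd_scs)
    have one: "(UP.nrm S)\<^sup>2 + (cmod l)\<^sup>2 = 1"
    proof -
      have "((\<lambda>n. (nr n (S n))\<^sup>2 + (cmod (a n))\<^sup>2) \<longlongrightarrow> (UP.nrm S)\<^sup>2 + (cmod l)\<^sup>2) U"
        by (intro tendsto_intros tendsto_nrm Sb l)
      hence "((\<lambda>n. 1) \<longlongrightarrow> (UP.nrm S)\<^sup>2 + (cmod l)\<^sup>2) U" by (simp add: Sa)
      thus ?thesis using tendsto_unique[OF U_nonbot _ tendsto_const] by blast
    qed
    have SK': "UP.nrm (act k S - S) \<le> \<epsilon> / 2 * UP.nrm S" if k: "k \<in> K" for k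
    proof (rule tendsto_le[OF U_nonbot])
      have kG: "k \<in> carrier G" using k K by blast
      show "((\<lambda>n. nr n ((act k S - S) n)) \<longlongrightarrow> UP.nrm (act k S - S)) U"
        by (rule tendsto_nrm, rule UP.diff_in) (use Sb kG in auto)
      show "((\<lambda>n. \<epsilon> / 2 * nr n (S n)) \<longlongrightarrow> \<epsilon> / 2 * UP.nrm S) U"
        by (intro tendsto_intros tendsto_nrm Sb)
      show "eventually (\<lambda>n. nr n ((act k S - S) n) \<le> \<epsilon> / 2 * nr n (S n)) U"
        using SK[OF k] by (simp add: act_def)
    qed
    have hS: "(R.avg K ^^ m) S = (\<lambda>n. h n (S n))" by (simp add: avg_funpow_eq_avgn h_def)
    have hSb: "(\<lambda>n. h n (S n)) \<in> bdd" using R.avg_funpow_in[OF K(2) Sb, of m] by (simp add: hS)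
    have half: "0 \<le> \<epsilon> / 2 * UP.nrm S" using \<epsilon> Sb by simp
    obtain w where w: "w \<in> R.Inv" "S - w \<in> R.Orth" "UP.nrm ((\<lambda>n. h n (S n)) - w) \<le> q ^ m * UP.nrm (S - w)"
      "\<epsilon> * UP.nrm (S - w) \<le> \<epsilon> / 2 * UP.nrm S"
    proof (rule R.kazhdan_averaging[OF conv K kp \<epsilon> Sb])
      fix w assume w: "w \<in> R.Inv" "S - w \<in> R.Orth"
        and 1: "\<And>m. UP.nrm ((R.avg K ^^ m) S - w) \<le> rate (card K) \<epsilon> ^ m * UP.nrm (S - w)"
        and 2: "\<And>D. 0 \<le> D \<Longrightarrow> (\<And>k. k \<in> K \<Longrightarrow> UP.nrm (act k S - S) \<le> D) \<Longrightarrow> \<epsilon> * UP.nrm (S - w) \<le> D"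
      show thesis
        by (rule that[OF w]) (use 1[of m] 2[OF half SK'] in \<open>simp_all only: hS q_def\<close>)
    qed
    have wb: "w \<in> bdd" using w(1) by (rule R.InvD)
    have Sw: "UP.nrm (S - w) \<le> UP.nrm S / 2" using w(4) \<epsilon> by (simp add: field_simps)
    have "UP.nrm S \<le> 1" by (rule nrm_leI[OF Sb]) (simp add: S1)
    hence "q ^ m * UP.nrm (S - w) \<le> (\<epsilon> / 16) * (1 / 2)"
      using Sw m q Sb wb \<epsilon> by (intro mult_mono) auto
    hence R: "UP.nrm ((\<lambda>n. h n (S n)) - w) \<le> \<epsilon> / 32" using w(3) by simp
    define W where "W = w + scs l Y"
    have Wb: "W \<in> bdd" using wb lY by (simp add: W_def)
    have "ip w Y = 0" using R.OrthD(2)[OF YO w(1)] UP.b_commute[OF wb Yb] by simp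
    hence "ip w (scs l Y) = 0" using wb Yb by (simp add: UP.b_sc_right)
    hence W2: "(UP.nrm W)\<^sup>2 = (UP.nrm w)\<^sup>2 + (cmod l)\<^sup>2"
      unfolding W_def using UP.nrm_add_sq[OF wb lY] Y1 Yb by simp
    have "UP.nrm S / 2 \<le> UP.nrm w" using UP.nrm_le_diff[OF Sb wb] Sw by simp
    hence "(UP.nrm S / 2)\<^sup>2 \<le> (UP.nrm w)\<^sup>2" using Sb by (intro power_mono) auto
    hence "(UP.nrm S)\<^sup>2 / 4 \<le> (UP.nrm w)\<^sup>2" by (simp add: power_divide)
    hence "1/4 \<le> (UP.nrm W)\<^sup>2" using one W2 zero_le_power2[of "cmod l"] by linarith
    hence "(1/2)\<^sup>2 \<le> (UP.nrm W)\<^sup>2" by (simp add: power_divide)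
    hence W: "1/2 \<le> UP.nrm W" using Wb by (intro power2_le_imp_le[of "1/2"]) auto
    define Z where "Z = (\<lambda>n. h n (S n)) + A"
    have Zb: "Z \<in> bdd" using hSb Ab by (simp add: Z_def)
    have ZW: "UP.nrm (Z - W) \<le> \<epsilon> / 32"
    proof -
      have eq: "Z - W = ((\<lambda>n. h n (S n)) - w) + (A - scs l Y)" by (simp add: Z_def W_def)
      have "UP.nrm (((\<lambda>n. h n (S n)) - w) + (A - scs l Y)) \<le> UP.nrm ((\<lambda>n. h n (S n)) - w) + UP.nrm (A - scs l Y)"
        by (rule UP.nrm_triangle) (use hSb wb Ab lY in auto)
      thus ?thesis unfolding eq using R Ab(2) by simp
    qed
    have Z: "1/4 \<le> UP.nrm Z"
      using UP.nrm_le_diff[OF Wb Zb] UP.nrm_diff_commute[OF Wb Zb] ZW W \<epsilon> by simp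
    define V where "V = (\<lambda>n. \<tau> n (Z n))"
    have Vb: "V \<in> bdd" "UP.nrm V = UP.nrm Z" unfolding V_def by (rule \<tau>_bdd[OF Zb], rule \<tau>_nrm[OF Zb])
    have VK: "UP.nrm (act k V - V) \<le> \<epsilon> / 16" if k: "k \<in> K" for k
    proof -
      have kG: "k \<in> carrier G" and \<theta>G: "\<theta> k \<in> carrier G" using k K \<theta> by auto
      define T where "T = (\<lambda>n. \<tau> n (act (\<theta> k) Z n))"
      have Tb: "T \<in> bdd" unfolding T_def by (rule \<tau>_bdd) (use \<theta>G Zb in simp)
      have TV: "T - V = (\<lambda>n. \<tau> n ((act (\<theta> k) Z - Z) n))"
      proof
        fix n
        have "act (\<theta> k) Z n = (act (\<theta> k) Z n - Z n) + Z n" by simp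
        hence "\<tau> n (act (\<theta> k) Z n) = \<tau> n (act (\<theta> k) Z n - Z n) + \<tau> n (Z n)" by (metis \<tau>_add)
        thus "(T - V) n = \<tau> n ((act (\<theta> k) Z - Z) n)" by (simp add: T_def V_def)
      qed
      have "UP.nrm (act k V - T) = 0"
        using \<tau>_\<theta>[OF k Zb] by (simp add: act_def V_def T_def)
      moreover have "UP.nrm (T - V) = UP.nrm (act (\<theta> k) Z - Z)"
        unfolding TV by (rule \<tau>_nrm, rule UP.diff_in) (use \<theta>G Zb in auto)
      moreover have "UP.nrm (act k V - V) \<le> UP.nrm (act k V - T) + UP.nrm (T - V)"
        by (rule UP.nrm_diff_triangle) (use kG Vb Tb in auto)
      moreover have "UP.nrm (act (\<theta> k) Z - Z) \<le> \<epsilon> / 16"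
      proof -
        have eq: "act (\<theta> k) Z - Z = (act (\<theta> k) (Z - W) - (Z - W)) + ((act (\<theta> k) w - w) + scs l (act (\<theta> k) Y - Y))"
          using \<theta>G by (simp add: W_def R.act_diff R.act_add R.act_sc UP.sc_diff)
        have in1: "act (\<theta> k) (Z - W) - (Z - W) \<in> bdd" "act (\<theta> k) w - w \<in> bdd" "scs l (act (\<theta> k) Y - Y) \<in> bdd"
          using \<theta>G Zb Wb wb Yb by auto
        have "UP.nrm (act (\<theta> k) (Z - W) - (Z - W)) \<le> UP.nrm (act (\<theta> k) (Z - W)) + UP.nrm (Z - W)"
          by (rule UP.nrm_triangle_diff) (use \<theta>G Zb Wb in auto)
        moreover have "UP.nrm (act (\<theta> k) (Z - W)) = UP.nrm (Z - W)" using \<theta>G Zb Wb by simp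
        moreover have "UP.nrm (scs l (act (\<theta> k) Y - Y)) = 0"
          using Y\<theta>[OF kG] Yb \<theta>G by (simp only: UP.nrm_sc UP.diff_in R.act_in mult_zero_right)
        ultimately show ?thesis unfolding eq
          using UP.nrm_triangle[OF in1(1) UP.add_in[OF in1(2,3)]] UP.nrm_triangle[OF in1(2,3)]
            R.InvD(2)[OF w(1) \<theta>G] ZW by linarith
      qed
      ultimately show ?thesis by linarith
    qed
    have "eventually (\<lambda>n. nr n (V n) = 0 \<or> (\<exists>k\<in>K. nr n (\<pi> k n (V n) - V n) > \<epsilon> / 2 * nr n (V n))) U"
      using SV unfolding Let_def V_def Z_def A_def by simp
    hence "eventually (\<lambda>n. nr n (V n) = 0) U \<or> eventually (\<lambda>n. \<exists>k\<in>K. nr n (\<pi> k n (V n) - V n) > \<epsilon> / 2 * nr n (V n)) U"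
    proof -
      assume ev: "eventually (\<lambda>n. nr n (V n) = 0 \<or> (\<exists>k\<in>K. nr n (\<pi> k n (V n) - V n) > \<epsilon> / 2 * nr n (V n))) U"
      show ?thesis
      proof (cases "eventually (\<lambda>n. nr n (V n) = 0) U")
        case False
        hence "eventually (\<lambda>n. nr n (V n) \<noteq> 0) U" using ultrafilter_not[OF ultra] by blast
        with ev have "eventually (\<lambda>n. \<exists>k\<in>K. nr n (\<pi> k n (V n) - V n) > \<epsilon> / 2 * nr n (V n)) U"
          by eventually_elim blast
        thus ?thesis by blast
      qed blast
    qed
    thus ?thesis
    proof
      assume "eventually (\<lambda>n. nr n (V n) = 0) U"
      hence "eventually (\<lambda>n. nr n (V n) \<le> 0) U" by eventually_elim simp
      hence "UP.nrm V \<le> 0" by (rule nrm_leI[OF Vb(1)])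
      thus ?thesis using Vb Z by simp
    next
      assume "eventually (\<lambda>n. \<exists>k\<in>K. nr n (\<pi> k n (V n) - V n) > \<epsilon> / 2 * nr n (V n)) U"
      then obtain k where k: "k \<in> K" "eventually (\<lambda>n. nr n (\<pi> k n (V n) - V n) > \<epsilon> / 2 * nr n (V n)) U"
        using ultrafilter_ex_finite[OF ultra K(1), of "\<lambda>k n. nr n (\<pi> k n (V n) - V n) > \<epsilon> / 2 * nr n (V n)"] by blast
      have kG: "k \<in> carrier G" using k K by blast
      have "\<epsilon> / 2 * UP.nrm V \<le> UP.nrm (act k V - V)"
      proof (rule tendsto_le[OF U_nonbot])
        show "((\<lambda>n. nr n ((act k V - V) n)) \<longlongrightarrow> UP.nrm (act k V - V)) U"
          by (rule tendsto_nrm, rule UP.diff_in) (use Vb kG in auto)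
        show "((\<lambda>n. \<epsilon> / 2 * nr n (V n)) \<longlongrightarrow> \<epsilon> / 2 * UP.nrm V) U"
          by (intro tendsto_intros tendsto_nrm Vb)
        show "eventually (\<lambda>n. \<epsilon> / 2 * nr n (V n) \<le> nr n ((act k V - V) n)) U"
          using k(2) by eventually_elim (simp add: act_def)
      qed
      moreover have "\<epsilon> / 2 * (1/4) \<le> \<epsilon> / 2 * UP.nrm V" using \<epsilon> Z Vb by (intro mult_left_mono) auto
      ultimately show ?thesis using VK[OF k(1)] \<epsilon> by simp
    qed
  qed
qed

end

section \<open>Positive definite kernels on a group with property (T)\<close>

definition psd :: "'g set \<Rightarrow> ('g \<Rightarrow> 'g \<Rightarrow> real) \<Rightarrow> bool"
  where "psd C \<kappa> \<longleftrightarrow> (\<forall>F c. finite F \<longrightarrow> F \<subseteq> C \<longrightarrow>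
    0 \<le> Re (\<Sum>x\<in>F. \<Sum>y\<in>F. c x * cnj (c y) * of_real (\<kappa> x y)))"

definition kform :: "'g set \<Rightarrow> ('g \<Rightarrow> 'g \<Rightarrow> real) \<Rightarrow> ('g \<Rightarrow>\<^sub>0 complex) \<Rightarrow> ('g \<Rightarrow>\<^sub>0 complex) \<Rightarrow> complex"
  where "kform C \<kappa> f h = (\<Sum>x\<in>Poly_Mapping.keys f \<inter> C. \<Sum>y\<in>Poly_Mapping.keys h \<inter> C.
    Poly_Mapping.lookup f x * cnj (Poly_Mapping.lookup h y) * of_real (\<kappa> x y))"

abbreviation lk :: "('g \<Rightarrow>\<^sub>0 complex) \<Rightarrow> 'g \<Rightarrow> complex" where "lk \<equiv> Poly_Mapping.lookup"

lemma kform_eq: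
  assumes "finite F" "Poly_Mapping.keys f \<inter> C \<subseteq> F" "Poly_Mapping.keys h \<inter> C \<subseteq> F" "F \<subseteq> C"
  shows "kform C \<kappa> f h = (\<Sum>x\<in>F. \<Sum>y\<in>F. lk f x * cnj (lk h y) * of_real (\<kappa> x y))"
proof -
  have nz: "lk f x = 0" if "x \<in> F - (Poly_Mapping.keys f \<inter> C)" for f :: "'a \<Rightarrow>\<^sub>0 complex" and x
    using that assms(4) by (auto simp: in_keys_iff)
  have "kform C \<kappa> f h = (\<Sum>x\<in>Poly_Mapping.keys f \<inter> C. \<Sum>y\<in>F. lk f x * cnj (lk h y) * of_real (\<kappa> x y))"
    unfolding kform_def using assms nz by (intro sum.cong refl sum.mono_neutral_left) auto
  also have "\<dots> = (\<Sum>x\<in>F. \<Sum>y\<in>F. lk f x * cnj (lk h y) * of_real (\<kappa> x y))"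
    using assms nz by (intro sum.mono_neutral_left) auto
  finally show ?thesis .
qed

definition scp :: "complex \<Rightarrow> ('g \<Rightarrow>\<^sub>0 complex) \<Rightarrow> 'g \<Rightarrow>\<^sub>0 complex"
  where "scp c f = Poly_Mapping.map (\<lambda>z. c * z) f"

lemma lookup_scp [simp]: "lk (scp c f) x = c * lk f x"
  by (simp add: scp_def Poly_Mapping.map.rep_eq when_def)

lemma keys_scp: "Poly_Mapping.keys (scp c f) \<subseteq> Poly_Mapping.keys f"
  by (auto simp: in_keys_iff)

lemma semi_inner_kform:
  assumes psd: "psd C \<kappa>" and sym: "\<And>x y. x \<in> C \<Longrightarrow> y \<in> C \<Longrightarrow> \<kappa> x y = \<kappa> y x"
  shows "semi_inner scp UNIV (kform C \<kappa>)"
proof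
  fix f g h :: "'a \<Rightarrow>\<^sub>0 complex" and c d :: complex
  define F where "F = (Poly_Mapping.keys f \<union> Poly_Mapping.keys g \<union> Poly_Mapping.keys h) \<inter> C"
  have F: "finite F" "F \<subseteq> C" "Poly_Mapping.keys f \<inter> C \<subseteq> F" "Poly_Mapping.keys g \<inter> C \<subseteq> F" "Poly_Mapping.keys h \<inter> C \<subseteq> F"
    "Poly_Mapping.keys (f + g) \<inter> C \<subseteq> F" "Poly_Mapping.keys (scp c f) \<inter> C \<subseteq> F"
    using Poly_Mapping.keys_add[of f g] keys_scp[of c f] by (auto simp: F_def)
  note e = kform_eq[OF F(1) _ _ F(2)]
  show "scp c (f + g) = scp c f + scp c g" "scp (c + d) f = scp c f + scp d f"
    "scp c (scp d f) = scp (c * d) f" "scp 1 f = f"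
    by (rule poly_mapping_eqI, simp add: lookup_add algebra_simps)+
  show "kform C \<kappa> (f + g) h = kform C \<kappa> f h + kform C \<kappa> g h"
    by (simp add: e F lookup_add algebra_simps sum.distrib)
  show "kform C \<kappa> (scp c f) g = c * kform C \<kappa> f g"
    by (simp add: e F sum_distrib_left mult.assoc)
  show "0 \<le> Re (kform C \<kappa> f f)"
    using psd F(1,2) unfolding psd_def e[OF F(3) F(3)] by blast
  have "kform C \<kappa> f g = (\<Sum>y\<in>F. \<Sum>x\<in>F. lk f x * cnj (lk g y) * of_real (\<kappa> x y))"
    unfolding e[OF F(3) F(4)] by (rule sum.swap)
  also have "\<dots> = (\<Sum>y\<in>F. \<Sum>x\<in>F. cnj (lk g y * cnj (lk f x) * of_real (\<kappa> y x)))"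
    using F(2) sym by (intro sum.cong refl) (auto simp: mult_ac subset_iff)
  also have "\<dots> = cnj (kform C \<kappa> g f)" by (simp add: e F cnj_sum)
  finally show "kform C \<kappa> f g = cnj (kform C \<kappa> g f)" .
qed auto

text \<open>The left translation of the group ring, and the average of the translations by the identity and by a
  finite set.\<close>

definition push :: "('g, 'm) monoid_scheme \<Rightarrow> 'g \<Rightarrow> ('g \<Rightarrow>\<^sub>0 complex) \<Rightarrow> 'g \<Rightarrow>\<^sub>0 complex"
  where "push G g f = Abs_poly_mapping (\<lambda>z. if z \<in> carrier G then lk f (inv\<^bsub>G\<^esub> g \<otimes>\<^bsub>G\<^esub> z) else 0)"

definition gavg :: "('g, 'm) monoid_scheme \<Rightarrow> 'g set \<Rightarrow> ('g \<Rightarrow>\<^sub>0 complex) \<Rightarrow> 'g \<Rightarrow>\<^sub>0 complex"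
  where "gavg G K f = scp (of_real (1 / (1 + real (card K)))) (f + (\<Sum>k\<in>K. push G k f))"

context group
begin

lemma lookup_push:
  assumes g: "g \<in> carrier G"
  shows "lk (push G g f) z = (if z \<in> carrier G then lk f (inv g \<otimes> z) else 0)"
proof -
  have "{z. (if z \<in> carrier G then lk f (inv g \<otimes> z) else 0) \<noteq> 0} \<subseteq> (\<lambda>x. g \<otimes> x) ` Poly_Mapping.keys f"
  proof
    fix z assume "z \<in> {z. (if z \<in> carrier G then lk f (inv g \<otimes> z) else 0) \<noteq> 0}"
    hence z: "z \<in> carrier G" "lk f (inv g \<otimes> z) \<noteq> 0" by (auto split: if_splits)
    hence "z = g \<otimes> (inv g \<otimes> z)" using g by (simp add: m_assoc[symmetric])
    thus "z \<in> (\<lambda>x. g \<otimes> x) ` Poly_Mapping.keys f" using z by (auto simp: in_keys_iff)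
  qed
  hence "finite {z. (if z \<in> carrier G then lk f (inv g \<otimes> z) else 0) \<noteq> 0}"
    by (rule finite_subset) simp
  thus ?thesis unfolding push_def by (subst lookup_Abs_poly_mapping) auto
qed

lemma lookup_push_mult: "g \<in> carrier G \<Longrightarrow> x \<in> carrier G \<Longrightarrow> lk (push G g f) (g \<otimes> x) = lk f x"
  by (simp add: lookup_push m_assoc[symmetric])

lemma keys_push: "g \<in> carrier G \<Longrightarrow> Poly_Mapping.keys (push G g f) \<subseteq> (\<lambda>x. g \<otimes> x) ` (Poly_Mapping.keys f \<inter> carrier G)"
proof
  fix z assume g: "g \<in> carrier G" and "z \<in> Poly_Mapping.keys (push G g f)"
  hence z: "z \<in> carrier G" "lk f (inv g \<otimes> z) \<noteq> 0" by (auto simp: in_keys_iff lookup_push split: if_splits)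
  hence "z = g \<otimes> (inv g \<otimes> z)" using g by (simp add: m_assoc[symmetric])
  thus "z \<in> (\<lambda>x. g \<otimes> x) ` (Poly_Mapping.keys f \<inter> carrier G)" using z g by (auto simp: in_keys_iff)
qed

lemma inj_mult: "g \<in> carrier G \<Longrightarrow> inj_on (\<lambda>x. g \<otimes> x) (carrier G)"
  by (auto simp: inj_on_def)

lemma push_add: "g \<in> carrier G \<Longrightarrow> push G g (f + h) = push G g f + push G g h"
  and push_scp: "g \<in> carrier G \<Longrightarrow> push G g (scp c f) = scp c (push G g f)"
  by (rule poly_mapping_eqI; simp add: lookup_push lookup_add)+

lemma push_mult: "g \<in> carrier G \<Longrightarrow> h \<in> carrier G \<Longrightarrow> push G (g \<otimes> h) f = push G g (push G h f)"
  by (rule poly_mapping_eqI) (auto simp: lookup_push inv_mult_group m_assoc)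

lemma kform_push:
  assumes g: "g \<in> carrier G" and inv: "\<And>x y. x \<in> carrier G \<Longrightarrow> y \<in> carrier G \<Longrightarrow> \<kappa> (g \<otimes> x) (g \<otimes> y) = \<kappa> x y"
  shows "kform (carrier G) \<kappa> (push G g f) (push G g h) = kform (carrier G) \<kappa> f h"
proof -
  define F where "F = (Poly_Mapping.keys f \<union> Poly_Mapping.keys h) \<inter> carrier G"
  have F: "finite F" "F \<subseteq> carrier G" "Poly_Mapping.keys f \<inter> carrier G \<subseteq> F" "Poly_Mapping.keys h \<inter> carrier G \<subseteq> F"
    by (auto simp: F_def)
  have inj: "inj_on (\<lambda>x. g \<otimes> x) F" using inj_mult[OF g] F(2) by (rule inj_on_subset)
  have k1: "Poly_Mapping.keys (push G g f) \<inter> carrier G \<subseteq> (\<lambda>x. g \<otimes> x) ` F" "Poly_Mapping.keys (push G g h) \<inter> carrier G \<subseteq> (\<lambda>x. g \<otimes> x) ` F"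
    using F(3,4) keys_push[OF g, of f] keys_push[OF g, of h] by blast+
  have "kform (carrier G) \<kappa> (push G g f) (push G g h) =
      (\<Sum>x\<in>(\<lambda>x. g \<otimes> x) ` F. \<Sum>y\<in>(\<lambda>x. g \<otimes> x) ` F. lk (push G g f) x * cnj (lk (push G g h) y) * of_real (\<kappa> x y))"
    by (rule kform_eq) (use F k1 g in auto)
  also have "\<dots> = (\<Sum>x\<in>F. \<Sum>y\<in>F. lk f x * cnj (lk h y) * of_real (\<kappa> x y))"
    by (simp add: sum.reindex[OF inj]) (use F(2) in \<open>auto intro!: sum.cong simp: lookup_push_mult[OF g] inv subset_iff\<close>)
  also have "\<dots> = kform (carrier G) \<kappa> f h" by (rule kform_eq[symmetric, OF F(1,3,4,2)])
  finally show ?thesis .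
qed

text \<open>The GNS representation of an invariant kernel, with its Hilbert space realized as an ultrapower.\<close>

lemma gns_orbit:
  assumes K: "finite K" "K \<subseteq> carrier G"
    and kp: "kazhdan_pair TYPE((nat \<Rightarrow> 'a \<Rightarrow>\<^sub>0 complex) \<Rightarrow> complex) G K \<epsilon>" and \<epsilon>: "0 < \<epsilon>" "\<epsilon> \<le> 1"
    and psd: "psd (carrier G) \<kappa>" and sym: "\<And>x y. x \<in> carrier G \<Longrightarrow> y \<in> carrier G \<Longrightarrow> \<kappa> x y = \<kappa> y x"
    and inv: "\<And>g x y. g \<in> carrier G \<Longrightarrow> x \<in> carrier G \<Longrightarrow> y \<in> carrier G \<Longrightarrow> \<kappa> (g \<otimes> x) (g \<otimes> y) = \<kappa> x y"
    and D: "0 \<le> D" "\<And>k. k \<in> K \<Longrightarrow> Re (kform (carrier G) \<kappa> (push G k f - f) (push G k f - f)) \<le> D\<^sup>2"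
    and g: "g \<in> carrier G"
  shows "Re (kform (carrier G) \<kappa> (push G g ((gavg G K ^^ m) f) - (gavg G K ^^ m) f)
      (push G g ((gavg G K ^^ m) f) - (gavg G K ^^ m) f)) \<le> (2 * rate (card K) \<epsilon> ^ m * D / \<epsilon>)\<^sup>2"
proof -
  obtain U :: "nat filter" where U: "U \<le> sequentially" "ultrafilter U"
    using ultrafilter_exists[of sequentially] by auto
  define b where "b = kform (carrier G) \<kappa>"
  interpret S: semi_inner scp UNIV b unfolding b_def by (rule semi_inner_kform[OF psd sym])
  interpret P: ultraproduct scp "\<lambda>_. b" U
    by unfold_locales (use U in auto)
  have iso: "b (push G g f) (push G g h) = b f h" if "g \<in> carrier G" for g f h
    unfolding b_def using that by (intro kform_push inv)
  have null1: "S.nrm (push G \<one> f - f) = 0" for f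
  proof -
    have "Poly_Mapping.keys (push G \<one> f - f) \<inter> carrier G = {}"
      by (auto simp: in_keys_iff lookup_minus lookup_push)
    hence "b (push G \<one> f - f) (push G \<one> f - f) = 0" unfolding b_def kform_def by simp
    thus ?thesis by (simp add: S.nrm_def)
  qed
  interpret R: ultra_rep scp "\<lambda>_. b" U G "\<lambda>g n. push G g"
  proof
    fix g X Y assume g: "g \<in> carrier G" and X: "X \<in> P.bdd" "Y \<in> P.bdd"
    show "(\<lambda>n. push G g (X n)) \<in> P.bdd"
      using X(1) by (simp add: P.bdd_def S.nrm_def iso[OF g])
    show "P.ip (\<lambda>n. push G g (X n)) (\<lambda>n. push G g (Y n)) = P.ip X Y"
      by (simp add: P.ip_def iso[OF g])
  next
    fix g h X assume "g \<in> carrier G" "h \<in> carrier G" "X \<in> P.bdd"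
    thus "P.UP.nrm ((\<lambda>n. push G (g \<otimes> h) (X n)) - (\<lambda>n. push G g (push G h (X n)))) = 0"
      by (simp add: push_mult)
  next
    fix X assume "X \<in> P.bdd"
    show "P.UP.nrm ((\<lambda>n. push G \<one> (X n)) - X) = 0"
      using P.null_bdd[of "(\<lambda>n. push G \<one> (X n)) - X"] null1 by simp
  qed (simp_all add: push_add push_scp)
  have const_b: "(\<lambda>_. f) \<in> P.bdd" for f by (auto simp: P.bdd_def intro!: exI[of _ "S.nrm f"])
  have const_n: "P.UP.nrm (\<lambda>_. f) = S.nrm f" for f
    by (rule P.nrm_eqI[OF const_b]) simp
  have act_c: "R.act g (\<lambda>_. f) - (\<lambda>_. f) = (\<lambda>_. push G g f - f)" for g f by (simp add: R.act_def fun_eq_iff)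
  have "R.avgn K n = gavg G K" for n by (rule ext) (simp add: R.avgn_def gavg_def)
  hence avg_c: "(R.R.avg K ^^ m) (\<lambda>_. f) = (\<lambda>_. (gavg G K ^^ m) f)" for m
    by (simp add: R.avg_funpow_eq_avgn)
  have "P.UP.nrm (R.act g ((R.R.avg K ^^ m) (\<lambda>_. f)) - (R.R.avg K ^^ m) (\<lambda>_. f)) \<le> 2 * rate (card K) \<epsilon> ^ m * D / \<epsilon>"
  proof (rule R.R.kazhdan_averaging_orbit[OF P.UP_converges K kp \<epsilon> const_b D(1) _ g])
    fix k assume "k \<in> K"
    hence "Re (b (push G k f - f) (push G k f - f)) \<le> D\<^sup>2" using D(2) by (simp add: b_def)
    hence "S.nrm (push G k f - f) \<le> sqrt (D\<^sup>2)" unfolding S.nrm_def by (rule real_sqrt_le_mono)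
    thus "P.UP.nrm (R.act k (\<lambda>_. f) - (\<lambda>_. f)) \<le> D" unfolding act_c const_n using D(1) by simp
  qed
  hence "S.nrm (push G g ((gavg G K ^^ m) f) - (gavg G K ^^ m) f) \<le> 2 * rate (card K) \<epsilon> ^ m * D / \<epsilon>"
    unfolding avg_c act_c const_n .
  hence "(S.nrm (push G g ((gavg G K ^^ m) f) - (gavg G K ^^ m) f))\<^sup>2 \<le> (2 * rate (card K) \<epsilon> ^ m * D / \<epsilon>)\<^sup>2"
    by (intro power_mono) auto
  hence "Re (b (push G g ((gavg G K ^^ m) f) - (gavg G K ^^ m) f) (push G g ((gavg G K ^^ m) f) - (gavg G K ^^ m) f))
      \<le> (2 * rate (card K) \<epsilon> ^ m * D / \<epsilon>)\<^sup>2"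
    unfolding S.nrm_def using S.b_nonneg by simp
  thus ?thesis by (simp add: b_def)
qed

definition total :: "('a \<Rightarrow>\<^sub>0 complex) \<Rightarrow> complex" where "total f = (\<Sum>x\<in>Poly_Mapping.keys f. lk f x)"

lemma total_eq: "finite F \<Longrightarrow> Poly_Mapping.keys f \<subseteq> F \<Longrightarrow> total f = (\<Sum>x\<in>F. lk f x)"
  unfolding total_def by (rule sum.mono_neutral_left) (auto simp: in_keys_iff)

lemma total_add: "total (f + h) = total f + total h"
proof -
  let ?F = "Poly_Mapping.keys f \<union> Poly_Mapping.keys h"
  have "finite ?F" "Poly_Mapping.keys f \<subseteq> ?F" "Poly_Mapping.keys h \<subseteq> ?F" "Poly_Mapping.keys (f + h) \<subseteq> ?F"
    using Poly_Mapping.keys_add[of f h] by auto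
  thus ?thesis by (simp add: total_eq[of ?F] lookup_add sum.distrib)
qed

lemma total_scp: "total (scp c f) = c * total f"
  using keys_scp[of c f] by (simp add: total_eq[of "Poly_Mapping.keys f"] sum_distrib_left)

lemma total_sum: "total (\<Sum>i\<in>A. f i) = (\<Sum>i\<in>A. total (f i))"
  by (induction A rule: infinite_finite_induct) (simp_all add: total_add, simp_all add: total_def)

lemma total_push:
  assumes g: "g \<in> carrier G" and f: "Poly_Mapping.keys f \<subseteq> carrier G"
  shows "total (push G g f) = total f"
proof -
  have inj: "inj_on (\<lambda>x. g \<otimes> x) (Poly_Mapping.keys f)" using inj_mult[OF g] f by (rule inj_on_subset)
  have "total (push G g f) = (\<Sum>x\<in>(\<lambda>x. g \<otimes> x) ` Poly_Mapping.keys f. lk (push G g f) x)"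
    by (rule total_eq) (use keys_push[OF g, of f] in auto)
  also have "\<dots> = (\<Sum>x\<in>Poly_Mapping.keys f. lk f x)"
    using f by (simp add: sum.reindex[OF inj]) (auto intro!: sum.cong simp: lookup_push_mult[OF g] subset_iff)
  finally show ?thesis by (simp add: total_def)
qed

lemma keys_sum_subset: "(\<And>i. i \<in> A \<Longrightarrow> Poly_Mapping.keys (f i) \<subseteq> C) \<Longrightarrow> Poly_Mapping.keys (\<Sum>i\<in>A. f i) \<subseteq> C"
proof (induction A rule: infinite_finite_induct)
  case (insert a A)
  have "Poly_Mapping.keys (\<Sum>i\<in>A. f i) \<subseteq> C" by (rule insert.IH) (simp add: insert.prems)
  moreover have "Poly_Mapping.keys (f a) \<subseteq> C" by (simp add: insert.prems)
  ultimately show ?case using Poly_Mapping.keys_add[of "f a" "\<Sum>i\<in>A. f i"] insert.hyps by simp blast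
qed auto

lemma gavg_props:
  assumes K: "finite K" "K \<subseteq> carrier G"
  shows "Poly_Mapping.keys ((gavg G K ^^ m) (Poly_Mapping.single \<one> 1)) \<subseteq> carrier G \<and>
    total ((gavg G K ^^ m) (Poly_Mapping.single \<one> 1)) = 1"
proof (induction m)
  case 0
  show ?case by (simp add: total_def)
next
  case (Suc m)
  define f where "f = (gavg G K ^^ m) (Poly_Mapping.single \<one> 1)"
  have f: "Poly_Mapping.keys f \<subseteq> carrier G" "total f = 1" using Suc by (simp_all add: f_def)
  have pk: "Poly_Mapping.keys (push G k f) \<subseteq> carrier G" if "k \<in> K" for k
    by (auto simp: in_keys_iff lookup_push[OF subsetD[OF K(2) that]] split: if_splits)
  have "Poly_Mapping.keys (\<Sum>k\<in>K. push G k f) \<subseteq> carrier G" by (rule keys_sum_subset) (rule pk)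
  hence "Poly_Mapping.keys (f + (\<Sum>k\<in>K. push G k f)) \<subseteq> carrier G"
    using f(1) by (intro order_trans[OF Poly_Mapping.keys_add] Un_least)
  hence "Poly_Mapping.keys (gavg G K f) \<subseteq> carrier G" unfolding gavg_def by (rule order_trans[OF keys_scp])
  moreover have "total (gavg G K f) = 1"
  proof -
    have "(\<Sum>k\<in>K. total (push G k f)) = (\<Sum>k\<in>K. 1)"
    proof (rule sum.cong[OF refl])
      fix k assume "k \<in> K"
      thus "total (push G k f) = 1" using total_push[OF subsetD[OF K(2)] f(1)] f(2) by simp
    qed
    hence "total (gavg G K f) = of_real (1 / (1 + real (card K))) * of_real (1 + real (card K))"
      using f by (simp add: gavg_def total_scp total_add total_sum)
    also have "\<dots> = of_real (1 / (1 + real (card K)) * (1 + real (card K)))" by (simp only: of_real_mult)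
    also have "1 / (1 + real (card K)) * (1 + real (card K)) = 1" by simp
    finally show ?thesis by simp
  qed
  ultimately show ?case by (simp add: f_def)
qed

end

lemma psd_one: "psd C (\<lambda>_ _. 1)"
  unfolding psd_def
proof (intro allI impI)
  fix F :: "'a set" and c :: "'a \<Rightarrow> complex"
  have "(\<Sum>x\<in>F. \<Sum>y\<in>F. c x * cnj (c y) * of_real 1) = (\<Sum>x\<in>F. c x) * cnj (\<Sum>x\<in>F. c x)"
    by (simp add: sum_product cnj_sum)
  also have "\<dots> = of_real ((cmod (\<Sum>x\<in>F. c x))\<^sup>2)" by (rule complex_norm_square[symmetric])
  finally show "0 \<le> Re (\<Sum>x\<in>F. \<Sum>y\<in>F. c x * cnj (c y) * of_real 1)" by simp
qed

lemma psd_add: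
  assumes "psd C \<kappa>" "psd C \<kappa>'" shows "psd C (\<lambda>x y. \<kappa> x y + \<kappa>' x y)"
  unfolding psd_def
proof (intro allI impI)
  fix F and c :: "'a \<Rightarrow> complex" assume F: "finite F" "F \<subseteq> C"
  have "0 \<le> Re (\<Sum>x\<in>F. \<Sum>y\<in>F. c x * cnj (c y) * of_real (\<kappa> x y))"
    "0 \<le> Re (\<Sum>x\<in>F. \<Sum>y\<in>F. c x * cnj (c y) * of_real (\<kappa>' x y))"
    using assms F unfolding psd_def by blast+
  thus "0 \<le> Re (\<Sum>x\<in>F. \<Sum>y\<in>F. c x * cnj (c y) * of_real (\<kappa> x y + \<kappa>' x y))"
    by (simp only: of_real_add distrib_left sum.distrib plus_complex.sel add_nonneg_nonneg)
qed

lemma mult_swap6: "(a * b) * (c * d) * e = b * d * (a * c * (e :: complex))"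
  by (simp only: mult_ac)

lemma psd_twist:
  assumes "psd C \<kappa>" shows "psd C (\<lambda>x y. r x * r y * \<kappa> x y)"
  unfolding psd_def
proof (intro allI impI)
  fix F and c :: "'a \<Rightarrow> complex" assume F: "finite F" "F \<subseteq> C"
  have eq: "(of_real (r x) * c x) * cnj (of_real (r y) * c y) * of_real (\<kappa> x y)
      = c x * cnj (c y) * of_real (r x * r y * \<kappa> x y)" for x y
    unfolding complex_cnj_mult complex_cnj_complex_of_real of_real_mult by (rule mult_swap6)
  have "0 \<le> Re (\<Sum>x\<in>F. \<Sum>y\<in>F. (of_real (r x) * c x) * cnj (of_real (r y) * c y) * of_real (\<kappa> x y))"
    using assms[unfolded psd_def, rule_format, OF F, of "\<lambda>x. of_real (r x) * c x"] .
  thus "0 \<le> Re (\<Sum>x\<in>F. \<Sum>y\<in>F. c x * cnj (c y) * of_real (r x * r y * \<kappa> x y))"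
    unfolding eq .
qed

lemma psd_scale: "psd C \<kappa> \<Longrightarrow> 0 \<le> t \<Longrightarrow> psd C (\<lambda>x y. t * \<kappa> x y)"
  by (drule psd_twist[of C \<kappa> "\<lambda>_. sqrt t"]) simp

lemma psd_zero: "psd C (\<lambda>_ _. 0)"
  by (simp add: psd_def)

lemma psd_sum: "(\<And>i. i \<in> A \<Longrightarrow> psd C (\<kappa> i)) \<Longrightarrow> psd C (\<lambda>x y. \<Sum>i\<in>A. \<kappa> i x y)"
proof (induction A rule: infinite_finite_induct)
  case (insert a A)
  have "psd C (\<lambda>x y. \<kappa> a x y + (\<Sum>i\<in>A. \<kappa> i x y))"
    by (rule psd_add) (use insert in auto)
  thus ?case using insert.hyps by simp
qed (simp_all add: psd_zero)

lemma psd_limit: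
  fixes \<kappa> :: "'n \<Rightarrow> 'g \<Rightarrow> 'g \<Rightarrow> real"
  assumes F: "F \<noteq> bot" and psd: "\<And>n. psd C (\<kappa> n)"
    and lim: "\<And>x y. x \<in> C \<Longrightarrow> y \<in> C \<Longrightarrow> ((\<lambda>n. \<kappa> n x y) \<longlongrightarrow> \<kappa>' x y) F"
  shows "psd C \<kappa>'"
  unfolding psd_def
proof (intro allI impI)
  fix I and c :: "'g \<Rightarrow> complex" assume I: "finite I" "I \<subseteq> C"
  have "((\<lambda>n. Re (\<Sum>x\<in>I. \<Sum>y\<in>I. c x * cnj (c y) * of_real (\<kappa> n x y)))
      \<longlongrightarrow> Re (\<Sum>x\<in>I. \<Sum>y\<in>I. c x * cnj (c y) * of_real (\<kappa>' x y))) F"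
    using I(2) by (intro tendsto_Re tendsto_sum tendsto_mult tendsto_const tendsto_of_real lim) auto
  thus "0 \<le> Re (\<Sum>x\<in>I. \<Sum>y\<in>I. c x * cnj (c y) * of_real (\<kappa>' x y))"
    by (rule tendsto_lowerbound) (use psd I F in \<open>auto simp: psd_def\<close>)
qed

text \<open>The exponential series exhibits \<open>exp (2 s a\<^sub>x a\<^sub>y)\<close> as a positive combination of kernels of rank
  one.\<close>

lemma psd_mult_exp:
  assumes psd: "psd C \<kappa>" and s: "0 \<le> s"
  shows "psd C (\<lambda>x y. \<kappa> x y * exp (2 * s * a x * a y))"
proof (rule psd_limit[OF sequentially_bot])
  fix n
  have "psd C (\<lambda>x y. \<Sum>m<n. ((2 * s) ^ m / fact m) * ((a x) ^ m * (a y) ^ m * \<kappa> x y))"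
    using s by (intro psd_sum psd_scale psd_twist psd) auto
  thus "psd C (\<lambda>x y. \<kappa> x y * (\<Sum>m<n. (2 * s * a x * a y) ^ m /\<^sub>R fact m))"
    by (simp add: sum_distrib_left power_mult_distrib divide_inverse mult_ac)
next
  fix x y
  have "(\<lambda>n. \<Sum>m<n. (2 * s * a x * a y) ^ m /\<^sub>R fact m) \<longlonglongrightarrow> exp (2 * s * a x * a y)"
    using exp_converges[of "2 * s * a x * a y"] by (simp add: sums_def)
  thus "(\<lambda>n. \<kappa> x y * (\<Sum>m<n. (2 * s * a x * a y) ^ m /\<^sub>R fact m)) \<longlonglongrightarrow> \<kappa> x y * exp (2 * s * a x * a y)"
    by (intro tendsto_intros)
qed

lemma psd_gaussian_step:
  assumes psd: "psd C \<kappa>" and s: "0 \<le> s"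
  shows "psd C (\<lambda>x y. \<kappa> x y * exp (- s * (a x - a y)\<^sup>2))"
proof -
  have "exp (- s * (a x - a y)\<^sup>2) = exp (- s * (a x)\<^sup>2) * exp (- s * (a y)\<^sup>2) * exp (2 * s * a x * a y)" for x y
    by (simp add: exp_add[symmetric] power2_diff algebra_simps)
  thus ?thesis
    using psd_twist[OF psd_mult_exp[OF psd s, of a], of "\<lambda>x. exp (- s * (a x)\<^sup>2)"] by (simp add: mult_ac)
qed

lemma psd_gaussian:
  fixes z :: "'g \<Rightarrow> 'i \<Rightarrow> complex"
  assumes s: "0 \<le> s"
  shows "psd C (\<lambda>x y. exp (- s * (\<Sum>i\<in>I. (cmod (z x i - z y i))\<^sup>2)))"
proof (induction I rule: infinite_finite_induct)
  case (insert i I)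
  have "exp (- s * (\<Sum>j\<in>insert i I. (cmod (z x j - z y j))\<^sup>2)) =
      exp (- s * (\<Sum>j\<in>I. (cmod (z x j - z y j))\<^sup>2)) * exp (- s * (Re (z x i) - Re (z y i))\<^sup>2)
        * exp (- s * (Im (z x i) - Im (z y i))\<^sup>2)" for x y
    using insert.hyps by (simp add: exp_add[symmetric] cmod_power2 algebra_simps)
  thus ?case
    using psd_gaussian_step[OF psd_gaussian_step[OF insert.IH s, of "\<lambda>x. Re (z x i)"] s, of "\<lambda>x. Im (z x i)"] by simp
qed (simp_all add: psd_one)

lemma psd_same_class: "psd C (\<lambda>x y. if p x = p y then 1 else 0)"
  unfolding psd_def
proof (intro allI impI)
  fix F and c :: "'a \<Rightarrow> complex" assume F: "finite F" "F \<subseteq> C"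
  have "psd C (\<lambda>x y. \<Sum>z\<in>p ` F. of_bool (p x = z) * of_bool (p y = z) * 1)"
    by (intro psd_sum psd_twist psd_one)
  hence "0 \<le> Re (\<Sum>x\<in>F. \<Sum>y\<in>F. c x * cnj (c y) * of_real (\<Sum>z\<in>p ` F. of_bool (p x = z) * of_bool (p y = z) * 1))"
    using F unfolding psd_def by blast
  also have "(\<Sum>x\<in>F. \<Sum>y\<in>F. c x * cnj (c y) * of_real (\<Sum>z\<in>p ` F. of_bool (p x = z) * of_bool (p y = z) * 1))
      = (\<Sum>x\<in>F. \<Sum>y\<in>F. c x * cnj (c y) * of_real (if p x = p y then 1 else 0))"
  proof (intro sum.cong refl)
    fix x y assume xy: "x \<in> F" "y \<in> F"
    have "(\<Sum>z\<in>p ` F. of_bool (p x = z) * of_bool (p y = z) * 1) = (\<Sum>z\<in>p ` F. if z = p x then of_bool (p y = z) else (0::real))"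
      by (rule sum.cong) auto
    also have "\<dots> = (if p x = p y then 1 else 0)" using F xy by (subst sum.delta) auto
    finally show "c x * cnj (c y) * of_real (\<Sum>z\<in>p ` F. of_bool (p x = z) * of_bool (p y = z) * 1)
        = c x * cnj (c y) * of_real (if p x = p y then 1 else 0)" by simp
  qed
  finally show "0 \<le> Re (\<Sum>x\<in>F. \<Sum>y\<in>F. c x * cnj (c y) * of_real (if p x = p y then 1 else 0))" .
qed

lemma kform_single:
  "a \<in> C \<Longrightarrow> c \<in> C \<Longrightarrow> kform C \<kappa> (Poly_Mapping.single a 1) (Poly_Mapping.single c 1) = of_real (\<kappa> a c)"
  by (simp add: kform_def)

context group
begin

lemma push_single: "g \<in> carrier G \<Longrightarrow> push G g (Poly_Mapping.single \<one> 1) = Poly_Mapping.single g 1"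
proof (rule poly_mapping_eqI)
  fix z assume g: "g \<in> carrier G"
  have "inv g \<otimes> z = \<one> \<longleftrightarrow> z = g" if "z \<in> carrier G"
    using g that inv_solve_left'[of \<one> g z] by auto
  thus "lk (push G g (Poly_Mapping.single \<one> 1)) z = lk (Poly_Mapping.single g 1) z"
    using g by (auto simp: lookup_push lookup_single when_def)
qed

lemma kform_moved:
  assumes psd: "psd (carrier G) \<kappa>" and sym: "\<And>x y. x \<in> carrier G \<Longrightarrow> y \<in> carrier G \<Longrightarrow> \<kappa> x y = \<kappa> y x"
    and one: "\<And>x. x \<in> carrier G \<Longrightarrow> \<kappa> x x = 1" and g: "g \<in> carrier G"
  shows "Re (kform (carrier G) \<kappa> (push G g (Poly_Mapping.single \<one> 1) - Poly_Mapping.single \<one> 1)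
    (push G g (Poly_Mapping.single \<one> 1) - Poly_Mapping.single \<one> 1)) = 2 - 2 * \<kappa> g \<one>"
proof -
  interpret S: semi_inner scp UNIV "kform (carrier G) \<kappa>" by (rule semi_inner_kform[OF psd sym])
  show ?thesis
    using g sym[of g \<one>] by (simp add: push_single S.b_diff_left S.b_diff_right kform_single one)
qed

text \<open>A Kazhdan set generates the group: the permutation representation on the cosets of the subgroup
  it generates has a vector fixed by this set.\<close>

lemma kazhdan_generates:
  assumes K: "finite K" "K \<subseteq> carrier G"
    and kp: "kazhdan_pair TYPE((nat \<Rightarrow> 'a \<Rightarrow>\<^sub>0 complex) \<Rightarrow> complex) G K \<epsilon>" and \<epsilon>: "0 < \<epsilon>" "\<epsilon> \<le> 1"
  shows "generate G K = carrier G"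
proof -
  let ?H = "generate G K"
  interpret H: subgroup ?H G by (rule generate_is_subgroup[OF K(2)])
  define p where "p x = (\<lambda>h. x \<otimes> h) ` ?H" for x
  define \<kappa> :: "'a \<Rightarrow> 'a \<Rightarrow> real" where "\<kappa> x y = (if p x = p y then 1 else 0)" for x y
  have psd: "psd (carrier G) \<kappa>" unfolding \<kappa>_def by (rule psd_same_class)
  have psub: "p x \<subseteq> carrier G" if "x \<in> carrier G" for x using that by (auto simp: p_def)
  have inv: "\<kappa> (g \<otimes> x) (g \<otimes> y) = \<kappa> x y" if "g \<in> carrier G" "x \<in> carrier G" "y \<in> carrier G" for g x y
  proof -
    have "p (g \<otimes> z) = (\<lambda>x. g \<otimes> x) ` p z" if "z \<in> carrier G" for z
      using that \<open>g \<in> carrier G\<close> by (auto simp: p_def m_assoc image_image)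
    thus ?thesis using that psub by (simp add: \<kappa>_def inj_on_image_eq_iff[OF inj_mult])
  qed
  have pK: "p k = p \<one>" if "k \<in> K" for k
  proof -
    have k: "k \<in> ?H" using that by (rule generate.incl)
    hence kG: "k \<in> carrier G" by simp
    have "h \<in> (\<lambda>h. k \<otimes> h) ` ?H" if "h \<in> ?H" for h
      by (rule image_eqI[of _ _ "inv k \<otimes> h"]) (use k kG that in \<open>auto simp: m_assoc[symmetric]\<close>)
    thus ?thesis using k by (auto simp: p_def image_def)
  qed
  have "g \<in> ?H" if g: "g \<in> carrier G" for g
  proof -
    have sym: "\<kappa> x y = \<kappa> y x" and one: "\<kappa> x x = 1" for x y by (simp_all add: \<kappa>_def eq_commute)
    note moved = kform_moved[OF psd sym one]
    have "Re (kform (carrier G) \<kappa> (push G k (Poly_Mapping.single \<one> 1) - Poly_Mapping.single \<one> 1)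
        (push G k (Poly_Mapping.single \<one> 1) - Poly_Mapping.single \<one> 1)) \<le> 0\<^sup>2" if k: "k \<in> K" for k
      unfolding moved[OF subsetD[OF K(2) k]] using pK[OF k] by (simp add: \<kappa>_def)
    from gns_orbit[OF K kp \<epsilon> psd sym inv order_refl this g, of 0]
    have "2 - 2 * \<kappa> g \<one> \<le> 0" using moved[OF g] by simp
    hence "p g = p \<one>" by (simp add: \<kappa>_def split: if_splits)
    moreover have "g \<otimes> \<one> \<in> p g" unfolding p_def by (rule imageI) simp
    ultimately show ?thesis using g by (auto simp: p_def)
  qed
  thus ?thesis using H.subset by blast
qed

end

context semi_inner
begin

lemma b_sum_right: "(\<And>i. i \<in> A \<Longrightarrow> f i \<in> S) \<Longrightarrow> y \<in> S \<Longrightarrow> b y (sum f A) = (\<Sum>i\<in>A. b y (f i))"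
  by (induction A rule: infinite_finite_induct) (simp_all add: b_add_right sum_in)

lemma b_lincomb:
  assumes "\<And>x. x \<in> F \<Longrightarrow> \<beta> x \<in> S"
  shows "b (\<Sum>x\<in>F. sc (c x) (\<beta> x)) (\<Sum>x\<in>F. sc (c x) (\<beta> x)) = (\<Sum>x\<in>F. \<Sum>y\<in>F. c x * cnj (c y) * b (\<beta> x) (\<beta> y))"
proof -
  have *: "(\<Sum>x\<in>F. sc (c x) (\<beta> x)) \<in> S" by (rule sum_in) (use assms in auto)
  have "b (\<Sum>x\<in>F. sc (c x) (\<beta> x)) (\<Sum>x\<in>F. sc (c x) (\<beta> x)) = (\<Sum>x\<in>F. b (sc (c x) (\<beta> x)) (\<Sum>x\<in>F. sc (c x) (\<beta> x)))"
    by (rule b_sum_left) (use assms * in auto)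
  also have "\<dots> = (\<Sum>x\<in>F. \<Sum>y\<in>F. c x * cnj (c y) * b (\<beta> x) (\<beta> y))"
    using assms by (intro sum.cong refl) (subst b_sum_right, auto intro!: sum.cong simp: b_sc_left b_sc_right)
  finally show ?thesis .
qed

text \<open>The derivative at 0 of the Gaussian kernels is a kernel of conditionally negative type: on
  combinations of total weight 0 it is the squared length of the combination of vectors.\<close>

lemma gaussian_derivative:
  assumes F: "finite F" and \<beta>: "\<And>x. x \<in> F \<Longrightarrow> \<beta> x \<in> S" and tot: "(\<Sum>x\<in>F. c x) = 0"
    and le: "\<And>s. s > 0 \<Longrightarrow> Re (\<Sum>x\<in>F. \<Sum>y\<in>F. c x * cnj (c y) * of_real (exp (- s * (nrm (\<beta> x - \<beta> y))\<^sup>2))) \<le> s * C"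
  shows "(nrm (\<Sum>x\<in>F. sc (c x) (\<beta> x)))\<^sup>2 \<le> C"
proof -
  define d where "d x y = (nrm (\<beta> x - \<beta> y))\<^sup>2" for x y
  have ctot: "(\<Sum>x\<in>F. cnj (c x)) = 0" using arg_cong[OF tot, of cnj] by (simp add: cnj_sum)
  have z: "(\<Sum>x\<in>F. \<Sum>y\<in>F. c x * cnj (c y)) = 0"
    by (simp only: sum_product[symmetric] ctot mult_zero_right)
  have lim: "((\<lambda>s. (exp (- s * d x y) - 1) / s) \<longlongrightarrow> - d x y) (at_right 0)" for x y
  proof -
    have "((\<lambda>s. exp (- s * d x y)) has_real_derivative - d x y) (at 0)"
      by (auto intro!: derivative_eq_intros)
    hence "((\<lambda>s. (exp (- s * d x y) - 1) / s) \<longlongrightarrow> - d x y) (at 0)"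
      by (simp add: DERIV_def)
    thus ?thesis by (rule filterlim_mono[OF _ order_refl at_le]) simp
  qed
  have le1: "Re (\<Sum>x\<in>F. \<Sum>y\<in>F. c x * cnj (c y) * of_real (- d x y)) \<le> C"
  proof (rule tendsto_upperbound)
    show "((\<lambda>s. Re (\<Sum>x\<in>F. \<Sum>y\<in>F. c x * cnj (c y) * of_real ((exp (- s * d x y) - 1) / s)))
        \<longlongrightarrow> Re (\<Sum>x\<in>F. \<Sum>y\<in>F. c x * cnj (c y) * of_real (- d x y))) (at_right 0)"
      by (intro tendsto_Re tendsto_sum tendsto_mult tendsto_const tendsto_of_real lim)
    have "Re (\<Sum>x\<in>F. \<Sum>y\<in>F. c x * cnj (c y) * of_real ((exp (- s * d x y) - 1) / s)) \<le> C" if s: "s > 0" for s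
    proof -
      have "c x * cnj (c y) * of_real ((exp (- s * d x y) - 1) / s) * of_real s
          = c x * cnj (c y) * of_real (exp (- s * d x y)) - c x * cnj (c y)" for x y
      proof -
        have "complex_of_real ((exp (- s * d x y) - 1) / s) * of_real s = of_real ((exp (- s * d x y) - 1) / s * s)"
          by (simp only: of_real_mult)
        also have "(exp (- s * d x y) - 1) / s * s = exp (- s * d x y) - 1" using s by simp
        finally show ?thesis by (simp only: mult.assoc of_real_diff of_real_1 right_diff_distrib mult_1_right)
      qed
      hence e: "(\<Sum>x\<in>F. \<Sum>y\<in>F. c x * cnj (c y) * of_real ((exp (- s * d x y) - 1) / s)) * of_real s
          = (\<Sum>x\<in>F. \<Sum>y\<in>F. c x * cnj (c y) * of_real (exp (- s * d x y)))"
        by (simp only: sum_distrib_right sum_subtractf z diff_zero)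
      have rr: "Re z * t = Re (z * of_real t)" for z t by simp
      have "Re (\<Sum>x\<in>F. \<Sum>y\<in>F. c x * cnj (c y) * of_real ((exp (- s * d x y) - 1) / s)) * s \<le> C * s"
        unfolding rr e using le[OF s] by (simp only: d_def mult.commute[of C])
      thus ?thesis using s by simp
    qed
    thus "\<forall>\<^sub>F s in at_right 0. Re (\<Sum>x\<in>F. \<Sum>y\<in>F. c x * cnj (c y) * of_real ((exp (- s * d x y) - 1) / s)) \<le> C"
      by (rule eventually_mono[OF eventually_at_right_less])
  qed simp
  have eq1: "(\<Sum>x\<in>F. \<Sum>y\<in>F. c x * cnj (c y) * of_real (- d x y))
      = b (\<Sum>x\<in>F. sc (c x) (\<beta> x)) (\<Sum>x\<in>F. sc (c x) (\<beta> x)) + b (\<Sum>x\<in>F. sc (cnj (c x)) (\<beta> x)) (\<Sum>x\<in>F. sc (cnj (c x)) (\<beta> x))"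
  proof -
    define N where "N x = complex_of_real ((nrm (\<beta> x))\<^sup>2)" for x
    have "of_real (- d x y) = - N x - N y + b (\<beta> x) (\<beta> y) + b (\<beta> y) (\<beta> x)" if "x \<in> F" "y \<in> F" for x y
      proof -
      have yx: "b (\<beta> y) (\<beta> x) = cnj (b (\<beta> x) (\<beta> y))" using that \<beta> b_commute by blast
      have "d x y = (nrm (\<beta> x))\<^sup>2 + (nrm (\<beta> y))\<^sup>2 - 2 * Re (b (\<beta> x) (\<beta> y))"
        unfolding d_def using that \<beta> by (intro nrm_diff_sq) auto
      thus ?thesis unfolding yx N_def by (simp add: complex_eq_iff)
    qed
    hence "(\<Sum>x\<in>F. \<Sum>y\<in>F. c x * cnj (c y) * of_real (- d x y))
        = (\<Sum>x\<in>F. \<Sum>y\<in>F. c x * cnj (c y) * (- N x - N y + b (\<beta> x) (\<beta> y) + b (\<beta> y) (\<beta> x)))"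
      by (intro sum.cong refl) auto
    also have "\<dots> = (\<Sum>x\<in>F. \<Sum>y\<in>F. (c x * cnj (c y) * b (\<beta> x) (\<beta> y) + c x * cnj (c y) * b (\<beta> y) (\<beta> x))
        - (c x * N x * cnj (c y) + c x * (cnj (c y) * N y)))"
      by (intro sum.cong refl) (simp add: algebra_simps)
    also have "\<dots> = ((\<Sum>x\<in>F. \<Sum>y\<in>F. c x * cnj (c y) * b (\<beta> x) (\<beta> y)) + (\<Sum>x\<in>F. \<Sum>y\<in>F. c x * cnj (c y) * b (\<beta> y) (\<beta> x)))
        - ((\<Sum>x\<in>F. \<Sum>y\<in>F. c x * N x * cnj (c y)) + (\<Sum>x\<in>F. \<Sum>y\<in>F. c x * (cnj (c y) * N y)))"
      by (simp only: sum_subtractf sum.distrib)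
    finally have eq2: "(\<Sum>x\<in>F. \<Sum>y\<in>F. c x * cnj (c y) * of_real (- d x y)) =
        ((\<Sum>x\<in>F. \<Sum>y\<in>F. c x * cnj (c y) * b (\<beta> x) (\<beta> y)) + (\<Sum>x\<in>F. \<Sum>y\<in>F. c x * cnj (c y) * b (\<beta> y) (\<beta> x)))
        - ((\<Sum>x\<in>F. \<Sum>y\<in>F. c x * N x * cnj (c y)) + (\<Sum>x\<in>F. \<Sum>y\<in>F. c x * (cnj (c y) * N y)))" .
    have z1: "(\<Sum>x\<in>F. \<Sum>y\<in>F. c x * N x * cnj (c y)) = 0"
      by (simp only: sum_product[symmetric] ctot mult_zero_right)
    have z2: "(\<Sum>x\<in>F. \<Sum>y\<in>F. c x * (cnj (c y) * N y)) = 0"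
      by (simp only: sum_product[symmetric] tot mult_zero_left)
    have z3: "(\<Sum>x\<in>F. \<Sum>y\<in>F. c x * cnj (c y) * b (\<beta> y) (\<beta> x))
        = (\<Sum>y\<in>F. \<Sum>x\<in>F. cnj (c y) * cnj (cnj (c x)) * b (\<beta> y) (\<beta> x))"
      unfolding complex_cnj_cnj by (subst sum.swap) (simp only: mult.commute)
    have z4: "(\<Sum>x\<in>F. \<Sum>y\<in>F. c x * cnj (c y) * b (\<beta> x) (\<beta> y)) = b (\<Sum>x\<in>F. sc (c x) (\<beta> x)) (\<Sum>x\<in>F. sc (c x) (\<beta> x))"
      by (rule b_lincomb[symmetric]) (rule \<beta>)
    have z5: "(\<Sum>y\<in>F. \<Sum>x\<in>F. cnj (c y) * cnj (cnj (c x)) * b (\<beta> y) (\<beta> x))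
        = b (\<Sum>x\<in>F. sc (cnj (c x)) (\<beta> x)) (\<Sum>x\<in>F. sc (cnj (c x)) (\<beta> x))"
      by (rule b_lincomb[symmetric]) (rule \<beta>)
    show ?thesis unfolding eq2 z1 z2 z3 z4 z5 by simp
  qed
  from le1 have "Re (b (\<Sum>x\<in>F. sc (c x) (\<beta> x)) (\<Sum>x\<in>F. sc (c x) (\<beta> x)))
      + Re (b (\<Sum>x\<in>F. sc (cnj (c x)) (\<beta> x)) (\<Sum>x\<in>F. sc (cnj (c x)) (\<beta> x))) \<le> C"
    unfolding eq1 plus_complex.sel .
  moreover have in1: "(\<Sum>x\<in>F. sc (c x) (\<beta> x)) \<in> S" "(\<Sum>x\<in>F. sc (cnj (c x)) (\<beta> x)) \<in> S"
    using \<beta> by (auto intro!: sum_in)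
  moreover have "Re (b (\<Sum>x\<in>F. sc (c x) (\<beta> x)) (\<Sum>x\<in>F. sc (c x) (\<beta> x))) = (nrm (\<Sum>x\<in>F. sc (c x) (\<beta> x)))\<^sup>2"
    unfolding b_self[OF in1(1)] by simp
  ultimately show ?thesis using b_nonneg[OF in1(2)] by linarith
qed

end

context semi_rep
begin

text \<open>The Delorme--Guichardet theorem, quantitatively. In the GNS representation of the Gaussian kernel
  of the cocycle with parameter \<open>s\<close>, averaging the cyclic vector makes it nearly invariant; dividing
  by \<open>s\<close> and letting \<open>s\<close> tend to 0 gives the same estimate for the affine action defined by the cocycle.\<close>

lemma cocycle_averaging:
  assumes K: "finite K" "K \<subseteq> carrier G"
    and kp: "kazhdan_pair TYPE((nat \<Rightarrow> 'g \<Rightarrow>\<^sub>0 complex) \<Rightarrow> complex) G K \<epsilon>" and \<epsilon>: "0 < \<epsilon>" "\<epsilon> \<le> 1"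
    and \<beta>: "\<And>g. g \<in> carrier G \<Longrightarrow> \<beta> g \<in> S"
    and coc: "\<And>g h. g \<in> carrier G \<Longrightarrow> h \<in> carrier G \<Longrightarrow> nrm (\<beta> (g \<otimes>\<^bsub>G\<^esub> h) - (\<beta> g + act g (\<beta> h))) = 0"
    and psd: "\<And>s. 0 < s \<Longrightarrow> psd (carrier G) (\<lambda>x y. exp (- s * (nrm (\<beta> x - \<beta> y))\<^sup>2))"
    and D: "0 \<le> D" "\<And>k. k \<in> K \<Longrightarrow> nrm (\<beta> k) \<le> D"
  shows "\<exists>\<xi>\<in>S. \<forall>g\<in>carrier G. nrm (\<beta> g + act g \<xi> - \<xi>) \<le> 4 * rate (card K) \<epsilon> ^ m * D / \<epsilon>"
proof -
  define v where "v = (gavg G K ^^ m) (Poly_Mapping.single \<one>\<^bsub>G\<^esub> 1)"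
  define I where "I = Poly_Mapping.keys v"
  have I: "finite I" "I \<subseteq> carrier G" and tv: "(\<Sum>x\<in>I. lk v x) = 1"
    using G.gavg_props[OF K, of m] by (simp_all add: I_def v_def G.total_def)
  have v0: "lk v x = 0" if "x \<notin> I" for x using that by (simp add: I_def in_keys_iff)
  define \<xi> where "\<xi> = (\<Sum>x\<in>I. sc (lk v x) (\<beta> x))"
  have IS: "x \<in> I \<Longrightarrow> \<beta> x \<in> S" "x \<in> I \<Longrightarrow> x \<in> carrier G" for x using I \<beta> by auto
  have \<xi>S: "\<xi> \<in> S" unfolding \<xi>_def by (rule sum_in) (use IS in auto)
  have \<beta>1: "nrm (\<beta> \<one>\<^bsub>G\<^esub>) = 0"
    using coc[of "\<one>\<^bsub>G\<^esub>" "\<one>\<^bsub>G\<^esub>"] \<beta> by simp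
  have iso: "nrm (\<beta> (g \<otimes>\<^bsub>G\<^esub> x) - \<beta> (g \<otimes>\<^bsub>G\<^esub> y)) = nrm (\<beta> x - \<beta> y)"
    if g: "g \<in> carrier G" "x \<in> carrier G" "y \<in> carrier G" for g x y
  proof -
    have eq: "\<beta> (g \<otimes>\<^bsub>G\<^esub> x) - \<beta> (g \<otimes>\<^bsub>G\<^esub> y) - act g (\<beta> x - \<beta> y)
        = (\<beta> (g \<otimes>\<^bsub>G\<^esub> x) - (\<beta> g + act g (\<beta> x))) - (\<beta> (g \<otimes>\<^bsub>G\<^esub> y) - (\<beta> g + act g (\<beta> y)))"
      using g by (simp add: act_diff)
    have "nrm (\<beta> (g \<otimes>\<^bsub>G\<^esub> x) - \<beta> (g \<otimes>\<^bsub>G\<^esub> y) - act g (\<beta> x - \<beta> y)) \<le> 0"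
      unfolding eq using nrm_triangle_diff[of "\<beta> (g \<otimes>\<^bsub>G\<^esub> x) - (\<beta> g + act g (\<beta> x))" "\<beta> (g \<otimes>\<^bsub>G\<^esub> y) - (\<beta> g + act g (\<beta> y))"]
        coc[OF g(1,2)] coc[OF g(1,3)] g \<beta> by simp
    hence "nrm (\<beta> (g \<otimes>\<^bsub>G\<^esub> x) - \<beta> (g \<otimes>\<^bsub>G\<^esub> y) - act g (\<beta> x - \<beta> y)) = 0"
      by (intro nrm_le_zeroD) (use g \<beta> in auto)
    hence "nrm (\<beta> (g \<otimes>\<^bsub>G\<^esub> x) - \<beta> (g \<otimes>\<^bsub>G\<^esub> y)) = nrm (act g (\<beta> x - \<beta> y))"
      by (rule nrm_cong0[rotated 2]) (use g \<beta> in auto)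
    thus ?thesis using g \<beta> by simp
  qed
  have "nrm (\<beta> g + act g \<xi> - \<xi>) \<le> 4 * rate (card K) \<epsilon> ^ m * D / \<epsilon>" if g: "g \<in> carrier G" for g
  proof -
    define f where "f = push G g v - v"
    define F where "F = I \<union> (\<lambda>x. g \<otimes>\<^bsub>G\<^esub> x) ` I"
    have F: "finite F" "F \<subseteq> carrier G" using I g by (auto simp: F_def)
    have pI: "lk (push G g v) x = 0" if "x \<notin> (\<lambda>x. g \<otimes>\<^bsub>G\<^esub> x) ` I" for x
      using G.keys_push[OF g, of v] that by (auto simp: I_def in_keys_iff)
    have kf: "Poly_Mapping.keys f \<subseteq> F"
    proof
      fix x assume "x \<in> Poly_Mapping.keys f"
      hence "lk (push G g v) x - lk v x \<noteq> 0" by (simp add: f_def in_keys_iff lookup_minus)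
      thus "x \<in> F" using v0[of x] pI[of x] by (cases "x \<in> I"; cases "x \<in> (\<lambda>x. g \<otimes>\<^bsub>G\<^esub> x) ` I") (auto simp: F_def)
    qed
    have inj: "inj_on (\<lambda>x. g \<otimes>\<^bsub>G\<^esub> x) I" using G.inj_mult[OF g] I(2) by (rule inj_on_subset)
    have tot: "(\<Sum>x\<in>F. lk f x) = 0"
    proof -
      have "(\<Sum>x\<in>F. lk f x) = (\<Sum>x\<in>F. lk (push G g v) x) - (\<Sum>x\<in>F. lk v x)"
        by (simp add: f_def lookup_minus sum_subtractf)
      also have "(\<Sum>x\<in>F. lk (push G g v) x) = G.total (push G g v)"
        by (rule G.total_eq[symmetric, OF F(1)]) (use pI in \<open>auto simp: F_def in_keys_iff\<close>)
      also have "\<dots> = G.total v" by (rule G.total_push[OF g]) (use I in \<open>simp add: I_def\<close>)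
      also have "\<dots> = (\<Sum>x\<in>F. lk v x)"
        by (rule G.total_eq[OF F(1)]) (auto simp: F_def I_def)
      finally show ?thesis by simp
    qed
    define R where "R = 2 * rate (card K) \<epsilon> ^ m * D / \<epsilon>"
    have R0: "0 \<le> R" using rate_nonneg[OF \<epsilon>] D \<epsilon> by (simp add: R_def)
    have "(nrm (\<Sum>x\<in>F. sc (lk f x) (\<beta> x)))\<^sup>2 \<le> 2 * R\<^sup>2"
    proof (rule gaussian_derivative[OF F(1) _ tot])
      show "x \<in> F \<Longrightarrow> \<beta> x \<in> S" for x using F \<beta> by blast
      fix s :: real assume s: "s > 0"
      define \<kappa> where "\<kappa> x y = exp (- s * (nrm (\<beta> x - \<beta> y))\<^sup>2)" for x y
      have \<kappa>: "psd (carrier G) \<kappa>" using psd[OF s] by (simp add: \<kappa>_def[abs_def])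
      have sym: "\<kappa> x y = \<kappa> y x" if "x \<in> carrier G" "y \<in> carrier G" for x y
        using nrm_diff_commute[of "\<beta> x" "\<beta> y"] that \<beta> by (simp add: \<kappa>_def)
      have one: "\<kappa> x x = 1" for x by (simp add: \<kappa>_def)
      have "Re (kform (carrier G) \<kappa> (push G g v - v) (push G g v - v))
          \<le> (2 * rate (card K) \<epsilon> ^ m * (sqrt (2 * s) * D) / \<epsilon>)\<^sup>2"
        unfolding v_def
      proof (rule G.gns_orbit[OF K kp \<epsilon> \<kappa> sym _ _ _ g])
        show "0 \<le> sqrt (2 * s) * D" using s D by simp
        fix k assume k: "k \<in> K"
        hence kG: "k \<in> carrier G" using K by blast
        have "nrm (\<beta> k - \<beta> \<one>\<^bsub>G\<^esub>) \<le> D" using nrm_triangle_diff[of "\<beta> k" "\<beta> \<one>\<^bsub>G\<^esub>"] kG \<beta> \<beta>1 D(2)[OF k] by simp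
        hence "s * (nrm (\<beta> k - \<beta> \<one>\<^bsub>G\<^esub>))\<^sup>2 \<le> s * D\<^sup>2" using s kG \<beta> by (intro mult_left_mono power_mono) auto
        moreover have "1 - s * (nrm (\<beta> k - \<beta> \<one>\<^bsub>G\<^esub>))\<^sup>2 \<le> \<kappa> k \<one>\<^bsub>G\<^esub>"
          unfolding \<kappa>_def using exp_ge_add_one_self[of "- s * (nrm (\<beta> k - \<beta> \<one>\<^bsub>G\<^esub>))\<^sup>2"] by simp
        moreover have "(sqrt (2 * s) * D)\<^sup>2 = 2 * (s * D\<^sup>2)" using s by (simp add: power_mult_distrib)
        ultimately have "2 - 2 * \<kappa> k \<one>\<^bsub>G\<^esub> \<le> (sqrt (2 * s) * D)\<^sup>2" by linarith
        thus "Re (kform (carrier G) \<kappa> (push G k (Poly_Mapping.single \<one>\<^bsub>G\<^esub> 1) - Poly_Mapping.single \<one>\<^bsub>G\<^esub> 1)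
            (push G k (Poly_Mapping.single \<one>\<^bsub>G\<^esub> 1) - Poly_Mapping.single \<one>\<^bsub>G\<^esub> 1)) \<le> (sqrt (2 * s) * D)\<^sup>2"
          using G.kform_moved[OF \<kappa> sym one kG] by simp
      qed (use iso in \<open>auto simp: \<kappa>_def\<close>)
      also have "(2 * rate (card K) \<epsilon> ^ m * (sqrt (2 * s) * D) / \<epsilon>)\<^sup>2 = (sqrt (2 * s) * R)\<^sup>2"
        by (simp add: R_def mult_ac)
      also have "\<dots> = s * (2 * R\<^sup>2)" using s by (simp add: power_mult_distrib)
      also have "kform (carrier G) \<kappa> (push G g v - v) (push G g v - v)
          = (\<Sum>x\<in>F. \<Sum>y\<in>F. lk f x * cnj (lk f y) * of_real (\<kappa> x y))"
        unfolding f_def[symmetric] by (rule kform_eq) (use F kf in auto)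
      finally show "Re (\<Sum>x\<in>F. \<Sum>y\<in>F. lk f x * cnj (lk f y) * of_real (exp (- s * (nrm (\<beta> x - \<beta> y))\<^sup>2))) \<le> s * (2 * R\<^sup>2)"
        by (simp add: \<kappa>_def)
    qed
    also have "2 * R\<^sup>2 \<le> (2 * R)\<^sup>2" by (simp add: power_mult_distrib)
    finally have LF: "nrm (\<Sum>x\<in>F. sc (lk f x) (\<beta> x)) \<le> 2 * R" by (rule power2_le_imp_le) (use R0 in simp)
    define E where "E = (\<Sum>x\<in>I. sc (lk v x) (\<beta> (g \<otimes>\<^bsub>G\<^esub> x) - (\<beta> g + act g (\<beta> x))))"
    have ES: "E \<in> S" unfolding E_def by (rule sum_in) (use IS g \<beta> in auto)
    have E0: "nrm E \<le> 0"
    proof -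
      have "nrm E \<le> (\<Sum>x\<in>I. nrm (sc (lk v x) (\<beta> (g \<otimes>\<^bsub>G\<^esub> x) - (\<beta> g + act g (\<beta> x)))))"
        unfolding E_def by (rule nrm_sum) (use IS g \<beta> in auto)
      also have "\<dots> = (\<Sum>x\<in>I. 0)"
        by (rule sum.cong) (use IS g \<beta> coc in auto)
      finally show ?thesis by simp
    qed
    have sc_sum_left: "sc (sum c A) x = (\<Sum>i\<in>A. sc (c i) x)" for c :: "'g \<Rightarrow> complex" and A x
      by (induction A rule: infinite_finite_induct) (simp_all add: sc_add_left)
    have "(\<Sum>x\<in>F. sc (lk (push G g v) x) (\<beta> x)) = (\<Sum>x\<in>(\<lambda>x. g \<otimes>\<^bsub>G\<^esub> x) ` I. sc (lk (push G g v) x) (\<beta> x))"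
      by (rule sum.mono_neutral_right) (use F pI in \<open>auto simp: F_def\<close>)
    also have "\<dots> = (\<Sum>x\<in>I. sc (lk v x) (\<beta> (g \<otimes>\<^bsub>G\<^esub> x)))"
      by (simp add: sum.reindex[OF inj]) (use IS g in \<open>auto intro!: sum.cong simp: G.lookup_push_mult\<close>)
    also have "\<dots> = E + (\<Sum>x\<in>I. sc (lk v x) (\<beta> g + act g (\<beta> x)))"
      by (simp add: E_def sc_diff sum_subtractf)
    also have "(\<Sum>x\<in>I. sc (lk v x) (\<beta> g + act g (\<beta> x))) = sc (\<Sum>x\<in>I. lk v x) (\<beta> g) + act g \<xi>"
      by (simp add: sc_add_right sum.distrib sc_sum_left \<xi>_def act_sum[OF g] act_sc[OF g])
    finally have p: "(\<Sum>x\<in>F. sc (lk (push G g v) x) (\<beta> x)) = E + (\<beta> g + act g \<xi>)" by (simp add: tv)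
    have "(\<Sum>x\<in>F. sc (lk v x) (\<beta> x)) = \<xi>" unfolding \<xi>_def
      by (rule sum.mono_neutral_right) (use F v0 in \<open>auto simp: F_def\<close>)
    moreover have "(\<Sum>x\<in>F. sc (lk f x) (\<beta> x)) = (\<Sum>x\<in>F. sc (lk (push G g v) x) (\<beta> x)) - (\<Sum>x\<in>F. sc (lk v x) (\<beta> x))"
    proof -
      have "sc (c - d) x = sc c x - sc d x" for c d x using sc_add_left[of "c - d" d x] by (simp add: algebra_simps)
      thus ?thesis by (simp add: f_def lookup_minus sum_subtractf)
    qed
    ultimately have eq: "\<beta> g + act g \<xi> - \<xi> = (\<Sum>x\<in>F. sc (lk f x) (\<beta> x)) - E" using p by simp
    have "(\<Sum>x\<in>F. sc (lk f x) (\<beta> x)) \<in> S" by (rule sum_in) (use F \<beta> in auto)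
    from nrm_triangle_diff[OF this ES] have "nrm (\<beta> g + act g \<xi> - \<xi>) \<le> 2 * R"
      unfolding eq using LF E0 by linarith
    thus ?thesis by (simp add: R_def)
  qed
  thus ?thesis using \<xi>S by blast
qed


end

section \<open>Asymptotic representations by matrices\<close>

text \<open>Half of the C*-identity, by duality for the inner product of matrices.\<close>

lemma opn_sq_le: "(opn A)\<^sup>2 \<le> opn (adj A * A)"
proof -
  have "norm (A * X) \<le> sqrt (opn (adj A * A)) * norm X" for X
  proof -
    have "(norm (A * X))\<^sup>2 = Re (cin (A * X) (A * X))" by (simp add: cin_norm)
    also have "\<dots> = Re (cin X (adj A * A * X))" by (subst cin_mult_left) (simp add: mult.assoc)
    also have "\<dots> \<le> norm X * norm (adj A * A * X)"
      using complex_Re_le_cmod[of "cin X (adj A * A * X)"] cin_bound[of X "adj A * A * X"] by linarith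
    also have "\<dots> \<le> norm X * (opn (adj A * A) * norm X)" by (intro mult_left_mono opn_mult_left) simp
    also have "\<dots> = (sqrt (opn (adj A * A)) * norm X)\<^sup>2"
      by (simp add: power_mult_distrib) (simp add: power2_eq_square mult_ac)
    finally show ?thesis by (rule power2_le_imp_le) simp
  qed
  hence "opn A \<le> sqrt (opn (adj A * A))" by (rule opn_le) simp
  hence "(opn A)\<^sup>2 \<le> (sqrt (opn (adj A * A)))\<^sup>2" by (intro power_mono) auto
  thus ?thesis by simp
qed

text \<open>More unknowns than equations.\<close>

lemma homogeneous_system:
  fixes x :: "'i \<Rightarrow> 'j \<Rightarrow> complex"
  assumes "finite J" "finite I" "card J < card I"
  shows "\<exists>c. (\<exists>i\<in>I. c i \<noteq> 0) \<and> (\<forall>j\<in>J. (\<Sum>i\<in>I. c i * x i j) = 0)"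
  using assms
proof (induction J arbitrary: I x rule: finite_induct)
  case empty
  then obtain i where "i \<in> I" by fastforce
  thus ?case by (intro exI[of _ "\<lambda>_. 1"]) auto
next
  case (insert j J)
  show ?case
  proof (cases "\<forall>i\<in>I. x i j = 0")
    case True
    obtain c where "\<exists>i\<in>I. c i \<noteq> 0" "\<forall>j\<in>J. (\<Sum>i\<in>I. c i * x i j) = 0"
      using insert.IH[of I x] insert.prems insert.hyps by auto
    thus ?thesis using True by (intro exI[of _ c]) (auto intro!: sum.neutral)
  next
    case False
    then obtain p where p: "p \<in> I" "x p j \<noteq> 0" by blast
    define y where "y i k = x i k - x i j / x p j * x p k" for i k
    have "card J < card (I - {p})" using insert.prems insert.hyps p by (simp add: card_Diff_singleton)
    then obtain c where c: "\<exists>i\<in>I - {p}. c i \<noteq> 0" "\<forall>k\<in>J. (\<Sum>i\<in>I - {p}. c i * y i k) = 0"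
      using insert.IH[of "I - {p}" y] insert.prems by auto
    define d where "d i = (if i = p then - (\<Sum>i\<in>I - {p}. c i * (x i j / x p j)) else c i)" for i
    have s: "(\<Sum>i\<in>I. d i * x i k) = (\<Sum>i\<in>I - {p}. c i * y i k)" for k
    proof -
      have "(\<Sum>i\<in>I. d i * x i k) = d p * x p k + (\<Sum>i\<in>I - {p}. d i * x i k)"
        using insert.prems p by (simp add: sum.remove)
      also have "(\<Sum>i\<in>I - {p}. d i * x i k) = (\<Sum>i\<in>I - {p}. c i * x i k)"
        by (rule sum.cong) (auto simp: d_def)
      also have "d p * x p k = - (\<Sum>i\<in>I - {p}. c i * (x i j / x p j * x p k))"
        by (simp add: d_def sum_distrib_right mult.assoc)
      finally show ?thesis by (simp add: y_def right_diff_distrib sum_subtractf)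
    qed
    have "y i j = 0" for i using p by (simp add: y_def)
    hence "(\<Sum>i\<in>I. d i * x i j) = 0" using s[of j] by simp
    moreover have "\<exists>i\<in>I. d i \<noteq> 0" using c(1) by (auto simp: d_def)
    ultimately show ?thesis using c(2) s by (intro exI[of _ d]) auto
  qed
qed

abbreviation adjs :: "(nat \<Rightarrow> fmat) \<Rightarrow> nat \<Rightarrow> fmat" where "adjs X \<equiv> (\<lambda>n. adj (X n))"

text \<open>All identities between matrices hold modulo sequences whose operator norms tend to 0 along the
  ultrafilter \<open>U\<close>.\<close>

definition null :: "nat filter \<Rightarrow> (nat \<Rightarrow> fmat) \<Rightarrow> bool"
  where "null U X \<longleftrightarrow> ((\<lambda>n. opn (X n)) \<longlongrightarrow> 0) U"

definition opb :: "nat filter \<Rightarrow> (nat \<Rightarrow> fmat) \<Rightarrow> bool"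
  where "opb U X \<longleftrightarrow> (\<exists>C. eventually (\<lambda>n. opn (X n) \<le> C) U)"

lemma opbE:
  assumes "opb U X" obtains C where "C > 0" "eventually (\<lambda>n. opn (X n) \<le> C) U"
proof -
  obtain C where "eventually (\<lambda>n. opn (X n) \<le> C) U" using assms by (auto simp: opb_def)
  hence "eventually (\<lambda>n. opn (X n) \<le> max C 1) U" by eventually_elim simp
  thus ?thesis by (intro that[of "max C 1"]) auto
qed

lemma opb_add: "opb U X \<Longrightarrow> opb U Y \<Longrightarrow> opb U (X + Y)"
proof -
  assume "opb U X" "opb U Y"
  then obtain C D where "eventually (\<lambda>n. opn (X n) \<le> C) U" "eventually (\<lambda>n. opn (Y n) \<le> D) U"
    by (auto simp: opb_def)
  hence "eventually (\<lambda>n. opn ((X + Y) n) \<le> C + D) U"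
  proof eventually_elim
    case (elim n)
    thus ?case using opn_add[of "X n" "Y n"] by simp
  qed
  thus ?thesis by (auto simp: opb_def)
qed

lemma opb_mult: "opb U X \<Longrightarrow> opb U Y \<Longrightarrow> opb U (X * Y)"
proof -
  assume "opb U X" "opb U Y"
  then obtain C D where C: "C > 0" "eventually (\<lambda>n. opn (X n) \<le> C) U" and D: "D > 0" "eventually (\<lambda>n. opn (Y n) \<le> D) U"
    by (metis opbE)
  from C(2) D(2) have "eventually (\<lambda>n. opn ((X * Y) n) \<le> C * D) U"
  proof eventually_elim
    case (elim n)
    have "opn (X n * Y n) \<le> opn (X n) * opn (Y n)" by (rule opn_mult)
    also have "\<dots> \<le> C * D" using elim C D by (intro mult_mono) auto
    finally show ?case by simp
  qed
  thus ?thesis by (auto simp: opb_def)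
qed

lemma opb_minus: "opb U (- X) \<longleftrightarrow> opb U X"
  by (simp add: opb_def)

lemma opb_diff: "opb U X \<Longrightarrow> opb U Y \<Longrightarrow> opb U (X - Y)"
  using opb_add[of U X "- Y"] by (simp add: opb_minus)

lemma opb_adj: "opb U (adjs X) \<longleftrightarrow> opb U X"
  by (simp add: opb_def)

lemma opb_scaleC: "opb U X \<Longrightarrow> opb U (\<lambda>n. scaleC c (X n))"
proof -
  assume "opb U X"
  then obtain C where "C > 0" "eventually (\<lambda>n. opn (X n) \<le> C) U" by (rule opbE)
  from this(2) have "eventually (\<lambda>n. opn (scaleC c (X n)) \<le> cmod c * C) U"
  proof eventually_elim
    case (elim n)
    thus ?case using opn_scaleC_le[of c "X n"] mult_left_mono[OF elim, of "cmod c"] by simp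
  qed
  thus ?thesis by (auto simp: opb_def)
qed

lemma null_opb: "null U X \<Longrightarrow> opb U X"
proof -
  assume "null U X"
  hence "eventually (\<lambda>n. opn (X n) < 1) U" unfolding null_def by (rule order_tendstoD) simp
  hence "eventually (\<lambda>n. opn (X n) \<le> 1) U" by eventually_elim simp
  thus ?thesis by (auto simp: opb_def)
qed

lemma null_zero: "null U 0" by (simp add: null_def)

lemma null_squeeze: "eventually (\<lambda>n. opn (X n) \<le> f n) U \<Longrightarrow> (f \<longlongrightarrow> 0) U \<Longrightarrow> null U X"
  unfolding null_def by (rule tendsto_sandwich[OF _ _ tendsto_const]) auto

lemma null_add: "null U X \<Longrightarrow> null U Y \<Longrightarrow> null U (X + Y)"
proof -
  assume "null U X" "null U Y"
  hence "((\<lambda>n. opn (X n) + opn (Y n)) \<longlongrightarrow> 0 + 0) U" unfolding null_def by (rule tendsto_add)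
  thus ?thesis by (intro null_squeeze[of _ "\<lambda>n. opn (X n) + opn (Y n)"]) (auto simp: opn_add)
qed

lemma null_minus: "null U (- X) \<longleftrightarrow> null U X"
  by (simp add: null_def)

lemma null_diff: "null U X \<Longrightarrow> null U Y \<Longrightarrow> null U (X - Y)"
  using null_add[of U X "- Y"] by (simp add: null_minus)

lemma null_adj: "null U (adjs X) \<longleftrightarrow> null U X"
  by (simp add: null_def)

lemma null_mult_left: "opb U X \<Longrightarrow> null U Y \<Longrightarrow> null U (X * Y)"
proof -
  assume X: "opb U X" and Y: "null U Y"
  obtain C where C: "C > 0" "eventually (\<lambda>n. opn (X n) \<le> C) U" using X by (rule opbE)
  show ?thesis
  proof (rule null_squeeze)
    show "((\<lambda>n. C * opn (Y n)) \<longlongrightarrow> 0) U" using tendsto_mult_left[OF Y[unfolded null_def], of C] by simp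
    show "eventually (\<lambda>n. opn ((X * Y) n) \<le> C * opn (Y n)) U"
      using C(2)
    proof eventually_elim
      case (elim n)
      have "opn (X n * Y n) \<le> opn (X n) * opn (Y n)" by (rule opn_mult)
      also have "\<dots> \<le> C * opn (Y n)" using elim by (intro mult_right_mono) auto
      finally show ?case by simp
    qed
  qed
qed

lemma null_mult_right: "null U X \<Longrightarrow> opb U Y \<Longrightarrow> null U (X * Y)"
proof -
  assume "null U X" "opb U Y"
  hence "null U (adjs Y * adjs X)" by (intro null_mult_left) (simp_all add: opb_adj null_adj)
  hence "null U (adjs (adjs Y * adjs X))" by (simp only: null_adj)
  thus ?thesis by (simp add: times_fun_def)
qed

lemma null_scaleC: "null U X \<Longrightarrow> null U (\<lambda>n. scaleC c (X n))"
proof -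
  assume "null U X"
  hence "((\<lambda>n. cmod c * opn (X n)) \<longlongrightarrow> cmod c * 0) U" unfolding null_def by (intro tendsto_mult tendsto_const)
  thus ?thesis by (intro null_squeeze[of _ "\<lambda>n. cmod c * opn (X n)"]) (auto simp: opn_scaleC_le)
qed

lemma null_trans: "null U (X - Y) \<Longrightarrow> null U (Y - Z) \<Longrightarrow> null U (X - Z)"
  using null_add[of U "X - Y" "Y - Z"] by simp

lemma null_sym: "null U (X - Y) \<Longrightarrow> null U (Y - X)"
  using null_minus[of U "X - Y"] by simp

lemma null_mult_cong:
  assumes "null U (X - X')" "null U (Y - Y')" "opb U X'" "opb U Y"
  shows "null U (X * Y - X' * Y')"
proof -
  have "X * Y - X' * Y' = (X - X') * Y + X' * (Y - Y')" by (simp add: algebra_simps)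
  thus ?thesis using assms by (simp only: null_add null_mult_left null_mult_right)
qed

text \<open>The matrices \<open>u w\<close> behave like a unitary representation up to null sequences. The projection \<open>I n\<close> is the
  unit of the \<open>n\<close>-th matrix algebra, realized as a corner.\<close>

locale asymptotic_rep = group W
  for W :: "('w, 'm) monoid_scheme" (structure) +
  fixes u :: "'w \<Rightarrow> nat \<Rightarrow> fmat" and I :: "nat \<Rightarrow> fmat" and U :: "nat filter"
  assumes ultra: "ultrafilter U" and free: "U \<le> sequentially"
    and I_adj: "adj (I n) = I n" and I_idem: "I n * I n = I n"
    and I_u: "w \<in> carrier W \<Longrightarrow> I n * u w n = u w n" and u_I: "w \<in> carrier W \<Longrightarrow> u w n * I n = u w n"
    and u_opb: "w \<in> carrier W \<Longrightarrow> opb U (u w)"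
    and u_mult: "v \<in> carrier W \<Longrightarrow> w \<in> carrier W \<Longrightarrow> null U (u (v \<otimes> w) - u v * u w)"
    and u_adj: "w \<in> carrier W \<Longrightarrow> null U (adjs (u w) - u (inv w))"
    and u_one: "null U (u \<one> - I)"
begin

text \<open>The sequences on which the ultraproduct is a bimodule: bounded in operator norm and supported in the corners.\<close>

definition cb :: "(nat \<Rightarrow> fmat) \<Rightarrow> bool"
  where "cb A \<longleftrightarrow> opb U A \<and> (\<forall>n. I n * A n = A n \<and> A n * I n = A n)"

text \<open>Compression to the corner makes the quotient by the vectors of norm zero finite dimensional.\<close>

definition form :: "nat \<Rightarrow> fmat \<Rightarrow> fmat \<Rightarrow> complex"
  where "form n X Y = cin (I n * X * I n) (I n * Y * I n)"

lemma semi_inner_form: "semi_inner scaleC UNIV (form n)"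
  by unfold_locales
    (simp_all add: form_def scaleC_simps distrib_left distrib_right cin_add_left scaleC_mult_left scaleC_mult_right
      cin_scaleC_left cin_norm cin_commute[of "I n * x * I n" "I n * y * I n" for x y, symmetric])

end

context asymptotic_rep
begin

sublocale P: ultraproduct scaleC form U
  by (rule ultraproduct.intro[OF semi_inner_form ultra free])

lemma nr_form: "P.nr n X = norm (I n * X * I n)"
proof -
  interpret S: semi_inner scaleC UNIV "form n" by (rule semi_inner_form)
  show ?thesis by (simp add: S.nrm_def form_def cin_norm)
qed

lemma opn_I: "opn (I n) \<le> 1"
proof -
  have "(opn (I n))\<^sup>2 \<le> opn (I n)" using opn_sq_le[of "I n"] by (simp add: I_adj I_idem)
  hence "opn (I n) * opn (I n) \<le> 1 * opn (I n)" by (simp add: power2_eq_square)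
  thus ?thesis using opn_nonneg[of "I n"] by (cases "opn (I n) = 0") (auto simp: mult_le_cancel_right)
qed

lemma norm_corner: "norm (I n * X * I n) \<le> norm X"
proof -
  have "norm (I n * X * I n) \<le> opn (I n) * norm (I n * X)" by (rule opn_mult_right)
  also have "\<dots> \<le> 1 * (opn (I n) * norm X)" by (intro mult_mono opn_I opn_mult_left) auto
  also have "\<dots> \<le> 1 * (1 * norm X)" by (intro mult_mono opn_I) auto
  finally show ?thesis by simp
qed

lemma bddI: "eventually (\<lambda>n. norm (X n) \<le> C) U \<Longrightarrow> X \<in> P.bdd"
  unfolding P.bdd_def nr_form mem_Collect_eq
  by (intro exI[of _ C], erule eventually_mono) (rule order_trans[OF norm_corner])

lemma cb_opb: "cb A \<Longrightarrow> opb U A" and cb_left: "cb A \<Longrightarrow> I n * A n = A n" and cb_right: "cb A \<Longrightarrow> A n * I n = A n"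
  by (simp_all add: cb_def)

lemma cb_I: "cb I"
  using opn_I by (auto simp: cb_def opb_def I_idem intro!: exI[of _ 1])

lemma cb_u: "w \<in> carrier W \<Longrightarrow> cb (u w)"
  by (simp add: cb_def I_u u_I u_opb)

lemma cb_mult: "cb A \<Longrightarrow> cb B \<Longrightarrow> cb (A * B)"
  by (simp add: cb_def opb_mult mult.assoc[symmetric]) (simp add: mult.assoc)

lemma cb_add: "cb A \<Longrightarrow> cb B \<Longrightarrow> cb (A + B)"
  by (simp add: cb_def opb_add distrib_left distrib_right)

lemma cb_diff: "cb A \<Longrightarrow> cb B \<Longrightarrow> cb (A - B)"
  by (simp add: cb_def opb_diff right_diff_distrib left_diff_distrib)

lemma cb_adj: "cb A \<Longrightarrow> cb (adjs A)"
  unfolding cb_def by (metis I_adj adj_mult opb_adj)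

lemma cb_scaleC: "cb A \<Longrightarrow> cb (\<lambda>n. scaleC c (A n))"
  by (simp add: cb_def opb_scaleC scaleC_mult_left scaleC_mult_right)

lemma nr_mult_left: "cb A \<Longrightarrow> P.nr n (A n * X) \<le> opn (A n) * P.nr n X"
proof -
  assume A: "cb A"
  have "I n * (A n * X) * I n = A n * (I n * X * I n)"
    using cb_left[OF A, of n] cb_right[OF A, of n] by (simp add: mult.assoc[symmetric])
  thus ?thesis unfolding nr_form by (simp add: opn_mult_left)
qed

lemma nr_mult_right: "cb A \<Longrightarrow> P.nr n (X * A n) \<le> opn (A n) * P.nr n X"
proof -
  assume A: "cb A"
  have "I n * (X * A n) * I n = (I n * X * I n) * A n"
    using cb_left[OF A, of n] cb_right[OF A, of n] by (simp add: mult.assoc)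
  thus ?thesis unfolding nr_form by (simp add: opn_mult_right)
qed

lemma bdd_bound: assumes "X \<in> P.bdd" obtains C where "C > 0" "eventually (\<lambda>n. P.nr n (X n) \<le> C) U"
proof -
  obtain C where "eventually (\<lambda>n. P.nr n (X n) \<le> C) U" using assms by (auto simp: P.bdd_def)
  hence "eventually (\<lambda>n. P.nr n (X n) \<le> max C 1) U" by eventually_elim simp
  thus ?thesis by (intro that[of "max C 1"]) auto
qed

lemma bdd_mult_left: "cb A \<Longrightarrow> X \<in> P.bdd \<Longrightarrow> A * X \<in> P.bdd"
proof -
  assume A: "cb A" and X: "X \<in> P.bdd"
  obtain C where C: "C > 0" "eventually (\<lambda>n. opn (A n) \<le> C) U" using cb_opb[OF A] by (rule opbE)
  obtain D where D: "D > 0" "eventually (\<lambda>n. P.nr n (X n) \<le> D) U" using X by (rule bdd_bound)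
  from C(2) D(2) have "eventually (\<lambda>n. P.nr n ((A * X) n) \<le> C * D) U"
  proof eventually_elim
    case (elim n)
    have "opn (A n) * P.nr n (X n) \<le> C * D" using elim C D by (intro mult_mono) auto
    thus ?case using nr_mult_left[OF A, of n "X n"] by simp
  qed
  thus ?thesis by (auto simp: P.bdd_def)
qed

lemma bdd_mult_right: "cb A \<Longrightarrow> X \<in> P.bdd \<Longrightarrow> X * A \<in> P.bdd"
proof -
  assume A: "cb A" and X: "X \<in> P.bdd"
  obtain C where C: "C > 0" "eventually (\<lambda>n. opn (A n) \<le> C) U" using cb_opb[OF A] by (rule opbE)
  obtain D where D: "D > 0" "eventually (\<lambda>n. P.nr n (X n) \<le> D) U" using X by (rule bdd_bound)
  from C(2) D(2) have "eventually (\<lambda>n. P.nr n ((X * A) n) \<le> C * D) U"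
  proof eventually_elim
    case (elim n)
    have "opn (A n) * P.nr n (X n) \<le> C * D" using elim C D by (intro mult_mono) auto
    thus ?case using nr_mult_right[OF A, of n "X n"] by simp
  qed
  thus ?thesis by (auto simp: P.bdd_def)
qed

lemma null_bdd_left: "cb A \<Longrightarrow> null U A \<Longrightarrow> X \<in> P.bdd \<Longrightarrow> P.UP.nrm (A * X) = 0"
proof -
  assume A: "cb A" "null U A" and X: "X \<in> P.bdd"
  have "((\<lambda>n. opn (A n) * P.nr n (X n)) \<longlongrightarrow> 0 * P.UP.nrm X) U"
    by (rule tendsto_mult[OF A(2)[unfolded null_def] P.tendsto_nrm[OF X]])
  hence l: "((\<lambda>n. opn (A n) * P.nr n (X n)) \<longlongrightarrow> 0) U" by simp
  have "((\<lambda>n. P.nr n ((A * X) n)) \<longlongrightarrow> 0) U"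
    by (rule tendsto_sandwich[OF _ _ tendsto_const l]) (use nr_mult_left[OF A(1)] in auto)
  thus ?thesis using P.null_bdd by blast
qed

lemma null_bdd_right: "cb A \<Longrightarrow> null U A \<Longrightarrow> X \<in> P.bdd \<Longrightarrow> P.UP.nrm (X * A) = 0"
proof -
  assume A: "cb A" "null U A" and X: "X \<in> P.bdd"
  have "((\<lambda>n. opn (A n) * P.nr n (X n)) \<longlongrightarrow> 0 * P.UP.nrm X) U"
    by (rule tendsto_mult[OF A(2)[unfolded null_def] P.tendsto_nrm[OF X]])
  hence l: "((\<lambda>n. opn (A n) * P.nr n (X n)) \<longlongrightarrow> 0) U" by simp
  have "((\<lambda>n. P.nr n ((X * A) n)) \<longlongrightarrow> 0) U"
    by (rule tendsto_sandwich[OF _ _ tendsto_const l]) (use nr_mult_right[OF A(1)] in auto)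
  thus ?thesis using P.null_bdd by blast
qed

lemma compress: "P.UP.nrm (I * X * I - X) = 0"
proof -
  have "P.nr n ((I * X * I - X) n) = 0" for n
  proof -
    have "I n * (I n * X n * I n - X n) * I n = 0"
      by (simp add: left_diff_distrib right_diff_distrib mult.assoc I_idem) (simp add: mult.assoc[symmetric] I_idem)
    thus ?thesis by (simp add: nr_form)
  qed
  thus ?thesis using P.null_bdd[of "I * X * I - X"] by simp
qed

lemma ip_mult_left: "cb A \<Longrightarrow> P.ip (A * X) Y = P.ip X (adjs A * Y)"
proof -
  assume A: "cb A"
  have "form n (A n * X n) (Y n) = form n (X n) (adj (A n) * Y n)" for n
  proof -
    have 1: "I n * (A n * X n) * I n = A n * (I n * X n * I n)"
      using cb_left[OF A, of n] cb_right[OF A, of n] by (simp add: mult.assoc[symmetric])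
    have 2: "I n * (adj (A n) * Y n) * I n = adj (A n) * (I n * Y n * I n)"
      using cb_left[OF cb_adj[OF A], of n] cb_right[OF cb_adj[OF A], of n] by (simp add: mult.assoc[symmetric])
    show ?thesis unfolding form_def 1 2 by (rule cin_mult_left)
  qed
  thus ?thesis by (simp add: P.ip_def)
qed

lemma ip_mult_right: "cb A \<Longrightarrow> P.ip (X * A) Y = P.ip X (Y * adjs A)"
proof -
  assume A: "cb A"
  have "form n (X n * A n) (Y n) = form n (X n) (Y n * adj (A n))" for n
  proof -
    have 1: "I n * (X n * A n) * I n = (I n * X n * I n) * A n"
      using cb_left[OF A, of n] cb_right[OF A, of n] by (simp add: mult.assoc)
    have 2: "I n * (Y n * adj (A n)) * I n = (I n * Y n * I n) * adj (A n)"
      using cb_left[OF cb_adj[OF A], of n] cb_right[OF cb_adj[OF A], of n] by (simp add: mult.assoc)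
    show ?thesis unfolding form_def 1 2 by (rule cin_mult_right)
  qed
  thus ?thesis by (simp add: P.ip_def)
qed

lemma bdd_mult: "cb A \<Longrightarrow> cb B \<Longrightarrow> X \<in> P.bdd \<Longrightarrow> A * X * B \<in> P.bdd"
  by (rule bdd_mult_right[OF _ bdd_mult_left])

lemma mult_cong_bdd:
  assumes "cb A" "cb A'" "cb B" "cb B'" "null U (A - A')" "null U (B - B')" and X: "X \<in> P.bdd"
  shows "P.UP.nrm (A * X * B - A' * X * B') = 0"
proof -
  have eq: "A * X * B - A' * X * B' = (A - A') * (X * B) + (A' * X) * (B - B')" by (simp add: algebra_simps)
  have b: "X * B \<in> P.bdd" "A' * X \<in> P.bdd" using assms by (auto intro: bdd_mult_left bdd_mult_right)
  have c: "cb (A - A')" "cb (B - B')" using assms by (auto intro: cb_diff)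
  have "P.UP.nrm ((A - A') * (X * B) + (A' * X) * (B - B'))
      \<le> P.UP.nrm ((A - A') * (X * B)) + P.UP.nrm ((A' * X) * (B - B'))"
    by (rule P.UP.nrm_triangle) (use b c in \<open>auto intro: bdd_mult_left bdd_mult_right\<close>)
  hence "P.UP.nrm ((A - A') * (X * B) + (A' * X) * (B - B')) \<le> 0"
    using null_bdd_left[OF c(1) assms(5) b(1)] null_bdd_right[OF c(2) assms(6) b(2)] by simp
  moreover have "(A - A') * (X * B) + (A' * X) * (B - B') \<in> P.bdd"
    using b c by (auto intro!: P.bdd_add intro: bdd_mult_left bdd_mult_right)
  ultimately show ?thesis unfolding eq by (simp add: antisym)
qed

lemma conj_cong_bdd:
  assumes "cb A" "cb A'" "null U (A - A')" and X: "X \<in> P.bdd"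
  shows "P.UP.nrm (A * X * adjs A - A' * X * adjs A') = 0"
proof -
  have "adjs A - adjs A' = adjs (A - A')" by (simp add: fun_eq_iff)
  hence "null U (adjs A - adjs A')" using assms(3) null_adj[of U "A - A'"] by simp
  thus ?thesis by (intro mult_cong_bdd cb_adj assms)
qed

lemma u_unitary: assumes w: "w \<in> carrier W" shows "null U (adjs (u w) * u w - I)"
proof -
  have iw: "inv w \<in> carrier W" using w by simp
  have "null U (u w - u w)" using null_zero by simp
  hence 1: "null U (adjs (u w) * u w - u (inv w) * u w)"
    by (rule null_mult_cong[OF u_adj[OF w] _ u_opb[OF iw] u_opb[OF w]])
  have 2: "null U (u (inv w) * u w - u \<one>)" using null_sym[OF u_mult[OF iw w]] w by simp
  show ?thesis by (rule null_trans[OF null_trans[OF 1 2] u_one])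
qed

definition ad :: "'w \<Rightarrow> nat \<Rightarrow> fmat \<Rightarrow> fmat" where "ad w n X = u w n * X * adj (u w n)"

lemma ad_seq: "(\<lambda>n. ad w n (X n)) = u w * X * adjs (u w)"
  by (simp add: ad_def times_fun_def)

sublocale R: ultra_rep scaleC form U W ad
proof
  fix w n X Y and c :: complex assume w: "w \<in> carrier W"
  show "ad w n (X + Y) = ad w n X + ad w n Y" by (simp add: ad_def distrib_left distrib_right)
  show "ad w n (scaleC c X) = scaleC c (ad w n X)" by (simp add: ad_def scaleC_mult_left scaleC_mult_right)
next
  fix w X assume w: "w \<in> carrier W" and X: "X \<in> P.bdd"
  show "(\<lambda>n. ad w n (X n)) \<in> P.bdd"
    unfolding ad_seq using w X by (intro bdd_mult_left bdd_mult_right cb_u cb_adj)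
next
  fix w X Y assume w: "w \<in> carrier W" and XY: "X \<in> P.bdd" "Y \<in> P.bdd"
  define V where "V = adjs (u w) * u w"
  have V: "cb V" "null U (V - I)" unfolding V_def using w by (auto intro: cb_mult cb_adj cb_u u_unitary)
  have "P.ip (\<lambda>n. ad w n (X n)) (\<lambda>n. ad w n (Y n)) = P.ip (u w * (X * adjs (u w))) (u w * Y * adjs (u w))"
    by (simp add: ad_seq mult.assoc)
  also have "\<dots> = P.ip X (adjs (u w) * (u w * Y * adjs (u w)) * adjs (adjs (u w)))"
    using w by (simp only: ip_mult_left ip_mult_right cb_u cb_adj)
  also have "adjs (u w) * (u w * Y * adjs (u w)) * adjs (adjs (u w)) = V * Y * V"
    by (simp add: V_def mult.assoc)
  also have "P.ip X (V * Y * V) = P.ip X Y"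
  proof (rule P.UP.b_cong0_right)
    have "P.UP.nrm (V * Y * V - Y) \<le> P.UP.nrm (V * Y * V - I * Y * I) + P.UP.nrm (I * Y * I - Y)"
      by (intro P.UP.nrm_diff_triangle bdd_mult V cb_I XY)
    hence "P.UP.nrm (V * Y * V - Y) \<le> 0"
      using mult_cong_bdd[OF V(1) cb_I V(1) cb_I V(2) V(2) XY(2)] compress[of Y] by simp
    moreover have "0 \<le> P.UP.nrm (V * Y * V - Y)"
      by (intro P.UP.nrm_nonneg P.UP.diff_in bdd_mult V XY)
    ultimately show "P.UP.nrm (V * Y * V - Y) = 0" by simp
  qed (intro bdd_mult V XY)+
  finally show "P.ip (\<lambda>n. ad w n (X n)) (\<lambda>n. ad w n (Y n)) = P.ip X Y" .
next
  fix v w X assume vw: "v \<in> carrier W" "w \<in> carrier W" and X: "X \<in> P.bdd"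
  have "P.UP.nrm (u (v \<otimes> w) * X * adjs (u (v \<otimes> w)) - (u v * u w) * X * adjs (u v * u w)) = 0"
    by (intro conj_cong_bdd cb_mult cb_u u_mult X) (use vw in auto)
  moreover have "(\<lambda>n. ad v n (ad w n (X n))) = (u v * u w) * X * adjs (u v * u w)"
    by (simp add: ad_def times_fun_def mult.assoc)
  ultimately show "P.UP.nrm ((\<lambda>n. ad (v \<otimes> w) n (X n)) - (\<lambda>n. ad v n (ad w n (X n)))) = 0"
    by (simp add: ad_seq)
next
  fix X assume X: "X \<in> P.bdd"
  have b: "u \<one> * X * adjs (u \<one>) \<in> P.bdd" "I * X * I \<in> P.bdd"
    by (intro bdd_mult cb_u cb_adj cb_I X one_closed)+
  have "P.UP.nrm (u \<one> * X * adjs (u \<one>) - I * X * adjs I) = 0"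
    by (intro conj_cong_bdd cb_u cb_I u_one X one_closed)
  moreover have "adjs I = I" by (simp add: fun_eq_iff I_adj)
  ultimately have "P.UP.nrm (u \<one> * X * adjs (u \<one>) - I * X * I) = 0" by simp
  hence "P.UP.nrm (u \<one> * X * adjs (u \<one>) - X) \<le> 0"
    using P.UP.nrm_diff_triangle[OF b X] compress[of X] by simp
  thus "P.UP.nrm ((\<lambda>n. ad \<one> n (X n)) - X) = 0"
    unfolding ad_seq using P.UP.nrm_nonneg[OF P.UP.diff_in[OF b(1) X]] by simp
qed

lemma supp_le_corner:
  assumes M: "supp_le M (I n)" shows "supp_le M (I n * Y * I n)"
proof -
  have "ent (I n * Y * I n) a b = 0" if "M \<le> a \<or> M \<le> b" for a b
  proof (cases "M \<le> a")
    case True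
    have "ent (I n * (Y * I n)) a b = 0" using ent_times[OF M] supp_leD[OF M] True by simp
    thus ?thesis by (simp add: mult.assoc)
  next
    case False
    thus ?thesis using ent_times'[OF M] supp_leD[OF M] that by simp
  qed
  thus ?thesis by (simp add: supp_le_def)
qed

text \<open>The vectors of the \<open>n\<close>-th space are determined, up to norm zero, by the entries of a matrix of fixed size.\<close>

lemma form_degenerate: "\<exists>D. \<forall>r>D. \<forall>x. \<exists>c. (\<exists>i<r. c i \<noteq> (0::complex)) \<and> P.nr n (\<Sum>i<(r::nat). scaleC (c i) (x i)) = 0"
proof -
  obtain M where M: "supp_le M (I n)" using ex_supp_le by blast
  show ?thesis
  proof (intro exI[of _ "M * M"] allI impI)
    fix r and x :: "nat \<Rightarrow> fmat" assume r: "M * M < r"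
    have "card ({..<M} \<times> {..<M}) < card {..<r}" using r by (simp add: card_cartesian_product)
    then obtain c where c: "\<exists>i\<in>{..<r}. c i \<noteq> 0"
      "\<forall>j\<in>{..<M} \<times> {..<M}. (\<Sum>i<r. c i * (case j of (a, b) \<Rightarrow> ent (I n * x i * I n) a b)) = 0"
      using homogeneous_system[of "{..<M} \<times> {..<M}" "{..<r}" "\<lambda>i j. case j of (a, b) \<Rightarrow> ent (I n * x i * I n) a b"] by auto
    note sl = supp_le_corner[OF M]
    define Z where "Z = I n * (\<Sum>i<r. scaleC (c i) (x i)) * I n"
    have Z: "Z = (\<Sum>i<r. scaleC (c i) (I n * x i * I n))"
      by (simp add: Z_def sum_distrib_left sum_distrib_right scaleC_mult_left scaleC_mult_right)
    have es: "ent (sum f A) a b = (\<Sum>i\<in>A. ent (f i) a b)" for f :: "nat \<Rightarrow> fmat" and A a b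
      by (induction A rule: infinite_finite_induct) auto
    have "ent Z a b = 0" for a b
    proof (cases "a < M \<and> b < M")
      case True
      thus ?thesis using c(2) by (auto simp: Z es)
    next
      case False
      thus ?thesis unfolding Z_def by (intro supp_leD[OF sl]) auto
    qed
    hence "Z = 0" by (intro fmat_eqI) simp
    hence "P.nr n (\<Sum>i<r. scaleC (c i) (x i)) = 0" by (simp add: nr_form Z_def)
    thus "\<exists>c. (\<exists>i<r. c i \<noteq> 0) \<and> P.nr n (\<Sum>i<r. scaleC (c i) (x i)) = 0" using c(1) by auto
  qed
qed

text \<open>Distances in the ultraproduct are limits of distances in Euclidean spaces, for which the Gaussian kernel
  is positive definite.\<close>

lemma psd_exp_dist:
  assumes s: "0 < s" and \<beta>: "\<And>x. x \<in> C \<Longrightarrow> \<beta> x \<in> P.bdd"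
  shows "psd C (\<lambda>x y. exp (- s * (P.UP.nrm (\<beta> x - \<beta> y))\<^sup>2))"
proof (rule psd_limit[OF P.U_nonbot])
  fix n
  obtain M where M: "supp_le M (I n)" using ex_supp_le by blast
  note sl = supp_le_corner[OF M]
  define z where "z x = (\<lambda>(a, b). ent (I n * \<beta> x n * I n) a b)" for x
  have "(P.nr n (\<beta> x n - \<beta> y n))\<^sup>2 = (\<Sum>i\<in>{..<M} \<times> {..<M}. (cmod (z x i - z y i))\<^sup>2)" for x y
  proof -
    have "I n * (\<beta> x n - \<beta> y n) * I n = I n * \<beta> x n * I n - I n * \<beta> y n * I n"
      by (simp add: left_diff_distrib right_diff_distrib)
    hence "(P.nr n (\<beta> x n - \<beta> y n))\<^sup>2 = (\<Sum>a<M. \<Sum>b<M. (cmod (z x (a, b) - z y (a, b)))\<^sup>2)"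
      unfolding nr_form norm_sq_entries[OF sl] by (simp add: z_def)
    also have "\<dots> = (\<Sum>i\<in>{..<M} \<times> {..<M}. (cmod (z x i - z y i))\<^sup>2)"
      unfolding sum.cartesian_product by (rule sum.cong) auto
    finally show ?thesis .
  qed
  thus "psd C (\<lambda>x y. exp (- s * (P.nr n ((\<beta> x - \<beta> y) n))\<^sup>2))"
    using psd_gaussian[of s C z "{..<M} \<times> {..<M}"] s by simp
next
  fix x y assume "x \<in> C" "y \<in> C"
  thus "((\<lambda>n. exp (- s * (P.nr n ((\<beta> x - \<beta> y) n))\<^sup>2)) \<longlongrightarrow> exp (- s * (P.UP.nrm (\<beta> x - \<beta> y))\<^sup>2)) U"
    using \<beta> by (intro tendsto_exp tendsto_mult tendsto_const tendsto_power P.tendsto_nrm P.UP.diff_in)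
qed

end

section \<open>Commutation forced by property (T)\<close>

text \<open>The group \<open>\<Gamma>\<close>, with Kazhdan pair \<open>(K, \<epsilon>)\<close>, is mapped to \<open>W\<close> by \<open>j\<close>, and conjugation by \<open>t\<close> realizes its
  endomorphism \<open>\<theta>\<close>. The involution \<open>a\<close> commutes with its conjugates by \<open>\<Gamma>\<close> and is fixed by \<open>\<theta>(\<Gamma>)\<close>.\<close>

locale kazhdan_conjugation = asymptotic_rep W u I U + \<Gamma>: group \<Gamma>
  for W :: "('w, 'm) monoid_scheme" (structure) and u I U and \<Gamma> :: "('g, 'n) monoid_scheme" +
  fixes j :: "'g \<Rightarrow> 'w" and \<theta> :: "'g \<Rightarrow> 'g" and t a :: 'w and K :: "'g set" and \<epsilon> :: real
  assumes j: "j \<in> hom \<Gamma> W" and \<theta>: "\<theta> \<in> hom \<Gamma> \<Gamma>"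
    and t: "t \<in> carrier W" and tj: "g \<in> carrier \<Gamma> \<Longrightarrow> t \<otimes> j g \<otimes> inv t = j (\<theta> g)"
    and K: "finite K" "K \<subseteq> carrier \<Gamma>" and \<epsilon>: "0 < \<epsilon>" "\<epsilon> \<le> 1"
    and kp: "kazhdan_pair TYPE((nat \<Rightarrow> fmat) \<Rightarrow> complex) \<Gamma> K \<epsilon>"
    and kp': "kazhdan_pair TYPE((nat \<Rightarrow> 'g \<Rightarrow>\<^sub>0 complex) \<Rightarrow> complex) \<Gamma> K \<epsilon>"
    and a: "a \<in> carrier W" and aa: "a \<otimes> a = \<one>"
    and comm: "g \<in> carrier \<Gamma> \<Longrightarrow> a \<otimes> (j g \<otimes> a \<otimes> inv (j g)) = (j g \<otimes> a \<otimes> inv (j g)) \<otimes> a"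
    and fix_a: "g \<in> carrier \<Gamma> \<Longrightarrow> j (\<theta> g) \<otimes> a \<otimes> inv (j (\<theta> g)) = a"
begin

definition c :: "'g \<Rightarrow> 'w" where "c g = j g \<otimes> a \<otimes> inv (j g)"

definition \<rho> :: "'g \<Rightarrow> nat \<Rightarrow> fmat" where "\<rho> g = u a - u (c g)"

text \<open>The commuting involutions \<open>a\<close> and \<open>c g\<close> have the same eigenvalues exactly where their product is 1, so
  \<open>(1 - a c\<^sub>g) / 2\<close> is the projection to the subspace where they differ.\<close>

definition x :: "'g \<Rightarrow> nat \<Rightarrow> fmat" where "x g = (\<lambda>n. scaleC (1/2) (I n - u (a \<otimes> c g) n))"

lemma j_in [simp]: "g \<in> carrier \<Gamma> \<Longrightarrow> j g \<in> carrier W" using j by (auto simp: hom_def)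
lemma \<theta>_in [simp]: "g \<in> carrier \<Gamma> \<Longrightarrow> \<theta> g \<in> carrier \<Gamma>" using \<theta> by (auto simp: hom_def)
lemma j_mult: "g \<in> carrier \<Gamma> \<Longrightarrow> h \<in> carrier \<Gamma> \<Longrightarrow> j (g \<otimes>\<^bsub>\<Gamma>\<^esub> h) = j g \<otimes> j h" using j by (auto simp: hom_def)
lemma \<theta>_mult: "g \<in> carrier \<Gamma> \<Longrightarrow> h \<in> carrier \<Gamma> \<Longrightarrow> \<theta> (g \<otimes>\<^bsub>\<Gamma>\<^esub> h) = \<theta> g \<otimes>\<^bsub>\<Gamma>\<^esub> \<theta> h" using \<theta> by (auto simp: hom_def)
lemma j_one: "j \<one>\<^bsub>\<Gamma>\<^esub> = \<one>"
  using j_mult[of "\<one>\<^bsub>\<Gamma>\<^esub>" "\<one>\<^bsub>\<Gamma>\<^esub>"] by simp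

lemma c_in [simp]: "g \<in> carrier \<Gamma> \<Longrightarrow> c g \<in> carrier W" using a by (simp add: c_def)
lemma c_one: "c \<one>\<^bsub>\<Gamma>\<^esub> = a" using a by (simp add: c_def j_one)
lemma c_\<theta>: "g \<in> carrier \<Gamma> \<Longrightarrow> c (\<theta> g) = a" using fix_a by (simp add: c_def)
lemma c_comm: "g \<in> carrier \<Gamma> \<Longrightarrow> c g \<otimes> a = a \<otimes> c g" using comm by (simp add: c_def)

lemma c_mult: "g \<in> carrier \<Gamma> \<Longrightarrow> h \<in> carrier \<Gamma> \<Longrightarrow> c (g \<otimes>\<^bsub>\<Gamma>\<^esub> h) = j g \<otimes> c h \<otimes> inv (j g)"
  using a by (simp add: c_def j_mult inv_mult_group m_assoc)

lemma cc: "g \<in> carrier \<Gamma> \<Longrightarrow> c g \<otimes> c g = \<one>"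
proof -
  assume g: "g \<in> carrier \<Gamma>"
  have 1: "inv (j g) \<otimes> (j g \<otimes> (a \<otimes> inv (j g))) = a \<otimes> inv (j g)"
    using a g by (simp add: m_assoc[symmetric])
  have "c g \<otimes> c g = j g \<otimes> (a \<otimes> (inv (j g) \<otimes> (j g \<otimes> (a \<otimes> inv (j g)))))"
    using a g by (simp add: c_def m_assoc)
  also have "\<dots> = j g \<otimes> ((a \<otimes> a) \<otimes> inv (j g))" unfolding 1 using a g by (simp add: m_assoc)
  finally show ?thesis using g by (simp add: aa)
qed

lemma zz: "g \<in> carrier \<Gamma> \<Longrightarrow> (a \<otimes> c g) \<otimes> (a \<otimes> c g) = \<one>"
proof -
  assume g: "g \<in> carrier \<Gamma>"
  have "(a \<otimes> c g) \<otimes> (a \<otimes> c g) = a \<otimes> ((c g \<otimes> a) \<otimes> c g)" using a g by (simp add: m_assoc)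
  also have "\<dots> = (a \<otimes> a) \<otimes> (c g \<otimes> c g)" using a g by (simp add: c_comm m_assoc)
  finally show ?thesis using g by (simp add: aa cc)
qed

lemma z_c: "g \<in> carrier \<Gamma> \<Longrightarrow> (a \<otimes> c g) \<otimes> a = c g" "g \<in> carrier \<Gamma> \<Longrightarrow> (a \<otimes> c g) \<otimes> c g = a"
  "g \<in> carrier \<Gamma> \<Longrightarrow> a \<otimes> (a \<otimes> c g) = c g" "g \<in> carrier \<Gamma> \<Longrightarrow> c g \<otimes> (a \<otimes> c g) = a"
proof -
  assume g: "g \<in> carrier \<Gamma>"
  show 1: "a \<otimes> (a \<otimes> c g) = c g" using a g m_assoc[of a a "c g"] by (simp add: aa)
  show 2: "(a \<otimes> c g) \<otimes> c g = a" using a g by (simp add: m_assoc cc)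
  show "(a \<otimes> c g) \<otimes> a = c g" using a g 1 by (simp add: m_assoc c_comm)
  show "c g \<otimes> (a \<otimes> c g) = a" using a g 2 by (simp add: m_assoc[symmetric] c_comm)
qed

lemma cb_\<rho>: "g \<in> carrier \<Gamma> \<Longrightarrow> cb (\<rho> g)" unfolding \<rho>_def using a by (intro cb_diff cb_u) auto

lemma cb_x: "g \<in> carrier \<Gamma> \<Longrightarrow> cb (x g)"
proof -
  assume "g \<in> carrier \<Gamma>"
  hence "cb (I - u (a \<otimes> c g))" using a by (intro cb_diff cb_u cb_I) auto
  from cb_scaleC[OF this, of "1/2"] show ?thesis by (simp add: x_def)
qed

lemma u_prod: "v \<in> carrier W \<Longrightarrow> w \<in> carrier W \<Longrightarrow> null U (u v * u w - u (v \<otimes> w))"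
  by (rule null_sym) (rule u_mult)

lemma x_idempotent: assumes g: "g \<in> carrier \<Gamma>" shows "null U (x g * x g - x g)"
proof -
  define v where "v = u (a \<otimes> c g)"
  have z: "a \<otimes> c g \<in> carrier W" using a g by simp
  have "x g * x g - x g = (\<lambda>n. scaleC (1/4) ((v * v - I) n))"
  proof
    fix n
    define y where "y = I n - v n"
    have "(x g * x g - x g) n = scaleC (1/2) y * scaleC (1/2) y - scaleC (1/2) y" by (simp add: x_def v_def y_def)
    also have "scaleC (1/2) y * scaleC (1/2) y - scaleC (1/2) y = scaleC (1/4) (y * y - (y + y))"
      by (intro fmat_eqI) (simp add: scaleC_mult_left scaleC_mult_right algebra_simps)
    also have "y * y - (y + y) = v n * v n - I n"
      using I_u[OF z, of n] u_I[OF z, of n] by (simp add: y_def v_def algebra_simps I_idem)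
    finally show "(x g * x g - x g) n = scaleC (1/4) ((v * v - I) n)" by simp
  qed
  moreover have "null U (v * v - I)"
    using null_trans[OF u_prod[OF z z] _] u_one by (simp add: v_def zz[OF g])
  ultimately show ?thesis using null_scaleC[of U "v * v - I" "1/4"] by simp
qed

lemma opn_u_eventually: assumes w: "w \<in> carrier W" shows "eventually (\<lambda>n. opn (u w n) \<le> 2) U"
proof -
  have "eventually (\<lambda>n. opn ((adjs (u w) * u w - I) n) < 1) U"
    using u_unitary[OF w] unfolding null_def by (rule order_tendstoD) simp
  thus ?thesis
  proof eventually_elim
    case (elim n)
    have "(opn (u w n))\<^sup>2 \<le> opn (adj (u w n) * u w n)" by (rule opn_sq_le)
    also have "\<dots> \<le> opn (adj (u w n) * u w n - I n) + opn (I n)"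
      using opn_add[of "adj (u w n) * u w n - I n" "I n"] by simp
    also have "\<dots> \<le> 2\<^sup>2" using elim opn_I[of n] by simp
    finally show ?case by (rule power2_le_imp_le) simp
  qed
qed

text \<open>The idempotent of the quotient is lifted to matrices whose defect is small in the Hilbert--Schmidt norm,
  not only in the operator norm. The bound by \<open>1 / (n + 1)\<close> is arbitrary; any null sequence would do.\<close>

lemma ex_good_lift:
  assumes g: "g \<in> carrier \<Gamma>"
  shows "\<exists>e. cb e \<and> null U (e - x g) \<and> eventually (\<lambda>n. norm (e n * e n - e n) \<le> 1 / (real n + 1)) U"
proof -
  have z: "a \<otimes> c g \<in> carrier W" using a g by simp
  define P where "P n \<longleftrightarrow> opn (x g n * x g n - x g n) \<le> 1/32 \<and> opn (x g n) \<le> 2" for n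
  have "eventually (\<lambda>n. opn ((x g * x g - x g) n) < 1/32) U"
    using x_idempotent[OF g] unfolding null_def by (rule order_tendstoD) simp
  hence evP: "eventually P U" using opn_u_eventually[OF z]
  proof eventually_elim
    case (elim n)
    have "opn (x g n) \<le> cmod (1/2) * opn (I n - u (a \<otimes> c g) n)" unfolding x_def by (rule opn_scaleC_le)
    also have "opn (I n - u (a \<otimes> c g) n) \<le> 1 + 2" using opn_diff[of "I n" "u (a \<otimes> c g) n"] opn_I[of n] elim by linarith
    finally show ?case using elim by (simp add: P_def)
  qed
  have "\<exists>y. (P n \<longrightarrow> norm (y * y - y) \<le> 1 / (real n + 1) \<and> opn (y - x g n) \<le> 10 * opn (x g n * x g n - x g n))
      \<and> I n * y = y \<and> y * I n = y \<and> (\<not> P n \<longrightarrow> y = x g n)" for n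
  proof (cases "P n")
    case True
    obtain y where "norm (y * y - y) \<le> 1 / (real n + 1)" "opn (y - x g n) \<le> 10 * opn (x g n * x g n - x g n)"
      "\<forall>p. p * x g n = x g n \<longrightarrow> p * y = y" "\<forall>p. x g n * p = x g n \<longrightarrow> y * p = y"
      using polish_idempotent[of "x g n" "1 / (real n + 1)"] True by (auto simp: P_def)
    thus ?thesis using True cb_left[OF cb_x[OF g], of n] cb_right[OF cb_x[OF g], of n] by (intro exI[of _ y]) simp
  next
    case False
    thus ?thesis using cb_left[OF cb_x[OF g], of n] cb_right[OF cb_x[OF g], of n] by (intro exI[of _ "x g n"]) simp
  qed
  then obtain e where e: "\<And>n. P n \<Longrightarrow> norm (e n * e n - e n) \<le> 1 / (real n + 1)"
    "\<And>n. P n \<Longrightarrow> opn (e n - x g n) \<le> 10 * opn (x g n * x g n - x g n)" "\<And>n. I n * e n = e n" "\<And>n. e n * I n = e n"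
    by metis
  have "((\<lambda>n. 10 * opn ((x g * x g - x g) n)) \<longlongrightarrow> 10 * 0) U"
    using x_idempotent[OF g] unfolding null_def by (intro tendsto_mult tendsto_const)
  hence nl: "null U (e - x g)"
    by (intro null_squeeze[of _ "\<lambda>n. 10 * opn ((x g * x g - x g) n)"]) (use evP in \<open>auto elim!: eventually_mono dest: e(2)\<close>)
  moreover have "cb e"
    using opb_add[OF null_opb[OF nl] cb_opb[OF cb_x[OF g]]] e(3,4) by (simp add: cb_def)
  moreover have "eventually (\<lambda>n. norm (e n * e n - e n) \<le> 1 / (real n + 1)) U" using evP by eventually_elim (rule e(1))
  ultimately show ?thesis by blast
qed

definition e :: "'g \<Rightarrow> nat \<Rightarrow> fmat"
  where "e g = (SOME e. cb e \<and> null U (e - x g) \<and> eventually (\<lambda>n. norm (e n * e n - e n) \<le> 1 / (real n + 1)) U)"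

lemma e: assumes g: "g \<in> carrier \<Gamma>"
  shows "cb (e g)" "null U (e g - x g)" "eventually (\<lambda>n. norm (e g n * e g n - e g n) \<le> 1 / (real n + 1)) U"
  using someI_ex[OF ex_good_lift[OF g]] unfolding e_def by blast+

lemma null_half: assumes "null U (X + X)" shows "null U X"
proof -
  have "(\<lambda>n. scaleC (1/2) ((X + X) n)) = X"
    by (rule ext, rule fmat_eqI) simp
  thus ?thesis using null_scaleC[OF assms, of "1/2"] by simp
qed

lemma x_double: "x g + x g = I - u (a \<otimes> c g)"
  by (rule ext, rule fmat_eqI) (simp add: x_def)

lemma I_mult: "cb A \<Longrightarrow> I * A = A" "cb A \<Longrightarrow> A * I = A"
  by (simp_all add: cb_def fun_eq_iff)

text \<open>The difference of \<open>a\<close> and \<open>c g\<close> lives where they differ, and there its square is 4.\<close>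

lemma x_\<rho>: assumes g: "g \<in> carrier \<Gamma>"
  shows "null U (x g * \<rho> g - \<rho> g)" "null U (\<rho> g * x g - \<rho> g)"
    "null U (\<rho> g * \<rho> g - (x g + x g + (x g + x g)))"
proof -
  define v where "v = u (a \<otimes> c g)"
  have z: "a \<otimes> c g \<in> carrier W" and cg: "c g \<in> carrier W" using a g by simp_all
  have n: "null U (v * u a - u (c g))" "null U (v * u (c g) - u a)" "null U (u a * v - u (c g))" "null U (u (c g) * v - u a)"
    using u_prod[OF z a] u_prod[OF z cg] u_prod[OF a z] u_prod[OF cg z] z_c[OF g] by (simp_all add: v_def)
  have "x g * \<rho> g - \<rho> g + (x g * \<rho> g - \<rho> g) = (x g + x g) * \<rho> g - (\<rho> g + \<rho> g)" by (simp add: algebra_simps)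
  also have "\<dots> = (v * u (c g) - u a) - (v * u a - u (c g))"
    unfolding x_double using I_mult(1)[OF cb_\<rho>[OF g]] by (simp add: v_def[symmetric] left_diff_distrib) (simp add: \<rho>_def algebra_simps)
  finally have "null U (x g * \<rho> g - \<rho> g + (x g * \<rho> g - \<rho> g))" using null_diff n by simp
  thus "null U (x g * \<rho> g - \<rho> g)" by (rule null_half)
  have "\<rho> g * x g - \<rho> g + (\<rho> g * x g - \<rho> g) = \<rho> g * (x g + x g) - (\<rho> g + \<rho> g)" by (simp add: algebra_simps)
  also have "\<dots> = (u (c g) * v - u a) - (u a * v - u (c g))"
    unfolding x_double using I_mult(2)[OF cb_\<rho>[OF g]] by (simp add: v_def[symmetric] right_diff_distrib) (simp add: \<rho>_def algebra_simps)
  finally have "null U (\<rho> g * x g - \<rho> g + (\<rho> g * x g - \<rho> g))" using null_diff n by simp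
  thus "null U (\<rho> g * x g - \<rho> g)" by (rule null_half)
  have p: "null U (u a * u a - u \<one>)" "null U (u (c g) * u (c g) - u \<one>)" "null U (u a * u (c g) - v)" "null U (u (c g) * u a - v)"
    using u_prod[OF a a] u_prod[OF cg cg] u_prod[OF a cg] u_prod[OF cg a] aa cc[OF g] c_comm[OF g] by (simp_all add: v_def)
  have "\<rho> g * \<rho> g - (x g + x g + (x g + x g)) = ((u a * u a - u \<one>) + (u (c g) * u (c g) - u \<one>)) + ((u \<one> - I) + (u \<one> - I))
      - ((u a * u (c g) - v) + (u (c g) * u a - v))"
    unfolding x_double v_def[symmetric] by (simp add: \<rho>_def algebra_simps)
  thus "null U (\<rho> g * \<rho> g - (x g + x g + (x g + x g)))"
    by (simp only: null_add null_diff p u_one)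
qed

text \<open>Compressing \<open>\<rho> g\<close> to \<open>e g\<close> changes it by a null sequence only, but it makes its Hilbert--Schmidt norm comparable
  to that of \<open>e g\<close>, and it exhibits it as a product of two such sequences.\<close>

definition r :: "'g \<Rightarrow> nat \<Rightarrow> fmat" where "r g = e g * \<rho> g * e g"

lemma cb_r: "g \<in> carrier \<Gamma> \<Longrightarrow> cb (r g)"
  unfolding r_def by (intro cb_mult e cb_\<rho>)

lemma r_\<rho>: assumes g: "g \<in> carrier \<Gamma>" shows "null U (r g - \<rho> g)"
proof -
  have "null U (e g * \<rho> g - x g * \<rho> g)"
    using null_mult_right[OF e(2)[OF g] cb_opb[OF cb_\<rho>[OF g]]] by (simp add: left_diff_distrib)
  hence 1: "null U (e g * \<rho> g - \<rho> g)" using x_\<rho>(1)[OF g] null_trans by blast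
  have 2: "null U (\<rho> g * e g - \<rho> g * x g)"
    using null_mult_left[OF cb_opb[OF cb_\<rho>[OF g]] e(2)[OF g]] by (simp add: right_diff_distrib)
  have "null U (e g * \<rho> g * e g - \<rho> g * e g)"
    using null_mult_right[OF 1 cb_opb[OF e(1)[OF g]]] by (simp add: left_diff_distrib)
  from null_trans[OF null_trans[OF this 2] x_\<rho>(2)[OF g]] show ?thesis by (simp add: r_def)
qed

text \<open>Since \<open>\<rho> g\<close> has square \<open>4 e g\<close>, it is inverted on \<open>e g\<close> by a quarter of itself.\<close>

definition F :: "'g \<Rightarrow> nat \<Rightarrow> fmat" where "F g = (\<lambda>n. scaleC (1/4) (\<rho> g n))"

lemma cb_F: "g \<in> carrier \<Gamma> \<Longrightarrow> cb (F g)"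
  unfolding F_def by (intro cb_scaleC cb_\<rho>)

lemma e_F: assumes g: "g \<in> carrier \<Gamma>" and Y: "null U (\<rho> g - Y)" shows "null U (e g - F g * Y)"
proof -
  have "null U (F g * \<rho> g - F g * Y)"
    using null_mult_left[OF cb_opb[OF cb_F[OF g]] Y] by (simp add: right_diff_distrib)
  moreover have "null U (x g - F g * \<rho> g)"
  proof -
    have "(\<lambda>n. scaleC (-1/4) ((\<rho> g * \<rho> g - (x g + x g + (x g + x g))) n)) = x g - F g * \<rho> g"
      by (rule ext, rule fmat_eqI) (simp add: F_def scaleC_mult_left algebra_simps)
    thus ?thesis using null_scaleC[OF x_\<rho>(3)[OF g], of "-1/4"] by simp
  qed
  ultimately show ?thesis using e(2)[OF g] null_trans by blast
qed

lemma u_conj: assumes v: "v \<in> carrier W" and w: "w \<in> carrier W"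
  shows "null U (u v * u w * adjs (u v) - u (v \<otimes> w \<otimes> inv v))"
proof -
  have 1: "null U (u v * u w * adjs (u v) - u (v \<otimes> w) * u (inv v))"
    by (rule null_mult_cong[OF u_prod[OF v w] u_adj[OF v]]) (use v w in \<open>simp_all add: u_opb opb_adj\<close>)
  show ?thesis by (rule null_trans[OF 1 u_prod]) (use v w in auto)
qed

definition cj :: "'g \<Rightarrow> (nat \<Rightarrow> fmat) \<Rightarrow> nat \<Rightarrow> fmat" where "cj g X = u (j g) * X * adjs (u (j g))"

lemma cj_diff: "cj g (X - Y) = cj g X - cj g Y"
  by (simp add: cj_def algebra_simps)

lemma cb_cj: "g \<in> carrier \<Gamma> \<Longrightarrow> cb X \<Longrightarrow> cb (cj g X)"
  unfolding cj_def by (intro cb_mult cb_u cb_adj) auto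

lemma null_cj: "g \<in> carrier \<Gamma> \<Longrightarrow> null U X \<Longrightarrow> null U (cj g X)"
  unfolding cj_def by (intro null_mult_right null_mult_left) (auto simp: u_opb opb_adj)

lemma \<rho>_cocycle: assumes g: "g \<in> carrier \<Gamma>" and h: "h \<in> carrier \<Gamma>"
  shows "null U (\<rho> (g \<otimes>\<^bsub>\<Gamma>\<^esub> h) - (\<rho> g + cj g (\<rho> h)))"
proof -
  have 1: "null U (cj g (u a) - u (c g))"
    unfolding cj_def c_def using u_conj[OF j_in[OF g] a] .
  have 2: "null U (cj g (u (c h)) - u (c (g \<otimes>\<^bsub>\<Gamma>\<^esub> h)))"
    unfolding cj_def c_mult[OF g h] by (rule u_conj) (use g h in auto)
  have "\<rho> (g \<otimes>\<^bsub>\<Gamma>\<^esub> h) - (\<rho> g + cj g (\<rho> h)) = (cj g (u (c h)) - u (c (g \<otimes>\<^bsub>\<Gamma>\<^esub> h))) - (cj g (u a) - u (c g))"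
    by (simp add: \<rho>_def cj_diff)
  thus ?thesis using null_diff[OF 2 1] by simp
qed

lemma r_cocycle: assumes g: "g \<in> carrier \<Gamma>" and h: "h \<in> carrier \<Gamma>"
  shows "null U (\<rho> (g \<otimes>\<^bsub>\<Gamma>\<^esub> h) - (r g + cj g (r h)))"
proof -
  have "null U (cj g (r h - \<rho> h))" by (rule null_cj[OF g r_\<rho>[OF h]])
  hence "null U ((r g - \<rho> g) + (cj g (r h) - cj g (\<rho> h)))" using r_\<rho>[OF g] by (simp add: cj_diff null_add)
  moreover have "\<rho> (g \<otimes>\<^bsub>\<Gamma>\<^esub> h) - (r g + cj g (r h)) = (\<rho> (g \<otimes>\<^bsub>\<Gamma>\<^esub> h) - (\<rho> g + cj g (\<rho> h))) - ((r g - \<rho> g) + (cj g (r h) - cj g (\<rho> h)))"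
    by simp
  ultimately show ?thesis using null_diff[OF \<rho>_cocycle[OF g h]] by metis
qed

lemma generates: "generate \<Gamma> K = carrier \<Gamma>"
  by (rule \<Gamma>.kazhdan_generates[OF K kp' \<epsilon>])

text \<open>Lengths are measured relative to the ranks of the projections \<open>e k\<close> for \<open>k\<close> in the Kazhdan set.\<close>

definition s :: "nat \<Rightarrow> real" where "s n = sqrt (\<Sum>k\<in>K. (norm (e k n))\<^sup>2)"

definition \<sigma> :: "(nat \<Rightarrow> fmat) \<Rightarrow> nat \<Rightarrow> fmat" where "\<sigma> X = (\<lambda>n. scaleC (of_real (1 / s n)) (X n))"

text \<open>The sequences of finite length when \<open>s\<close> is the unit of length.\<close>

definition dom :: "(nat \<Rightarrow> fmat) \<Rightarrow> bool"
  where "dom X \<longleftrightarrow> (\<exists>C. eventually (\<lambda>n. norm (X n) \<le> C * s n) U)"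

lemma s_nonneg [simp]: "0 \<le> s n" by (simp add: s_def sum_nonneg)

lemma domE: assumes "dom X" obtains C where "C > 0" "eventually (\<lambda>n. norm (X n) \<le> C * s n) U"
proof -
  obtain C where "eventually (\<lambda>n. norm (X n) \<le> C * s n) U" using assms by (auto simp: dom_def)
  hence "eventually (\<lambda>n. norm (X n) \<le> max C 1 * s n) U"
  proof eventually_elim
    case (elim n)
    have "C * s n \<le> max C 1 * s n" by (intro mult_right_mono) auto
    thus ?case using elim by linarith
  qed
  thus ?thesis by (intro that[of "max C 1"]) auto
qed

lemma dom_zero: "dom 0" by (auto simp: dom_def intro!: exI[of _ 0])

lemma dom_e: "k \<in> K \<Longrightarrow> dom (e k)"
proof -
  assume k: "k \<in> K"
  have "norm (e k n) \<le> s n" for n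
  proof -
    have "(norm (e k n))\<^sup>2 \<le> (\<Sum>k\<in>K. (norm (e k n))\<^sup>2)" by (rule member_le_sum) (use k K in auto)
    thus ?thesis unfolding s_def by (rule real_le_rsqrt)
  qed
  thus ?thesis by (auto simp: dom_def intro!: exI[of _ 1])
qed

lemma dom_add: "dom X \<Longrightarrow> dom Y \<Longrightarrow> dom (X + Y)"
proof -
  assume "dom X" "dom Y"
  then obtain C D where "eventually (\<lambda>n. norm (X n) \<le> C * s n) U" "eventually (\<lambda>n. norm (Y n) \<le> D * s n) U"
    by (auto simp: dom_def)
  hence "eventually (\<lambda>n. norm ((X + Y) n) \<le> (C + D) * s n) U"
  proof eventually_elim
    case (elim n)
    thus ?case using norm_triangle_ineq[of "X n" "Y n"] by (simp add: distrib_right)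
  qed
  thus ?thesis by (auto simp: dom_def)
qed

lemma dom_minus: "dom X \<Longrightarrow> dom (- X)" by (simp add: dom_def)

lemma dom_adj: "dom X \<Longrightarrow> dom (adjs X)" by (simp add: dom_def)

lemma dom_mult_left: assumes A: "opb U A" and X: "dom X" shows "dom (A * X)"
proof -
  obtain C where C: "C > 0" "eventually (\<lambda>n. opn (A n) \<le> C) U" using A by (rule opbE)
  obtain D where D: "D > 0" "eventually (\<lambda>n. norm (X n) \<le> D * s n) U" using X by (rule domE)
  from C(2) D(2) have "eventually (\<lambda>n. norm ((A * X) n) \<le> C * D * s n) U"
  proof eventually_elim
    case (elim n)
    have "norm (A n * X n) \<le> opn (A n) * norm (X n)" by (rule opn_mult_left)
    also have "\<dots> \<le> C * (D * s n)" using elim C by (intro mult_mono) auto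
    finally show ?case by (simp add: mult.assoc)
  qed
  thus ?thesis by (auto simp: dom_def)
qed

lemma dom_mult_right: assumes A: "opb U A" and X: "dom X" shows "dom (X * A)"
proof -
  have "dom (adjs (adjs A * adjs X))" by (intro dom_adj dom_mult_left) (use assms in \<open>simp_all add: opb_adj dom_adj\<close>)
  thus ?thesis by (simp add: times_fun_def)
qed

lemma dom_cj: "g \<in> carrier \<Gamma> \<Longrightarrow> dom X \<Longrightarrow> dom (cj g X)"
  unfolding cj_def by (intro dom_mult_right dom_mult_left) (auto simp: u_opb opb_adj)

lemma e_null_if: assumes g: "g \<in> carrier \<Gamma>" shows "null U (\<rho> g) \<longleftrightarrow> null U (e g)"
proof
  assume "null U (\<rho> g)"
  hence "null U (e g - F g * 0)" by (intro e_F[OF g]) simp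
  thus "null U (e g)" by simp
next
  assume "null U (e g)"
  hence "null U (r g)" unfolding r_def using g e(1)[OF g] cb_\<rho>[OF g] by (intro null_mult_left) (auto intro: opb_mult cb_opb)
  thus "null U (\<rho> g)" using null_diff[OF _ r_\<rho>[OF g], of "r g"] by simp
qed

text \<open>By the cocycle identity, the elements at which \<open>\<rho>\<close> is null form a subgroup.\<close>

lemma null_generated:
  assumes n: "\<And>k. k \<in> K \<Longrightarrow> null U (\<rho> k)" and g: "g \<in> carrier \<Gamma>"
  shows "null U (\<rho> g)"
proof -
  have "g \<in> carrier \<Gamma> \<and> null U (\<rho> g)" if "g \<in> generate \<Gamma> K" for g
    using that
  proof (induction rule: generate.induct)
    case one
    have "\<rho> \<one>\<^bsub>\<Gamma>\<^esub> = 0" unfolding \<rho>_def c_one by simp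
    thus ?case by (simp only: null_zero \<Gamma>.one_closed simp_thms)
  next
    case (incl k)
    thus ?case using n K by blast
  next
    case (inv k)
    hence k: "k \<in> carrier \<Gamma>" "null U (\<rho> k)" using n K by auto
    have "null U (\<rho> (inv\<^bsub>\<Gamma>\<^esub> k \<otimes>\<^bsub>\<Gamma>\<^esub> k) - (\<rho> (inv\<^bsub>\<Gamma>\<^esub> k) + cj (inv\<^bsub>\<Gamma>\<^esub> k) (\<rho> k)))"
      by (rule \<rho>_cocycle) (use k in auto)
    hence "null U (- (\<rho> (inv\<^bsub>\<Gamma>\<^esub> k)) - cj (inv\<^bsub>\<Gamma>\<^esub> k) (\<rho> k))" using k by (simp add: \<rho>_def[of "\<one>\<^bsub>\<Gamma>\<^esub>"] c_one)
    from null_add[OF this null_cj[of "inv\<^bsub>\<Gamma>\<^esub> k", OF _ k(2)]] k show ?case by (simp add: null_minus)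
  next
    case (eng g h)
    hence "null U (\<rho> g + cj g (\<rho> h))" by (intro null_add null_cj) auto
    from null_add[OF \<rho>_cocycle[of g h] this] eng show ?case by simp
  qed
  thus ?thesis using g generates by blast
qed

text \<open>If \<open>e\<close> differs from \<open>A Y\<close> by a small operator, then \<open>e \<approx> e\<^sup>2\<close> differs from \<open>e A Y\<close> by at most half the length of
  \<open>e\<close>, which can be absorbed. This controls the rank of \<open>e g\<close> for products \<open>g\<close> of elements of \<open>K\<close>.\<close>

lemma dom_step:
  assumes g: "g \<in> carrier \<Gamma>" and s: "c0 > 0" "eventually (\<lambda>n. c0 \<le> s n) U"
    and Y: "null U (e g - A * Y)" "opb U A" "dom Y"
  shows "dom (e g)"
proof -
  have eA: "opb U (e g * A)" by (rule opb_mult[OF cb_opb[OF e(1)[OF g]] Y(2)])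
  obtain C where C: "C > 0" "eventually (\<lambda>n. norm ((e g * A * Y) n) \<le> C * s n) U"
    using dom_mult_left[OF eA Y(3)] by (rule domE)
  have "eventually (\<lambda>n. opn ((e g - A * Y) n) < 1/2) U"
    using Y(1) unfolding null_def by (rule order_tendstoD) simp
  with C(2) s(2) e(3)[OF g] have "eventually (\<lambda>n. norm (e g n) \<le> (2 / c0 + 2 * C) * s n) U"
  proof eventually_elim
    case (elim n)
    let ?e = "e g n" and ?z = "(e g - A * Y) n"
    have "?e = (?e * ?z + e g n * A n * Y n) - (?e * ?e - ?e)" by (simp add: algebra_simps)
    hence "norm ?e \<le> norm (?e * ?z + e g n * A n * Y n) + norm (?e * ?e - ?e)" by (metis norm_triangle_ineq4)
    also have "norm (?e * ?z + e g n * A n * Y n) \<le> norm (?e * ?z) + norm (e g n * A n * Y n)" by (rule norm_triangle_ineq)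
    also have "norm (?e * ?z) \<le> opn ?z * norm ?e" by (rule opn_mult_right)
    also have "opn ?z * norm ?e \<le> 1/2 * norm ?e" using elim by (intro mult_right_mono) auto
    finally have "norm ?e \<le> 1/2 * norm ?e + C * s n + 1 / (real n + 1)" using elim by simp
    moreover have "1 / (real n + 1) \<le> 1" by simp
    moreover have "1 \<le> s n / c0" using elim s(1) by simp
    ultimately have "norm ?e \<le> 2 * (s n / c0) + 2 * (C * s n)" by linarith
    thus ?case by (simp add: algebra_simps)
  qed
  thus ?thesis by (auto simp: dom_def)
qed

lemma dom_r: "g \<in> carrier \<Gamma> \<Longrightarrow> dom (e g) \<Longrightarrow> dom (r g)"
  unfolding r_def using e(1) cb_\<rho> by (intro dom_mult_left opb_mult cb_opb)

lemma dom_all: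
  assumes s: "c0 > 0" "eventually (\<lambda>n. c0 \<le> s n) U" and g: "g \<in> carrier \<Gamma>"
  shows "dom (e g)"
proof -
  have "g \<in> carrier \<Gamma> \<and> dom (e g)" if "g \<in> generate \<Gamma> K" for g
    using that
  proof (induction rule: generate.induct)
    case one
    have "null U (\<rho> \<one>\<^bsub>\<Gamma>\<^esub>)" by (simp add: \<rho>_def c_one null_zero)
    hence "null U (e \<one>\<^bsub>\<Gamma>\<^esub> - 0 * 0)" by (simp add: e_null_if)
    thus ?case using dom_step[OF _ s _ _ dom_zero, of "\<one>\<^bsub>\<Gamma>\<^esub>" 0] null_opb[OF null_zero] by simp
  next
    case (incl k)
    thus ?case using dom_e K by blast
  next
    case (inv k)
    hence k: "k \<in> carrier \<Gamma>" "dom (r k)" using dom_e K dom_r by auto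
    let ?i = "inv\<^bsub>\<Gamma>\<^esub> k"
    have i: "?i \<in> carrier \<Gamma>" using k by simp
    have "null U (\<rho> (?i \<otimes>\<^bsub>\<Gamma>\<^esub> k) - (r ?i + cj ?i (r k)))" by (rule r_cocycle[OF i k(1)])
    hence "null U (- r ?i - cj ?i (r k))" using k by (simp add: \<rho>_def[of "\<one>\<^bsub>\<Gamma>\<^esub>"] c_one)
    from null_diff[OF this r_\<rho>[OF i]] null_minus[of U "- r ?i - cj ?i (r k)"]
    have "null U (r ?i - - cj ?i (r k))"
      using null_minus[of U "- r ?i - cj ?i (r k)"] \<open>null U (- r ?i - cj ?i (r k))\<close> by (simp add: add.commute)
    from null_trans[OF null_sym[OF r_\<rho>[OF i]] this]
    have "null U (e ?i - F ?i * (- cj ?i (r k)))" by (rule e_F[OF i])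
    thus ?case using dom_step[OF i s _ cb_opb[OF cb_F[OF i]] dom_minus[OF dom_cj[OF i k(2)]]] i by blast
  next
    case (eng g h)
    hence gh: "g \<in> carrier \<Gamma>" "h \<in> carrier \<Gamma>" "dom (r g + cj g (r h))" by (auto intro!: dom_add dom_cj dom_r)
    have m: "g \<otimes>\<^bsub>\<Gamma>\<^esub> h \<in> carrier \<Gamma>" using gh by simp
    show ?case using dom_step[OF m s e_F[OF m r_cocycle[OF gh(1,2)]] cb_opb[OF cb_F[OF m]] gh(3)] m by blast
  qed
  thus ?thesis using g generates by blast
qed

lemma \<sigma>_bdd: assumes "dom X" shows "\<sigma> X \<in> P.bdd"
proof -
  obtain C where C: "C > 0" "eventually (\<lambda>n. norm (X n) \<le> C * s n) U" using assms by (rule domE)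
  from C(2) have "eventually (\<lambda>n. norm (\<sigma> X n) \<le> C) U"
  proof eventually_elim
    case (elim n)
    show ?case
    proof (cases "s n = 0")
      case False
      hence "0 < s n" using s_nonneg[of n] by linarith
      thus ?thesis using elim by (simp add: \<sigma>_def norm_divide field_simps)
    qed (use C in \<open>simp add: \<sigma>_def\<close>)
  qed
  thus ?thesis by (rule bddI)
qed

lemma \<sigma>_diff: "\<sigma> (X - Y) = \<sigma> X - \<sigma> Y" and \<sigma>_add: "\<sigma> (X + Y) = \<sigma> X + \<sigma> Y"
  and \<sigma>_mult_left: "\<sigma> (X * Y) = X * \<sigma> Y" and \<sigma>_mult_right: "\<sigma> (X * Y) = \<sigma> X * Y"
  by (auto simp: \<sigma>_def fun_eq_iff scaleC_simps scaleC_mult_left scaleC_mult_right)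

text \<open>Moving \<open>B\<close> to the other side of the inner product bounds it by the operator norm of \<open>Z\<close> times the lengths of
  \<open>A\<close> and \<open>B\<close>. A single vector in place of \<open>A B\<close> would not do: operators of small norm can have any length.\<close>

lemma ip_null:
  assumes Z: "cb Z" "null U Z" and A: "cb A" "dom A" and B: "cb B" "dom B"
  shows "P.ip (\<sigma> Z) (\<sigma> (A * B)) = 0"
proof -
  obtain C where C: "C > 0" "eventually (\<lambda>n. norm (A n) \<le> C * s n) U" using A(2) by (rule domE)
  obtain D where D: "D > 0" "eventually (\<lambda>n. norm (B n) \<le> D * s n) U" using B(2) by (rule domE)
  have cor: "I n * Y n * I n = Y n" if "cb Y" for Y n using cb_left[OF that] cb_right[OF that] by simp
  have eq: "form n (\<sigma> Z n) (\<sigma> (A * B) n) = of_real ((1 / s n)\<^sup>2) * cin (Z n * adj (B n)) (A n)" for n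
  proof -
    have "form n (\<sigma> Z n) (\<sigma> (A * B) n) = of_real (1 / s n) * cnj (of_real (1 / s n)) * cin (Z n) (A n * B n)"
      unfolding form_def \<sigma>_def scaleC_mult_left scaleC_mult_right cor[OF Z(1)] cor[OF cb_mult[OF A(1) B(1)]]
      by (simp add: cin_scaleC_left cin_scaleC_right)
    also have "cin (Z n) (A n * B n) = cin (Z n * adj (B n)) (A n)"
      by (simp add: cin_mult_right)
    also have "of_real (1 / s n) * cnj (of_real (1 / s n)) = complex_of_real ((1 / s n)\<^sup>2)" by (simp add: power2_eq_square)
    finally show ?thesis .
  qed
  have "((\<lambda>n. of_real ((1 / s n)\<^sup>2) * cin (Z n * adj (B n)) (A n)) \<longlongrightarrow> 0) U"
  proof (rule tendsto_norm_zero_cancel, rule tendsto_sandwich[OF _ _ tendsto_const])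
    have "((\<lambda>n. opn (Z n) * (C * D)) \<longlongrightarrow> 0 * (C * D)) U"
      using Z(2) unfolding null_def by (intro tendsto_mult tendsto_const)
    thus "((\<lambda>n. opn (Z n) * (C * D)) \<longlongrightarrow> 0) U" by simp
    show "eventually (\<lambda>n. norm (of_real ((1 / s n)\<^sup>2) * cin (Z n * adj (B n)) (A n)) \<le> opn (Z n) * (C * D)) U"
      using C(2) D(2)
    proof eventually_elim
      case (elim n)
      have "cmod (cin (Z n * adj (B n)) (A n)) \<le> norm (Z n * adj (B n)) * norm (A n)" by (rule cin_bound)
      also have "\<dots> \<le> (opn (Z n) * norm (adj (B n))) * norm (A n)" by (intro mult_right_mono opn_mult_left) simp
      also have "\<dots> \<le> (opn (Z n) * (D * s n)) * (C * s n)"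
        using elim C D by (intro mult_mono) auto
      finally have "cmod (cin (Z n * adj (B n)) (A n)) \<le> opn (Z n) * (C * D) * (s n)\<^sup>2"
        by (simp add: power2_eq_square mult_ac)
      hence "(1 / s n)\<^sup>2 * cmod (cin (Z n * adj (B n)) (A n)) \<le> (1 / s n)\<^sup>2 * (opn (Z n) * (C * D) * (s n)\<^sup>2)"
        by (rule mult_left_mono) simp
      also have "\<dots> \<le> opn (Z n) * (C * D)" using C D by (cases "s n = 0") (simp_all add: power_divide)
      finally show ?case by (simp add: norm_mult norm_power norm_divide power_divide)
    qed
  qed simp
  thus ?thesis unfolding eq[symmetric] by (rule P.ip_eqI)
qed

end

context asymptotic_rep
begin

lemma ultra_rep_hom:
  assumes G: "group G" and f: "f \<in> hom G W"
  shows "ultra_rep scaleC form U G (\<lambda>g. ad (f g))"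
proof -
  have in_W: "f g \<in> carrier W" if "g \<in> carrier G" for g using f that by (auto simp: hom_def)
  have mult: "f (g \<otimes>\<^bsub>G\<^esub> h) = f g \<otimes> f h" if "g \<in> carrier G" "h \<in> carrier G" for g h using f that by (auto simp: hom_def)
  have one: "f \<one>\<^bsub>G\<^esub> = \<one>"
    using mult[of "\<one>\<^bsub>G\<^esub>" "\<one>\<^bsub>G\<^esub>"] in_W[of "\<one>\<^bsub>G\<^esub>"] group.is_monoid[OF G] monoid.one_closed[of G] monoid.l_one[of G "\<one>\<^bsub>G\<^esub>"]
    by simp
  interpret G: group G by (rule G)
  show ?thesis
    by unfold_locales (simp_all only: in_W mult one R.\<pi>_add R.\<pi>_sc R.\<pi>_bdd R.\<pi>_ip R.\<pi>_mult R.\<pi>_one)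
qed

end

context kazhdan_conjugation
begin

text \<open>The defect \<open>Z\<close> of the cocycle identity is small in operator norm, and it is itself a combination of products
  of two vectors. So it is orthogonal to itself.\<close>

lemma r_cocycle_nrm:
  assumes c0: "c0 > 0" "eventually (\<lambda>n. c0 \<le> s n) U"
    and g: "g \<in> carrier \<Gamma>" and h: "h \<in> carrier \<Gamma>"
  shows "P.UP.nrm (\<sigma> (r (g \<otimes>\<^bsub>\<Gamma>\<^esub> h)) - (\<sigma> (r g) + cj g (\<sigma> (r h)))) = 0"
proof -
  let ?gh = "g \<otimes>\<^bsub>\<Gamma>\<^esub> h"
  have gh: "?gh \<in> carrier \<Gamma>" using g h by simp
  have de: "dom (e k)" "dom (r k)" if "k \<in> carrier \<Gamma>" for k using dom_all[OF c0 that] dom_r[OF that] by auto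
  define Z where "Z = r ?gh - (r g + cj g (r h))"
  have cbZ: "cb Z" unfolding Z_def using g h gh by (intro cb_diff cb_add cb_cj cb_r)
  have nZ: "null U Z" unfolding Z_def by (rule null_trans[OF r_\<rho>[OF gh] r_cocycle[OF g h]])
  have orth: "P.ip (\<sigma> Z) (\<sigma> (r k)) = 0" if k: "k \<in> carrier \<Gamma>" for k
    unfolding r_def using k
    by (intro ip_null[OF cbZ nZ] cb_mult e cb_\<rho> dom_mult_right[OF cb_opb[OF cb_\<rho>]] de)
  have cjr: "cj g (r h) = (u (j g) * (e h * \<rho> h)) * (e h * adjs (u (j g)))"
    by (simp add: cj_def r_def mult.assoc)
  have ju: "cb (u (j g))" using g by (intro cb_u) auto
  have orth': "P.ip (\<sigma> Z) (\<sigma> (cj g (r h))) = 0"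
    unfolding cjr
    by (rule ip_null[OF cbZ nZ])
      (intro cb_mult cb_adj ju e[OF h] cb_\<rho>[OF h] dom_mult_left[OF cb_opb[OF ju]] dom_mult_right[OF cb_opb[OF cb_\<rho>[OF h]]]
        dom_mult_right[OF cb_opb[OF cb_adj[OF ju]]] de[OF h])+
  have \<sigma>cj: "\<sigma> (cj g (r h)) = cj g (\<sigma> (r h))"
    unfolding cj_def \<sigma>_mult_right[of "u (j g) * r h"] \<sigma>_mult_left[of "u (j g)" "r h"] ..
  have eq: "\<sigma> Z = \<sigma> (r ?gh) - (\<sigma> (r g) + \<sigma> (cj g (r h)))" unfolding Z_def \<sigma>_diff \<sigma>_add ..
  have b: "\<sigma> (r ?gh) \<in> P.bdd" "\<sigma> (r g) \<in> P.bdd" "\<sigma> (cj g (r h)) \<in> P.bdd"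
    using de gh g h by (auto intro!: \<sigma>_bdd dom_cj)
  have bZ: "\<sigma> Z \<in> P.bdd" unfolding eq by (intro P.UP.diff_in P.UP.add_in b)
  have "P.ip (\<sigma> Z) (\<sigma> (r ?gh) - (\<sigma> (r g) + \<sigma> (cj g (r h)))) = 0"
    unfolding P.UP.b_diff_right[OF bZ b(1) P.UP.add_in[OF b(2,3)]] P.UP.b_add_right[OF bZ b(2,3)]
    using orth[OF gh] orth[OF g] orth' by simp
  hence "P.ip (\<sigma> Z) (\<sigma> Z) = 0" unfolding eq[symmetric] .
  hence "P.UP.nrm (\<sigma> Z) = 0" by (simp add: P.UP.nrm_def)
  thus ?thesis unfolding eq \<sigma>cj .
qed

lemma norm_s_sum:
  assumes s: "s n > 0" shows "(\<Sum>k\<in>K. (norm (\<sigma> (e k) n))\<^sup>2) = 1"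
proof -
  have "(norm (\<sigma> (e k) n))\<^sup>2 = (norm (e k n))\<^sup>2 / (s n)\<^sup>2" for k
    using s by (simp add: \<sigma>_def norm_divide power_divide)
  hence "(\<Sum>k\<in>K. (norm (\<sigma> (e k) n))\<^sup>2) = (\<Sum>k\<in>K. (norm (e k n))\<^sup>2) / (s n)\<^sup>2" by (simp add: sum_divide_distrib)
  also have "(\<Sum>k\<in>K. (norm (e k n))\<^sup>2) = (s n)\<^sup>2" by (simp add: s_def sum_nonneg)
  finally show ?thesis using s by simp
qed

text \<open>The projection \<open>e k\<close> is recovered from \<open>r k\<close> by multiplication with a bounded sequence, up to the defect of
  idempotence, which is negligible because \<open>s\<close> is bounded below.\<close>

lemma \<sigma>_e_nrm:
  assumes c0: "c0 > 0" "eventually (\<lambda>n. c0 \<le> s n) U"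
    and k: "k \<in> K" and z: "P.UP.nrm (\<sigma> (r k)) = 0"
  shows "P.UP.nrm (\<sigma> (e k)) = 0"
proof -
  have g: "k \<in> carrier \<Gamma>" using k K by auto
  have b: "\<sigma> (e k) \<in> P.bdd" "\<sigma> (r k) \<in> P.bdd" using dom_all[OF c0 g] dom_r[OF g] by (auto intro: \<sigma>_bdd)
  have FB: "F k * \<sigma> (r k) \<in> P.bdd" by (rule bdd_mult_left[OF cb_F[OF g] b(2)])
  have F0: "P.UP.nrm (F k * \<sigma> (r k)) = 0"
  proof -
    obtain C where C: "C > 0" "eventually (\<lambda>n. opn (F k n) \<le> C) U" using cb_opb[OF cb_F[OF g]] by (rule opbE)
    have "((\<lambda>n. C * P.nr n (\<sigma> (r k) n)) \<longlongrightarrow> C * 0) U"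
      using P.tendsto_nrm[OF b(2)] unfolding z by (intro tendsto_mult tendsto_const)
    hence l: "((\<lambda>n. C * P.nr n (\<sigma> (r k) n)) \<longlongrightarrow> 0) U" by simp
    have "((\<lambda>n. P.nr n ((F k * \<sigma> (r k)) n)) \<longlongrightarrow> 0) U"
    proof (rule tendsto_sandwich[OF _ _ tendsto_const l])
      show "eventually (\<lambda>n. P.nr n ((F k * \<sigma> (r k)) n) \<le> C * P.nr n (\<sigma> (r k) n)) U"
        using C(2)
      proof eventually_elim
        case (elim n)
        have "P.nr n (F k n * \<sigma> (r k) n) \<le> opn (F k n) * P.nr n (\<sigma> (r k) n)" by (rule nr_mult_left[OF cb_F[OF g]])
        also have "\<dots> \<le> C * P.nr n (\<sigma> (r k) n)" using elim by (intro mult_right_mono) simp_all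
        finally show ?case by simp
      qed
    qed simp
    thus ?thesis using P.null_bdd by blast
  qed
  have nl: "null U (e k - F k * r k)" by (rule e_F[OF g null_sym[OF r_\<rho>[OF g]]])
  have cbn: "cb (e k - F k * r k)" using g by (intro cb_diff cb_mult e cb_F cb_r)
  have 1: "P.UP.nrm ((e k - F k * r k) * \<sigma> (e k)) = 0" by (rule null_bdd_left[OF cbn nl b(1)])
  have 2: "P.UP.nrm (F k * r k * \<sigma> (e k)) = 0"
  proof -
    have eq: "F k * r k * \<sigma> (e k) = F k * \<sigma> (r k) * e k"
      by (simp add: fun_eq_iff \<sigma>_def scaleC_mult_left scaleC_mult_right mult.assoc)
    obtain C where C: "C > 0" "eventually (\<lambda>n. opn (e k n) \<le> C) U" using cb_opb[OF e(1)[OF g]] by (rule opbE)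
    have "((\<lambda>n. C * P.nr n ((F k * \<sigma> (r k)) n)) \<longlongrightarrow> C * 0) U"
      using P.tendsto_nrm[OF FB] unfolding F0 by (intro tendsto_mult tendsto_const)
    hence l: "((\<lambda>n. C * P.nr n ((F k * \<sigma> (r k)) n)) \<longlongrightarrow> 0) U" by simp
    have "((\<lambda>n. P.nr n ((F k * \<sigma> (r k) * e k) n)) \<longlongrightarrow> 0) U"
    proof (rule tendsto_sandwich[OF _ _ tendsto_const l])
      show "eventually (\<lambda>n. P.nr n ((F k * \<sigma> (r k) * e k) n) \<le> C * P.nr n ((F k * \<sigma> (r k)) n)) U"
        using C(2)
      proof eventually_elim
        case (elim n)
        have "P.nr n ((F k * \<sigma> (r k)) n * e k n) \<le> opn (e k n) * P.nr n ((F k * \<sigma> (r k)) n)" by (rule nr_mult_right[OF e(1)[OF g]])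
        also have "\<dots> \<le> C * P.nr n ((F k * \<sigma> (r k)) n)" using elim by (intro mult_right_mono) simp_all
        finally show ?case by simp
      qed
    qed simp
    thus ?thesis unfolding eq using P.null_bdd by blast
  qed
  have 3: "P.UP.nrm (\<sigma> (e k) - e k * \<sigma> (e k)) \<le> 0"
  proof (rule tendsto_le[OF P.U_nonbot _ P.tendsto_nrm])
    show "((\<lambda>n. inverse (real (Suc n)) / c0) \<longlongrightarrow> 0) U"
      using tendsto_mono[OF free LIMSEQ_inverse_real_of_nat] tendsto_divide_zero by blast
    show "\<sigma> (e k) - e k * \<sigma> (e k) \<in> P.bdd" using b e(1)[OF g] by (intro P.UP.diff_in bdd_mult_left)
    show "eventually (\<lambda>n. P.nr n ((\<sigma> (e k) - e k * \<sigma> (e k)) n) \<le> inverse (real (Suc n)) / c0) U"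
      using c0(2) e(3)[OF g]
    proof eventually_elim
      case (elim n)
      have "(\<sigma> (e k) - e k * \<sigma> (e k)) n = scaleC (of_real (1 / s n)) (e k n - e k n * e k n)"
        by (simp add: \<sigma>_def scaleC_mult_right scaleC_simps)
      hence "P.nr n ((\<sigma> (e k) - e k * \<sigma> (e k)) n) \<le> norm (scaleC (of_real (1 / s n)) (e k n - e k n * e k n))"
        unfolding nr_form by (simp only: norm_corner)
      also have "\<dots> = norm (e k n * e k n - e k n) / s n"
        using s_nonneg[of n] by (simp add: norm_divide norm_minus_commute)
      also have "\<dots> \<le> (1 / (real n + 1)) / c0" using elim c0(1) by (intro frac_le) auto
      finally show ?case by (simp add: inverse_eq_divide add.commute)
    qed
  qed
  have bb: "e k * \<sigma> (e k) \<in> P.bdd" "(e k - F k * r k) * \<sigma> (e k) \<in> P.bdd" "F k * r k * \<sigma> (e k) \<in> P.bdd"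
    using b g e(1)[OF g] cbn by (auto intro!: bdd_mult_left cb_mult cb_F cb_r)
  have "e k * \<sigma> (e k) = (e k - F k * r k) * \<sigma> (e k) + F k * r k * \<sigma> (e k)" by (simp add: algebra_simps)
  hence 4: "P.UP.nrm (e k * \<sigma> (e k)) \<le> 0" using P.UP.nrm_triangle[OF bb(2,3)] 1 2 by simp
  have "P.UP.nrm (\<sigma> (e k)) \<le> 0" using P.UP.nrm_le_diff[OF b(1) bb(1)] 3 4 by simp
  thus ?thesis using P.UP.nrm_nonneg[OF b(1)] by simp
qed

text \<open>By the choice of \<open>s\<close> the squared lengths of the rescaled projections over \<open>K\<close> add up to 1.\<close>

lemma not_all_null:
  assumes c0: "c0 > 0" "eventually (\<lambda>n. c0 \<le> s n) U"
  shows "\<exists>k\<in>K. P.UP.nrm (\<sigma> (r k)) \<noteq> 0"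
proof (rule ccontr)
  assume "\<not> ?thesis"
  hence z: "P.UP.nrm (\<sigma> (e k)) = 0" if "k \<in> K" for k using \<sigma>_e_nrm[OF c0 that] that by blast
  have lim: "((\<lambda>n. \<Sum>k\<in>K. (P.nr n (\<sigma> (e k) n))\<^sup>2) \<longlongrightarrow> (\<Sum>k\<in>K. 0\<^sup>2)) U"
  proof (intro tendsto_sum tendsto_power)
    fix k assume k: "k \<in> K"
    have "\<sigma> (e k) \<in> P.bdd" using dom_e[OF k] by (rule \<sigma>_bdd)
    from P.tendsto_nrm[OF this] show "((\<lambda>n. P.nr n (\<sigma> (e k) n)) \<longlongrightarrow> 0) U" by (simp only: z[OF k])
  qed
  have ev: "eventually (\<lambda>n. (\<Sum>k\<in>K. (P.nr n (\<sigma> (e k) n))\<^sup>2) = 1) U"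
    using c0(2)
  proof eventually_elim
    case (elim n)
    have "P.nr n (\<sigma> (e k) n) = norm (\<sigma> (e k) n)" if k: "k \<in> K" for k
    proof -
      have "k \<in> carrier \<Gamma>" using k K by auto
      note c = cb_left[OF e(1)[OF this], of n] cb_right[OF e(1)[OF this], of n]
      show ?thesis unfolding nr_form \<sigma>_def scaleC_mult_left scaleC_mult_right c ..
    qed
    hence "(\<Sum>k\<in>K. (P.nr n (\<sigma> (e k) n))\<^sup>2) = (\<Sum>k\<in>K. (norm (\<sigma> (e k) n))\<^sup>2)" by (intro sum.cong refl) (simp only:)
    also have "\<dots> = 1" by (rule norm_s_sum[OF less_le_trans[OF c0(1) elim]])
    finally show ?case .
  qed
  have "((\<lambda>n. 1::real) \<longlongrightarrow> (\<Sum>k\<in>K. 0\<^sup>2)) U" by (rule Lim_transform_eventually[OF lim ev])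
  from tendsto_unique[OF P.U_nonbot tendsto_const this] show False by simp
qed

text \<open>Conjugation by \<open>t\<inverse>\<close> carries the action of \<open>\<theta> g\<close> to that of \<open>g\<close>.\<close>

lemma tau_intertwines:
  assumes g: "g \<in> carrier \<Gamma>" and X: "X \<in> P.bdd"
  shows "P.UP.nrm ((\<lambda>n. ad (j g) n (ad (inv t) n (X n))) - (\<lambda>n. ad (inv t) n (ad (j (\<theta> g)) n (X n)))) = 0"
proof -
  have w: "j g \<in> carrier W" "inv t \<in> carrier W" "j (\<theta> g) \<in> carrier W" using g t by auto
  have "inv t \<otimes> j (\<theta> g) = inv t \<otimes> (t \<otimes> (j g \<otimes> inv t))" using tj[OF g] t w by (simp add: m_assoc)
  also have "\<dots> = j g \<otimes> inv t" using t w by (simp add: m_assoc[symmetric])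
  finally have eq: "inv t \<otimes> j (\<theta> g) = j g \<otimes> inv t" .
  let ?Z = "\<lambda>n. ad (j g \<otimes> inv t) n (X n)"
  let ?A = "\<lambda>n. ad (j g) n (ad (inv t) n (X n))" and ?B = "\<lambda>n. ad (inv t) n (ad (j (\<theta> g)) n (X n))"
  have b: "?Z \<in> P.bdd" "?A \<in> P.bdd" "?B \<in> P.bdd"
    by (rule R.\<pi>_bdd[OF m_closed[OF w(1,2)] X], rule R.\<pi>_bdd[OF w(1) R.\<pi>_bdd[OF w(2) X]],
        rule R.\<pi>_bdd[OF w(2) R.\<pi>_bdd[OF w(3) X]])
  have 1: "P.UP.nrm (?Z - ?A) = 0" by (rule R.\<pi>_mult[OF w(1,2) X])
  have 2: "P.UP.nrm (?Z - ?B) = 0" using R.\<pi>_mult[OF w(2,3) X] unfolding eq .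
  have "P.UP.nrm (?A - ?B) \<le> P.UP.nrm (?A - ?Z) + P.UP.nrm (?Z - ?B)" by (rule P.UP.nrm_diff_triangle[OF b(2,1,3)])
  also have "P.UP.nrm (?A - ?Z) = 0" by (rule trans[OF P.UP.nrm_diff_commute[OF b(2,1)] 1])
  also note 2
  finally have "P.UP.nrm (?A - ?B) \<le> 0" unfolding add_0 .
  thus ?thesis by (rule antisym) (rule P.UP.nrm_nonneg[OF P.UP.diff_in[OF b(2,3)]])
qed

lemma \<rho>_\<theta>: "g \<in> carrier \<Gamma> \<Longrightarrow> \<rho> (\<theta> g) = 0"
  unfolding \<rho>_def by (simp only: c_\<theta> diff_self)

lemma \<sigma>_r_\<theta>: "g \<in> carrier \<Gamma> \<Longrightarrow> \<sigma> (r (\<theta> g)) = 0"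
  unfolding r_def \<sigma>_def by (rule ext, rule fmat_eqI) (simp add: \<rho>_\<theta>)

text \<open>The cocycle is trivialized up to \<open>\<eta> m\<close> by a vector \<open>\<xi>\<close>. It vanishes on \<open>\<theta>(\<Gamma>)\<close>, so \<open>\<xi>\<close> is \<open>\<eta> m\<close>-invariant under
  \<open>\<theta>(\<Gamma>)\<close>, and therefore within \<open>\<eta> m / \<epsilon>\<close> of a \<open>\<theta>(\<Gamma>)\<close>-invariant vector. This vector is \<open>\<Gamma>\<close>-invariant.\<close>

lemma norm_r_small:
  assumes c0: "c0 > 0" "eventually (\<lambda>n. c0 \<le> s n) U"
    and D: "0 \<le> D" "\<And>k. k \<in> K \<Longrightarrow> P.UP.nrm (\<sigma> (r k)) \<le> D" and k: "k \<in> carrier \<Gamma>"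
  defines "\<eta> \<equiv> \<lambda>m. 4 * rate (card K) \<epsilon> ^ m * D / \<epsilon>"
  shows "P.UP.nrm (\<sigma> (r k)) \<le> \<eta> m + 2 * (\<eta> m / \<epsilon>)"
proof -
  interpret Q: ultra_rep scaleC form U \<Gamma> "\<lambda>g. ad (j g)"
    by (rule ultra_rep_hom[OF \<Gamma>.is_group j])
  have j\<theta>: "(\<lambda>g. j (\<theta> g)) \<in> hom \<Gamma> W"
    by (rule homI) (simp_all add: j_mult \<theta>_mult)
  interpret Q\<theta>: ultra_rep scaleC form U \<Gamma> "\<lambda>g. ad (j (\<theta> g))"
    by (rule ultra_rep_hom[OF \<Gamma>.is_group j\<theta>])
  have act: "Q.act g X = cj g X" for g X unfolding Q.act_def ad_seq cj_def ..
  have act\<theta>: "Q\<theta>.act g X = Q.act (\<theta> g) X" for g X unfolding Q.act_def Q\<theta>.act_def ..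
  have b: "\<sigma> (r g) \<in> P.bdd" if "g \<in> carrier \<Gamma>" for g by (rule \<sigma>_bdd[OF dom_r[OF that dom_all[OF c0 that]]])
  have coc: "P.UP.nrm (\<sigma> (r (g \<otimes>\<^bsub>\<Gamma>\<^esub> h)) - (\<sigma> (r g) + Q.act g (\<sigma> (r h)))) = 0"
    if "g \<in> carrier \<Gamma>" "h \<in> carrier \<Gamma>" for g h
    unfolding act by (rule r_cocycle_nrm[OF c0 that])
  obtain \<xi> where \<xi>: "\<xi> \<in> P.bdd" and \<xi>g: "\<And>g. g \<in> carrier \<Gamma> \<Longrightarrow> P.UP.nrm (\<sigma> (r g) + Q.act g \<xi> - \<xi>) \<le> \<eta> m"
    using Q.R.cocycle_averaging[OF K kp' \<epsilon> b coc psd_exp_dist[OF _ b] D, of m] unfolding \<eta>_def by blast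
  have \<eta>0: "0 \<le> \<eta> m" unfolding \<eta>_def using D(1) \<epsilon> rate_nonneg[OF \<epsilon>, of "card K"] by simp
  have fx: "P.UP.nrm (Q\<theta>.act g \<xi> - \<xi>) \<le> \<eta> m" if g: "g \<in> carrier \<Gamma>" for g
    using \<xi>g[OF \<theta>_in[OF g]] unfolding \<sigma>_r_\<theta>[OF g] add_0 act\<theta> .
  obtain w where w: "w \<in> Q\<theta>.R.Inv" and near: "\<epsilon> * P.UP.nrm (\<xi> - w) \<le> \<eta> m"
  proof (rule Q\<theta>.R.kazhdan_averaging[OF P.UP_converges K kp \<epsilon> \<xi>])
    fix w
    assume "w \<in> Q\<theta>.R.Inv"
      and *: "\<And>D. 0 \<le> D \<Longrightarrow> (\<And>k. k \<in> K \<Longrightarrow> P.UP.nrm (Q\<theta>.act k \<xi> - \<xi>) \<le> D) \<Longrightarrow> \<epsilon> * P.UP.nrm (\<xi> - w) \<le> D"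
    moreover have "\<epsilon> * P.UP.nrm (\<xi> - w) \<le> \<eta> m" by (rule *[OF \<eta>0 fx]) (use K(2) in blast)
    ultimately show thesis by (intro that)
  qed
  have wS: "w \<in> P.bdd" using w by (rule Q\<theta>.R.InvD)
  have it: "inv t \<in> carrier W" using t by simp
  have "w \<in> Q.R.Inv"
  proof (rule Q.conjugate_invariants[OF K kp \<epsilon> \<theta>_in, where \<tau> = "ad (inv t)"])
    show "ad (inv t) n (x + y) = ad (inv t) n x + ad (inv t) n y" for n x y by (rule R.\<pi>_add[OF it])
    show "ad (inv t) n (scaleC c x) = scaleC c (ad (inv t) n x)" for n c x by (rule R.\<pi>_sc[OF it])
    show "(\<lambda>n. ad (inv t) n (X n)) \<in> P.bdd" if "X \<in> P.bdd" for X by (rule R.\<pi>_bdd[OF it that])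
    show "P.UP.nrm (\<lambda>n. ad (inv t) n (X n)) = P.UP.nrm X" if "X \<in> P.bdd" for X
      using R.R.act_nrm[OF it that] unfolding R.act_def .
    show "P.UP.nrm ((\<lambda>n. ad (j k) n (ad (inv t) n (X n))) - (\<lambda>n. ad (inv t) n (ad (j (\<theta> k)) n (X n)))) = 0"
      if "k \<in> K" "X \<in> P.bdd" for k X
      by (rule tau_intertwines[OF _ that(2)]) (use that K in blast)
    show "P.UP.nrm (Q.act (\<theta> g) w - w) = 0" if "g \<in> carrier \<Gamma>" for g
      using Q\<theta>.R.InvD(2)[OF w that] unfolding act\<theta> .
  qed (rule form_degenerate wS | assumption)+
  hence "P.UP.nrm (Q.act k \<xi> - \<xi>) \<le> 2 * P.UP.nrm (\<xi> - w)" by (rule Q.R.act_near_Inv[OF k \<xi>])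
  also have "\<dots> \<le> 2 * (\<eta> m / \<epsilon>)" using near \<epsilon>(1) by (simp add: field_simps)
  finally have 1: "P.UP.nrm (Q.act k \<xi> - \<xi>) \<le> 2 * (\<eta> m / \<epsilon>)" .
  have aS: "Q.act k \<xi> \<in> P.bdd" by (rule Q.R.act_in[OF k \<xi>])
  have "P.UP.nrm (\<sigma> (r k)) \<le> P.UP.nrm (\<sigma> (r k) - (\<xi> - Q.act k \<xi>)) + P.UP.nrm (\<xi> - Q.act k \<xi>)"
    by (rule P.UP.nrm_le_diff[OF b[OF k] P.UP.diff_in[OF \<xi> aS]])
  also have "P.UP.nrm (\<xi> - Q.act k \<xi>) = P.UP.nrm (Q.act k \<xi> - \<xi>)" by (rule P.UP.nrm_diff_commute[OF \<xi> aS])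
  also have "\<sigma> (r k) - (\<xi> - Q.act k \<xi>) = \<sigma> (r k) + Q.act k \<xi> - \<xi>" by (rule diff_diff_eq2)
  finally show ?thesis using \<xi>g[OF k] 1 by linarith
qed

lemma norm_e_le_s: "k \<in> K \<Longrightarrow> norm (e k n) \<le> s n"
  unfolding s_def by (rule real_le_rsqrt) (rule member_le_sum[OF _ _ K(1)], auto)

text \<open>If \<open>\<rho>\<close> does not vanish on \<open>K\<close>, some \<open>e k\<close> has operator norm bounded below, so \<open>s\<close> is bounded below and the
  rescaled cocycle is defined. It is arbitrarily small, but not zero on \<open>K\<close>.\<close>

theorem asymptotic_commutation:
  assumes g: "g \<in> carrier \<Gamma>" shows "null U (\<rho> g)"
proof (rule null_generated[OF _ g], rule ccontr)
  fix k0 assume k0: "k0 \<in> K" and nn: "\<not> null U (\<rho> k0)"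
  have "\<not> null U (e k0)" using nn e_null_if k0 K(2) by blast
  then obtain c0 where c0: "c0 > 0" "\<not> eventually (\<lambda>n. opn (e k0 n) < c0) U"
  proof -
    have "\<not> (\<forall>c0>0. eventually (\<lambda>n. opn (e k0 n) < c0) U)"
    proof
      assume *: "\<forall>c0>0. eventually (\<lambda>n. opn (e k0 n) < c0) U"
      have "((\<lambda>n. opn (e k0 n)) \<longlongrightarrow> 0) U"
        by (rule tendstoI) (use * in \<open>simp add: dist_real_def\<close>)
      thus False using \<open>\<not> null U (e k0)\<close> by (simp only: null_def simp_thms)
    qed
    thus thesis using that by blast
  qed
  from c0(2) have "eventually (\<lambda>n. \<not> opn (e k0 n) < c0) U" by (simp only: ultrafilter_not[OF ultra])
  hence ev: "eventually (\<lambda>n. c0 \<le> s n) U"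
  proof eventually_elim
    case (elim n)
    thus ?case using opn_le_norm[of "e k0 n"] norm_e_le_s[OF k0, of n] by linarith
  qed
  define D where "D = (\<Sum>k\<in>K. P.UP.nrm (\<sigma> (r k)))"
  have b: "\<sigma> (r k) \<in> P.bdd" if "k \<in> carrier \<Gamma>" for k
    by (rule \<sigma>_bdd[OF dom_r[OF that dom_all[OF c0(1) ev that]]])
  have pos: "0 \<le> P.UP.nrm (\<sigma> (r k))" if "k \<in> K" for k by (rule P.UP.nrm_nonneg[OF b]) (use that K in blast)
  have D: "0 \<le> D" "\<And>k. k \<in> K \<Longrightarrow> P.UP.nrm (\<sigma> (r k)) \<le> D"
    unfolding D_def by (rule sum_nonneg[OF pos], assumption) (rule member_le_sum[OF _ pos K(1)], auto)
  let ?\<eta> = "\<lambda>m. 4 * rate (card K) \<epsilon> ^ m * D / \<epsilon>"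
  have "(\<lambda>m. rate (card K) \<epsilon> ^ m) \<longlonglongrightarrow> 0"
    using rate_nonneg[OF \<epsilon>] rate_less_1[OF \<epsilon>] by (intro LIMSEQ_realpow_zero)
  hence "(\<lambda>m. ?\<eta> m + 2 * (?\<eta> m / \<epsilon>)) \<longlonglongrightarrow> 4 * 0 * D / \<epsilon> + 2 * (4 * 0 * D / \<epsilon> / \<epsilon>)"
    by (intro tendsto_add tendsto_divide tendsto_mult tendsto_const) (use \<epsilon>(1) in auto)
  hence l: "(\<lambda>m. ?\<eta> m + 2 * (?\<eta> m / \<epsilon>)) \<longlonglongrightarrow> 0" by simp
  obtain k where k: "k \<in> K" "P.UP.nrm (\<sigma> (r k)) \<noteq> 0" using not_all_null[OF c0(1) ev] by blast
  have kG: "k \<in> carrier \<Gamma>" using k K by blast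
  have "P.UP.nrm (\<sigma> (r k)) \<le> ?\<eta> m + 2 * (?\<eta> m / \<epsilon>)" for m by (rule norm_r_small[OF c0(1) ev D kG])
  hence "P.UP.nrm (\<sigma> (r k)) \<le> 0" by (intro LIMSEQ_le_const[OF l]) blast
  with pos[OF k(1)] k(2) show False by simp
qed

end

section \<open>Square-summable functions\<close>

abbreviation E :: "'x set \<Rightarrow> ('x \<Rightarrow> complex) set" where "E X \<equiv> carrier (ell2 X)"

lemma E_iff: "f \<in> E X \<longleftrightarrow> (\<forall>x. x \<notin> X \<longrightarrow> f x = 0) \<and> (\<lambda>x. (cmod (f x))\<^sup>2) summable_on X"
  by (simp add: ell2_def)

lemma cinner_ell2: "cinner (ell2 X) f g = (\<Sum>\<^sub>\<infinity>x\<in>X. f x * cnj (g x))"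
  by (simp add: ell2_def)

lemma ell2_simps: "f \<oplus>\<^bsub>ell2 X\<^esub> g = f + g" "\<zero>\<^bsub>ell2 X\<^esub> = 0" "c \<odot>\<^bsub>ell2 X\<^esub> f = (\<lambda>x. c * f x)"
  by (simp_all add: ell2_def fun_eq_iff)

lemma E_outside: "f \<in> E X \<Longrightarrow> x \<notin> X \<Longrightarrow> f x = 0" by (simp add: E_iff)

lemma E_prod_summable: assumes "f \<in> E X" "g \<in> E X" shows "(\<lambda>x. f x * cnj (g x)) summable_on X"
proof -
  have "(\<lambda>x. cmod (f x) * cmod (g x)) abs_summable_on X"
    by (rule abs_summable_product) (use assms in \<open>simp_all add: E_iff power2_eq_square\<close>)
  hence "(\<lambda>x. f x * cnj (g x)) abs_summable_on X" by (simp add: norm_mult)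
  thus ?thesis by (rule abs_summable_summable)
qed

lemma E_add: assumes "f \<in> E X" "g \<in> E X" shows "f + g \<in> E X"
proof -
  have "(\<lambda>x. 2 * (cmod (f x))\<^sup>2 + 2 * (cmod (g x))\<^sup>2) summable_on X"
    using assms by (intro summable_on_add summable_on_cmult_right) (simp_all add: E_iff)
  moreover have "(cmod (f x + g x))\<^sup>2 \<le> 2 * (cmod (f x))\<^sup>2 + 2 * (cmod (g x))\<^sup>2" for x
  proof -
    have "(cmod (f x + g x))\<^sup>2 \<le> (cmod (f x) + cmod (g x))\<^sup>2" by (intro power_mono norm_triangle_ineq) simp
    also have "\<dots> \<le> 2 * (cmod (f x))\<^sup>2 + 2 * (cmod (g x))\<^sup>2"
      using sum_squares_bound[of "cmod (f x)" "cmod (g x)"] by (simp add: power2_sum)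
    finally show ?thesis .
  qed
  ultimately have "(\<lambda>x. (cmod (f x + g x))\<^sup>2) summable_on X"
    by (rule summable_on_comparison_test) simp_all
  thus ?thesis using assms by (simp add: E_iff)
qed

lemma E_scale: "f \<in> E X \<Longrightarrow> (\<lambda>x. c * f x) \<in> E X"
  by (simp add: E_iff norm_mult power_mult_distrib summable_on_cmult_right)

interpretation ell2: semi_inner "\<lambda>c f x. c * f x" "carrier (ell2 X)" "cinner (ell2 X)" for X :: "'x set"
proof
  fix f g h :: "'x \<Rightarrow> complex" and c d :: complex
  show "0 \<in> E X" by (simp add: E_iff)
  assume f: "f \<in> E X"
  show "(\<lambda>x. c * f x) \<in> E X" by (rule E_scale[OF f])
  show "0 \<le> Re (cinner (ell2 X) f f)"
    unfolding cinner_ell2 infsum_Re[OF E_prod_summable[OF f f], symmetric] by (rule infsum_nonneg) simp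
  assume g: "g \<in> E X"
  show "f + g \<in> E X" by (rule E_add[OF f g])
  show "cinner (ell2 X) (\<lambda>x. c * f x) g = c * cinner (ell2 X) f g"
    by (simp add: cinner_ell2 infsum_cmult_right' mult.assoc)
  have "cnj (cinner (ell2 X) g f) = (\<Sum>\<^sub>\<infinity>x\<in>X. cnj (g x * cnj (f x)))" unfolding cinner_ell2 by (rule infsum_cnj[symmetric])
  thus "cinner (ell2 X) f g = cnj (cinner (ell2 X) g f)" by (simp add: cinner_ell2 mult.commute)
  assume h: "h \<in> E X"
  show "cinner (ell2 X) (f + g) h = cinner (ell2 X) f h + cinner (ell2 X) g h"
    using infsum_add[OF E_prod_summable[OF f h] E_prod_summable[OF g h]] by (simp add: cinner_ell2 distrib_right)
qed (simp_all add: fun_eq_iff algebra_simps)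

lemma hnorm_ell2: "hnorm (ell2 X) f = ell2.nrm X f"
  by (simp add: hnorm_def ell2.nrm_def)

lemma nrm_sq: assumes f: "f \<in> E X" shows "(ell2.nrm X f)\<^sup>2 = (\<Sum>\<^sub>\<infinity>x\<in>X. (cmod (f x))\<^sup>2)"
proof -
  have "(ell2.nrm X f)\<^sup>2 = Re (cinner (ell2 X) f f)" using ell2.b_self[OF f] by simp
  also have "\<dots> = (\<Sum>\<^sub>\<infinity>x\<in>X. Re (f x * cnj (f x)))" unfolding cinner_ell2 by (rule infsum_Re[OF E_prod_summable[OF f f], symmetric])
  also have "(\<lambda>x. Re (f x * cnj (f x))) = (\<lambda>x. (cmod (f x))\<^sup>2)" by (simp add: cmod_power2 flip: power2_eq_square)
  finally show ?thesis .
qed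

definition \<delta> :: "'x \<Rightarrow> 'x \<Rightarrow> complex" where "\<delta> x = (\<lambda>y. if y = x then 1 else 0)"

lemma fin_in_E: assumes "finite F" "F \<subseteq> X" "\<And>x. x \<notin> F \<Longrightarrow> f x = 0" shows "f \<in> E X"
proof -
  have "(\<lambda>x. (cmod (f x))\<^sup>2) summable_on X \<longleftrightarrow> (\<lambda>x. (cmod (f x))\<^sup>2) summable_on F"
    by (rule summable_on_cong_neutral) (use assms in auto)
  thus ?thesis using assms by (auto simp: E_iff)
qed

lemma \<delta>_in [simp]: "x \<in> X \<Longrightarrow> \<delta> x \<in> E X"
  by (rule fin_in_E[of "{x}"]) (auto simp: \<delta>_def)

lemma cinner_\<delta>: assumes "x \<in> X" shows "cinner (ell2 X) f (\<delta> x) = f x"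
proof -
  have "(\<Sum>\<^sub>\<infinity>y\<in>X. f y * cnj (\<delta> x y)) = (\<Sum>\<^sub>\<infinity>y\<in>{x}. f y * cnj (\<delta> x y))"
    by (rule infsum_cong_neutral) (use assms in \<open>auto simp: \<delta>_def\<close>)
  thus ?thesis by (simp add: cinner_ell2 \<delta>_def)
qed

lemma cinner_\<delta>': "x \<in> X \<Longrightarrow> f \<in> E X \<Longrightarrow> cinner (ell2 X) (\<delta> x) f = cnj (f x)"
  using ell2.b_commute[of "\<delta> x" X f] by (simp add: cinner_\<delta>)

lemma nrm_\<delta>: "x \<in> X \<Longrightarrow> ell2.nrm X (\<delta> x) = 1"
  by (simp add: ell2.nrm_def cinner_\<delta>) (simp add: \<delta>_def)

lemma point_le_nrm: assumes "f \<in> E X" shows "cmod (f x) \<le> ell2.nrm X f"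
proof (cases "x \<in> X")
  case True
  thus ?thesis using ell2.b_bound[OF assms \<delta>_in[OF True]] by (simp add: cinner_\<delta> nrm_\<delta>)
qed (use assms in \<open>simp add: E_outside\<close>)

lemma nrm_zeroD: "f \<in> E X \<Longrightarrow> ell2.nrm X f \<le> 0 \<Longrightarrow> f = 0"
  by (rule ext) (use order_trans[OF point_le_nrm, of f X 0] in \<open>simp only: zero_fun_apply norm_le_zero_iff\<close>)

lemma ell2_truncate:
  assumes f: "f \<in> E X" and e: "e > 0"
  obtains F where "finite F" "F \<subseteq> X" "ell2.nrm X (f - (\<lambda>x. if x \<in> F then f x else 0)) < e"
proof -
  have sm: "(\<lambda>x. (cmod (f x))\<^sup>2) summable_on X" using f by (simp add: E_iff)
  have "((\<lambda>F. \<Sum>x\<in>F. (cmod (f x))\<^sup>2) \<longlongrightarrow> (\<Sum>\<^sub>\<infinity>x\<in>X. (cmod (f x))\<^sup>2)) (finite_subsets_at_top X)"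
    using sm by (rule infsum_tendsto)
  hence "eventually (\<lambda>F. (\<Sum>\<^sub>\<infinity>x\<in>X. (cmod (f x))\<^sup>2) - e\<^sup>2 < (\<Sum>x\<in>F. (cmod (f x))\<^sup>2)) (finite_subsets_at_top X)"
    by (rule order_tendstoD) (use e in simp)
  then obtain F where F: "finite F" "F \<subseteq> X" "(\<Sum>\<^sub>\<infinity>x\<in>X. (cmod (f x))\<^sup>2) - e\<^sup>2 < (\<Sum>x\<in>F. (cmod (f x))\<^sup>2)"
    unfolding eventually_finite_subsets_at_top by blast
  let ?g = "\<lambda>x. if x \<in> F then f x else 0"
  have g: "?g \<in> E X" by (rule fin_in_E[OF F(1,2)]) simp
  have "(ell2.nrm X (f - ?g))\<^sup>2 = (\<Sum>\<^sub>\<infinity>x\<in>X. (cmod ((f - ?g) x))\<^sup>2)" by (rule nrm_sq) (use f g in simp)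
  also have "\<dots> = (\<Sum>\<^sub>\<infinity>x\<in>X - F. (cmod (f x))\<^sup>2)" by (rule infsum_cong_neutral) auto
  also have "\<dots> = (\<Sum>\<^sub>\<infinity>x\<in>X. (cmod (f x))\<^sup>2) - (\<Sum>x\<in>F. (cmod (f x))\<^sup>2)"
    using infsum_Diff[OF sm _ F(2)] F(1) by (simp add: summable_on_finite)
  also have "\<dots> < e\<^sup>2" using F(3) by simp
  finally have "ell2.nrm X (f - ?g) < e" using e by (simp add: power_less_imp_less_base)
  thus thesis using that F by blast
qed

section \<open>Bounded operators on square-summable functions\<close>

abbreviation L :: "'x set \<Rightarrow> (('x \<Rightarrow> complex) \<Rightarrow> 'x \<Rightarrow> complex) set" where "L X \<equiv> bounded_ops (ell2 X)"

lemma L_iff: "T \<in> L X \<longleftrightarrow> T \<in> extensional (E X) \<and> T \<in> E X \<rightarrow> E X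
    \<and> (\<forall>f\<in>E X. \<forall>g\<in>E X. T (f + g) = T f + T g) \<and> (\<forall>c. \<forall>f\<in>E X. T (\<lambda>x. c * f x) = (\<lambda>x. c * T f x))
    \<and> (\<exists>C. \<forall>f\<in>E X. ell2.nrm X (T f) \<le> C * ell2.nrm X f)"
  by (auto simp: bounded_ops_def linear_op_def ell2_simps hnorm_ell2)

lemma L_in [simp]: "T \<in> L X \<Longrightarrow> f \<in> E X \<Longrightarrow> T f \<in> E X" by (auto simp: L_iff)
lemma L_add: "T \<in> L X \<Longrightarrow> f \<in> E X \<Longrightarrow> g \<in> E X \<Longrightarrow> T (f + g) = T f + T g" by (auto simp: L_iff)
lemma L_scale: "T \<in> L X \<Longrightarrow> f \<in> E X \<Longrightarrow> T (\<lambda>x. c * f x) = (\<lambda>x. c * T f x)" by (auto simp: L_iff)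
lemma L_ext: "T \<in> L X \<Longrightarrow> T \<in> extensional (E X)" by (simp add: L_iff)

lemma L_minus: "T \<in> L X \<Longrightarrow> f \<in> E X \<Longrightarrow> T (- f) = - T f"
  using L_scale[of T X f "-1"] by (simp add: fun_Compl_def)

lemma L_diff: "T \<in> L X \<Longrightarrow> f \<in> E X \<Longrightarrow> g \<in> E X \<Longrightarrow> T (f - g) = T f - T g"
  by (simp only: diff_conv_add_uminus L_add L_minus ell2.uminus_in)

lemma L_zero: "T \<in> L X \<Longrightarrow> T 0 = 0"
  using L_diff[of T X 0 0] by (simp only: diff_self ell2.zero_in simp_thms)

lemma L_sum: "T \<in> L X \<Longrightarrow> (\<And>i. i \<in> A \<Longrightarrow> f i \<in> E X) \<Longrightarrow> T (sum f A) = (\<Sum>i\<in>A. T (f i))"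
proof (induction A rule: infinite_finite_induct)
  case (insert a A)
  have "T (sum f (insert a A)) = T (f a + sum f A)" unfolding sum.insert[OF insert(1,2)] ..
  also have "\<dots> = T (f a) + T (sum f A)" by (rule L_add[OF insert(4) insert(5) ell2.sum_in]) (use insert in blast)+
  also have "T (sum f A) = (\<Sum>i\<in>A. T (f i))" by (rule insert) (use insert in blast)+
  finally show ?case unfolding sum.insert[OF insert(1,2)] .
qed (simp_all only: sum.infinite sum.empty L_zero not_False_eq_True)

lemma LE: assumes "T \<in> L X" obtains C where "0 \<le> C" "\<And>f. f \<in> E X \<Longrightarrow> ell2.nrm X (T f) \<le> C * ell2.nrm X f"
proof -
  obtain C where C: "\<forall>f\<in>E X. ell2.nrm X (T f) \<le> C * ell2.nrm X f" using assms by (auto simp: L_iff)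
  have "ell2.nrm X (T f) \<le> max C 0 * ell2.nrm X f" if "f \<in> E X" for f
  proof -
    have "C * ell2.nrm X f \<le> max C 0 * ell2.nrm X f" by (intro mult_right_mono) (use that in auto)
    thus ?thesis using C that by fastforce
  qed
  thus thesis by (intro that[of "max C 0"]) auto
qed

lemma LI:
  assumes "T \<in> extensional (E X)" "\<And>f. f \<in> E X \<Longrightarrow> T f \<in> E X" "\<And>f g. f \<in> E X \<Longrightarrow> g \<in> E X \<Longrightarrow> T (f + g) = T f + T g"
    "\<And>c f. f \<in> E X \<Longrightarrow> T (\<lambda>x. c * f x) = (\<lambda>x. c * T f x)" "\<And>f. f \<in> E X \<Longrightarrow> ell2.nrm X (T f) \<le> C * ell2.nrm X f"
  shows "T \<in> L X"
  unfolding L_iff by (intro conjI ballI allI exI[of _ C] funcsetI) (rule assms | assumption)+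

lemma truncate_eq_sum:
  assumes "finite F" shows "(\<lambda>x. if x \<in> F then f x else 0) = (\<Sum>x\<in>F. (\<lambda>y. f x * \<delta> x y))"
proof
  fix y
  have "(\<Sum>x\<in>F. f x * \<delta> x y) = (\<Sum>x\<in>F. if y = x then f x else 0)" by (intro sum.cong) (auto simp: \<delta>_def)
  thus "(if y \<in> F then f y else 0) = (\<Sum>x\<in>F. (\<lambda>y. f x * \<delta> x y)) y" using assms by (simp add: sum_fun_apply)
qed

text \<open>By density of the finitely supported functions.\<close>

lemma functional_zero:
  fixes \<phi> :: "('x \<Rightarrow> complex) \<Rightarrow> complex"
  assumes add: "\<And>f g. f \<in> E X \<Longrightarrow> g \<in> E X \<Longrightarrow> \<phi> (f + g) = \<phi> f + \<phi> g"
    and sc: "\<And>c f. f \<in> E X \<Longrightarrow> \<phi> f = 0 \<Longrightarrow> \<phi> (\<lambda>x. c * f x) = 0"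
    and bd: "\<And>f. f \<in> E X \<Longrightarrow> cmod (\<phi> f) \<le> C * ell2.nrm X f" and C: "0 \<le> C"
    and pt: "\<And>x. x \<in> X \<Longrightarrow> \<phi> (\<delta> x) = 0" and f: "f \<in> E X"
  shows "\<phi> f = 0"
proof -
  have "cmod (\<phi> f) \<le> e" if e: "e > 0" for e
  proof -
    obtain F where F: "finite F" "F \<subseteq> X" and lt: "ell2.nrm X (f - (\<lambda>x. if x \<in> F then f x else 0)) < e / (C + 1)"
      using ell2_truncate[OF f, of "e / (C + 1)"] e C by auto
    let ?g = "\<lambda>x. if x \<in> F then f x else 0"
    have g: "?g \<in> E X" by (rule fin_in_E[OF F]) simp
    have z: "\<phi> 0 = 0" using add[OF ell2.zero_in ell2.zero_in] unfolding add_0 by (rule iffD1[OF add_cancel_right_right])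
    have "\<phi> (\<Sum>x\<in>A. (\<lambda>y. f x * \<delta> x y)) = 0" if "finite A" "A \<subseteq> X" for A
      using that
    proof (induction A)
      case (insert a A)
      have m: "(\<lambda>y. f x * \<delta> x y) \<in> E X" if "x \<in> insert a A" for x using that insert.prems by (intro E_scale \<delta>_in) auto
      have "\<phi> ((\<lambda>y. f a * \<delta> a y) + (\<Sum>x\<in>A. (\<lambda>y. f x * \<delta> x y))) = \<phi> (\<lambda>y. f a * \<delta> a y) + \<phi> (\<Sum>x\<in>A. (\<lambda>y. f x * \<delta> x y))"
        by (rule add[OF m ell2.sum_in]) (use m in blast)+
      also have "\<phi> (\<lambda>y. f a * \<delta> a y) = 0" by (rule sc[OF \<delta>_in pt]) (use insert.prems in blast)+
      also have "\<phi> (\<Sum>x\<in>A. (\<lambda>y. f x * \<delta> x y)) = 0" by (rule insert.IH) (use insert.prems in blast)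
      finally show ?case unfolding sum.insert[OF insert.hyps] add_0 .
    qed (simp only: sum.empty z)
    hence pg: "\<phi> ?g = 0" unfolding truncate_eq_sum[OF F(1)] using F by blast
    have "\<phi> ((f - ?g) + ?g) = \<phi> (f - ?g)" unfolding add[OF ell2.diff_in[OF f g] g] pg by (rule add_0_right)
    hence "cmod (\<phi> f) \<le> C * ell2.nrm X (f - ?g)" unfolding diff_add_cancel using bd[OF ell2.diff_in[OF f g]] by (simp only:)
    also have "\<dots> \<le> (C + 1) * (e / (C + 1))" using lt C ell2.nrm_nonneg[OF ell2.diff_in[OF f g]] by (intro mult_mono) auto
    finally show ?thesis using C by simp
  qed
  hence "cmod (\<phi> f) \<le> 0" by (rule dense_ge)
  thus ?thesis by simp
qed

lemma L_eqI:
  assumes S: "S \<in> L X" and T: "T \<in> L X" and eq: "\<And>x. x \<in> X \<Longrightarrow> S (\<delta> x) = T (\<delta> x)"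
  shows "S = T"
proof (rule extensionalityI[OF L_ext[OF S] L_ext[OF T]], rule ext)
  fix f y assume f: "f \<in> E X"
  obtain C where C: "0 \<le> C" "\<And>f. f \<in> E X \<Longrightarrow> ell2.nrm X (S f) \<le> C * ell2.nrm X f" using S by (rule LE) blast
  obtain D where D: "0 \<le> D" "\<And>f. f \<in> E X \<Longrightarrow> ell2.nrm X (T f) \<le> D * ell2.nrm X f" using T by (rule LE) blast
  have "S f y - T f y = 0"
  proof (rule functional_zero[where \<phi> = "\<lambda>f. S f y - T f y" and C = "C + D", OF _ _ _ _ _ f])
    show "0 \<le> C + D" using C(1) D(1) by simp
    show "S (\<delta> x) y - T (\<delta> x) y = 0" if "x \<in> X" for x using eq[OF that] by simp
  next
    fix f assume f: "f \<in> E X"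
    show "S (\<lambda>x. c * f x) y - T (\<lambda>x. c * f x) y = 0" if "S f y - T f y = 0" for c
      unfolding L_scale[OF S f] L_scale[OF T f] using that by simp
    have "cmod (S f y - T f y) \<le> cmod (S f y) + cmod (T f y)" by (rule norm_triangle_ineq4)
    also have "\<dots> \<le> C * ell2.nrm X f + D * ell2.nrm X f"
      by (rule add_mono[OF order_trans[OF point_le_nrm[OF L_in[OF S f]] C(2)[OF f]] order_trans[OF point_le_nrm[OF L_in[OF T f]] D(2)[OF f]]])
    finally show "cmod (S f y - T f y) \<le> (C + D) * ell2.nrm X f" unfolding distrib_right .
    fix g assume g: "g \<in> E X"
    show "S (f + g) y - T (f + g) y = S f y - T f y + (S g y - T g y)"
      unfolding L_add[OF S f g] L_add[OF T f g] by simp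
  qed
  thus "S f y = T f y" by simp
qed

text \<open>Boundedness of \<open>T\<close> turns \<open>x \<mapsto> \<langle>f, T \<delta>\<^sub>x\<rangle>\<close> into a square-summable function of \<open>x\<close>; this is the
  value of the adjoint at \<open>f\<close>.\<close>

lemma ex_adjoint:
  assumes T: "T \<in> L X"
  shows "\<exists>S\<in>L X. \<forall>f\<in>E X. \<forall>g\<in>E X. cinner (ell2 X) (S f) g = cinner (ell2 X) f (T g)"
proof -
  obtain C where C: "0 \<le> C" "\<And>f. f \<in> E X \<Longrightarrow> ell2.nrm X (T f) \<le> C * ell2.nrm X f" using T by (rule LE) blast
  define s where "s f = (\<lambda>x. if x \<in> X then cinner (ell2 X) f (T (\<delta> x)) else 0)" for f
  have fin: "(\<Sum>x\<in>F. (cmod (s f x))\<^sup>2) \<le> (C * ell2.nrm X f)\<^sup>2" if f: "f \<in> E X" and F: "finite F" "F \<subseteq> X" for f F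
  proof -
    let ?g = "\<lambda>x. if x \<in> F then s f x else 0"
    define N where "N = (\<Sum>x\<in>F. (cmod (s f x))\<^sup>2)"
    have g: "?g \<in> E X" by (rule fin_in_E[OF F]) simp
    have m: "(\<lambda>y. s f x * \<delta> x y) \<in> E X" if "x \<in> F" for x using that F by (intro E_scale \<delta>_in) auto
    have dE: "T (\<delta> x) \<in> E X" "\<delta> x \<in> E X" if "x \<in> F" for x using that F T by auto
    have "(ell2.nrm X ?g)\<^sup>2 = (\<Sum>\<^sub>\<infinity>x\<in>X. (cmod (?g x))\<^sup>2)" by (rule nrm_sq[OF g])
    also have "\<dots> = (\<Sum>\<^sub>\<infinity>x\<in>F. (cmod (s f x))\<^sup>2)" by (rule infsum_cong_neutral) (use F in auto)
    finally have gn: "ell2.nrm X ?g = sqrt N" using F ell2.nrm_nonneg[OF g] by (simp add: N_def real_sqrt_unique)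
    have "T ?g = (\<Sum>x\<in>F. T (\<lambda>y. s f x * \<delta> x y))" unfolding truncate_eq_sum[OF F(1)] by (rule L_sum[OF T m])
    also have "\<dots> = (\<Sum>x\<in>F. (\<lambda>y. s f x * T (\<delta> x) y))" by (rule sum.cong[OF refl]) (rule L_scale[OF T dE(2)])
    finally have "cinner (ell2 X) f (T ?g) = cnj (cinner (ell2 X) (\<Sum>x\<in>F. (\<lambda>y. s f x * T (\<delta> x) y)) f)"
      using ell2.b_commute[OF f L_in[OF T g]] by simp
    also have "cinner (ell2 X) (\<Sum>x\<in>F. (\<lambda>y. s f x * T (\<delta> x) y)) f = (\<Sum>x\<in>F. cinner (ell2 X) (\<lambda>y. s f x * T (\<delta> x) y) f)"
      by (rule ell2.b_sum_left[OF E_scale[OF dE(1)] f])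
    also have "\<dots> = (\<Sum>x\<in>F. s f x * cnj (s f x))"
    proof (rule sum.cong[OF refl])
      fix x assume x: "x \<in> F"
      have "cinner (ell2 X) (\<lambda>y. s f x * T (\<delta> x) y) f = s f x * cinner (ell2 X) (T (\<delta> x)) f" by (rule ell2.b_sc_left[OF dE(1)[OF x] f])
      also have "cinner (ell2 X) (T (\<delta> x)) f = cnj (s f x)" using ell2.b_commute[OF dE(1)[OF x] f] x F by (auto simp: s_def)
      finally show "cinner (ell2 X) (\<lambda>y. s f x * T (\<delta> x) y) f = s f x * cnj (s f x)" .
    qed
    also have "cnj (\<Sum>x\<in>F. s f x * cnj (s f x)) = of_real N" unfolding N_def of_real_sum complex_norm_square cnj_sum complex_cnj_mult complex_cnj_cnj by (simp only: mult.commute)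
    finally have cN: "cinner (ell2 X) f (T ?g) = of_real N" .
    have N0: "0 \<le> N" by (simp add: N_def sum_nonneg)
    have "N = cmod (cinner (ell2 X) f (T ?g))" unfolding cN norm_of_real using N0 by simp
    also have "\<dots> \<le> ell2.nrm X f * ell2.nrm X (T ?g)" by (rule ell2.b_bound[OF f L_in[OF T g]])
    also have "\<dots> \<le> ell2.nrm X f * (C * sqrt N)" using C(2)[OF g] ell2.nrm_nonneg[OF f] unfolding gn by (rule mult_left_mono)
    finally have le: "N \<le> C * ell2.nrm X f * sqrt N" by (simp add: mult_ac)
    have "sqrt N \<le> C * ell2.nrm X f"
    proof (cases "N = 0")
      case False
      hence "0 < sqrt N" using N0 by simp
      moreover have "sqrt N * sqrt N \<le> C * ell2.nrm X f * sqrt N" using le N0 by simp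
      ultimately show ?thesis by (rule mult_right_le_imp_le[rotated])
    qed (use C(1) ell2.nrm_nonneg[OF f] in simp)
    thus ?thesis unfolding N_def[symmetric] by (rule sqrt_le_D)
  qed
  have sE: "s f \<in> E X" if f: "f \<in> E X" for f
  proof -
    have "(\<lambda>x. (cmod (s f x))\<^sup>2) summable_on X"
      by (rule nonneg_bdd_above_summable_on) (auto intro!: bdd_aboveI2[of _ _ "(C * ell2.nrm X f)\<^sup>2"] fin[OF f])
    thus ?thesis by (simp add: E_iff s_def)
  qed
  have sb: "ell2.nrm X (s f) \<le> C * ell2.nrm X f" if f: "f \<in> E X" for f
  proof (rule power2_le_imp_le)
    show "(ell2.nrm X (s f))\<^sup>2 \<le> (C * ell2.nrm X f)\<^sup>2" unfolding nrm_sq[OF sE[OF f]]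
      by (rule infsum_le_finite_sums) (use sE[OF f] in \<open>auto simp: E_iff fin[OF f]\<close>)
  qed (use C(1) ell2.nrm_nonneg[OF f] in simp)
  have dE: "T (\<delta> x) \<in> E X" if "x \<in> X" for x using that T by simp
  define S where "S = (\<lambda>f\<in>E X. s f)"
  have SL: "S \<in> L X"
  proof (rule LI[of _ _ C])
    fix f g c assume f: "f \<in> E X"
    show "S f \<in> E X" "ell2.nrm X (S f) \<le> C * ell2.nrm X f" using f sE sb by (simp_all add: S_def)
    show "S (\<lambda>x. c * f x) = (\<lambda>x. c * S f x)"
      using f E_scale[OF f] ell2.b_sc_left[OF f dE] by (auto simp: S_def s_def fun_eq_iff)
    assume g: "g \<in> E X"
    show "S (f + g) = S f + S g"
      using f g E_add[OF f g] ell2.b_add_left[OF f g dE] by (auto simp: S_def s_def fun_eq_iff)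
  qed (simp add: S_def)
  have "cinner (ell2 X) (S f) g = cinner (ell2 X) f (T g)" if f: "f \<in> E X" and g: "g \<in> E X" for f g
  proof -
    note Sf = L_in[OF SL f]
    have "cinner (ell2 X) (S f) g - cinner (ell2 X) f (T g) = 0"
    proof (rule functional_zero[where C = "ell2.nrm X (S f) + ell2.nrm X f * C", OF _ _ _ _ _ g])
      show "0 \<le> ell2.nrm X (S f) + ell2.nrm X f * C" using C(1) ell2.nrm_nonneg[OF f] ell2.nrm_nonneg[OF Sf] by simp
      show "cinner (ell2 X) (S f) (\<delta> x) - cinner (ell2 X) f (T (\<delta> x)) = 0" if "x \<in> X" for x
        using that f by (simp add: cinner_\<delta> S_def s_def)
    next
      fix h assume h: "h \<in> E X"
      show "cinner (ell2 X) (S f) (\<lambda>x. c * h x) - cinner (ell2 X) f (T (\<lambda>x. c * h x)) = 0"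
        if z: "cinner (ell2 X) (S f) h - cinner (ell2 X) f (T h) = 0" for c
        unfolding L_scale[OF T h] ell2.b_sc_right[OF Sf h] ell2.b_sc_right[OF f L_in[OF T h]] using z by simp
      have "cmod (cinner (ell2 X) (S f) h - cinner (ell2 X) f (T h)) \<le> cmod (cinner (ell2 X) (S f) h) + cmod (cinner (ell2 X) f (T h))"
        by (rule norm_triangle_ineq4)
      also have "\<dots> \<le> ell2.nrm X (S f) * ell2.nrm X h + ell2.nrm X f * (C * ell2.nrm X h)"
        by (intro add_mono ell2.b_bound[OF Sf h] order_trans[OF ell2.b_bound[OF f L_in[OF T h]]] mult_left_mono C(2)[OF h] ell2.nrm_nonneg[OF f])
      finally show "cmod (cinner (ell2 X) (S f) h - cinner (ell2 X) f (T h)) \<le> (ell2.nrm X (S f) + ell2.nrm X f * C) * ell2.nrm X h"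
        by (simp add: distrib_right mult.assoc)
      fix k assume k: "k \<in> E X"
      show "cinner (ell2 X) (S f) (h + k) - cinner (ell2 X) f (T (h + k))
        = cinner (ell2 X) (S f) h - cinner (ell2 X) f (T h) + (cinner (ell2 X) (S f) k - cinner (ell2 X) f (T k))"
        unfolding L_add[OF T h k] ell2.b_add_right[OF Sf h k] ell2.b_add_right[OF f L_in[OF T h] L_in[OF T k]] by simp
    qed
    thus ?thesis by simp
  qed
  thus ?thesis using SL by blast
qed

lemma adjoint_unique:
  assumes S: "S \<in> L X" "\<forall>f\<in>E X. \<forall>g\<in>E X. cinner (ell2 X) (S f) g = cinner (ell2 X) f (T g)"
    and S': "S' \<in> L X" "\<forall>f\<in>E X. \<forall>g\<in>E X. cinner (ell2 X) (S' f) g = cinner (ell2 X) f (T g)"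
  shows "S = S'"
proof (rule extensionalityI[OF L_ext[OF S(1)] L_ext[OF S'(1)]], rule ext)
  fix f x assume f: "f \<in> E X"
  show "S f x = S' f x"
  proof (cases "x \<in> X")
    case True
    thus ?thesis using S(2) S'(2) f \<delta>_in[OF True] by (metis cinner_\<delta>)
  qed (use E_outside[OF L_in[OF S(1) f]] E_outside[OF L_in[OF S'(1) f]] in simp)
qed

lemma adjoint_op:
  assumes T: "T \<in> L X"
  shows "adjoint_op (ell2 X) T \<in> L X"
    "f \<in> E X \<Longrightarrow> g \<in> E X \<Longrightarrow> cinner (ell2 X) (adjoint_op (ell2 X) T f) g = cinner (ell2 X) f (T g)"
proof -
  let ?P = "\<lambda>S. S \<in> L X \<and> (\<forall>f\<in>E X. \<forall>g\<in>E X. cinner (ell2 X) (S f) g = cinner (ell2 X) f (T g))"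
  have "\<exists>!S. ?P S" using ex_adjoint[OF T] adjoint_unique by blast
  from theI'[OF this] show "adjoint_op (ell2 X) T \<in> L X"
    "f \<in> E X \<Longrightarrow> g \<in> E X \<Longrightarrow> cinner (ell2 X) (adjoint_op (ell2 X) T f) g = cinner (ell2 X) f (T g)"
    unfolding adjoint_op_def by blast+
qed

lemma adjoint_opI:
  assumes "T \<in> L X" "S \<in> L X" "\<And>f g. f \<in> E X \<Longrightarrow> g \<in> E X \<Longrightarrow> cinner (ell2 X) (S f) g = cinner (ell2 X) f (T g)"
  shows "adjoint_op (ell2 X) T = S"
  by (rule adjoint_unique[of _ X T]) (use assms adjoint_op[OF assms(1)] in blast)+

section \<open>The algebra of bounded operators\<close>

lemma bounded_operators_simps:
  "carrier (bounded_operators (ell2 X)) = L X" "mult (bounded_operators (ell2 X)) = compose (E X)"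
  "one (bounded_operators (ell2 X)) = (\<lambda>f\<in>E X. f)" "zero (bounded_operators (ell2 X)) = (\<lambda>f\<in>E X. 0)"
  "add (bounded_operators (ell2 X)) = (\<lambda>S T. \<lambda>f\<in>E X. S f + T f)"
  "star (bounded_operators (ell2 X)) = adjoint_op (ell2 X)"
  "module.smult (bounded_operators (ell2 X)) = (\<lambda>c T. \<lambda>f\<in>E X. \<lambda>x. c * T f x)"
  by (simp_all only: bounded_operators_def ell2_simps partial_object.simps monoid.simps ring.simps module.simps star_algebra.simps)

lemma L_compose: assumes S: "S \<in> L X" and T: "T \<in> L X" shows "compose (E X) S T \<in> L X"
proof -
  obtain C where C: "0 \<le> C" "\<And>f. f \<in> E X \<Longrightarrow> ell2.nrm X (S f) \<le> C * ell2.nrm X f" using S by (rule LE) blast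
  obtain D where D: "0 \<le> D" "\<And>f. f \<in> E X \<Longrightarrow> ell2.nrm X (T f) \<le> D * ell2.nrm X f" using T by (rule LE) blast
  have e: "compose (E X) S T f = S (T f)" if "f \<in> E X" for f using that by (rule compose_eq)
  show ?thesis
  proof (rule LI[of _ _ "C * D"])
    show "compose (E X) S T \<in> extensional (E X)" by (rule compose_extensional)
    fix f g :: "'a \<Rightarrow> complex" and c assume f: "f \<in> E X"
    show "compose (E X) S T f \<in> E X" unfolding e[OF f] by (rule L_in[OF S L_in[OF T f]])
    show "compose (E X) S T (\<lambda>x. c * f x) = (\<lambda>x. c * compose (E X) S T f x)"
      unfolding e[OF f] e[OF E_scale[OF f]] L_scale[OF T f] by (rule L_scale[OF S L_in[OF T f]])
    have "ell2.nrm X (S (T f)) \<le> C * (D * ell2.nrm X f)"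
      by (rule order_trans[OF C(2)[OF L_in[OF T f]] mult_left_mono[OF D(2)[OF f] C(1)]])
    thus "ell2.nrm X (compose (E X) S T f) \<le> C * D * ell2.nrm X f" unfolding e[OF f] mult.assoc .
    assume g: "g \<in> E X"
    show "compose (E X) S T (f + g) = compose (E X) S T f + compose (E X) S T g"
      unfolding e[OF f] e[OF g] e[OF E_add[OF f g]] L_add[OF T f g] by (rule L_add[OF S L_in[OF T f] L_in[OF T g]])
  qed
qed

lemma L_plus: assumes S: "S \<in> L X" and T: "T \<in> L X" shows "(\<lambda>f\<in>E X. S f + T f) \<in> L X"
proof -
  obtain C where C: "0 \<le> C" "\<And>f. f \<in> E X \<Longrightarrow> ell2.nrm X (S f) \<le> C * ell2.nrm X f" using S by (rule LE) blast
  obtain D where D: "0 \<le> D" "\<And>f. f \<in> E X \<Longrightarrow> ell2.nrm X (T f) \<le> D * ell2.nrm X f" using T by (rule LE) blast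
  show ?thesis
  proof (rule LI[of _ _ "C + D"])
    fix f g :: "'a \<Rightarrow> complex" and c assume f: "f \<in> E X"
    show "(\<lambda>f\<in>E X. S f + T f) f \<in> E X" unfolding restrict_apply'[OF f] by (rule E_add[OF L_in[OF S f] L_in[OF T f]])
    show "(\<lambda>f\<in>E X. S f + T f) (\<lambda>x. c * f x) = (\<lambda>x. c * (\<lambda>f\<in>E X. S f + T f) f x)"
      unfolding restrict_apply'[OF f] restrict_apply'[OF E_scale[OF f]] L_scale[OF S f] L_scale[OF T f]
      by (rule ext) (simp add: distrib_left)
    show "ell2.nrm X ((\<lambda>f\<in>E X. S f + T f) f) \<le> (C + D) * ell2.nrm X f"
      unfolding restrict_apply'[OF f] distrib_right
      by (rule order_trans[OF ell2.nrm_triangle[OF L_in[OF S f] L_in[OF T f]] add_mono[OF C(2)[OF f] D(2)[OF f]]])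
    assume g: "g \<in> E X"
    show "(\<lambda>f\<in>E X. S f + T f) (f + g) = (\<lambda>f\<in>E X. S f + T f) f + (\<lambda>f\<in>E X. S f + T f) g"
      unfolding restrict_apply'[OF f] restrict_apply'[OF g] restrict_apply'[OF E_add[OF f g]] L_add[OF S f g] L_add[OF T f g]
      by (simp only: ac_simps)
  qed simp
qed

lemma L_smult: assumes T: "T \<in> L X" shows "(\<lambda>f\<in>E X. \<lambda>x. c * T f x) \<in> L X"
proof -
  obtain D where D: "0 \<le> D" "\<And>f. f \<in> E X \<Longrightarrow> ell2.nrm X (T f) \<le> D * ell2.nrm X f" using T by (rule LE) blast
  show ?thesis
  proof (rule LI[of _ _ "cmod c * D"])
    fix f g :: "'a \<Rightarrow> complex" and d assume f: "f \<in> E X"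
    show "(\<lambda>f\<in>E X. \<lambda>x. c * T f x) f \<in> E X" unfolding restrict_apply'[OF f] by (rule E_scale[OF L_in[OF T f]])
    show "(\<lambda>f\<in>E X. \<lambda>x. c * T f x) (\<lambda>x. d * f x) = (\<lambda>x. d * (\<lambda>f\<in>E X. \<lambda>x. c * T f x) f x)"
      unfolding restrict_apply'[OF f] restrict_apply'[OF E_scale[OF f]] L_scale[OF T f]
      by (rule ext) (simp add: mult.left_commute)
    show "ell2.nrm X ((\<lambda>f\<in>E X. \<lambda>x. c * T f x) f) \<le> cmod c * D * ell2.nrm X f"
      unfolding restrict_apply'[OF f] ell2.nrm_sc[OF L_in[OF T f]] mult.assoc by (rule mult_left_mono[OF D(2)[OF f]]) simp
    assume g: "g \<in> E X"
    show "(\<lambda>f\<in>E X. \<lambda>x. c * T f x) (f + g) = (\<lambda>f\<in>E X. \<lambda>x. c * T f x) f + (\<lambda>f\<in>E X. \<lambda>x. c * T f x) g"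
      unfolding restrict_apply'[OF f] restrict_apply'[OF g] restrict_apply'[OF E_add[OF f g]] L_add[OF T f g]
      by (rule ext) (simp add: distrib_left)
  qed simp
qed

lemma L_one: "(\<lambda>f\<in>E X. f) \<in> L X"
  by (rule LI[of _ _ 1]) (simp_all only: restrict_extensional restrict_apply' E_add E_scale mult_1 order_refl)

lemma L_null: "(\<lambda>f\<in>E X. 0) \<in> L X"
proof (rule LI[of _ _ 0])
  fix f g :: "'a \<Rightarrow> complex" and c assume f: "f \<in> E X"
  show "(\<lambda>f\<in>E X. 0) f \<in> E X" unfolding restrict_apply'[OF f] by (rule ell2.zero_in)
  show "(\<lambda>f\<in>E X. 0) (\<lambda>x. c * f x) = (\<lambda>x. c * (\<lambda>f\<in>E X. 0) f x)"
    unfolding restrict_apply'[OF f] restrict_apply'[OF E_scale[OF f]] by (rule ext) simp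
  show "ell2.nrm X ((\<lambda>f\<in>E X. 0) f) \<le> 0 * ell2.nrm X f" unfolding restrict_apply'[OF f] ell2.nrm_zero by simp
  assume g: "g \<in> E X"
  show "(\<lambda>f\<in>E X. 0) (f + g) = (\<lambda>f\<in>E X. 0) f + (\<lambda>f\<in>E X. 0 :: 'a \<Rightarrow> complex) g"
    unfolding restrict_apply'[OF f] restrict_apply'[OF g] restrict_apply'[OF E_add[OF f g]] by simp
qed simp

lemma op_norm_le:
  assumes "\<And>f. f \<in> E X \<Longrightarrow> ell2.nrm X (T f) \<le> C * ell2.nrm X f" "0 \<le> C" shows "op_norm (ell2 X) T \<le> C"
  unfolding op_norm_def hnorm_ell2
proof (rule cSUP_least)
  show "{f \<in> E X. ell2.nrm X f \<le> 1} \<noteq> {}" using ell2.zero_in[of X] ell2.nrm_zero[of X] by (metis (mono_tags, lifting) empty_iff mem_Collect_eq zero_le_one)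
  fix f assume f: "f \<in> {f \<in> E X. ell2.nrm X f \<le> 1}"
  have "C * ell2.nrm X f \<le> C * 1" using f assms(2) by (intro mult_left_mono) auto
  thus "ell2.nrm X (T f) \<le> C" using assms(1)[of f] f by simp
qed

lemma op_norm_bound:
  assumes T: "T \<in> L X" and f: "f \<in> E X" shows "ell2.nrm X (T f) \<le> op_norm (ell2 X) T * ell2.nrm X f"
proof (cases "ell2.nrm X f = 0")
  case True
  obtain D where D: "0 \<le> D" "\<And>f. f \<in> E X \<Longrightarrow> ell2.nrm X (T f) \<le> D * ell2.nrm X f" using T by (rule LE) blast
  show ?thesis using D(2)[OF f] True by simp
next
  case False
  obtain D where D: "0 \<le> D" "\<And>f. f \<in> E X \<Longrightarrow> ell2.nrm X (T f) \<le> D * ell2.nrm X f" using T by (rule LE) blast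
  have pos: "0 < ell2.nrm X f" using False ell2.nrm_nonneg[OF f] by linarith
  let ?c = "complex_of_real (1 / ell2.nrm X f)"
  have g: "(\<lambda>x. ?c * f x) \<in> {f \<in> E X. ell2.nrm X f \<le> 1}"
    using ell2.nrm_sc[OF f, of ?c] pos by (intro CollectI conjI E_scale[OF f]) (simp add: norm_divide)
  have "bdd_above ((\<lambda>f. ell2.nrm X (T f)) ` {f \<in> E X. ell2.nrm X f \<le> 1})"
  proof (rule bdd_aboveI2)
    fix f assume f: "f \<in> {f \<in> E X. ell2.nrm X f \<le> 1}"
    have "D * ell2.nrm X f \<le> D * 1" using f D(1) by (intro mult_left_mono) auto
    thus "ell2.nrm X (T f) \<le> D" using D(2)[of f] f by simp
  qed
  from cSUP_upper[OF g this] have "ell2.nrm X (T (\<lambda>x. ?c * f x)) \<le> op_norm (ell2 X) T"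
    unfolding op_norm_def hnorm_ell2 .
  hence "cmod ?c * ell2.nrm X (T f) \<le> op_norm (ell2 X) T" unfolding L_scale[OF T f] ell2.nrm_sc[OF L_in[OF T f]] .
  thus ?thesis using pos by (simp add: norm_divide field_simps)
qed

text \<open>Stated for subsets, since a finite sum in a structure refers to the carrier of the structure.\<close>

lemma sub_abelian_monoid:
  assumes C: "C \<subseteq> L X" "(\<lambda>f\<in>E X. 0) \<in> C" "\<And>S T. S \<in> C \<Longrightarrow> T \<in> C \<Longrightarrow> (\<lambda>f\<in>E X. S f + T f) \<in> C"
  shows "abelian_monoid (bounded_operators (ell2 X)\<lparr>carrier := C\<rparr>)"
proof (rule abelian_monoidI, goal_cases)
  case (3 S T V)
  show ?case by (rule extensionalityI[of _ "E X"]) (simp_all add: bounded_operators_simps add.assoc)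
next
  case (4 S)
  hence "S \<in> extensional (E X)" using C by (auto simp: L_iff)
  thus ?case by (intro extensionalityI[of _ "E X"]) (simp_all add: bounded_operators_simps)
next
  case (5 S T)
  show ?case by (rule extensionalityI[of _ "E X"]) (simp_all add: bounded_operators_simps add.commute)
qed (use C in \<open>simp_all add: bounded_operators_simps\<close>)

lemma finsum_apply:
  assumes C: "C \<subseteq> L X" "(\<lambda>f\<in>E X. 0) \<in> C" "\<And>S T. S \<in> C \<Longrightarrow> T \<in> C \<Longrightarrow> (\<lambda>f\<in>E X. S f + T f) \<in> C"
    and T: "\<And>i. i \<in> I \<Longrightarrow> T i \<in> C" and f: "f \<in> E X"
  shows "finsum (bounded_operators (ell2 X)\<lparr>carrier := C\<rparr>) T I f = (\<Sum>i\<in>I. T i f)"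
proof -
  interpret B: abelian_monoid "bounded_operators (ell2 X)\<lparr>carrier := C\<rparr>" by (rule sub_abelian_monoid[OF C])
  show ?thesis using T
  proof (induction I rule: infinite_finite_induct)
    case (infinite I)
    thus ?case unfolding B.finsum_infinite[OF infinite(1)] sum.infinite[OF infinite(1)] by (simp add: bounded_operators_simps f)
  next
    case empty
    show ?case unfolding B.finsum_empty by (simp add: bounded_operators_simps f)
  next
    case (insert i I)
    have "finsum (bounded_operators (ell2 X)\<lparr>carrier := C\<rparr>) T (insert i I) = T i \<oplus>\<^bsub>bounded_operators (ell2 X)\<lparr>carrier := C\<rparr>\<^esub> finsum (bounded_operators (ell2 X)\<lparr>carrier := C\<rparr>) T I"
      by (rule B.finsum_insert) (use insert in auto)
    hence "finsum (bounded_operators (ell2 X)\<lparr>carrier := C\<rparr>) T (insert i I) f = T i f + finsum (bounded_operators (ell2 X)\<lparr>carrier := C\<rparr>) T I f"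
      by (simp add: bounded_operators_simps f)
    also have "finsum (bounded_operators (ell2 X)\<lparr>carrier := C\<rparr>) T I f = (\<Sum>i\<in>I. T i f)" by (rule insert.IH) (use insert in auto)
    finally show ?case unfolding sum.insert[OF insert(1,2)] .
  qed
qed

lemma L_carrier: "bounded_operators (ell2 X)\<lparr>carrier := L X\<rparr> = bounded_operators (ell2 X)"
  by (simp add: bounded_operators_def)

lemma abelian_group_L: "abelian_group (bounded_operators (ell2 X))"
proof (rule abelian_groupI, goal_cases)
  case (3 S T V)
  show ?case by (rule extensionalityI[of _ "E X"]) (simp_all add: bounded_operators_simps add.assoc)
next
  case (4 S T)
  show ?case by (rule extensionalityI[of _ "E X"]) (simp_all add: bounded_operators_simps add.commute)
next
  case (5 S)
  hence "S \<in> extensional (E X)" by (simp add: bounded_operators_simps L_ext)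
  thus ?case by (intro extensionalityI[of _ "E X"]) (simp_all add: bounded_operators_simps)
next
  case (6 S)
  hence S: "S \<in> L X" by (simp add: bounded_operators_simps)
  have "(\<lambda>f\<in>E X. (\<lambda>f\<in>E X. \<lambda>x. (-1) * S f x) f + S f) = (\<lambda>f\<in>E X. 0)"
    by (rule extensionalityI[of _ "E X"]) (simp_all add: fun_eq_iff)
  thus ?case using L_smult[OF S, of "-1"] by (intro bexI[of _ "\<lambda>f\<in>E X. \<lambda>x. (-1) * S f x"]) (simp_all only: bounded_operators_simps)
qed (simp_all add: bounded_operators_simps L_plus L_null)

lemma L_minus_apply:
  assumes S: "S \<in> L X" and T: "T \<in> L X" and f: "f \<in> E X"
  shows "S \<ominus>\<^bsub>bounded_operators (ell2 X)\<^esub> T \<in> L X" "(S \<ominus>\<^bsub>bounded_operators (ell2 X)\<^esub> T) f = S f - T f"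
proof -
  interpret B: abelian_group "bounded_operators (ell2 X)" by (rule abelian_group_L)
  have ST: "S \<in> carrier (bounded_operators (ell2 X))" "T \<in> carrier (bounded_operators (ell2 X))"
    using S T by (simp_all add: bounded_operators_simps)
  show "S \<ominus>\<^bsub>bounded_operators (ell2 X)\<^esub> T \<in> L X" using B.minus_closed[OF ST] by (simp only: bounded_operators_simps)
  have "\<ominus>\<^bsub>bounded_operators (ell2 X)\<^esub> T \<oplus>\<^bsub>bounded_operators (ell2 X)\<^esub> T = \<zero>\<^bsub>bounded_operators (ell2 X)\<^esub>" by (rule B.l_neg[OF ST(2)])
  from fun_cong[OF this, of f] have "(\<ominus>\<^bsub>bounded_operators (ell2 X)\<^esub> T) f + T f = 0" by (simp only: bounded_operators_simps restrict_apply'[OF f])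
  hence "(\<ominus>\<^bsub>bounded_operators (ell2 X)\<^esub> T) f = - T f" by (simp only: eq_neg_iff_add_eq_0)
  moreover have "(S \<ominus>\<^bsub>bounded_operators (ell2 X)\<^esub> T) f = S f + (\<ominus>\<^bsub>bounded_operators (ell2 X)\<^esub> T) f"
    by (simp only: a_minus_def bounded_operators_simps restrict_apply'[OF f])
  ultimately show "(S \<ominus>\<^bsub>bounded_operators (ell2 X)\<^esub> T) f = S f - T f" by (simp only: diff_conv_add_uminus)
qed

section \<open>The reduced group C*-algebra\<close>

context group
begin

text \<open>The left translations without the extensionality convention, their finite combinations, and the set of
  operators approximated by the latter, with the operator norm spelled out as a bound.\<close>

definition tl :: "'a \<Rightarrow> ('a \<Rightarrow> complex) \<Rightarrow> 'a \<Rightarrow> complex"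
  where "tl g f = (\<lambda>x. if x \<in> carrier G then f (inv g \<otimes> x) else 0)"

definition comb :: "'a set \<Rightarrow> ('a \<Rightarrow> complex) \<Rightarrow> ('a \<Rightarrow> complex) \<Rightarrow> 'a \<Rightarrow> complex"
  where "comb F c f = (\<lambda>x. \<Sum>g\<in>F. c g * tl g f x)"

definition red :: "(('a \<Rightarrow> complex) \<Rightarrow> 'a \<Rightarrow> complex) set"
  where "red = {T \<in> L (carrier G). \<forall>e>0. \<exists>F c. finite F \<and> F \<subseteq> carrier G
    \<and> (\<forall>f\<in>E (carrier G). ell2.nrm (carrier G) (T f - comb F c f) \<le> e * ell2.nrm (carrier G) f)}"

lemma translate_bij: "g \<in> carrier G \<Longrightarrow> bij_betw (\<lambda>x. g \<otimes> x) (carrier G) (carrier G)"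
  by (rule bij_betw_byWitness[where f' = "\<lambda>x. inv g \<otimes> x"]) (auto simp: m_assoc[symmetric])

lemma cinner_tl:
  assumes g: "g \<in> carrier G"
  shows "cinner (ell2 (carrier G)) (tl g f) h = cinner (ell2 (carrier G)) f (tl (inv g) h)"
proof -
  have "cinner (ell2 (carrier G)) (tl g f) h = (\<Sum>\<^sub>\<infinity>x\<in>carrier G. f (inv g \<otimes> x) * cnj (h x))"
    unfolding cinner_ell2 by (rule infsum_cong) (simp add: tl_def)
  also have "\<dots> = (\<Sum>\<^sub>\<infinity>x\<in>carrier G. f (inv g \<otimes> (g \<otimes> x)) * cnj (h (g \<otimes> x)))"
    by (rule infsum_reindex_bij_betw[OF translate_bij[OF g], symmetric])
  also have "\<dots> = cinner (ell2 (carrier G)) f (tl (inv g) h)"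
    unfolding cinner_ell2 by (rule infsum_cong) (use g in \<open>simp add: tl_def m_assoc[symmetric]\<close>)
  finally show ?thesis .
qed

lemma tl_in: assumes g: "g \<in> carrier G" and f: "f \<in> E (carrier G)" shows "tl g f \<in> E (carrier G)"
proof -
  have "(\<lambda>x. (cmod (f (inv g \<otimes> x)))\<^sup>2) summable_on carrier G \<longleftrightarrow> (\<lambda>x. (cmod (f x))\<^sup>2) summable_on carrier G"
    by (rule summable_on_reindex_bij_betw[OF translate_bij]) (use g in simp)
  hence "(\<lambda>x. (cmod (f (inv g \<otimes> x)))\<^sup>2) summable_on carrier G" using f by (simp add: E_iff)
  thus ?thesis unfolding E_iff tl_def by (auto cong: summable_on_cong)
qed

lemma tl_tl: "g \<in> carrier G \<Longrightarrow> h \<in> carrier G \<Longrightarrow> tl g (tl h f) = tl (g \<otimes> h) f"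
  by (rule ext) (simp add: tl_def inv_mult_group m_assoc)

lemma tl_one: "f \<in> E (carrier G) \<Longrightarrow> tl \<one> f = f"
  by (rule ext) (simp add: tl_def E_outside)

lemma tl_\<delta>: "g \<in> carrier G \<Longrightarrow> x \<in> carrier G \<Longrightarrow> tl g (\<delta> x) = \<delta> (g \<otimes> x)"
  by (rule ext) (auto simp: tl_def \<delta>_def m_assoc[symmetric] inv_solve_left)

lemma nrm_tl:
  assumes g: "g \<in> carrier G" and f: "f \<in> E (carrier G)"
  shows "ell2.nrm (carrier G) (tl g f) = ell2.nrm (carrier G) f"
  unfolding ell2.nrm_def cinner_tl[OF g] tl_tl[OF inv_closed[OF g] g] l_inv[OF g] tl_one[OF f] ..

lemma left_regular_apply: "f \<in> E (carrier G) \<Longrightarrow> left_regular G g f = tl g f"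
  by (simp add: left_regular_def tl_def)

lemma left_regular_L: assumes g: "g \<in> carrier G" shows "left_regular G g \<in> L (carrier G)"
proof (rule LI[of _ _ 1])
  fix f h :: "'a \<Rightarrow> complex" and c assume f: "f \<in> E (carrier G)"
  show "left_regular G g f \<in> E (carrier G)" unfolding left_regular_apply[OF f] by (rule tl_in[OF g f])
  show "left_regular G g (\<lambda>x. c * f x) = (\<lambda>x. c * left_regular G g f x)"
    unfolding left_regular_apply[OF f] left_regular_apply[OF E_scale[OF f]] by (rule ext) (simp add: tl_def)
  show "ell2.nrm (carrier G) (left_regular G g f) \<le> 1 * ell2.nrm (carrier G) f"
    unfolding left_regular_apply[OF f] nrm_tl[OF g f] by simp
  assume h: "h \<in> E (carrier G)"
  show "left_regular G g (f + h) = left_regular G g f + left_regular G g h"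
    unfolding left_regular_apply[OF f] left_regular_apply[OF h] left_regular_apply[OF E_add[OF f h]]
    by (rule ext) (simp add: tl_def)
qed (simp add: left_regular_def)

lemma comb_eq: "comb F c f = (\<Sum>g\<in>F. (\<lambda>x. c g * tl g f x))"
  by (rule ext) (simp add: comb_def sum_fun_apply)

lemma comb_in: "F \<subseteq> carrier G \<Longrightarrow> f \<in> E (carrier G) \<Longrightarrow> comb F c f \<in> E (carrier G)"
  unfolding comb_eq by (rule ell2.sum_in) (rule E_scale, rule tl_in, blast)

lemma carrier_reduced: "carrier (reduced_group_algebra G) = red"
proof -
  let ?X = "carrier G" and ?B = "bounded_operators (ell2 (carrier G))"
  interpret B: abelian_group ?B by (rule abelian_group_L)
  define P where "P F c = (\<Oplus>\<^bsub>?B\<^esub>g\<in>F. c g \<odot>\<^bsub>?B\<^esub> left_regular G g)" for F and c :: "'a \<Rightarrow> complex"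
  have tm: "c \<odot>\<^bsub>?B\<^esub> left_regular G g \<in> L ?X" if "g \<in> ?X" for c g
    unfolding bounded_operators_simps by (rule L_smult[OF left_regular_L[OF that]])
  have PL: "P F c \<in> L ?X" if "F \<subseteq> ?X" for F c
  proof -
    have "P F c \<in> carrier ?B" unfolding P_def
      by (rule B.finsum_closed) (use tm that in \<open>auto simp: bounded_operators_simps(1)\<close>)
    thus ?thesis unfolding bounded_operators_simps .
  qed
  have Pf: "P F c f = comb F c f" if F: "F \<subseteq> ?X" and f: "f \<in> E ?X" for F c f
  proof -
    have "P F c f = finsum (?B\<lparr>carrier := L ?X\<rparr>) (\<lambda>g. c g \<odot>\<^bsub>?B\<^esub> left_regular G g) F f" unfolding P_def L_carrier ..
    also have "\<dots> = (\<Sum>g\<in>F. (c g \<odot>\<^bsub>?B\<^esub> left_regular G g) f)"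
      by (rule finsum_apply[OF order_refl L_null L_plus tm f]) (use F in blast)+
    also have "\<dots> = comb F c f" unfolding comb_eq bounded_operators_simps restrict_apply'[OF f] left_regular_apply[OF f] ..
    finally show ?thesis .
  qed
  have carr: "carrier (reduced_group_algebra G) = {T \<in> L ?X. \<forall>e>0. \<exists>F c. finite F \<and> F \<subseteq> ?X \<and> op_norm (ell2 ?X) (T \<ominus>\<^bsub>?B\<^esub> P F c) < e}"
    by (simp add: reduced_group_algebra_def Let_def P_def bounded_operators_simps(1))
  show ?thesis unfolding carr
  proof (intro antisym subsetI)
    fix T assume "T \<in> {T \<in> L ?X. \<forall>e>0. \<exists>F c. finite F \<and> F \<subseteq> ?X \<and> op_norm (ell2 ?X) (T \<ominus>\<^bsub>?B\<^esub> P F c) < e}"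
    hence T: "T \<in> L ?X" and ap: "\<And>e. e > 0 \<Longrightarrow> \<exists>F c. finite F \<and> F \<subseteq> ?X \<and> op_norm (ell2 ?X) (T \<ominus>\<^bsub>?B\<^esub> P F c) < e" by blast+
    show "T \<in> red" unfolding red_def
    proof (intro CollectI conjI T allI impI)
      fix e :: real assume "e > 0"
      then obtain F c where F: "finite F" "F \<subseteq> ?X" and lt: "op_norm (ell2 ?X) (T \<ominus>\<^bsub>?B\<^esub> P F c) < e" using ap by blast
      have "ell2.nrm ?X (T f - comb F c f) \<le> e * ell2.nrm ?X f" if f: "f \<in> E ?X" for f
      proof -
        note M = L_minus_apply[OF T PL[OF F(2), of c] f]
        have "ell2.nrm ?X (T f - comb F c f) \<le> op_norm (ell2 ?X) (T \<ominus>\<^bsub>?B\<^esub> P F c) * ell2.nrm ?X f"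
          using op_norm_bound[OF M(1) f] unfolding M(2) Pf[OF F(2) f] .
        also have "\<dots> \<le> e * ell2.nrm ?X f" using lt ell2.nrm_nonneg[OF f] by (intro mult_right_mono) auto
        finally show ?thesis .
      qed
      thus "\<exists>F c. finite F \<and> F \<subseteq> ?X \<and> (\<forall>f\<in>E ?X. ell2.nrm ?X (T f - comb F c f) \<le> e * ell2.nrm ?X f)" using F by blast
    qed
  next
    fix T assume "T \<in> red"
    hence T: "T \<in> L ?X" and ap: "\<And>e. e > 0 \<Longrightarrow> \<exists>F c. finite F \<and> F \<subseteq> ?X \<and> (\<forall>f\<in>E ?X. ell2.nrm ?X (T f - comb F c f) \<le> e * ell2.nrm ?X f)"
      unfolding red_def by blast+
    show "T \<in> {T \<in> L ?X. \<forall>e>0. \<exists>F c. finite F \<and> F \<subseteq> ?X \<and> op_norm (ell2 ?X) (T \<ominus>\<^bsub>?B\<^esub> P F c) < e}"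
    proof (intro CollectI conjI T allI impI)
      fix e :: real assume e: "e > 0"
      then obtain F c where F: "finite F" "F \<subseteq> ?X" and le: "\<forall>f\<in>E ?X. ell2.nrm ?X (T f - comb F c f) \<le> e / 2 * ell2.nrm ?X f"
        using ap[of "e / 2"] by auto
      have "op_norm (ell2 ?X) (T \<ominus>\<^bsub>?B\<^esub> P F c) \<le> e / 2"
      proof (rule op_norm_le)
        fix f assume f: "f \<in> E ?X"
        show "ell2.nrm ?X ((T \<ominus>\<^bsub>?B\<^esub> P F c) f) \<le> e / 2 * ell2.nrm ?X f"
          unfolding L_minus_apply(2)[OF T PL[OF F(2), of c] f] Pf[OF F(2) f] using le f by blast
      qed (use e in simp)
      hence "op_norm (ell2 ?X) (T \<ominus>\<^bsub>?B\<^esub> P F c) < e" using e by simp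
      thus "\<exists>F c. finite F \<and> F \<subseteq> ?X \<and> op_norm (ell2 ?X) (T \<ominus>\<^bsub>?B\<^esub> P F c) < e" using F by blast
    qed
  qed
qed

lemma reduced_eq: "reduced_group_algebra G = bounded_operators (ell2 (carrier G))\<lparr>carrier := red\<rparr>"
  by (rule star_algebra.equality) (simp_all only: carrier_reduced, simp_all add: reduced_group_algebra_def Let_def)

end

section \<open>Stable finiteness\<close>

context group
begin

lemma redD: "T \<in> red \<Longrightarrow> T \<in> L (carrier G)"
  "T \<in> red \<Longrightarrow> e > 0 \<Longrightarrow> \<exists>F c. finite F \<and> F \<subseteq> carrier G
    \<and> (\<forall>f\<in>E (carrier G). ell2.nrm (carrier G) (T f - comb F c f) \<le> e * ell2.nrm (carrier G) f)"
  by (auto simp: red_def)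

lemma redI:
  assumes "T \<in> L (carrier G)" "\<And>e. e > 0 \<Longrightarrow> \<exists>F c. finite F \<and> F \<subseteq> carrier G
    \<and> (\<forall>f\<in>E (carrier G). ell2.nrm (carrier G) (T f - comb F c f) \<le> e * ell2.nrm (carrier G) f)"
  shows "T \<in> red"
  using assms by (simp add: red_def)

lemma red_finite:
  assumes "T \<in> L (carrier G)" "finite F" "F \<subseteq> carrier G" "\<And>f. f \<in> E (carrier G) \<Longrightarrow> T f = comb F c f"
  shows "T \<in> red"
proof (rule redI[OF assms(1)])
  fix e :: real assume e: "e > 0"
  have "ell2.nrm (carrier G) (T f - comb F c f) \<le> e * ell2.nrm (carrier G) f" if f: "f \<in> E (carrier G)" for f
    unfolding assms(4)[OF f] diff_self ell2.nrm_zero using e ell2.nrm_nonneg[OF f] by simp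
  thus "\<exists>F c. finite F \<and> F \<subseteq> carrier G
    \<and> (\<forall>f\<in>E (carrier G). ell2.nrm (carrier G) (T f - comb F c f) \<le> e * ell2.nrm (carrier G) f)"
    using assms(2,3) by blast
qed

lemma red_zero: "(\<lambda>f\<in>E (carrier G). 0) \<in> red"
  by (rule red_finite[OF L_null, of "{}"]) (simp_all only: finite.emptyI empty_subsetI restrict_apply', simp add: comb_eq)

lemma red_left_regular: assumes g: "g \<in> carrier G" shows "left_regular G g \<in> red"
  by (rule red_finite[OF left_regular_L[OF g], of "{g}" "\<lambda>_. 1"]) (use g in \<open>simp_all add: left_regular_apply comb_def\<close>)

lemma comb_extend:
  assumes "finite F'" "F \<subseteq> F'" shows "comb F c f = comb F' (\<lambda>g. if g \<in> F then c g else 0) f"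
  unfolding comb_def by (rule ext, rule sum.mono_neutral_cong_left) (use assms in auto)

lemma red_add: assumes S: "S \<in> red" and T: "T \<in> red" shows "(\<lambda>f\<in>E (carrier G). S f + T f) \<in> red"
proof (rule redI[OF L_plus[OF redD(1)[OF S] redD(1)[OF T]]])
  let ?X = "carrier G"
  fix e :: real assume "e > 0"
  hence e: "e / 2 > 0" by simp
  obtain F c where F: "finite F" "F \<subseteq> ?X" "\<forall>f\<in>E ?X. ell2.nrm ?X (S f - comb F c f) \<le> e / 2 * ell2.nrm ?X f"
    using redD(2)[OF S e] by blast
  obtain F' c' where F': "finite F'" "F' \<subseteq> ?X" "\<forall>f\<in>E ?X. ell2.nrm ?X (T f - comb F' c' f) \<le> e / 2 * ell2.nrm ?X f"
    using redD(2)[OF T e] by blast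
  let ?c = "\<lambda>g. (if g \<in> F then c g else 0) + (if g \<in> F' then c' g else 0)"
  have "ell2.nrm ?X ((\<lambda>f\<in>E (carrier G). S f + T f) f - comb (F \<union> F') ?c f) \<le> e * ell2.nrm ?X f" if f: "f \<in> E ?X" for f
  proof -
    have "comb (F \<union> F') ?c f = comb (F \<union> F') (\<lambda>g. if g \<in> F then c g else 0) f + comb (F \<union> F') (\<lambda>g. if g \<in> F' then c' g else 0) f"
      by (rule ext) (simp add: comb_def distrib_right sum.distrib)
    also have "\<dots> = comb F c f + comb F' c' f" using F(1) F'(1) by (simp only: comb_extend[of "F \<union> F'" F] comb_extend[of "F \<union> F'" F'] finite_UnI Un_upper1 Un_upper2)
    finally have cm: "comb (F \<union> F') ?c f = comb F c f + comb F' c' f" .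
    have m: "S f - comb F c f \<in> E ?X" "T f - comb F' c' f \<in> E ?X"
      using redD(1)[OF S] redD(1)[OF T] f F F' by (auto intro!: ell2.diff_in comb_in)
    have "(\<lambda>f\<in>E (carrier G). S f + T f) f - comb (F \<union> F') ?c f = (S f - comb F c f) + (T f - comb F' c' f)"
      unfolding restrict_apply'[OF f] cm by (rule add_diff_add)
    hence "ell2.nrm ?X ((\<lambda>f\<in>E (carrier G). S f + T f) f - comb (F \<union> F') ?c f) \<le> ell2.nrm ?X (S f - comb F c f) + ell2.nrm ?X (T f - comb F' c' f)"
      using ell2.nrm_triangle[OF m] by (simp only:)
    also have "\<dots> \<le> e / 2 * ell2.nrm ?X f + e / 2 * ell2.nrm ?X f" by (rule add_mono[OF F(3)[rule_format, OF f] F'(3)[rule_format, OF f]])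
    finally show ?thesis by simp
  qed
  thus "\<exists>F c. finite F \<and> F \<subseteq> ?X \<and> (\<forall>f\<in>E ?X. ell2.nrm ?X ((\<lambda>f\<in>E (carrier G). S f + T f) f - comb F c f) \<le> e * ell2.nrm ?X f)"
    using F F' by (intro exI[of _ "F \<union> F'"] exI[of _ ?c]) simp
qed

text \<open>The convolution of two finitely supported functions collects the products by their value in the group.\<close>

lemma comb_comb:
  assumes F: "finite F" "F \<subseteq> carrier G" and F': "finite F'" "F' \<subseteq> carrier G"
  shows "\<exists>H d. finite H \<and> H \<subseteq> carrier G \<and> (\<forall>f. comb F c (comb F' c' f) = comb H d f)"
proof -
  let ?p = "\<lambda>(g, h). g \<otimes> h"
  define H where "H = ?p ` (F \<times> F')"
  define d where "d k = (\<Sum>p\<in>{p \<in> F \<times> F'. ?p p = k}. c (fst p) * c' (snd p))" for k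
  have "comb F c (comb F' c' f) x = comb H d f x" for f x
  proof -
    have "comb F c (comb F' c' f) x = (\<Sum>g\<in>F. \<Sum>h\<in>F'. c g * c' h * tl g (tl h f) x)"
      unfolding comb_def by (rule sum.cong[OF refl]) (simp add: tl_def sum_distrib_left mult.assoc)
    also have "\<dots> = (\<Sum>g\<in>F. \<Sum>h\<in>F'. c g * c' h * tl (g \<otimes> h) f x)"
      by (intro sum.cong refl) (use F F' in \<open>simp add: tl_tl subsetD\<close>)
    also have "\<dots> = (\<Sum>p\<in>F \<times> F'. c (fst p) * c' (snd p) * tl (?p p) f x)" by (simp add: sum.cartesian_product case_prod_beta)
    also have "\<dots> = (\<Sum>k\<in>H. \<Sum>p\<in>{p \<in> F \<times> F'. ?p p = k}. c (fst p) * c' (snd p) * tl (?p p) f x)"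
      unfolding H_def by (rule sum.image_gen) (use F F' in simp)
    also have "\<dots> = (\<Sum>k\<in>H. d k * tl k f x)"
      unfolding d_def sum_distrib_right by (intro sum.cong refl) auto
    finally show ?thesis by (simp add: comb_def)
  qed
  hence "comb F c (comb F' c' f) = comb H d f" for f by (rule ext)
  moreover have "finite H" "H \<subseteq> carrier G" unfolding H_def using F F' by auto
  ultimately show ?thesis by blast
qed

lemma red_compose: assumes S: "S \<in> red" and T: "T \<in> red" shows "compose (E (carrier G)) S T \<in> red"
proof (rule redI[OF L_compose[OF redD(1)[OF S] redD(1)[OF T]]])
  let ?X = "carrier G"
  note SL = redD(1)[OF S] and TL = redD(1)[OF T]
  fix e :: real assume e: "e > 0"
  obtain C where C: "0 \<le> C" "\<And>f. f \<in> E ?X \<Longrightarrow> ell2.nrm ?X (S f) \<le> C * ell2.nrm ?X f" using SL by (rule LE) blast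
  obtain D where D: "0 \<le> D" "\<And>f. f \<in> E ?X \<Longrightarrow> ell2.nrm ?X (T f) \<le> D * ell2.nrm ?X f" using TL by (rule LE) blast
  have CD: "0 < C + D + 1" using C(1) D(1) by simp
  define r where "r = min 1 (e / (C + D + 1))"
  have r: "0 < r" "r \<le> 1" using e CD by (simp_all add: r_def)
  have "(C + D + 1) * r \<le> (C + D + 1) * (e / (C + D + 1))" using CD by (intro mult_left_mono) (simp_all add: r_def)
  hence rE: "(C + D + 1) * r \<le> e" using CD by simp
  obtain F c where F: "finite F" "F \<subseteq> ?X" "\<forall>f\<in>E ?X. ell2.nrm ?X (S f - comb F c f) \<le> r * ell2.nrm ?X f"
    using redD(2)[OF S r(1)] by blast
  obtain F' c' where F': "finite F'" "F' \<subseteq> ?X" "\<forall>f\<in>E ?X. ell2.nrm ?X (T f - comb F' c' f) \<le> r * ell2.nrm ?X f"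
    using redD(2)[OF T r(1)] by blast
  obtain H d where H: "finite H" "H \<subseteq> ?X" "\<forall>f. comb F c (comb F' c' f) = comb H d f" using comb_comb[OF F(1,2) F'(1,2), of c c'] by (elim exE conjE)
  have main: "ell2.nrm ?X (compose (E ?X) S T f - comb H d f) \<le> e * ell2.nrm ?X f" if f: "f \<in> E ?X" for f
  proof -
    define v where "v = T f - comb F' c' f"
    define p where "p = comb F' c' f"
    have p: "p \<in> E ?X" unfolding p_def by (rule comb_in[OF F'(2) f])
    have v: "v \<in> E ?X" unfolding v_def by (rule ell2.diff_in[OF L_in[OF TL f] comb_in[OF F'(2) f]])
    have q: "S p - comb F c p \<in> E ?X" by (rule ell2.diff_in[OF L_in[OF SL p] comb_in[OF F(2) p]])
    have vn: "ell2.nrm ?X v \<le> r * ell2.nrm ?X f" unfolding v_def by (rule F'(3)[rule_format, OF f])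
    have pv: "T f - v = p" unfolding v_def p_def by (simp only: diff_diff_eq2 add_diff_cancel_left')
    have "ell2.nrm ?X p \<le> ell2.nrm ?X (T f) + ell2.nrm ?X v" using ell2.nrm_triangle_diff[OF L_in[OF TL f] v] unfolding pv .
    also have "\<dots> \<le> D * ell2.nrm ?X f + 1 * ell2.nrm ?X f"
      by (rule add_mono[OF D(2)[OF f] order_trans[OF vn mult_right_mono[OF r(2) ell2.nrm_nonneg[OF f]]]])
    finally have pn: "ell2.nrm ?X p \<le> (D + 1) * ell2.nrm ?X f" by (simp add: distrib_right)
    have "v + p = T f" unfolding v_def p_def by (rule diff_add_cancel)
    moreover have "comb H d f = comb F c p" unfolding p_def by (rule H(3)[rule_format, symmetric])
    ultimately have "compose (E ?X) S T f - comb H d f = S (v + p) - comb F c p" by (simp only: compose_eq[OF f])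
    also have "\<dots> = S v + (S p - comb F c p)" unfolding L_add[OF SL v p] by (rule add_diff_eq[symmetric])
    finally have dec: "compose (E ?X) S T f - comb H d f = S v + (S p - comb F c p)" .
    have "ell2.nrm ?X (compose (E ?X) S T f - comb H d f) \<le> ell2.nrm ?X (S v) + ell2.nrm ?X (S p - comb F c p)"
      unfolding dec by (rule ell2.nrm_triangle[OF L_in[OF SL v] q])
    also have "\<dots> \<le> C * (r * ell2.nrm ?X f) + r * ((D + 1) * ell2.nrm ?X f)"
    proof (rule add_mono)
      show "ell2.nrm ?X (S v) \<le> C * (r * ell2.nrm ?X f)" by (rule order_trans[OF C(2)[OF v] mult_left_mono[OF vn C(1)]])
      have "ell2.nrm ?X (S p - comb F c p) \<le> r * ell2.nrm ?X p" by (rule F(3)[rule_format, OF p])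
      also have "\<dots> \<le> r * ((D + 1) * ell2.nrm ?X f)" using pn r(1) by (intro mult_left_mono) auto
      finally show "ell2.nrm ?X (S p - comb F c p) \<le> r * ((D + 1) * ell2.nrm ?X f)" .
    qed
    also have "\<dots> = (C + D + 1) * r * ell2.nrm ?X f" by (simp add: algebra_simps)
    also have "\<dots> \<le> e * ell2.nrm ?X f" by (rule mult_right_mono[OF rE ell2.nrm_nonneg[OF f]])
    finally show ?thesis .
  qed
  show "\<exists>F c. finite F \<and> F \<subseteq> ?X \<and> (\<forall>f\<in>E ?X. ell2.nrm ?X (compose (E ?X) S T f - comb F c f) \<le> e * ell2.nrm ?X f)"
    by (intro exI[of _ H] exI[of _ d] conjI H(1,2) ballI main)
qed

abbreviation adjoint :: "(('a \<Rightarrow> complex) \<Rightarrow> 'a \<Rightarrow> complex) \<Rightarrow> ('a \<Rightarrow> complex) \<Rightarrow> 'a \<Rightarrow> complex"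
  where "adjoint \<equiv> adjoint_op (ell2 (carrier G))"

lemma cinner_comb:
  assumes F: "F \<subseteq> carrier G" and f: "f \<in> E (carrier G)" and h: "h \<in> E (carrier G)"
  shows "cinner (ell2 (carrier G)) (comb (m_inv G ` F) (\<lambda>k. cnj (c (inv k))) f) h = cinner (ell2 (carrier G)) f (comb F c h)"
proof -
  let ?X = "carrier G"
  have gX: "g \<in> ?X" if "g \<in> F" for g using that F by blast
  have inj: "inj_on (m_inv G) F" by (rule inj_on_subset[OF inv_inj F])
  have m: "(\<lambda>x. c g * tl g h x) \<in> E ?X" if "g \<in> F" for g by (rule E_scale[OF tl_in[OF gX[OF that] h]])
  have m': "(\<lambda>x. cnj (c g) * tl (inv g) f x) \<in> E ?X" if "g \<in> F" for g
    by (rule E_scale[OF tl_in[OF _ f]]) (use gX[OF that] in simp)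
  have "comb (m_inv G ` F) (\<lambda>k. cnj (c (inv k))) f = (\<Sum>g\<in>F. (\<lambda>x. cnj (c g) * tl (inv g) f x))"
    unfolding comb_eq sum.reindex[OF inj] by (rule sum.cong[OF refl]) (use gX in simp)
  hence "cinner (ell2 ?X) (comb (m_inv G ` F) (\<lambda>k. cnj (c (inv k))) f) h
      = (\<Sum>g\<in>F. cinner (ell2 ?X) (\<lambda>x. cnj (c g) * tl (inv g) f x) h)"
    by (simp only: ell2.b_sum_left[OF m' h])
  also have "\<dots> = (\<Sum>g\<in>F. cinner (ell2 ?X) f (\<lambda>x. c g * tl g h x))"
  proof (rule sum.cong[OF refl])
    fix g assume "g \<in> F"
    note g = gX[OF this]
    show "cinner (ell2 ?X) (\<lambda>x. cnj (c g) * tl (inv g) f x) h = cinner (ell2 ?X) f (\<lambda>x. c g * tl g h x)"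
      unfolding ell2.b_sc_left[OF tl_in[OF inv_closed[OF g] f] h] ell2.b_sc_right[OF f tl_in[OF g h]] cinner_tl[OF inv_closed[OF g]] inv_inv[OF g] ..
  qed
  also have "\<dots> = cnj (\<Sum>g\<in>F. cinner (ell2 ?X) (\<lambda>x. c g * tl g h x) f)"
    unfolding cnj_sum by (rule sum.cong[OF refl]) (rule ell2.b_commute[OF f m])
  also have "\<dots> = cnj (cinner (ell2 ?X) (comb F c h) f)" 
  proof -
    have "cinner (ell2 ?X) (\<Sum>g\<in>F. (\<lambda>x. c g * tl g h x)) f = (\<Sum>g\<in>F. cinner (ell2 ?X) (\<lambda>x. c g * tl g h x) f)"
      by (rule ell2.b_sum_left[OF m f])
    thus ?thesis unfolding comb_eq by (simp only:)
  qed
  also have "\<dots> = cinner (ell2 ?X) f (comb F c h)" by (rule ell2.b_commute[OF f comb_in[OF F h], symmetric])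
  finally show ?thesis .
qed

lemma red_adjoint: assumes T: "T \<in> red" shows "adjoint T \<in> red"
proof (rule redI[OF adjoint_op(1)[OF redD(1)[OF T]]])
  let ?X = "carrier G"
  note TL = redD(1)[OF T]
  fix e :: real assume e: "e > 0"
  obtain F c where F: "finite F" "F \<subseteq> ?X" "\<forall>f\<in>E ?X. ell2.nrm ?X (T f - comb F c f) \<le> e * ell2.nrm ?X f"
    using redD(2)[OF T e] by blast
  let ?F = "m_inv G ` F" and ?c = "\<lambda>k. cnj (c (inv k))"
  have F': "?F \<subseteq> ?X" using F(2) by auto
  have "ell2.nrm ?X (adjoint T f - comb ?F ?c f) \<le> e * ell2.nrm ?X f" if f: "f \<in> E ?X" for f
  proof -
    define v where "v = adjoint T f - comb ?F ?c f"
    note a = L_in[OF adjoint_op(1)[OF TL] f] and b = comb_in[OF F' f]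
    have v: "v \<in> E ?X" unfolding v_def by (rule ell2.diff_in[OF a b])
    have Dv: "T v - comb F c v \<in> E ?X" by (rule ell2.diff_in[OF L_in[OF TL v] comb_in[OF F(2) v]])
    have "cinner (ell2 ?X) v v = cinner (ell2 ?X) (adjoint T f) v - cinner (ell2 ?X) (comb ?F ?c f) v"
      by (subst v_def) (rule ell2.b_diff_left[OF a b v])
    also have "\<dots> = cinner (ell2 ?X) f (T v - comb F c v)"
      unfolding adjoint_op(2)[OF TL f v] cinner_comb[OF F(2) f v] by (rule ell2.b_diff_right[OF f L_in[OF TL v] comb_in[OF F(2) v], symmetric])
    finally have "(ell2.nrm ?X v)\<^sup>2 = cmod (cinner (ell2 ?X) f (T v - comb F c v))"
      using ell2.b_self[OF v] by (metis abs_of_nonneg norm_of_real zero_le_power2)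
    also have "\<dots> \<le> ell2.nrm ?X f * ell2.nrm ?X (T v - comb F c v)" by (rule ell2.b_bound[OF f Dv])
    also have "\<dots> \<le> ell2.nrm ?X f * (e * ell2.nrm ?X v)" by (rule mult_left_mono[OF F(3)[rule_format, OF v] ell2.nrm_nonneg[OF f]])
    finally have le: "ell2.nrm ?X v * ell2.nrm ?X v \<le> e * ell2.nrm ?X f * ell2.nrm ?X v" by (simp add: power2_eq_square mult_ac)
    have "ell2.nrm ?X v \<le> e * ell2.nrm ?X f"
    proof (cases "ell2.nrm ?X v = 0")
      case False
      hence "0 < ell2.nrm ?X v" using ell2.nrm_nonneg[OF v] by linarith
      with le show ?thesis by (rule mult_right_le_imp_le)
    qed (use e ell2.nrm_nonneg[OF f] in simp)
    thus ?thesis unfolding v_def .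
  qed
  thus "\<exists>F c. finite F \<and> F \<subseteq> ?X \<and> (\<forall>f\<in>E ?X. ell2.nrm ?X (adjoint T f - comb F c f) \<le> e * ell2.nrm ?X f)"
    using F(1) F' by (intro exI[of _ ?F] exI[of _ ?c]) simp
qed

text \<open>Right translations commute with \<open>red\<close>, so its elements are convolutions.\<close>

lemma red_invariant:
  assumes T: "T \<in> red" and xyz: "x \<in> carrier G" "y \<in> carrier G" "z \<in> carrier G"
  shows "T (\<delta> (x \<otimes> z)) (y \<otimes> z) = T (\<delta> x) y"
proof -
  let ?X = "carrier G"
  have "cmod (T (\<delta> (x \<otimes> z)) (y \<otimes> z) - T (\<delta> x) y) \<le> e" if "e > 0" for e
  proof -
    have e: "e / 2 > 0" using that by simp
    obtain F c where F: "finite F" "F \<subseteq> ?X" "\<forall>f\<in>E ?X. ell2.nrm ?X (T f - comb F c f) \<le> e / 2 * ell2.nrm ?X f"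
      using redD(2)[OF T e] by blast
    have near: "cmod (T (\<delta> w) v - comb F c (\<delta> w) v) \<le> e / 2" if w: "w \<in> ?X" for w v
    proof -
      note d = \<delta>_in[OF w]
      have "cmod ((T (\<delta> w) - comb F c (\<delta> w)) v) \<le> ell2.nrm ?X (T (\<delta> w) - comb F c (\<delta> w))"
        by (rule point_le_nrm[OF ell2.diff_in[OF L_in[OF redD(1)[OF T] d] comb_in[OF F(2) d]]])
      also have "\<dots> \<le> e / 2" using F(3)[rule_format, OF d] by (simp add: nrm_\<delta>[OF w])
      finally show ?thesis by simp
    qed
    have "comb F c (\<delta> (x \<otimes> z)) (y \<otimes> z) = comb F c (\<delta> x) y"
      unfolding comb_def
    proof (rule sum.cong[OF refl])
      fix g assume "g \<in> F"
      hence g: "g \<in> ?X" using F by blast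
      have "(y \<otimes> z = g \<otimes> (x \<otimes> z)) = (y = g \<otimes> x)" using g xyz by (simp add: m_assoc[symmetric])
      thus "c g * tl g (\<delta> (x \<otimes> z)) (y \<otimes> z) = c g * tl g (\<delta> x) y" using g xyz by (simp add: tl_\<delta>) (simp add: \<delta>_def)
    qed
    hence "T (\<delta> (x \<otimes> z)) (y \<otimes> z) - T (\<delta> x) y
        = (T (\<delta> (x \<otimes> z)) (y \<otimes> z) - comb F c (\<delta> (x \<otimes> z)) (y \<otimes> z)) - (T (\<delta> x) y - comb F c (\<delta> x) y)" by simp
    hence "cmod (T (\<delta> (x \<otimes> z)) (y \<otimes> z) - T (\<delta> x) y) \<le> cmod (T (\<delta> (x \<otimes> z)) (y \<otimes> z) - comb F c (\<delta> (x \<otimes> z)) (y \<otimes> z)) + cmod (T (\<delta> x) y - comb F c (\<delta> x) y)"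
      by (metis norm_triangle_ineq4)
    also have "\<dots> \<le> e / 2 + e / 2" by (intro add_mono near) (use xyz in auto)
    finally show ?thesis by simp
  qed
  hence "cmod (T (\<delta> (x \<otimes> z)) (y \<otimes> z) - T (\<delta> x) y) \<le> 0" by (rule dense_ge)
  thus ?thesis by simp
qed

text \<open>The rows and the columns of a convolution are rearrangements of each other; this is the trace property.\<close>

lemma nrm_adjoint_\<delta>:
  assumes T: "T \<in> red" and x: "x \<in> carrier G"
  shows "ell2.nrm (carrier G) (adjoint T (\<delta> x)) = ell2.nrm (carrier G) (T (\<delta> x))"
proof -
  let ?X = "carrier G"
  note TL = redD(1)[OF T] and d = \<delta>_in[OF x]
  note a = L_in[OF adjoint_op(1)[OF TL] d] and b = L_in[OF TL d]
  have eq: "cmod (adjoint T (\<delta> x) y) = cmod (T (\<delta> x) (x \<otimes> inv y \<otimes> x))" if y: "y \<in> ?X" for y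
  proof -
    have "adjoint T (\<delta> x) y = cinner (ell2 ?X) (\<delta> x) (T (\<delta> y))"
      using adjoint_op(2)[OF TL d \<delta>_in[OF y]] by (simp only: cinner_\<delta>[OF y])
    also have "\<dots> = cnj (T (\<delta> y) x)" by (rule cinner_\<delta>'[OF x L_in[OF TL \<delta>_in[OF y]]])
    also have "T (\<delta> y) x = T (\<delta> (y \<otimes> (inv y \<otimes> x))) (x \<otimes> (inv y \<otimes> x))" using red_invariant[OF T y x, of "inv y \<otimes> x"] x y by simp
    also have "y \<otimes> (inv y \<otimes> x) = x" using x y by (simp add: m_assoc[symmetric])
    finally show ?thesis using x y by (simp add: m_assoc)
  qed
  have inv: "x \<otimes> inv (x \<otimes> inv y \<otimes> x) \<otimes> x = y" if y: "y \<in> ?X" for y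
  proof -
    have "x \<otimes> inv (x \<otimes> inv y \<otimes> x) = x \<otimes> (inv x \<otimes> (y \<otimes> inv x))" using x y by (simp add: inv_mult_group)
    also have "\<dots> = y \<otimes> inv x" using x y by (simp add: m_assoc[symmetric])
    finally show ?thesis using x y by (simp add: m_assoc)
  qed
  have bij: "bij_betw (\<lambda>y. x \<otimes> inv y \<otimes> x) ?X ?X"
  proof (rule bij_betw_byWitness[where f' = "\<lambda>y. x \<otimes> inv y \<otimes> x"])
    show "\<forall>y\<in>?X. x \<otimes> inv (x \<otimes> inv y \<otimes> x) \<otimes> x = y" "\<forall>y\<in>?X. x \<otimes> inv (x \<otimes> inv y \<otimes> x) \<otimes> x = y"
      by (rule ballI, rule inv, assumption)+
    show "(\<lambda>y. x \<otimes> inv y \<otimes> x) ` ?X \<subseteq> ?X" "(\<lambda>y. x \<otimes> inv y \<otimes> x) ` ?X \<subseteq> ?X"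
      by (intro image_subsetI m_closed inv_closed x, assumption)+
  qed
  have "(ell2.nrm ?X (adjoint T (\<delta> x)))\<^sup>2 = (\<Sum>\<^sub>\<infinity>y\<in>?X. (cmod (T (\<delta> x) (x \<otimes> inv y \<otimes> x)))\<^sup>2)"
    unfolding nrm_sq[OF a] by (rule infsum_cong) (simp only: eq)
  also have "\<dots> = (ell2.nrm ?X (T (\<delta> x)))\<^sup>2" unfolding nrm_sq[OF b] by (rule infsum_reindex_bij_betw[OF bij])
  finally show ?thesis by (rule power2_eq_imp_eq[OF _ ell2.nrm_nonneg[OF a] ell2.nrm_nonneg[OF b]])
qed

end

context group
begin

text \<open>With \<open>v\<close> the image of the \<open>j\<close>-th copy of \<open>\<delta>\<^sub>x\<close> under the adjoint matrix, the squared distance of that copy to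
  the image of \<open>v\<close> is \<open>1 - N j\<close>, where \<open>N j\<close> is the squared length of \<open>v\<close>. These distances add up to 0, because by
  the trace property the \<open>N j\<close> add up to the squared lengths of the columns, which are 1.\<close>

lemma isometry_unitary:
  fixes T :: "nat \<Rightarrow> nat \<Rightarrow> ('a \<Rightarrow> complex) \<Rightarrow> 'a \<Rightarrow> complex"
  assumes T: "\<And>i j. i < k \<Longrightarrow> j < k \<Longrightarrow> T i j \<in> red"
    and iso: "\<And>i j f. i < k \<Longrightarrow> j < k \<Longrightarrow> f \<in> E (carrier G)
      \<Longrightarrow> (\<Sum>l<k. adjoint (T l i) (T l j f)) = (if i = j then f else 0)"
    and i: "i < k" and j: "j < k" and x: "x \<in> carrier G"
  shows "(\<Sum>l<k. T i l (adjoint (T j l) (\<delta> x))) = (if i = j then \<delta> x else 0)"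
proof -
  let ?X = "carrier G" and ?ip = "cinner (ell2 (carrier G))" and ?n = "ell2.nrm (carrier G)"
  have TL: "T i j \<in> L ?X" "adjoint (T i j) \<in> L ?X" if "i < k" "j < k" for i j
    using redD(1)[OF T[OF that]] adjoint_op(1)[OF redD(1)[OF T[OF that]]] by blast+
  have d: "\<delta> x \<in> E ?X" by (rule \<delta>_in[OF x])
  have adj: "?ip (T i j f) g = ?ip f (adjoint (T i j) g)" if ij: "i < k" "j < k" and f: "f \<in> E ?X" and g: "g \<in> E ?X" for i j f g
  proof -
    have "?ip (T i j f) g = cnj (?ip g (T i j f))" by (rule ell2.b_commute[OF L_in[OF TL(1)[OF ij] f] g])
    also have "?ip g (T i j f) = ?ip (adjoint (T i j) g) f" by (rule adjoint_op(2)[OF TL(1)[OF ij] g f, symmetric])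
    also have "cnj \<dots> = ?ip f (adjoint (T i j) g)" by (rule ell2.b_commute[OF f L_in[OF TL(2)[OF ij] g], symmetric])
    finally show ?thesis .
  qed
  have sum_right: "?ip f (\<Sum>l<k. h l) = (\<Sum>l<k. ?ip f (h l))" if f: "f \<in> E ?X" and h: "\<And>l. l < k \<Longrightarrow> h l \<in> E ?X" for f h
  proof -
    have "?ip f (\<Sum>l<k. h l) = cnj (?ip (\<Sum>l<k. h l) f)" by (rule ell2.b_commute[OF f ell2.sum_in]) (use h in simp)
    also have "?ip (\<Sum>l<k. h l) f = (\<Sum>l<k. ?ip (h l) f)" by (rule ell2.b_sum_left[OF _ f]) (use h in simp)
    also have "cnj \<dots> = (\<Sum>l<k. ?ip f (h l))" unfolding cnj_sum by (rule sum.cong[OF refl]) (use h ell2.b_commute[OF f] in simp)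
    finally show ?thesis .
  qed
  have gram: "(\<Sum>i<k. ?ip (T i l f) (T i m g)) = (if l = m then ?ip f g else 0)"
    if l: "l < k" and m: "m < k" and f: "f \<in> E ?X" and g: "g \<in> E ?X" for l m f g
  proof -
    have Tg: "T i m g \<in> E ?X" "adjoint (T i l) (T i m g) \<in> E ?X" if "i < k" for i
      by (rule L_in[OF TL(1)[OF that m] g], rule L_in[OF TL(2)[OF that l] L_in[OF TL(1)[OF that m] g]])
    have "(\<Sum>i<k. ?ip (T i l f) (T i m g)) = (\<Sum>i<k. ?ip f (adjoint (T i l) (T i m g)))"
      by (rule sum.cong[OF refl], rule adj[OF _ l f Tg(1)]) simp_all
    also have "\<dots> = ?ip f (\<Sum>i<k. adjoint (T i l) (T i m g))" by (rule sum_right[OF f Tg(2), symmetric])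
    also have "\<dots> = (if l = m then ?ip f g else 0)" unfolding iso[OF l m g] using ell2.b_zero_right[OF f] by (cases "l = m") (simp_all only: if_True if_False simp_thms)
    finally show ?thesis .
  qed
  define v where "v j l = adjoint (T j l) (\<delta> x)" for j l
  have v: "v j l \<in> E ?X" if "j < k" "l < k" for j l unfolding v_def by (rule L_in[OF TL(2)[OF that] d])
  define w where "w i j = (\<Sum>l<k. T i l (v j l))" for i j
  have Tv: "T i l (v j m) \<in> E ?X" if "i < k" "j < k" "l < k" "m < k" for i j l m
    by (rule L_in[OF TL(1)[OF that(1,3)] v[OF that(2,4)]])
  have w: "w i j \<in> E ?X" if "i < k" "j < k" for i j unfolding w_def by (rule ell2.sum_in, rule Tv) (use that in simp_all)
  define N where "N j = (\<Sum>l<k. (?n (v j l))\<^sup>2)" for j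
  define D where "D i j = (if i = j then \<delta> x else 0) - w i j" for i j
  have D: "D i j \<in> E ?X" if "i < k" "j < k" for i j
    unfolding D_def by (rule ell2.diff_in[OF _ w[OF that]]) (simp only: d ell2.zero_in split: if_split, simp)
  have ww: "(\<Sum>i<k. (?n (w i j))\<^sup>2) = N j" if j: "j < k" for j
  proof -
    have "complex_of_real (\<Sum>i<k. (?n (w i j))\<^sup>2) = (\<Sum>i<k. ?ip (w i j) (w i j))"
      unfolding of_real_sum by (rule sum.cong[OF refl], rule ell2.b_self[OF w, symmetric]) (use j in simp_all)
    also have "\<dots> = (\<Sum>i<k. \<Sum>l<k. \<Sum>m<k. ?ip (T i l (v j l)) (T i m (v j m)))"
    proof (rule sum.cong[OF refl])
      fix i assume "i \<in> {..<k}"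
      hence i: "i < k" by simp
      have "?ip (w i j) (w i j) = (\<Sum>l<k. ?ip (T i l (v j l)) (w i j))"
        by (subst (1) w_def, rule ell2.b_sum_left[OF Tv w[OF i j]]) (use i j in simp_all)
      also have "\<dots> = (\<Sum>l<k. \<Sum>m<k. ?ip (T i l (v j l)) (T i m (v j m)))"
        unfolding w_def by (rule sum.cong[OF refl], rule sum_right[OF Tv Tv]) (use i j in simp_all)
      finally show "?ip (w i j) (w i j) = (\<Sum>l<k. \<Sum>m<k. ?ip (T i l (v j l)) (T i m (v j m)))" .
    qed
    also have "\<dots> = (\<Sum>l<k. \<Sum>i<k. \<Sum>m<k. ?ip (T i l (v j l)) (T i m (v j m)))" by (rule sum.swap)
    also have "\<dots> = (\<Sum>l<k. \<Sum>m<k. \<Sum>i<k. ?ip (T i l (v j l)) (T i m (v j m)))" by (rule sum.cong[OF refl], rule sum.swap)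
    also have "\<dots> = (\<Sum>l<k. \<Sum>m<k. if l = m then ?ip (v j l) (v j m) else 0)"
      by (rule sum.cong[OF refl], rule sum.cong[OF refl], rule gram[OF _ _ v v]) (use j in simp_all)
    also have "\<dots> = (\<Sum>l<k. ?ip (v j l) (v j l))" by (rule sum.cong[OF refl]) simp
    also have "\<dots> = of_real (N j)" unfolding N_def of_real_sum by (rule sum.cong[OF refl], rule ell2.b_self[OF v]) (use j in simp_all)
    finally show ?thesis by (simp only: of_real_eq_iff)
  qed
  have dw: "Re (?ip (\<delta> x) (w j j)) = N j" if j: "j < k" for j
  proof -
    have "?ip (\<delta> x) (w j j) = (\<Sum>l<k. ?ip (\<delta> x) (T j l (v j l)))" unfolding w_def by (rule sum_right[OF d Tv]) (use j in simp_all)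
    also have "\<dots> = (\<Sum>l<k. ?ip (v j l) (v j l))"
    proof (rule sum.cong[OF refl])
      fix l assume "l \<in> {..<k}"
      hence l: "l < k" by simp
      show "?ip (\<delta> x) (T j l (v j l)) = ?ip (v j l) (v j l)" using adjoint_op(2)[OF TL(1)[OF j l] d v[OF j l]] unfolding v_def ..
    qed
    also have "\<dots> = of_real (N j)" unfolding N_def of_real_sum by (rule sum.cong[OF refl], rule ell2.b_self[OF v]) (use j in simp_all)
    finally show ?thesis by simp
  qed
  have DN: "(\<Sum>i<k. (?n (D i j))\<^sup>2) = 1 - N j" if j: "j < k" for j
  proof -
    have "(?n (D i j))\<^sup>2 = (if i = j then 1 - 2 * N j else 0) + (?n (w i j))\<^sup>2" if i: "i < k" for i
    proof (cases "i = j")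
      case True
      have "D i j = \<delta> x - w i j" unfolding D_def if_P[OF True] ..
      hence "(?n (D i j))\<^sup>2 = (?n (\<delta> x))\<^sup>2 + (?n (w i j))\<^sup>2 - 2 * Re (?ip (\<delta> x) (w i j))"
        using ell2.nrm_diff_sq[OF d w[OF i j]] by (simp only:)
      also have "Re (?ip (\<delta> x) (w i j)) = N j" using dw[OF j] True by simp
      finally show ?thesis using True by (simp add: nrm_\<delta>[OF x])
    next
      case False
      have "D i j = - w i j" unfolding D_def using False by (simp only: if_False diff_0)
      hence "?n (D i j) = ?n (w i j)" using ell2.nrm_minus[OF w[OF i j]] by (simp only:)
      thus ?thesis using False by simp
    qed
    hence "(\<Sum>i<k. (?n (D i j))\<^sup>2) = (\<Sum>i<k. (if i = j then 1 - 2 * N j else 0) + (?n (w i j))\<^sup>2)" by (intro sum.cong[OF refl]) simp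
    also have "\<dots> = 1 - 2 * N j + N j" unfolding sum.distrib ww[OF j] using j by simp
    finally show ?thesis by simp
  qed
  \<comment> \<open>Here the trace property enters: rows and columns have the same total length.\<close>
  have "(\<Sum>j<k. N j) = (\<Sum>j<k. \<Sum>l<k. (?n (T j l (\<delta> x)))\<^sup>2)"
    unfolding N_def v_def by (intro sum.cong[OF refl]) (simp add: nrm_adjoint_\<delta>[OF T x])
  also have "\<dots> = (\<Sum>l<k. \<Sum>j<k. (?n (T j l (\<delta> x)))\<^sup>2)" by (rule sum.swap)
  also have "\<dots> = (\<Sum>l<k. 1)"
  proof (rule sum.cong[OF refl])
    fix l assume "l \<in> {..<k}"
    hence l: "l < k" by simp
    have "complex_of_real (\<Sum>j<k. (?n (T j l (\<delta> x)))\<^sup>2) = (\<Sum>j<k. ?ip (T j l (\<delta> x)) (T j l (\<delta> x)))"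
      unfolding of_real_sum by (rule sum.cong[OF refl], rule ell2.b_self[OF L_in[OF TL(1) d], symmetric]) (use l in simp_all)
    also have "\<dots> = ?ip (\<delta> x) (\<delta> x)" using gram[OF l l d d] by simp
    also have "\<dots> = of_real ((?n (\<delta> x))\<^sup>2)" by (rule ell2.b_self[OF d])
    also have "\<dots> = 1" by (simp add: nrm_\<delta>[OF x])
    finally show "(\<Sum>j<k. (?n (T j l (\<delta> x)))\<^sup>2) = 1" by (simp only: of_real_eq_1_iff)
  qed
  finally have "(\<Sum>j<k. \<Sum>i<k. (?n (D i j))\<^sup>2) = 0" using DN by (simp add: sum_subtractf)
  hence "(\<Sum>i<k. (?n (D i j))\<^sup>2) = 0" using j by (subst (asm) sum_nonneg_eq_0_iff) (auto intro: sum_nonneg)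
  hence "(?n (D i j))\<^sup>2 = 0" using i by (subst (asm) sum_nonneg_eq_0_iff) auto
  hence "?n (D i j) \<le> 0" by simp
  hence "D i j = 0" by (rule nrm_zeroD[OF D[OF i j]])
  hence "(if i = j then \<delta> x else 0) = w i j" unfolding D_def by (rule iffD2[OF eq_iff_diff_eq_0])
  thus ?thesis unfolding w_def v_def ..
qed

theorem stably_finite_reduced: "stably_finite (reduced_group_algebra G)"
  unfolding stably_finite_def finite_algebra_def
proof (intro allI impI ballI)
  fix k :: nat and X
  let ?R = "reduced_group_algebra G" and ?M = "matrix_algebra k (reduced_group_algebra G)"
  assume X: "X \<in> carrier ?M" and iso: "star ?M X \<otimes>\<^bsub>?M\<^esub> X = \<one>\<^bsub>?M\<^esub>"
  define T where "T i j = X $$ (i, j)" for i j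
  have T: "T i j \<in> red" if "i < k" "j < k" for i j
    using X that by (simp add: matrix_algebra_def carrier_reduced T_def)
  have sums: "finsum ?R S {..<k} f = (\<Sum>l<k. S l f)" "finsum ?R S {..<k} \<in> red"
    if S: "\<And>l. l < k \<Longrightarrow> S l \<in> red" and f: "f \<in> E (carrier G)" for S f
  proof -
    have sub: "red \<subseteq> L (carrier G)" by (auto simp: red_def)
    interpret R: abelian_monoid ?R unfolding reduced_eq by (rule sub_abelian_monoid[OF sub red_zero red_add])
    show "finsum ?R S {..<k} f = (\<Sum>l<k. S l f)"
      unfolding reduced_eq by (rule finsum_apply[OF sub red_zero red_add _ f]) (use S in simp_all)
    have "finsum ?R S {..<k} \<in> carrier ?R" by (rule R.finsum_closed) (use S in \<open>auto simp: carrier_reduced\<close>)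
    thus "finsum ?R S {..<k} \<in> red" by (simp only: carrier_reduced)
  qed
  have ops: "mult ?R = compose (E (carrier G))" "star ?R = adjoint" "one ?R = (\<lambda>f\<in>E (carrier G). f)" "zero ?R = (\<lambda>f\<in>E (carrier G). 0)"
    unfolding reduced_eq by (simp_all add: bounded_operators_simps)
  have iso': "(\<Sum>l<k. adjoint (T l i) (T l j f)) = (if i = j then f else 0)"
    if i: "i < k" and j: "j < k" and f: "f \<in> E (carrier G)" for i j f
  proof -
    have m: "compose (E (carrier G)) (adjoint (T l i)) (T l j) \<in> red" if "l < k" for l
      by (rule red_compose[OF red_adjoint[OF T[OF that i]] T[OF that j]])
    have "(\<Sum>l<k. adjoint (T l i) (T l j f)) = (\<Sum>l<k. compose (E (carrier G)) (adjoint (T l i)) (T l j) f)"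
      by (rule sum.cong[OF refl]) (simp only: compose_eq[OF f])
    also have "\<dots> = finsum ?R (\<lambda>l. compose (E (carrier G)) (adjoint (T l i)) (T l j)) {..<k} f" by (rule sums(1)[OF m f, symmetric])
    also have "finsum ?R (\<lambda>l. compose (E (carrier G)) (adjoint (T l i)) (T l j)) {..<k} = (star ?M X \<otimes>\<^bsub>?M\<^esub> X) $$ (i, j)"
    proof -
      interpret R: abelian_monoid ?R unfolding reduced_eq by (rule sub_abelian_monoid[OF _ red_zero red_add]) (auto simp: red_def)
      have "(star ?M X \<otimes>\<^bsub>?M\<^esub> X) $$ (i, j) = finsum ?R (\<lambda>l. star ?M X $$ (i, l) \<otimes>\<^bsub>?R\<^esub> X $$ (l, j)) {..<k}"
        using i j by (simp add: matrix_algebra_def)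
      also have "\<dots> = finsum ?R (\<lambda>l. compose (E (carrier G)) (adjoint (T l i)) (T l j)) {..<k}"
        by (rule R.finsum_cong'[OF refl]) (use i j m in \<open>auto simp: matrix_algebra_def ops T_def carrier_reduced\<close>)
      finally show ?thesis ..
    qed
    also have "(star ?M X \<otimes>\<^bsub>?M\<^esub> X) $$ (i, j) = (if i = j then one ?R else zero ?R)" unfolding iso using i j by (simp add: matrix_algebra_def)
    also have "(if i = j then one ?R else zero ?R) f = (if i = j then f else 0)" using f by (simp add: ops)
    finally show ?thesis .
  qed
  note un = isometry_unitary[of k T, OF T iso']
  show "X \<otimes>\<^bsub>?M\<^esub> star ?M X = \<one>\<^bsub>?M\<^esub>"
  proof (rule eq_matI)
    show "dim_row (X \<otimes>\<^bsub>?M\<^esub> star ?M X) = dim_row \<one>\<^bsub>?M\<^esub>" "dim_col (X \<otimes>\<^bsub>?M\<^esub> star ?M X) = dim_col \<one>\<^bsub>?M\<^esub>"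
      by (simp_all add: matrix_algebra_def)
    fix i j assume "i < dim_row \<one>\<^bsub>?M\<^esub>" "j < dim_col \<one>\<^bsub>?M\<^esub>"
    hence i: "i < k" and j: "j < k" by (simp_all add: matrix_algebra_def)
    have m: "compose (E (carrier G)) (T i l) (adjoint (T j l)) \<in> red" if "l < k" for l
      by (rule red_compose[OF T[OF i that] red_adjoint[OF T[OF j that]]])
    interpret R: abelian_monoid ?R unfolding reduced_eq by (rule sub_abelian_monoid[OF _ red_zero red_add]) (auto simp: red_def)
    let ?S = "finsum ?R (\<lambda>l. compose (E (carrier G)) (T i l) (adjoint (T j l))) {..<k}"
    have "(X \<otimes>\<^bsub>?M\<^esub> star ?M X) $$ (i, j) = finsum ?R (\<lambda>l. X $$ (i, l) \<otimes>\<^bsub>?R\<^esub> star ?M X $$ (l, j)) {..<k}"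
      using i j by (simp add: matrix_algebra_def)
    also have "\<dots> = ?S"
      by (rule R.finsum_cong'[OF refl]) (use i j m in \<open>auto simp: matrix_algebra_def ops T_def carrier_reduced\<close>)
    also have "?S = (if i = j then one ?R else zero ?R)"
    proof (rule L_eqI[where X = "carrier G"])
      show "?S \<in> L (carrier G)" by (rule redD(1)[OF sums(2)[OF m ell2.zero_in]])
      show "(if i = j then one ?R else zero ?R) \<in> L (carrier G)" by (simp add: ops L_one L_null)
      fix x assume x: "x \<in> carrier G"
      have "?S (\<delta> x) = (\<Sum>l<k. compose (E (carrier G)) (T i l) (adjoint (T j l)) (\<delta> x))" by (rule sums(1)[OF m \<delta>_in[OF x]])
      also have "\<dots> = (\<Sum>l<k. T i l (adjoint (T j l) (\<delta> x)))" by (rule sum.cong[OF refl]) (simp only: compose_eq[OF \<delta>_in[OF x]])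
      also have "\<dots> = (if i = j then \<delta> x else 0)" by (rule un[OF _ _ _ _ _ i j x])
      also have "\<dots> = (if i = j then one ?R else zero ?R) (\<delta> x)" using \<delta>_in[OF x] by (simp add: ops)
      finally show "?S (\<delta> x) = (if i = j then one ?R else zero ?R) (\<delta> x)" .
    qed
    also have "\<dots> = \<one>\<^bsub>?M\<^esub> $$ (i, j)" using i j by (simp add: matrix_algebra_def)
    finally show "(X \<otimes>\<^bsub>?M\<^esub> star ?M X) $$ (i, j) = \<one>\<^bsub>?M\<^esub> $$ (i, j)" .
  qed
qed

end

section \<open>Asymptotic representations from embeddings into matrix quotients\<close>

definition fm :: "complex mat \<Rightarrow> fmat"
  where "fm A = Fmat (\<lambda>i j. if i < dim_row A \<and> j < dim_col A then A $$ (i, j) else 0)"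

lemma ent_Fmat: "(\<And>i j. N \<le> i \<or> N \<le> j \<Longrightarrow> f i j = 0) \<Longrightarrow> ent (Fmat f) = f"
  by (rule Fmat_inverse) blast

lemma ent_fm: "ent (fm A) i j = (if i < dim_row A \<and> j < dim_col A then A $$ (i, j) else 0)"
  unfolding fm_def by (subst ent_Fmat[of "max (dim_row A) (dim_col A)"]) auto

lemma supp_le_fm: "A \<in> carrier_mat m m \<Longrightarrow> supp_le m (fm A)"
  by (auto simp: supp_le_def ent_fm)

lemma fm_add: "A \<in> carrier_mat m m \<Longrightarrow> B \<in> carrier_mat m m \<Longrightarrow> fm (A + B) = fm A + fm B"
  by (rule fmat_eqI) (auto simp: ent_fm)

lemma fm_mult: assumes A: "A \<in> carrier_mat m m" and B: "B \<in> carrier_mat m m" shows "fm (A * B) = fm A * fm B"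
proof (rule fmat_eqI)
  fix i j
  show "ent (fm (A * B)) i j = ent (fm A * fm B) i j"
  proof (cases "i < m \<and> j < m")
    case True
    thus ?thesis unfolding ent_times[OF supp_le_fm[OF A]] using A B
      by (auto simp: ent_fm scalar_prod_def atLeast0LessThan intro!: sum.cong)
  qed (use A B in \<open>auto simp: ent_times[OF supp_le_fm[OF A]] ent_fm\<close>)
qed

lemma fm_adjoint: "A \<in> carrier_mat m m \<Longrightarrow> fm (mat_adjoint A) = adj (fm A)"
  by (rule fmat_eqI) (auto simp: ent_fm mat_adjoint_def mat_of_rows_def)

text \<open>A vector as the first column of a matrix; this reduces the operator norm on vectors to \<open>opn\<close>.\<close>

definition colm :: "complex Matrix.vec \<Rightarrow> fmat"
  where "colm v = Fmat (\<lambda>i j. if j = 0 \<and> i < dim_vec v then vec_index v i else 0)"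

lemma ent_colm: "ent (colm v) i j = (if j = 0 \<and> i < dim_vec v then vec_index v i else 0)"
  unfolding colm_def by (subst ent_Fmat[of "Suc (dim_vec v)"]) auto

lemma norm_colm: "norm (colm v) = vec_norm2 v"
proof -
  have "supp_le (Suc (dim_vec v)) (colm v)" by (auto simp: supp_le_def ent_colm)
  hence "(norm (colm v))\<^sup>2 = (\<Sum>i<Suc (dim_vec v). \<Sum>j<Suc (dim_vec v). (cmod (ent (colm v) i j))\<^sup>2)" by (rule norm_sq_entries)
  also have "\<dots> = (\<Sum>i<Suc (dim_vec v). (cmod (ent (colm v) i 0))\<^sup>2)"
    by (rule sum.cong[OF refl], subst sum.mono_neutral_right[of _ "{0}"]) (auto simp: ent_colm)
  also have "\<dots> = (\<Sum>i<dim_vec v. (cmod (vec_index v i))\<^sup>2)" by (simp add: ent_colm)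
  finally have "(norm (colm v))\<^sup>2 = (vec_norm2 v)\<^sup>2" unfolding vec_norm2_def by (simp add: sum_nonneg)
  thus ?thesis by (rule power2_eq_imp_eq) (simp_all add: vec_norm2_def sum_nonneg)
qed

lemma fm_colm: assumes A: "A \<in> carrier_mat m m" and v: "v \<in> carrier_vec m" shows "fm A * colm v = colm (A *\<^sub>v v)"
proof (rule fmat_eqI)
  fix i j
  show "ent (fm A * colm v) i j = ent (colm (A *\<^sub>v v)) i j"
    unfolding ent_times[OF supp_le_fm[OF A]] using A v
    by (auto simp: ent_fm ent_colm scalar_prod_def atLeast0LessThan intro!: sum.cong)
qed

lemma vec_norm2_nonneg [simp]: "0 \<le> vec_norm2 v" by (simp add: vec_norm2_def sum_nonneg)

lemma vec_norm2_le: assumes "A \<in> carrier_mat m m" "v \<in> carrier_vec m" shows "vec_norm2 (A *\<^sub>v v) \<le> opn (fm A) * vec_norm2 v"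
  using opn_mult_left[of "fm A" "colm v"] unfolding fm_colm[OF assms] norm_colm .

lemma mat_op_norm_le: assumes A: "A \<in> carrier_mat m m" shows "mat_op_norm A \<le> opn (fm A)"
  unfolding mat_op_norm_def
proof (rule cSUP_least)
  have "0\<^sub>v m \<in> {v \<in> carrier_vec (dim_col A). vec_norm2 v \<le> 1}" using A by (simp add: vec_norm2_def)
  thus "{v \<in> carrier_vec (dim_col A). vec_norm2 v \<le> 1} \<noteq> {}" by blast
  fix v assume v: "v \<in> {v \<in> carrier_vec (dim_col A). vec_norm2 v \<le> 1}"
  have "vec_norm2 (A *\<^sub>v v) \<le> opn (fm A) * vec_norm2 v" by (rule vec_norm2_le[OF A]) (use v A in simp)
  also have "\<dots> \<le> opn (fm A) * 1" using v by (intro mult_left_mono) auto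
  finally show "vec_norm2 (A *\<^sub>v v) \<le> opn (fm A)" by simp
qed

lemma vec_norm2_smult: "vec_norm2 (c \<cdot>\<^sub>v v) = cmod c * vec_norm2 v"
  by (simp add: vec_norm2_def norm_mult power_mult_distrib sum_distrib_left[symmetric] real_sqrt_mult)

lemma vec_norm2_mat_op_norm:
  assumes A: "A \<in> carrier_mat m m" and v: "v \<in> carrier_vec m"
  shows "vec_norm2 (A *\<^sub>v v) \<le> mat_op_norm A * vec_norm2 v"
proof (cases "vec_norm2 v = 0")
  case True
  thus ?thesis using vec_norm2_le[OF A v] by simp
next
  case False
  hence pos: "0 < vec_norm2 v" using vec_norm2_nonneg[of v] by linarith
  let ?c = "complex_of_real (1 / vec_norm2 v)"
  have w: "?c \<cdot>\<^sub>v v \<in> {v \<in> carrier_vec (dim_col A). vec_norm2 v \<le> 1}"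
    using v A pos by (simp add: vec_norm2_smult norm_divide)
  have "bdd_above ((\<lambda>v. vec_norm2 (A *\<^sub>v v)) ` {v \<in> carrier_vec (dim_col A). vec_norm2 v \<le> 1})"
  proof (rule bdd_aboveI2)
    fix v assume v: "v \<in> {v \<in> carrier_vec (dim_col A). vec_norm2 v \<le> 1}"
    have "vec_norm2 (A *\<^sub>v v) \<le> opn (fm A) * vec_norm2 v" by (rule vec_norm2_le[OF A]) (use v A in simp)
    also have "\<dots> \<le> opn (fm A) * 1" using v by (intro mult_left_mono) auto
    finally show "vec_norm2 (A *\<^sub>v v) \<le> opn (fm A)" by simp
  qed
  from cSUP_upper[OF w this] have "vec_norm2 (A *\<^sub>v (?c \<cdot>\<^sub>v v)) \<le> mat_op_norm A" unfolding mat_op_norm_def .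
  also have "A *\<^sub>v (?c \<cdot>\<^sub>v v) = ?c \<cdot>\<^sub>v (A *\<^sub>v v)" by (rule mult_mat_vec[OF A v])
  finally have "cmod ?c * vec_norm2 (A *\<^sub>v v) \<le> mat_op_norm A" unfolding vec_norm2_smult .
  thus ?thesis using pos by (simp add: norm_divide field_simps)
qed

text \<open>The squared Hilbert--Schmidt norm is the sum of the squared norms of the columns.\<close>

lemma opn_fm_le: assumes A: "A \<in> carrier_mat m m" shows "opn (fm A) \<le> mat_op_norm A"
proof -
  have "0\<^sub>v m \<in> {v \<in> carrier_vec (dim_col A). vec_norm2 v \<le> 1}" using A by (simp add: vec_norm2_def)
  have c0: "0 \<le> mat_op_norm A"
  proof (cases "m = 0")
    case True
    have "mat_op_norm A = (SUP v\<in>{v \<in> carrier_vec (dim_col A). vec_norm2 v \<le> 1}. 0)"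
      unfolding mat_op_norm_def by (rule SUP_cong[OF refl]) (use A True in \<open>auto simp: vec_norm2_def\<close>)
    also have "\<dots> = 0" using \<open>0\<^sub>v m \<in> _\<close> by (subst cSUP_const) auto
    finally show ?thesis by simp
  next
    case False
    have "vec_norm2 (unit_vec m 0 :: complex Matrix.vec) = 1"
    proof -
      have "(\<Sum>i<m. (cmod (vec_index (unit_vec m 0) i))\<^sup>2) = (\<Sum>i<m. if i = 0 then 1 else 0)" by (rule sum.cong) auto
      thus ?thesis using False by (simp add: vec_norm2_def)
    qed
    hence "vec_norm2 (A *\<^sub>v unit_vec m 0) \<le> mat_op_norm A" using vec_norm2_mat_op_norm[OF A unit_vec_carrier[of m 0]] by simp
    thus ?thesis by (rule order_trans[OF vec_norm2_nonneg])
  qed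
  show ?thesis
  proof (rule opn_le[OF _ c0])
    fix X :: fmat
    obtain N0 where N0: "supp_le N0 X" using ex_supp_le by blast
    define N where "N = max N0 m"
    have N: "supp_le N X" "supp_le N (fm A)" "m \<le> N"
      using supp_le_mono[OF N0] supp_le_mono[OF supp_le_fm[OF A]] by (simp_all add: N_def)
    define v where "v j = Matrix.vec m (\<lambda>i. ent X i j)" for j
    have v: "v j \<in> carrier_vec m" for j by (simp add: v_def)
    have en: "ent (fm A * X) i j = (if i < m then vec_index (A *\<^sub>v v j) i else 0)" for i j
      unfolding ent_times[OF supp_le_fm[OF A]] using A
      by (auto simp: ent_fm v_def scalar_prod_def atLeast0LessThan intro!: sum.cong)
    have vn: "(vec_norm2 (A *\<^sub>v v j))\<^sup>2 \<le> (mat_op_norm A)\<^sup>2 * (vec_norm2 (v j))\<^sup>2" for j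
      using power_mono[OF vec_norm2_mat_op_norm[OF A v[of j]], of 2] by (simp add: power_mult_distrib)
    have split: "(\<Sum>i<N. if i < m then g i else 0) = (\<Sum>i<m. g i)" for g :: "nat \<Rightarrow> real"
      by (rule sum.mono_neutral_cong_right) (use N(3) in auto)
    have "(norm (fm A * X))\<^sup>2 = (\<Sum>i<N. \<Sum>j<N. (cmod (ent (fm A * X) i j))\<^sup>2)"
      by (rule norm_sq_entries[OF supp_le_times[OF N(2,1)]])
    also have "\<dots> = (\<Sum>j<N. \<Sum>i<N. (cmod (ent (fm A * X) i j))\<^sup>2)" by (rule sum.swap)
    also have "\<dots> = (\<Sum>j<N. (vec_norm2 (A *\<^sub>v v j))\<^sup>2)"
    proof (rule sum.cong[OF refl])
      fix j
      have "(\<Sum>i<N. (cmod (ent (fm A * X) i j))\<^sup>2) = (\<Sum>i<N. if i < m then (cmod (vec_index (A *\<^sub>v v j) i))\<^sup>2 else 0)"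
        by (rule sum.cong) (simp_all add: en)
      also have "\<dots> = (\<Sum>i<m. (cmod (vec_index (A *\<^sub>v v j) i))\<^sup>2)" by (rule split)
      also have "\<dots> = (vec_norm2 (A *\<^sub>v v j))\<^sup>2" using A by (simp add: vec_norm2_def sum_nonneg)
      finally show "(\<Sum>i<N. (cmod (ent (fm A * X) i j))\<^sup>2) = (vec_norm2 (A *\<^sub>v v j))\<^sup>2" .
    qed
    also have "\<dots> \<le> (\<Sum>j<N. (mat_op_norm A)\<^sup>2 * (vec_norm2 (v j))\<^sup>2)" by (rule sum_mono) (rule vn)
    also have "\<dots> = (mat_op_norm A)\<^sup>2 * (\<Sum>j<N. \<Sum>i<m. (cmod (ent X i j))\<^sup>2)"
      by (simp add: sum_distrib_left[symmetric] vec_norm2_def sum_nonneg v_def)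
    also have "\<dots> \<le> (mat_op_norm A)\<^sup>2 * (\<Sum>j<N. \<Sum>i<N. (cmod (ent X i j))\<^sup>2)"
      by (intro mult_left_mono sum_mono sum_mono2) (use N(3) in auto)
    also have "(\<Sum>j<N. \<Sum>i<N. (cmod (ent X i j))\<^sup>2) = (norm X)\<^sup>2" unfolding norm_sq_entries[OF N(1)] by (rule sum.swap)
    finally have "(norm (fm A * X))\<^sup>2 \<le> (mat_op_norm A * norm X)\<^sup>2" by (simp add: power_mult_distrib)
    thus "norm (fm A * X) \<le> mat_op_norm A * norm X" by (rule power2_le_imp_le) (use c0 in simp)
  qed
qed

lemma opn_fm: "A \<in> carrier_mat m m \<Longrightarrow> opn (fm A) = mat_op_norm A"
  by (rule antisym[OF opn_fm_le mat_op_norm_le])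

lemma fm_minus: "A \<in> carrier_mat m m \<Longrightarrow> B \<in> carrier_mat m m \<Longrightarrow> fm (A - B) = fm A - fm B"
  by (rule fmat_eqI) (auto simp: ent_fm)

lemma mat_adjoint_carrier: "A \<in> carrier_mat m m \<Longrightarrow> mat_adjoint A \<in> carrier_mat m m"
  by (intro carrier_matI) (auto simp: mat_adjoint_def mat_of_rows_def)

lemma matrix_sum_iff: "X \<in> matrix_sum d \<longleftrightarrow> (\<forall>n. X n \<in> carrier_mat (d n) (d n)) \<and> null sequentially (\<lambda>n. fm (X n))"
proof -
  have "(\<lambda>n. mat_op_norm (X n)) = (\<lambda>n. opn (fm (X n)))" if "\<forall>n. X n \<in> carrier_mat (d n) (d n)"
    using that opn_fm by (intro ext) metis
  thus ?thesis unfolding matrix_sum_def null_def by auto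
qed

lemma in_coset_iff:
  "y \<in> matrix_sum d +>\<^bsub>matrix_product d\<^esub> x \<longleftrightarrow> (\<exists>h\<in>matrix_sum d. y = (\<lambda>n. h n + x n))"
  by (simp add: a_r_coset_def r_coset_def matrix_product_def)

lemma coset_null:
  assumes "y \<in> matrix_sum d +>\<^bsub>matrix_product d\<^esub> x" "\<And>n. x n \<in> carrier_mat (d n) (d n)"
  shows "null sequentially (\<lambda>n. fm (y n) - fm (x n))"
proof -
  obtain h where h: "h \<in> matrix_sum d" "y = (\<lambda>n. h n + x n)" using assms(1) by (auto simp: in_coset_iff)
  have "fm (y n) = fm (h n) + fm (x n)" for n
    unfolding h(2) by (rule fm_add[of _ "d n"]) (use assms(2) h in \<open>simp_all add: matrix_sum_iff\<close>)
  thus ?thesis using h by (simp add: matrix_sum_iff)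
qed

lemma coset_self:
  assumes "\<And>n. x n \<in> carrier_mat (d n) (d n)" shows "x \<in> matrix_sum d +>\<^bsub>matrix_product d\<^esub> x"
proof -
  have "fm (0\<^sub>m (d n) (d n)) = 0" for n by (rule fmat_eqI) (simp add: ent_fm)
  hence "(\<lambda>n. 0\<^sub>m (d n) (d n)) \<in> matrix_sum d" by (simp add: matrix_sum_iff null_def)
  moreover have "x = (\<lambda>n. 0\<^sub>m (d n) (d n) + x n)" using assms by (auto intro!: ext)
  ultimately show ?thesis unfolding in_coset_iff by - (rule bexI[of _ "\<lambda>n. 0\<^sub>m (d n) (d n)"], assumption+)
qed

lemma coset_subset:
  assumes x: "\<And>n. x n \<in> carrier_mat (d n) (d n)" and y: "\<And>n. y n \<in> carrier_mat (d n) (d n)"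
    and nl: "null sequentially (\<lambda>n. fm (x n) - fm (y n))"
  shows "matrix_sum d +>\<^bsub>matrix_product d\<^esub> x \<subseteq> matrix_sum d +>\<^bsub>matrix_product d\<^esub> y"
proof
  fix z assume "z \<in> matrix_sum d +>\<^bsub>matrix_product d\<^esub> x"
  then obtain h where h: "h \<in> matrix_sum d" "z = (\<lambda>n. h n + x n)" by (auto simp: in_coset_iff)
  define k where "k n = h n + (x n - y n)" for n
  have hc: "h n \<in> carrier_mat (d n) (d n)" for n using h by (simp add: matrix_sum_iff)
  have "fm (k n) = fm (h n) + (fm (x n) - fm (y n))" for n
    unfolding k_def using hc x minus_carrier_mat[OF y] y by (simp add: fm_add[of _ "d n"] fm_minus[of _ "d n"])
  moreover have "null sequentially ((\<lambda>n. fm (h n)) + (\<lambda>n. fm (x n) - fm (y n)))"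
    by (rule null_add[OF _ nl]) (use h in \<open>simp add: matrix_sum_iff\<close>)
  ultimately have "null sequentially (\<lambda>n. fm (k n))" by (simp add: plus_fun_def)
  moreover have "k n \<in> carrier_mat (d n) (d n)" for n unfolding k_def by (rule add_carrier_mat[OF minus_carrier_mat[OF y]])
  ultimately have "k \<in> matrix_sum d" by (simp add: matrix_sum_iff)
  moreover have "z = (\<lambda>n. k n + y n)"
  proof
    fix n
    show "z n = k n + y n" unfolding h(2) k_def using hc[of n] x[of n] y[of n] by (intro eq_matI) auto
  qed
  ultimately show "z \<in> matrix_sum d +>\<^bsub>matrix_product d\<^esub> y" unfolding in_coset_iff by - (rule bexI[of _ k], assumption+)
qed

context group
begin

lemma left_regular_mult:
  assumes v: "v \<in> carrier G" and w: "w \<in> carrier G"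
  shows "compose (E (carrier G)) (left_regular G v) (left_regular G w) = left_regular G (v \<otimes> w)"
proof (rule extensionalityI[of _ "E (carrier G)"])
  fix f assume f: "f \<in> E (carrier G)"
  show "compose (E (carrier G)) (left_regular G v) (left_regular G w) f = left_regular G (v \<otimes> w) f"
    unfolding compose_eq[OF f] left_regular_apply[OF f] left_regular_apply[OF tl_in[OF w f]] by (rule tl_tl[OF v w])
qed (simp_all add: left_regular_def compose_extensional)

lemma left_regular_adjoint: assumes w: "w \<in> carrier G" shows "adjoint (left_regular G w) = left_regular G (inv w)"
proof (rule adjoint_opI[OF left_regular_L[OF w] left_regular_L[OF inv_closed[OF w]]])
  fix f h assume f: "f \<in> E (carrier G)" and h: "h \<in> E (carrier G)"
  show "cinner (ell2 (carrier G)) (left_regular G (inv w) f) h = cinner (ell2 (carrier G)) f (left_regular G w h)"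
    unfolding left_regular_apply[OF f] left_regular_apply[OF h] cinner_tl[OF inv_closed[OF w]] inv_inv[OF w] ..
qed

lemma left_regular_inj: assumes v: "v \<in> carrier G" and w: "w \<in> carrier G" and eq: "left_regular G v = left_regular G w" shows "v = w"
proof -
  have "\<delta> v = \<delta> w" using fun_cong[OF eq, of "\<delta> \<one>"] v w by (simp only: left_regular_apply \<delta>_in one_closed tl_\<delta> r_one)
  from fun_cong[OF this, of v] show ?thesis by (simp add: \<delta>_def split: if_splits)
qed

text \<open>All relations are read off from representatives of the cosets: the product of two cosets contains the product
  of the representatives, and so on.\<close>

theorem MF_asymptotic_rep:
  assumes MF: "MF_algebra (reduced_group_algebra G)"
  obtains u I where "\<And>n. adj (I n) = I n" "\<And>n. I n * I n = I n"
    "\<And>w n. w \<in> carrier G \<Longrightarrow> I n * u w n = u w n" "\<And>w n. w \<in> carrier G \<Longrightarrow> u w n * I n = u w n"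
    "\<And>w. w \<in> carrier G \<Longrightarrow> \<exists>C. \<forall>n. opn (u w n) \<le> C"
    "\<And>v w. v \<in> carrier G \<Longrightarrow> w \<in> carrier G \<Longrightarrow> null sequentially (u (v \<otimes> w) - u v * u w)"
    "\<And>w. w \<in> carrier G \<Longrightarrow> null sequentially (adjs (u w) - u (inv w))"
    "null sequentially (u \<one> - I)"
    "\<And>v w. v \<in> carrier G \<Longrightarrow> w \<in> carrier G \<Longrightarrow> v \<noteq> w \<Longrightarrow> \<not> null sequentially (u v - u w)"
proof -
  let ?R = "reduced_group_algebra G"
  obtain d f where hom: "star_hom ?R (star_quotient (matrix_product d) (matrix_sum d)) f" and inj: "inj_on f (carrier ?R)"
    using MF by (auto simp: MF_algebra_def)
  let ?M = "matrix_product d" and ?J = "matrix_sum d"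
  let ?lam = "left_regular G"
  have lam: "?lam w \<in> carrier ?R" if "w \<in> carrier G" for w using red_left_regular[OF that] by (simp only: carrier_reduced)
  have ops: "mult ?R = compose (E (carrier G))" "star ?R = adjoint"
    unfolding reduced_eq by (simp_all add: bounded_operators_simps)
  have "\<exists>x. x \<in> carrier ?M \<and> f (?lam w) = ?J +>\<^bsub>?M\<^esub> x" if "w \<in> carrier G" for w
  proof -
    have "f (?lam w) \<in> carrier (star_quotient ?M ?J)" using hom lam[OF that] by (auto simp: star_hom_def)
    thus ?thesis by (auto simp: star_quotient_def FactRing_simps)
  qed
  then obtain x where x: "\<And>w. w \<in> carrier G \<Longrightarrow> x w \<in> carrier ?M" "\<And>w. w \<in> carrier G \<Longrightarrow> f (?lam w) = ?J +>\<^bsub>?M\<^esub> x w" by metis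
  have xc: "x w n \<in> carrier_mat (d n) (d n)" if "w \<in> carrier G" for w n using x(1)[OF that] by (simp add: matrix_product_def)
  define y where "y w = (\<lambda>n. fm (x w n))" for w
  define I where "I = (\<lambda>n. fm (1\<^sub>m (d n)))"
  have y_mult: "null sequentially (y v * y w - y (v \<otimes> w))" if v: "v \<in> carrier G" and w: "w \<in> carrier G" for v w
  proof -
    have "f (?lam (v \<otimes> w)) = f (?lam v \<otimes>\<^bsub>?R\<^esub> ?lam w)" by (simp only: ops left_regular_mult[OF v w])
    also have "\<dots> = f (?lam v) \<otimes>\<^bsub>star_quotient ?M ?J\<^esub> f (?lam w)" using hom lam[OF v] lam[OF w] by (simp add: star_hom_def)
    also have "\<dots> = (\<Union>a\<in>f (?lam v). \<Union>b\<in>f (?lam w). ?J +>\<^bsub>?M\<^esub> (a \<otimes>\<^bsub>?M\<^esub> b))"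
      by (simp add: star_quotient_def FactRing_def rcoset_mult_def)
    finally have "?J +>\<^bsub>?M\<^esub> x (v \<otimes> w) = (\<Union>a\<in>f (?lam v). \<Union>b\<in>f (?lam w). ?J +>\<^bsub>?M\<^esub> (a \<otimes>\<^bsub>?M\<^esub> b))" using x(2)[of "v \<otimes> w"] v w by simp
    moreover have "x v \<in> f (?lam v)" "x w \<in> f (?lam w)" unfolding x(2)[OF v] x(2)[OF w] by (rule coset_self[OF xc[OF v]], rule coset_self[OF xc[OF w]])
    moreover have "x v \<otimes>\<^bsub>?M\<^esub> x w \<in> ?J +>\<^bsub>?M\<^esub> (x v \<otimes>\<^bsub>?M\<^esub> x w)"
      by (rule coset_self) (simp add: matrix_product_def mult_carrier_mat[OF xc[OF v] xc[OF w]])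
    ultimately have "x v \<otimes>\<^bsub>?M\<^esub> x w \<in> ?J +>\<^bsub>?M\<^esub> x (v \<otimes> w)" by blast
    from coset_null[OF this] have "null sequentially (\<lambda>n. fm (x v n * x w n) - fm (x (v \<otimes> w) n))" using xc v w by (simp add: matrix_product_def)
    moreover have "fm (x v n * x w n) = y v n * y w n" for n unfolding y_def by (rule fm_mult[OF xc[OF v] xc[OF w]])
    ultimately show ?thesis by (simp add: y_def fun_diff_def times_fun_def)
  qed
  have y_adj: "null sequentially (adjs (y w) - y (inv w))" if w: "w \<in> carrier G" for w
  proof -
    have "f (?lam (inv w)) = f (star ?R (?lam w))" by (simp only: ops left_regular_adjoint[OF w])
    also have "\<dots> = star (star_quotient ?M ?J) (f (?lam w))" using hom lam[OF w] by (simp add: star_hom_def)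
    also have "\<dots> = (\<Union>a\<in>f (?lam w). ?J +>\<^bsub>?M\<^esub> star ?M a)" by (simp add: star_quotient_def)
    finally have "?J +>\<^bsub>?M\<^esub> x (inv w) = (\<Union>a\<in>f (?lam w). ?J +>\<^bsub>?M\<^esub> star ?M a)" using x(2)[of "inv w"] w by simp
    moreover have "x w \<in> f (?lam w)" unfolding x(2)[OF w] by (rule coset_self[OF xc[OF w]])
    moreover have "star ?M (x w) \<in> ?J +>\<^bsub>?M\<^esub> star ?M (x w)"
      by (rule coset_self) (simp only: matrix_product_def star_algebra.simps mat_adjoint_carrier[OF xc[OF w]])
    ultimately have "star ?M (x w) \<in> ?J +>\<^bsub>?M\<^esub> x (inv w)" by blast
    from coset_null[OF this] have "null sequentially (\<lambda>n. fm (mat_adjoint (x w n)) - fm (x (inv w) n))" using xc w by (simp add: matrix_product_def)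
    moreover have "fm (mat_adjoint (x w n)) = adj (y w n)" for n unfolding y_def by (rule fm_adjoint[OF xc[OF w]])
    ultimately show ?thesis by (simp add: y_def fun_diff_def)
  qed
  have y_sep: "\<not> null sequentially (y v - y w)" if v: "v \<in> carrier G" and w: "w \<in> carrier G" and ne: "v \<noteq> w" for v w
  proof
    assume "null sequentially (y v - y w)"
    hence n: "null sequentially (\<lambda>n. fm (x v n) - fm (x w n))" by (simp add: y_def fun_diff_def)
    have n': "null sequentially (\<lambda>n. fm (x w n) - fm (x v n))" using null_sym[of sequentially "y v" "y w"] \<open>null sequentially (y v - y w)\<close> by (simp add: y_def fun_diff_def)
    have "f (?lam v) = f (?lam w)" unfolding x(2)[OF v] x(2)[OF w]
      by (rule antisym[OF coset_subset[OF xc[OF v] xc[OF w] n] coset_subset[OF xc[OF w] xc[OF v] n']])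
    thus False using inj_onD[OF inj _ lam[OF v] lam[OF w]] left_regular_inj[OF v w] ne by blast
  qed
  have opnI: "opn (y w n) \<le> mat_op_norm (x w n)" if "w \<in> carrier G" for w n unfolding y_def by (rule opn_fm_le[OF xc[OF that]])
  have y_bd: "\<exists>C. \<forall>n. opn (y w n) \<le> C" if w: "w \<in> carrier G" for w
  proof -
    obtain C where "\<forall>n. mat_op_norm (x w n) \<le> C" using x(1)[OF w] by (auto simp: matrix_product_def)
    thus ?thesis using opnI[OF w] order_trans by blast
  qed
  have Iy: "I n * y w n = y w n" "y w n * I n = y w n" if w: "w \<in> carrier G" for w n
    unfolding I_def y_def using fm_mult[OF one_carrier_mat xc[OF w], of n] fm_mult[OF xc[OF w] one_carrier_mat, of n] xc[OF w, of n] by simp_all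
  have II: "I n * I n = I n" for n unfolding I_def using fm_mult[OF one_carrier_mat one_carrier_mat, of "d n"] by simp
  have Iadj: "adj (I n) = I n" for n unfolding I_def by (rule fmat_eqI) (simp add: ent_fm)
  have opn_I: "opn (I n) \<le> 1" for n
  proof -
    have "(opn (I n))\<^sup>2 \<le> opn (I n) * 1" using opn_sq_le[of "I n"] by (simp add: Iadj II)
    thus ?thesis using opn_nonneg[of "I n"] by (cases "opn (I n) = 0") (simp_all add: power2_eq_square)
  qed
  \<comment> \<open>The homomorphism need not map the unit to the unit: the complementary projection is added.\<close>
  define u where "u w = y w + (I - y \<one>)" for w
  show thesis
  proof (rule that[of I u])
    fix n v w assume w: "w \<in> carrier G"
    show "I n * u w n = u w n" "u w n * I n = u w n"
      using Iy[OF w, of n] Iy[OF one_closed, of n] II[of n] by (simp_all add: u_def distrib_left distrib_right right_diff_distrib left_diff_distrib)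
    obtain C where C: "\<forall>n. opn (y w n) \<le> C" using y_bd[OF w] by blast
    obtain D where D: "\<forall>n. opn (y \<one> n) \<le> D" using y_bd[OF one_closed] by blast
    have "opn (u w n) \<le> C + (1 + D)" for n
      using opn_add[of "y w n" "I n - y \<one> n"] opn_diff[of "I n" "y \<one> n"] opn_I[of n] C D by (simp add: u_def) (smt (verit))
    thus "\<exists>C. \<forall>n. opn (u w n) \<le> C" by blast
    have "adjs (u w) - u (inv w) = (adjs (y w) - y (inv w)) - (adjs (y \<one>) - y (inv \<one>))"
      by (rule ext) (simp add: u_def Iadj)
    thus "null sequentially (adjs (u w) - u (inv w))" using null_diff[OF y_adj[OF w] y_adj[OF one_closed]] by simp
    assume v: "v \<in> carrier G"
    have "u (v \<otimes> w) - u v * u w = - (((y v * y w - y (v \<otimes> w)) - (y v * y \<one> - y (v \<otimes> \<one>))) - ((y \<one> * y w - y (\<one> \<otimes> w)) - (y \<one> * y \<one> - y (\<one> \<otimes> \<one>))))"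
    proof
      fix n
      show "(u (v \<otimes> w) - u v * u w) n = (- (((y v * y w - y (v \<otimes> w)) - (y v * y \<one> - y (v \<otimes> \<one>))) - ((y \<one> * y w - y (\<one> \<otimes> w)) - (y \<one> * y \<one> - y (\<one> \<otimes> \<one>))))) n"
        using v w Iy[OF w, of n] Iy[OF v, of n] Iy[OF one_closed, of n] II[of n]
        by (simp add: u_def distrib_left distrib_right right_diff_distrib left_diff_distrib)
    qed
    moreover have "null sequentially (((y v * y w - y (v \<otimes> w)) - (y v * y \<one> - y (v \<otimes> \<one>))) - ((y \<one> * y w - y (\<one> \<otimes> w)) - (y \<one> * y \<one> - y (\<one> \<otimes> \<one>))))"
      by (intro null_diff y_mult v w one_closed)
    ultimately show "null sequentially (u (v \<otimes> w) - u v * u w)" by (simp only: null_minus)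
    assume "v \<noteq> w"
    moreover have "u v - u w = y v - y w" by (simp add: u_def)
    ultimately show "\<not> null sequentially (u v - u w)" using y_sep[OF v w] by simp
  next
    show "null sequentially (u \<one> - I)" by (simp add: u_def null_zero)
  qed (rule Iadj II)+
qed

end

section \<open>The wreath product\<close>

locale coset_wreath_product = group G + \<Gamma>: subgroup \<Gamma> G
  for G :: "'g monoid" (structure) and \<Gamma> :: "'g set"
begin

abbreviation lc :: "'g set set" where "lc \<equiv> lcosets \<Gamma>"
abbreviation A :: "('g set \<Rightarrow> int) monoid" where "A \<equiv> coset_sum G \<Gamma>"
abbreviation act :: "'g \<Rightarrow> ('g set \<Rightarrow> int) \<Rightarrow> 'g set \<Rightarrow> int" where "act \<equiv> coset_action G \<Gamma>"
abbreviation W :: "(('g set \<Rightarrow> int) \<times> 'g) monoid" where "W \<equiv> coset_wreath G \<Gamma>"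

lemma lc_in: "g \<in> carrier G \<Longrightarrow> y \<in> lc \<Longrightarrow> g <# y \<in> lc"
  by (auto simp: LCOSETS_def lcos_m_assoc \<Gamma>.subset)

lemma lc_sub: "y \<in> lc \<Longrightarrow> y \<subseteq> carrier G" by (rule \<Gamma>.lcosets_carrier[OF is_group])

lemma lc_assoc: "g \<in> carrier G \<Longrightarrow> h \<in> carrier G \<Longrightarrow> y \<in> lc \<Longrightarrow> g <# (h <# y) = (g \<otimes> h) <# y"
  by (rule lcos_m_assoc[OF lc_sub])

lemma lc_one: "y \<in> lc \<Longrightarrow> \<one> <# y = y" by (rule lcos_mult_one[OF lc_sub])

lemma lc_solve:
  assumes g: "g \<in> carrier G" and x: "x \<in> lc" and y: "y \<in> lc" shows "inv g <# x = y \<longleftrightarrow> x = g <# y"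
proof
  assume "inv g <# x = y"
  hence "g <# y = g <# (inv g <# x)" by (simp only:)
  also have "\<dots> = x" unfolding lc_assoc[OF g inv_closed[OF g] x] r_inv[OF g] by (rule lc_one[OF x])
  finally show "x = g <# y" ..
next
  assume "x = g <# y"
  hence "inv g <# x = inv g <# (g <# y)" by (simp only:)
  also have "\<dots> = y" unfolding lc_assoc[OF inv_closed[OF g] g y] l_inv[OF g] by (rule lc_one[OF y])
  finally show "inv g <# x = y" .
qed

definition zer :: "'g set \<Rightarrow> int" where "zer = (\<lambda>x\<in>lc. 0)"
definition ind :: "'g set \<Rightarrow> 'g set \<Rightarrow> int" where "ind y = (\<lambda>x\<in>lc. if x = y then 1 else 0)"

lemma group_A: "group A" unfolding coset_sum_def by (rule sum_group) (rule group_integer_mod_group)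

lemma A_iff: "a \<in> carrier A \<longleftrightarrow> a \<in> extensional lc \<and> (\<forall>x\<in>lc. 0 \<le> a x \<and> a x < 2) \<and> finite {x \<in> lc. a x \<noteq> 0}"
  unfolding coset_sum_def
  by (subst carrier_sum_group) (auto simp: carrier_integer_mod_group PiE_iff)

lemma A_mult: "a \<otimes>\<^bsub>A\<^esub> b = (\<lambda>x\<in>lc. (a x + b x) mod 2)" by (simp add: coset_sum_def)

lemma A_one: "\<one>\<^bsub>A\<^esub> = zer" by (simp add: coset_sum_def zer_def)

lemma A_comm: "a \<otimes>\<^bsub>A\<^esub> b = b \<otimes>\<^bsub>A\<^esub> a" unfolding A_mult by (simp add: add.commute)

lemma A_double: "a \<otimes>\<^bsub>A\<^esub> a = zer" unfolding A_mult zer_def by (rule restrict_ext) simp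

lemma zer_in: "zer \<in> carrier A" by (simp add: A_iff zer_def)

lemma ind_in: "ind y \<in> carrier A"
proof -
  have "finite {x \<in> lc. ind y x \<noteq> 0}" by (rule finite_subset[of _ "{y}"]) (auto simp: ind_def split: if_splits)
  thus ?thesis by (simp add: A_iff ind_def)
qed

lemma act_apply: "x \<in> lc \<Longrightarrow> act g a x = a (inv g <# x)" by (simp add: coset_action_def)

lemma act_ext: "act g a \<in> extensional lc" by (simp add: coset_action_def)

lemma act_in: assumes g: "g \<in> carrier G" and a: "a \<in> carrier A" shows "act g a \<in> carrier A"
proof -
  have "{x \<in> lc. act g a x \<noteq> 0} \<subseteq> (\<lambda>y. g <# y) ` {x \<in> lc. a x \<noteq> 0}"
  proof
    fix x assume x: "x \<in> {x \<in> lc. act g a x \<noteq> 0}"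
    hence "x \<in> lc" "inv g <# x \<in> {x \<in> lc. a x \<noteq> 0}" using g by (auto simp: act_apply lc_in)
    moreover have "g <# (inv g <# x) = x"
      using lc_solve[OF g calculation(1) lc_in[OF inv_closed[OF g] calculation(1)]] by (simp only: simp_thms)
    ultimately show "x \<in> (\<lambda>y. g <# y) ` {x \<in> lc. a x \<noteq> 0}" by (intro rev_image_eqI[of "inv g <# x"]) simp_all
  qed
  moreover have "finite {x \<in> lc. a x \<noteq> 0}" using a by (simp add: A_iff)
  ultimately have "finite {x \<in> lc. act g a x \<noteq> 0}" using finite_subset by blast
  thus ?thesis using a lc_in[OF inv_closed[OF g]] by (simp add: A_iff act_ext act_apply)
qed

lemma act_mult: "g \<in> carrier G \<Longrightarrow> act g (a \<otimes>\<^bsub>A\<^esub> b) = act g a \<otimes>\<^bsub>A\<^esub> act g b"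
  by (rule extensionalityI[of _ lc]) (simp_all add: act_ext act_apply A_mult lc_in)

lemma act_act: "g \<in> carrier G \<Longrightarrow> h \<in> carrier G \<Longrightarrow> act g (act h a) = act (g \<otimes> h) a"
  by (rule extensionalityI[of _ lc]) (simp_all add: act_ext act_apply lc_in lc_assoc inv_mult_group)

lemma act_one: "a \<in> carrier A \<Longrightarrow> act \<one> a = a"
  by (rule extensionalityI[of _ lc]) (simp_all add: act_ext act_apply lc_one A_iff)

lemma act_zer: "g \<in> carrier G \<Longrightarrow> act g zer = zer"
  by (rule extensionalityI[of _ lc]) (simp_all add: act_ext act_apply zer_def lc_in)

lemma act_ind: "g \<in> carrier G \<Longrightarrow> y \<in> lc \<Longrightarrow> act g (ind y) = ind (g <# y)"
  by (rule extensionalityI[of _ lc]) (simp_all add: act_ext act_apply ind_def lc_in lc_solve)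

lemma W_carrier: "carrier W = carrier A \<times> carrier G"
  and W_mult: "(a, g) \<otimes>\<^bsub>W\<^esub> (b, h) = (a \<otimes>\<^bsub>A\<^esub> act g b, g \<otimes> h)"
  and W_one: "\<one>\<^bsub>W\<^esub> = (zer, \<one>)"
  by (simp_all add: coset_wreath_def semidirect_product_def A_one)

lemma group_W: "group W"
proof -
  interpret A: group A by (rule group_A)
  show ?thesis
  proof (rule groupI)
    show "\<one>\<^bsub>W\<^esub> \<in> carrier W" by (simp add: W_one W_carrier zer_in)
  next
    fix p q assume "p \<in> carrier W" "q \<in> carrier W"
    thus "p \<otimes>\<^bsub>W\<^esub> q \<in> carrier W" by (auto simp: W_carrier W_mult act_in)
  next
    fix p q r assume "p \<in> carrier W" "q \<in> carrier W" "r \<in> carrier W"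
    then obtain a g b h c k where "p = (a, g)" "q = (b, h)" "r = (c, k)"
      and "a \<in> carrier A" "b \<in> carrier A" "c \<in> carrier A" "g \<in> carrier G" "h \<in> carrier G" "k \<in> carrier G"
      by (auto simp: W_carrier)
    thus "p \<otimes>\<^bsub>W\<^esub> q \<otimes>\<^bsub>W\<^esub> r = p \<otimes>\<^bsub>W\<^esub> (q \<otimes>\<^bsub>W\<^esub> r)"
      by (simp only: W_mult act_mult act_act A.m_assoc act_in m_closed m_assoc)
  next
    fix p assume "p \<in> carrier W"
    then obtain a g where p: "p = (a, g)" "a \<in> carrier A" "g \<in> carrier G" by (auto simp: W_carrier)
    show "\<one>\<^bsub>W\<^esub> \<otimes>\<^bsub>W\<^esub> p = p" using p A.l_one[of a] by (simp add: W_one W_mult act_one A_one)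
    have "(act (inv g) a, inv g) \<otimes>\<^bsub>W\<^esub> p = \<one>\<^bsub>W\<^esub>" using p by (simp add: W_one W_mult A_double)
    moreover have "(act (inv g) a, inv g) \<in> carrier W" using p by (simp add: W_carrier act_in)
    ultimately show "\<exists>q\<in>carrier W. q \<otimes>\<^bsub>W\<^esub> p = \<one>\<^bsub>W\<^esub>" by blast
  qed
qed

lemma ind_mult_act: "y \<in> lc \<Longrightarrow> g \<in> carrier G \<Longrightarrow> (ind y, \<one>) \<otimes>\<^bsub>W\<^esub> (zer, g) = (ind y, g)"
  and act_mult_ind: "y \<in> lc \<Longrightarrow> g \<in> carrier G \<Longrightarrow> (zer, g) \<otimes>\<^bsub>W\<^esub> (ind y, \<one>) = (ind (g <# y), g)"
  and zer_mult: "g \<in> carrier G \<Longrightarrow> h \<in> carrier G \<Longrightarrow> (zer, g) \<otimes>\<^bsub>W\<^esub> (zer, h) = (zer, g \<otimes> h)"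
  and ind_mult_ind: "(ind y, \<one>) \<otimes>\<^bsub>W\<^esub> (ind z, \<one>) = (ind y \<otimes>\<^bsub>A\<^esub> ind z, \<one>)"
  using group.is_monoid[OF group_A] monoid.r_one[of A "ind y"] monoid.l_one[of A "ind (g <# y)"] monoid.l_one[of A zer]
  by (simp_all add: W_mult act_zer act_ind act_one A_one ind_in zer_in)

lemma ind_inj: assumes "y \<in> lc" "ind y = ind z" shows "y = z"
proof -
  have "ind y y = ind z y" by (simp only: assms(2))
  thus ?thesis using assms(1) by (simp add: ind_def split: if_splits)
qed

text \<open>The locale assumptions of \<open>kazhdan_conjugation\<close> are met with \<open>\<theta> g = t g t\<inverse>\<close> and with \<open>a\<close> the generator at the
  coset \<open>t\<Gamma>\<close>, whose conjugate by \<open>g\<close> is the generator at \<open>g t\<Gamma>\<close>.\<close>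

theorem not_MF:
  fixes L :: "'l monoid" and \<phi> :: "('g set \<Rightarrow> int) \<times> 'g \<Rightarrow> 'l" and t :: 'g
  assumes T: "property_T (G\<lparr>carrier := \<Gamma>\<rparr>)" and t: "t \<in> carrier G"
    and proper: "(t <# \<Gamma>) #> inv t \<subset> \<Gamma>"
    and L: "group L" and \<phi>: "\<phi> \<in> hom W L" and inj: "inj_on \<phi> (carrier W)"
  shows "\<not> MF_algebra (reduced_group_algebra L)"
proof
  assume MF: "MF_algebra (reduced_group_algebra L)"
  interpret L: group L by (rule L)
  let ?\<Gamma> = "G\<lparr>carrier := \<Gamma>\<rparr>"
  interpret \<Gamma>': group ?\<Gamma> by (rule \<Gamma>.subgroup_is_group[OF is_group])
  have \<phi>_in: "\<phi> p \<in> carrier L" if "p \<in> carrier W" for p using \<phi> that by (auto simp: hom_def)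
  have \<phi>_mult: "\<phi> p \<otimes>\<^bsub>L\<^esub> \<phi> q = \<phi> (p \<otimes>\<^bsub>W\<^esub> q)" if "p \<in> carrier W" "q \<in> carrier W" for p q using \<phi> that by (auto simp: hom_def)
  have W1: "(zer, g) \<in> carrier W" "(ind y, \<one>) \<in> carrier W" if "g \<in> carrier G" for g y
    using that by (simp_all add: W_carrier zer_in ind_in)
  have \<Gamma>G: "g \<in> carrier G" if "g \<in> \<Gamma>" for g using that by (rule \<Gamma>.mem_carrier)
  define y where "y = t <# \<Gamma>"
  have y: "y \<in> lc" using t by (auto simp: y_def LCOSETS_def)
  define j where "j g = \<phi> (zer, g)" for g
  define \<theta> where "\<theta> g = t \<otimes> g \<otimes> inv t" for g
  define a where "a = \<phi> (ind y, \<one>)"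
  have aL: "a \<in> carrier L" unfolding a_def by (rule \<phi>_in[OF W1(2)[OF one_closed]])
  have \<theta>_in: "\<theta> g \<in> \<Gamma>" if "g \<in> \<Gamma>" for g
  proof (rule subsetD[OF psubset_imp_subset[OF proper]])
    have "t \<otimes> g \<in> t <# \<Gamma>" unfolding l_coset_def by (rule UN_I[OF that]) (rule singletonI)
    thus "\<theta> g \<in> (t <# \<Gamma>) #> inv t" unfolding \<theta>_def r_coset_def by (rule UN_I) (rule singletonI)
  qed
  have j_in: "j g \<in> carrier L" if "g \<in> carrier G" for g unfolding j_def by (rule \<phi>_in[OF W1(1)[OF that]])
  have j_mult: "j g \<otimes>\<^bsub>L\<^esub> j h = j (g \<otimes> h)" if "g \<in> carrier G" "h \<in> carrier G" for g h
    unfolding j_def \<phi>_mult[OF W1(1)[OF that(1)] W1(1)[OF that(2)]] zer_mult[OF that] ..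
  have conj: "j g \<otimes>\<^bsub>L\<^esub> a \<otimes>\<^bsub>L\<^esub> inv\<^bsub>L\<^esub> (j g) = \<phi> (ind (g <# y), \<one>)" if g: "g \<in> carrier G" for g
  proof (rule L.inv_solve_right'[THEN iffD2])
    show "j g \<otimes>\<^bsub>L\<^esub> a = \<phi> (ind (g <# y), \<one>) \<otimes>\<^bsub>L\<^esub> j g"
      unfolding j_def a_def \<phi>_mult[OF W1(1)[OF g] W1(2)[OF g]] \<phi>_mult[OF W1(2)[OF g] W1(1)[OF g]]
        act_mult_ind[OF y g] ind_mult_act[OF lc_in[OF g y] g] ..
  qed (intro L.m_closed j_in[OF g] aL \<phi>_in[OF W1(2)[OF one_closed]])+
  have one: "\<phi> (zer, \<one>) = \<one>\<^bsub>L\<^esub>"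
  proof -
    have "j \<one> \<otimes>\<^bsub>L\<^esub> j \<one> = j \<one>" using j_mult[of \<one> \<one>] by simp
    thus ?thesis using j_in[of \<one>] by (simp add: j_def)
  qed
  have \<theta>y: "\<theta> g <# y = y" if g: "g \<in> \<Gamma>" for g
  proof -
    have "\<theta> g <# y = (\<theta> g \<otimes> t) <# \<Gamma>" unfolding y_def using t \<Gamma>G[OF g] by (intro lcos_m_assoc \<Gamma>.subset) (simp_all add: \<theta>_def)
    also have "\<theta> g \<otimes> t = t \<otimes> g" using t \<Gamma>G[OF g] by (simp add: \<theta>_def m_assoc)
    also have "(t \<otimes> g) <# \<Gamma> = t <# (g <# \<Gamma>)" by (rule lcos_m_assoc[OF \<Gamma>.subset t \<Gamma>G[OF g], symmetric])
    also have "g <# \<Gamma> = \<Gamma>" by (rule coset_join3[OF \<Gamma>G[OF g] \<Gamma>.subgroup_axioms g])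
    finally show ?thesis unfolding y_def .
  qed
  obtain g0 where g0: "g0 \<in> \<Gamma>" "g0 \<notin> (t <# \<Gamma>) #> inv t" using psubset_imp_ex_mem[OF proper] by blast
  have g0y: "g0 <# y \<noteq> y"
  proof
    assume eq: "g0 <# y = y"
    have "t \<in> y" unfolding y_def by (rule lcos_self[OF t \<Gamma>.subgroup_axioms])
    hence "g0 \<otimes> t \<in> g0 <# y" unfolding l_coset_def by (rule UN_I) (rule singletonI)
    hence "g0 \<otimes> t \<in> t <# \<Gamma>" unfolding eq unfolding y_def .
    hence "g0 \<otimes> t \<otimes> inv t \<in> (t <# \<Gamma>) #> inv t" unfolding r_coset_def by (rule UN_I) (rule singletonI)
    thus False using g0 t \<Gamma>G[OF g0(1)] by (simp add: m_assoc)
  qed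
  obtain K \<epsilon> where K: "finite K" "K \<subseteq> carrier ?\<Gamma>" and \<epsilon>: "\<epsilon> > 0" and kp: "kazhdan_pair TYPE('g \<Rightarrow> complex) ?\<Gamma> K \<epsilon>"
    using T unfolding property_T_def by blast
  define \<epsilon>' where "\<epsilon>' = min \<epsilon> 1"
  have kp1: "kazhdan_pair TYPE('g \<Rightarrow> complex) ?\<Gamma> K \<epsilon>'"
    unfolding kazhdan_pair_def
  proof (intro allI impI)
    fix H :: "('g \<Rightarrow> complex) inner_module" and \<pi> \<xi>
    assume H: "hilbert_space H" and rep: "unitary_rep ?\<Gamma> H \<pi>" and \<xi>: "\<xi> \<in> carrier H" "\<xi> \<noteq> \<zero>\<^bsub>H\<^esub>"
      and near: "\<forall>g\<in>K. hnorm H (\<pi> g \<xi> \<ominus>\<^bsub>H\<^esub> \<xi>) < \<epsilon>' * hnorm H \<xi>"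
    have "\<epsilon>' * hnorm H \<xi> \<le> \<epsilon> * hnorm H \<xi>"
      unfolding \<epsilon>'_def by (rule mult_right_mono) (simp_all add: hilbert_space.hnorm_nonneg[OF H \<xi>(1)])
    hence "hnorm H (\<pi> g \<xi> \<ominus>\<^bsub>H\<^esub> \<xi>) < \<epsilon> * hnorm H \<xi>" if "g \<in> K" for g
      by (rule less_le_trans[OF near[rule_format, OF that]])
    thus "\<exists>\<eta>\<in>carrier H. \<eta> \<noteq> \<zero>\<^bsub>H\<^esub> \<and> (\<forall>g\<in>carrier ?\<Gamma>. \<pi> g \<eta> = \<eta>)"
      by (rule kp[unfolded kazhdan_pair_def, rule_format, OF H rep \<xi>])
  qed
  note any = kazhdan_pair_any_type[OF \<Gamma>'.is_group K(2) kp1]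
  obtain I u where u: "\<And>n. adj (I n) = I n" "\<And>n. I n * I n = I n"
    "\<And>w n. w \<in> carrier L \<Longrightarrow> I n * u w n = u w n" "\<And>w n. w \<in> carrier L \<Longrightarrow> u w n * I n = u w n"
    "\<And>w. w \<in> carrier L \<Longrightarrow> \<exists>C. \<forall>n. opn (u w n) \<le> C"
    "\<And>v w. v \<in> carrier L \<Longrightarrow> w \<in> carrier L \<Longrightarrow> null sequentially (u (v \<otimes>\<^bsub>L\<^esub> w) - u v * u w)"
    "\<And>w. w \<in> carrier L \<Longrightarrow> null sequentially (adjs (u w) - u (inv\<^bsub>L\<^esub> w))"
    "null sequentially (u \<one>\<^bsub>L\<^esub> - I)"
    "\<And>v w. v \<in> carrier L \<Longrightarrow> w \<in> carrier L \<Longrightarrow> v \<noteq> w \<Longrightarrow> \<not> null sequentially (u v - u w)"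
    
  proof (rule L.MF_asymptotic_rep[OF MF], goal_cases)
    case (1 u I)
    show ?case by (rule 1(1)) (rule 1(2-); assumption?)+
  qed
  define b where "b = \<phi> (ind (g0 <# y), \<one>)"
  have bL: "b \<in> carrier L" unfolding b_def by (rule \<phi>_in[OF W1(2)[OF one_closed]])
  have ab: "a \<noteq> b"
  proof
    assume "a = b"
    hence "(ind y, \<one>) = (ind (g0 <# y), \<one>)" unfolding a_def b_def by (rule inj_onD[OF inj _ W1(2)[OF one_closed] W1(2)[OF one_closed]])
    hence "ind y = ind (g0 <# y)" by simp
    thus False using ind_inj[OF y, of "g0 <# y"] g0y by simp
  qed
  \<comment> \<open>An ultrafilter along which the two conjugates stay apart.\<close>
  have "\<not> (\<forall>c>0. eventually (\<lambda>n. opn ((u a - u b) n) < c) sequentially)"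
  proof
    assume *: "\<forall>c>0. eventually (\<lambda>n. opn ((u a - u b) n) < c) sequentially"
    have "(\<lambda>n. opn ((u a - u b) n)) \<longlonglongrightarrow> 0" by (rule tendstoI) (use * in \<open>simp add: dist_real_def\<close>)
    thus False using u(9)[OF aL bL ab] unfolding null_def by blast
  qed
  then obtain c0 where c0: "c0 > 0" "\<not> eventually (\<lambda>n. opn ((u a - u b) n) < c0) sequentially" by blast
  have "inf sequentially (principal {n. \<not> opn ((u a - u b) n) < c0}) \<noteq> bot"
  proof
    assume "inf sequentially (principal {n. \<not> opn ((u a - u b) n) < c0}) = bot"
    hence "eventually (\<lambda>n. False) (inf sequentially (principal {n. \<not> opn ((u a - u b) n) < c0}))" by simp
    thus False using c0(2) unfolding eventually_inf_principal by simp
  qed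
  then obtain U where Ule: "U \<le> inf sequentially (principal {n. \<not> opn ((u a - u b) n) < c0})" and U: "ultrafilter U"
    using ultrafilter_exists by blast
  have free: "U \<le> sequentially" using Ule by (simp only: le_inf_iff)
  have apart: "eventually (\<lambda>n. \<not> opn ((u a - u b) n) < c0) U" using Ule by (simp add: le_principal)
  have nU: "null U X" if "null sequentially X" for X using tendsto_mono[OF free] that unfolding null_def by blast
  interpret KC: kazhdan_conjugation L u I U ?\<Gamma> j \<theta> "j t" a K \<epsilon>'
  proof (intro kazhdan_conjugation.intro kazhdan_conjugation_axioms.intro asymptotic_rep.intro asymptotic_rep_axioms.intro)
    show "group L" "group ?\<Gamma>" by (rule L, rule \<Gamma>'.is_group)
    show "ultrafilter U" "U \<le> sequentially" by (rule U, rule free)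
    show "opb U (u w)" if "w \<in> carrier L" for w using u(5)[OF that] unfolding opb_def by (auto intro: always_eventually)
    show "null U (u (v \<otimes>\<^bsub>L\<^esub> w) - u v * u w)" if "v \<in> carrier L" "w \<in> carrier L" for v w by (rule nU[OF u(6)[OF that]])
    show "null U (adjs (u w) - u (inv\<^bsub>L\<^esub> w))" if "w \<in> carrier L" for w by (rule nU[OF u(7)[OF that]])
    show "null U (u \<one>\<^bsub>L\<^esub> - I)" by (rule nU[OF u(8)])
    show "j \<in> hom ?\<Gamma> L" by (rule homI) (simp_all add: j_in j_mult \<Gamma>G)
    show "\<theta> \<in> hom ?\<Gamma> ?\<Gamma>"
    proof (rule homI)
      fix g h assume "g \<in> carrier ?\<Gamma>" "h \<in> carrier ?\<Gamma>"
      hence gh: "g \<in> carrier G" "h \<in> carrier G" by (simp_all add: \<Gamma>G)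
      have c: "inv t \<otimes> (t \<otimes> (h \<otimes> inv t)) = h \<otimes> inv t" using t gh by (simp add: m_assoc[symmetric])
      show "\<theta> (g \<otimes>\<^bsub>?\<Gamma>\<^esub> h) = \<theta> g \<otimes>\<^bsub>?\<Gamma>\<^esub> \<theta> h" using t gh by (simp add: \<theta>_def m_assoc c)
    qed (simp add: \<theta>_in)
    show "j t \<in> carrier L" by (rule j_in[OF t])
    show "0 < \<epsilon>'" "\<epsilon>' \<le> 1" using \<epsilon> by (simp_all add: \<epsilon>'_def)
    show "a \<in> carrier L" by (rule aL)
    show "a \<otimes>\<^bsub>L\<^esub> a = \<one>\<^bsub>L\<^esub>"
      unfolding a_def \<phi>_mult[OF W1(2)[OF one_closed] W1(2)[OF one_closed]] ind_mult_ind A_double by (rule one)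
  next
    fix g assume "g \<in> carrier ?\<Gamma>"
    hence g: "g \<in> \<Gamma>" "g \<in> carrier G" by (simp_all add: \<Gamma>G)
    have \<theta>G: "\<theta> g \<in> carrier G" by (rule \<Gamma>G[OF \<theta>_in[OF g(1)]])
    show "j t \<otimes>\<^bsub>L\<^esub> j g \<otimes>\<^bsub>L\<^esub> inv\<^bsub>L\<^esub> j t = j (\<theta> g)"
    proof (rule L.inv_solve_right'[THEN iffD2])
      show "j t \<otimes>\<^bsub>L\<^esub> j g = j (\<theta> g) \<otimes>\<^bsub>L\<^esub> j t"
        unfolding j_mult[OF t g(2)] j_mult[OF \<theta>G t] using t g(2) by (simp add: \<theta>_def m_assoc)
    qed (intro L.m_closed j_in[OF t] j_in[OF g(2)] j_in[OF \<theta>G])+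
    show "a \<otimes>\<^bsub>L\<^esub> (j g \<otimes>\<^bsub>L\<^esub> a \<otimes>\<^bsub>L\<^esub> inv\<^bsub>L\<^esub> j g) = j g \<otimes>\<^bsub>L\<^esub> a \<otimes>\<^bsub>L\<^esub> inv\<^bsub>L\<^esub> j g \<otimes>\<^bsub>L\<^esub> a"
      unfolding conj[OF g(2)] unfolding a_def \<phi>_mult[OF W1(2)[OF one_closed] W1(2)[OF one_closed]] ind_mult_ind
      by (simp only: A_comm[of "ind y"])
    show "j (\<theta> g) \<otimes>\<^bsub>L\<^esub> a \<otimes>\<^bsub>L\<^esub> inv\<^bsub>L\<^esub> j (\<theta> g) = a" 
      using conj[OF \<theta>G] unfolding \<theta>y[OF g(1)] a_def[symmetric] .
  qed (rule u(1) u(2) u(3) u(4) K any; assumption?)+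
  have g0': "g0 \<in> carrier ?\<Gamma>" using g0(1) by simp
  have "null U (u a - u b)"
    using KC.asymptotic_commutation[OF g0'] unfolding KC.\<rho>_def KC.c_def conj[OF \<Gamma>G[OF g0(1)]] b_def[symmetric] .
  hence "eventually (\<lambda>n. opn ((u a - u b) n) < c0) U" unfolding null_def by (rule order_tendstoD) (rule c0(1))
  with apart have "eventually (\<lambda>n. False) U" by eventually_elim simp
  thus False using U by (simp add: ultrafilter_def)
qed

end

theorem corollary4p4:
  fixes G :: "'g monoid" and \<Gamma> :: "'g set" and t :: 'g
  assumes "group G"
    and "subgroup \<Gamma> G"
    and "property_T (G\<lparr>carrier := \<Gamma>\<rparr>)"
    and "t \<in> carrier G"
    and "(t <#\<^bsub>G\<^esub> \<Gamma>) #>\<^bsub>G\<^esub> inv\<^bsub>G\<^esub> t \<subset> \<Gamma>"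
  shows "(stably_finite (reduced_group_algebra (coset_wreath G \<Gamma>)) \<and>
          \<not> MF_algebra (reduced_group_algebra (coset_wreath G \<Gamma>))) \<and>
         (\<forall>(L :: 'l monoid) W'. group L \<longrightarrow> subgroup W' L \<longrightarrow>
            coset_wreath G \<Gamma> \<cong> L\<lparr>carrier := W'\<rparr> \<longrightarrow>
            stably_finite (reduced_group_algebra L) \<and> \<not> MF_algebra (reduced_group_algebra L))"
proof -
  interpret coset_wreath_product G \<Gamma> by (rule coset_wreath_product.intro[OF assms(1,2)])
  have "stably_finite (reduced_group_algebra L) \<and> \<not> MF_algebra (reduced_group_algebra L)"
    if L: "group L" and W': "subgroup W' L" and iso: "W \<cong> L\<lparr>carrier := W'\<rparr>" for L :: "'l monoid" and W'
  proof -
    obtain \<phi> where \<phi>: "\<phi> \<in> iso W (L\<lparr>carrier := W'\<rparr>)" using iso by (auto simp: is_iso_def)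
    have "\<phi> \<in> hom W L" "inj_on \<phi> (carrier W)"
      using \<phi> subgroup.mem_carrier[OF W'] by (auto simp: iso_def hom_def bij_betw_def)
    from not_MF[OF assms(3-5) L this] show ?thesis by (rule conjI[OF group.stably_finite_reduced[OF L]])
  qed
  moreover have "\<not> MF_algebra (reduced_group_algebra W)"
    by (rule not_MF[OF assms(3-5) group_W, of id]) (simp_all add: hom_def)
  ultimately show ?thesis by (intro conjI allI impI group.stably_finite_reduced[OF group_W]) simp_all
qed

end
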